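(* Let $f\in W^{-1,p'}(\Omega)$. Assume that $\alpha,\beta\in\mathbb{R}$ are such that either $\beta<\underline{\beta}(\alpha)$ or $\beta>\bar{\beta}(\alpha)$. Then the problem $$-\Delta_p u-\Delta_q u=\alpha|u|^{p-2}u+\beta|u|^{q-2}u+f(x)\ \text{ in }\Omega,\qquad u=0\ \text{ on }\partial\Omega,$$ has at least one (weak) solution.
   Context: Standing assumptions: $N\ge 1$, $\Omega\subset\mathbb{R}^N$ is a bounded domain with $C^2$-boundary, $1<q<p<\infty$, $p'=p/(p-1)$; $\Delta_r u=\mathrm{div}(|\nabla u|^{r-2}\nabla u)$. $W_0^{1,p}=W_0^{1,p}(\Omega)$ has the norm $\|\nabla u\|_p$, where $\|\cdot\|_p$ is the $L^p(\Omega)$-norm; $W^{-1,p'}(\Omega)$ is its dual and $\langle f,u\rangle$ (written formally as $\int_\Omega fu\,dx$) is the dual pairing. A (weak) solution of the problem is a function $u\in W_0^{1,p}$ such that $\int_\Omega(|\nabla u|^{p-2}+|\nabla u|^{q-2})\nabla u\cdot\nabla\varphi\,dx=\int_\Omega(\alpha|u|^{p-2}u+\beta|u|^{q-2}u)\varphi\,dx+\langle f,\varphi\rangle$ for all $\varphi\in W_0^{1,p}$. $ES(p;\alpha)$ is the set of all weak solutions $u\in W_0^{1,p}$ of $-\Delta_p u=\alpha|u|^{p-2}u$ in $\Omega$, $u=0$ on $\partial\Omega$; $\sigma(-\Delta_p)$ is the set of $\alpha\in\mathbb{R}$ with $ES(p;\alpha)\ne\{0\}$. For $\alpha\in\sigma(-\Delta_p)$,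 $$\underline{\beta}(\alpha):=\inf\left\{\frac{\|\nabla u\|_q^q}{\|u\|_q^q}:\ u\in ES(p;\alpha)\setminus\{0\}\right\},\qquad \bar{\beta}(\alpha):=\sup\left\{\frac{\|\nabla u\|_q^q}{\|u\|_q^q}:\ u\in ES(p;\alpha)\setminus\{0\}\right\},$$ and $\underline{\beta}(\alpha):=+\infty$, $\bar{\beta}(\alpha):=-\infty$ for $\alpha\notin\sigma(-\Delta_p)$. *)

theory Defs
  imports "HOL-Analysis.Analysis"
begin

section \<open>Functions of class \<open>C\<^sup>k\<close> and domains with \<open>C\<^sup>2\<close>-boundary\<close>

text \<open>Meant for open \<open>S\<close>.\<close>

primrec Ck_on :: "nat \<Rightarrow> 'a::euclidean_space set \<Rightarrow> ('a \<Rightarrow> real) \<Rightarrow> bool" where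
  "Ck_on 0 S f \<longleftrightarrow> continuous_on S f"
| "Ck_on (Suc k) S f \<longleftrightarrow>
     (\<forall>x\<in>S. f differentiable (at x)) \<and>
     (\<forall>b\<in>Basis. Ck_on k S (\<lambda>x. frechet_derivative f (at x) b))"

text \<open>Near each boundary point the set lies strictly above the graph of a \<open>C\<^sup>2\<close> function \<open>\<gamma>\<close>
  over the hyperplane orthogonal to a unit vector \<open>e\<close> (the rotated last coordinate direction).
  Only the values of \<open>\<gamma>\<close> on that hyperplane are used; a \<open>C\<^sup>2\<close> function on the hyperplane
  extends to the whole space by composition with the orthogonal projection.\<close>

definition C2_boundary :: "'a::euclidean_space set \<Rightarrow> bool" where
  "C2_boundary \<Omega> \<longleftrightarrow>
     (\<forall>x0\<in>frontier \<Omega>. \<exists>r>0. \<exists>e \<gamma>. norm e = 1 \<and> Ck_on 2 UNIV \<gamma> \<and>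
        \<Omega> \<inter> ball x0 r = {x \<in> ball x0 r. x \<bullet> e > \<gamma> (x - (x \<bullet> e) *\<^sub>R e)})"

definition bounded_C2_domain :: "'a::euclidean_space set \<Rightarrow> bool" where
  "bounded_C2_domain \<Omega> \<longleftrightarrow>
     open \<Omega> \<and> connected \<Omega> \<and> \<Omega> \<noteq> {} \<and> bounded \<Omega> \<and> C2_boundary \<Omega>"

definition test_functions :: "'a::euclidean_space set \<Rightarrow> ('a \<Rightarrow> real) set" where
  "test_functions \<Omega> =
     {\<phi>. (\<forall>k. Ck_on k UNIV \<phi>) \<and> (\<exists>K. compact K \<and> K \<subseteq> \<Omega> \<and> (\<forall>x. x \<notin> K \<longrightarrow> \<phi> x = 0))}"

section \<open>Lebesgue and Sobolev spaces\<close>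

text \<open>Elements are representatives, not equivalence classes modulo null sets; equality with
  \<open>0\<close> is therefore expressed almost everywhere.\<close>

definition Lp_space :: "real \<Rightarrow> 'a::euclidean_space set \<Rightarrow> ('a \<Rightarrow> 'b::euclidean_space) set" where
  "Lp_space r \<Omega> = {u \<in> borel_measurable (lebesgue_on \<Omega>).
     integrable (lebesgue_on \<Omega>) (\<lambda>x. norm (u x) powr r)}"

definition Lp_norm :: "real \<Rightarrow> 'a::euclidean_space set \<Rightarrow> ('a \<Rightarrow> 'b::euclidean_space) \<Rightarrow> real" where
  "Lp_norm r \<Omega> u = (LINT x|lebesgue_on \<Omega>. norm (u x) powr r) powr (1 / r)"

definition locally_integrable ::
  "'a::euclidean_space set \<Rightarrow> ('a \<Rightarrow> 'b::euclidean_space) \<Rightarrow> bool" where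
  "locally_integrable \<Omega> u \<longleftrightarrow>
     (\<forall>K. compact K \<and> K \<subseteq> \<Omega> \<longrightarrow> integrable (lebesgue_on K) u)"

definition is_weak_gradient ::
  "'a::euclidean_space set \<Rightarrow> ('a \<Rightarrow> real) \<Rightarrow> ('a \<Rightarrow> 'a) \<Rightarrow> bool" where
  "is_weak_gradient \<Omega> u G \<longleftrightarrow>
     locally_integrable \<Omega> u \<and> locally_integrable \<Omega> G \<and>
     (\<forall>\<phi>\<in>test_functions \<Omega>. \<forall>b\<in>Basis.
        (LINT x|lebesgue_on \<Omega>. u x * frechet_derivative \<phi> (at x) b)
        = - (LINT x|lebesgue_on \<Omega>. (G x \<bullet> b) * \<phi> x))"

text \<open>A weak gradient is unique up to a null set, and the value below is used only inside
  integrals, so the choice of representative is immaterial.\<close>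

definition weak_grad :: "'a::euclidean_space set \<Rightarrow> ('a \<Rightarrow> real) \<Rightarrow> 'a \<Rightarrow> 'a" where
  "weak_grad \<Omega> u = (SOME G. is_weak_gradient \<Omega> u G)"

definition W1p :: "real \<Rightarrow> 'a::euclidean_space set \<Rightarrow> ('a \<Rightarrow> real) set" where
  "W1p p \<Omega> = {u \<in> Lp_space p \<Omega>. \<exists>G\<in>Lp_space p \<Omega>. is_weak_gradient \<Omega> u G}"

definition W1p_norm :: "real \<Rightarrow> 'a::euclidean_space set \<Rightarrow> ('a \<Rightarrow> real) \<Rightarrow> real" where
  "W1p_norm p \<Omega> u =
     (Lp_norm p \<Omega> u powr p + Lp_norm p \<Omega> (weak_grad \<Omega> u) powr p) powr (1 / p)"

text \<open>The closure of the test functions in \<open>W\<^sup>1\<^sup>,\<^sup>p\<close>.\<close>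

definition W01p :: "real \<Rightarrow> 'a::euclidean_space set \<Rightarrow> ('a \<Rightarrow> real) set" where
  "W01p p \<Omega> = {u \<in> W1p p \<Omega>. \<exists>\<phi>. (\<forall>n. \<phi> n \<in> test_functions \<Omega>) \<and>
     (\<lambda>n. W1p_norm p \<Omega> (\<lambda>x. u x - \<phi> n x)) \<longlonglongrightarrow> 0}"

definition W01p_norm :: "real \<Rightarrow> 'a::euclidean_space set \<Rightarrow> ('a \<Rightarrow> real) \<Rightarrow> real" where
  "W01p_norm p \<Omega> u = Lp_norm p \<Omega> (weak_grad \<Omega> u)"

text \<open>The dual space \<open>W\<^sup>-\<^sup>1\<^sup>,\<^sup>p\<^sup>'\<close>; the pairing of \<open>f\<close> with \<open>u\<close> is the application \<open>f u\<close>. Linearity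
  and the bound make \<open>f\<close> invariant under almost-everywhere equality. Values of \<open>f\<close>
  outside \<open>W01p p \<Omega>\<close> are irrelevant.\<close>

definition W01p_dual ::
  "real \<Rightarrow> 'a::euclidean_space set \<Rightarrow> (('a \<Rightarrow> real) \<Rightarrow> real) set" where
  "W01p_dual p \<Omega> = {f.
     (\<forall>u\<in>W01p p \<Omega>. \<forall>v\<in>W01p p \<Omega>. f (\<lambda>x. u x + v x) = f u + f v) \<and>
     (\<forall>c. \<forall>u\<in>W01p p \<Omega>. f (\<lambda>x. c * u x) = c * f u) \<and>
     (\<exists>C. \<forall>u\<in>W01p p \<Omega>. \<bar>f u\<bar> \<le> C * W01p_norm p \<Omega> u)}"

section \<open>The eigenvalue problem for the p-Laplacian\<close>

text \<open>Since \<open>0 powr s = 0\<close> for every real \<open>s\<close>, expressions such as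
  \<open>\<bar>u\<bar> powr (p - 2) * u\<close> have the intended value \<open>0\<close> where \<open>u = 0\<close>, also for \<open>p < 2\<close>.\<close>

definition ES :: "real \<Rightarrow> 'a::euclidean_space set \<Rightarrow> real \<Rightarrow> ('a \<Rightarrow> real) set" where
  "ES p \<Omega> \<alpha> = {u \<in> W01p p \<Omega>. \<forall>\<phi>\<in>W01p p \<Omega>.
     (LINT x|lebesgue_on \<Omega>.
        norm (weak_grad \<Omega> u x) powr (p - 2) * (weak_grad \<Omega> u x \<bullet> weak_grad \<Omega> \<phi> x))
     = \<alpha> * (LINT x|lebesgue_on \<Omega>. \<bar>u x\<bar> powr (p - 2) * u x * \<phi> x)}"

definition ES_nonzero :: "real \<Rightarrow> 'a::euclidean_space set \<Rightarrow> real \<Rightarrow> ('a \<Rightarrow> real) set" where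
  "ES_nonzero p \<Omega> \<alpha> = {u \<in> ES p \<Omega> \<alpha>. \<not> (AE x in lebesgue_on \<Omega>. u x = 0)}"

definition plap_spectrum :: "real \<Rightarrow> 'a::euclidean_space set \<Rightarrow> real set" where
  "plap_spectrum p \<Omega> = {\<alpha>. ES_nonzero p \<Omega> \<alpha> \<noteq> {}}"

definition rayleigh :: "real \<Rightarrow> 'a::euclidean_space set \<Rightarrow> ('a \<Rightarrow> real) \<Rightarrow> real" where
  "rayleigh q \<Omega> u = Lp_norm q \<Omega> (weak_grad \<Omega> u) powr q / Lp_norm q \<Omega> u powr q"

definition beta_lower :: "real \<Rightarrow> real \<Rightarrow> 'a::euclidean_space set \<Rightarrow> real \<Rightarrow> ereal" where
  "beta_lower p q \<Omega> \<alpha> =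
     (if \<alpha> \<in> plap_spectrum p \<Omega> then (INF u\<in>ES_nonzero p \<Omega> \<alpha>. ereal (rayleigh q \<Omega> u)) else \<infinity>)"

definition beta_upper :: "real \<Rightarrow> real \<Rightarrow> 'a::euclidean_space set \<Rightarrow> real \<Rightarrow> ereal" where
  "beta_upper p q \<Omega> \<alpha> =
     (if \<alpha> \<in> plap_spectrum p \<Omega> then (SUP u\<in>ES_nonzero p \<Omega> \<alpha>. ereal (rayleigh q \<Omega> u)) else - \<infinity>)"

section \<open>The (p,q)-Laplace problem\<close>

definition weak_solution ::
  "real \<Rightarrow> real \<Rightarrow> 'a::euclidean_space set \<Rightarrow> real \<Rightarrow> real \<Rightarrow> (('a \<Rightarrow> real) \<Rightarrow> real)
   \<Rightarrow> ('a \<Rightarrow> real) \<Rightarrow> bool" where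
  "weak_solution p q \<Omega> \<alpha> \<beta> f u \<longleftrightarrow> u \<in> W01p p \<Omega> \<and>
     (\<forall>\<phi>\<in>W01p p \<Omega>.
        (LINT x|lebesgue_on \<Omega>.
           (norm (weak_grad \<Omega> u x) powr (p - 2) + norm (weak_grad \<Omega> u x) powr (q - 2)) *
           (weak_grad \<Omega> u x \<bullet> weak_grad \<Omega> \<phi> x))
        = (LINT x|lebesgue_on \<Omega>.
             (\<alpha> * \<bar>u x\<bar> powr (p - 2) * u x + \<beta> * \<bar>u x\<bar> powr (q - 2) * u x) * \<phi> x) + f \<phi>)"

end

theory Submission
 imports Defs "HOL-Homology.Homology" "HOL-Complex_Analysis.Complex_Analysis"
begin

text \<open>
The equation is the Euler-Lagrange equation of the functional
\<open>E(u) = (A\<^sub>p(u) - \<alpha> B\<^sub>p(u)) / p + (A\<^sub>q(u) - \<beta> B\<^sub>q(u)) / q - f(u)\<close>, where \<open>A\<^sub>r\<close> and \<open>B\<^sub>r\<close> denote the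
integrals of the power \<open>r\<close> of the gradient and of the function. For large \<open>\<alpha>\<close> it is indefinite, and
almost critical sequences need not be bounded when \<open>\<alpha>\<close> is an eigenvalue. A solution is found as
the limit of almost critical points of minimax type, in finite-dimensional spaces \<open>W n\<close> of test
functions and with \<open>\<alpha>\<close> replaced by nearby numbers \<open>\<gamma>\<close>.

The topological input is the theorem of Borsuk and Ulam. It bounds the dimension of a sphere that has
an odd map into the set where \<open>A\<^sub>p / B\<^sub>p < \<rho>\<close> (\<open>sphere_index_bounded\<close>, by compactness of the embedding
into \<open>L\<^sup>p\<close>). Take a sphere of maximal dimension in this set. On the cone over a large multiple of its
image the functional \<open>E\<^sub>\<gamma>\<close> is bounded above and very negative on the boundary, while \<open>E\<^sub>\<gamma>\<close> is bounded
below where \<open>A\<^sub>p / B\<^sub>p \<ge> \<rho> > \<gamma>\<close>. If there were no almost critical points, the cone could be deformed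
into the set \<open>A\<^sub>p / B\<^sub>p < \<rho>\<close> with its boundary fixed, and two antipodal copies of it would form an odd
image of a sphere of one dimension more (\<open>linking_almost_critical_point\<close>).

One of the two bounds can be kept uniform as \<open>\<gamma>\<close> tends to \<open>\<alpha>\<close>. With \<open>\<gamma> = \<alpha> - \<epsilon>\<close> and \<open>\<rho> = \<alpha>\<close> the sphere
stays fixed and the energies remain bounded above (\<open>galerkin_solution_below\<close>). With \<open>\<gamma> = \<alpha> + \<epsilon>\<close> and
fixed \<open>\<rho> > \<alpha>\<close> they remain bounded below (\<open>galerkin_solution_above\<close>). A one-sided bound is enough: if
the norms of almost critical points \<open>u\<close> diverged, the normalized functions would converge to an
eigenfunction \<open>v\<close> for \<open>\<alpha>\<close>, and the identity
\<open>p E(u) - E'(u) u = (p / q - 1) (A\<^sub>q(u) - \<beta> B\<^sub>q(u)) - (p - 1) f(u)\<close> divided by the power \<open>q\<close> of the norm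
would give \<open>A\<^sub>q(v) \<le> \<beta> B\<^sub>q(v)\<close> in the first case and \<open>A\<^sub>q(v) \<ge> \<beta> B\<^sub>q(v)\<close> in the second
(\<open>critical_sequence_not_divergent\<close>). The first is impossible for \<open>\<beta>\<close> below the quotients of all
eigenfunctions and the second for \<open>\<beta>\<close> above them. Bounded almost critical points converge strongly,
because they are almost minimizers of a uniformly convex functional (\<open>almost_solutions_compact\<close>), and
the limit solves the equation.

The facts about Sobolev spaces behind this are the Poincare inequality, compactness in \<open>L\<^sup>p\<close>,
separability and the uniqueness of weak gradients. The first three rest on one estimate, for the
translates of a test function (\<open>test_function_translation\<close>).
\<close>

section \<open>The degree of odd maps of spheres\<close>

text \<open>The sphere of dimension \<open>n - 1\<close>. All spheres live in one space of sequences, so that each is the equator of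
the next one; for \<open>n = 0\<close> it is empty.\<close>

definition unit_sph :: "nat => (nat => real) set" where
 "unit_sph n = {x. (\<Sum>i<n. x i ^ 2) = 1 \<and> (\<forall>i\<ge>n. x i = 0)}"

lemma nsphere_eq_unit_sph: "nsphere n = top_of_set (unit_sph (Suc n))"
proof -
 have "{x::nat=>real. (\<Sum>i\<le>n. x i ^ 2) = 1 \<and> (\<forall>i>n. x i = 0)} = unit_sph (Suc n)"
  unfolding unit_sph_def by (simp add: lessThan_Suc_atMost Suc_le_eq)
 thus ?thesis by (simp add: nsphere euclidean_product_topology)
qed

lemma topspace_nsphere_unit_sph [simp]: "topspace (nsphere n) = unit_sph (Suc n)" by (simp add: nsphere_eq_unit_sph)

lemma continuous_map_nsphere_iff:
 "continuous_map (nsphere n) (nsphere m) f \<longleftrightarrow>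
   continuous_on (unit_sph (Suc n)) f \<and> f ` unit_sph (Suc n) \<subseteq> unit_sph (Suc m)" by (auto simp: nsphere_eq_unit_sph)

lemma unit_sph_uminus: "x \<in> unit_sph n ==> (\<lambda>i. - x i) \<in> unit_sph n" by (simp add: unit_sph_def)

lemma unit_sph_abs_le: assumes "x \<in> unit_sph n" shows "\<bar>x i\<bar> \<le> 1"
proof (cases "i < n")
 case True
 hence "x i ^ 2 \<le> (\<Sum>i<n. x i ^ 2)" by (intro member_le_sum) auto
 thus ?thesis using assms by (simp add: unit_sph_def abs_square_le_1)
qed (use assms in \<open>auto simp: unit_sph_def\<close>)

lemma continuous_on_coord: "continuous_on S (\<lambda>x::nat=>real. x i)" by (rule continuous_on_subset[OF continuous_on_product_coordinates]) auto

lemma compact_coordinate_box: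
 "compact {c::nat => real. (\<forall>i\<in>S. \<bar>c i\<bar> \<le> R) \<and> (\<forall>i. i \<notin> S --> c i = 0)}"
proof -
 define P where "P = (\<lambda>i::nat. if i \<in> S then {-R..R} else {0::real})"
 have "compactin (product_topology (\<lambda>i. euclidean) UNIV) (Pi\<^sub>E UNIV P)" by (simp add: compactin_PiE P_def)
 hence "compact (Pi\<^sub>E UNIV P)" by (simp add: euclidean_product_topology)
 moreover have "Pi\<^sub>E UNIV P = {c. (\<forall>i\<in>S. \<bar>c i\<bar> \<le> R) \<and> (\<forall>i. i \<notin> S --> c i = 0)}"
 proof (rule Set.set_eqI)
  fix c :: "nat => real"
  have "c \<in> Pi\<^sub>E UNIV P \<longleftrightarrow> (\<forall>i. c i \<in> P i)" by (simp add: PiE_iff)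
  also have "\<dots> \<longleftrightarrow> (\<forall>i. (i \<in> S --> \<bar>c i\<bar> \<le> R) \<and> (i \<notin> S --> c i = 0))" by (intro all_cong1) (auto simp: P_def)
  finally show "c \<in> Pi\<^sub>E UNIV P \<longleftrightarrow> c \<in> {c. (\<forall>i\<in>S. \<bar>c i\<bar> \<le> R) \<and> (\<forall>i. i \<notin> S --> c i = 0)}" by blast
 qed
 ultimately show ?thesis by simp
qed

lemma compact_coordinate_sublevel:
 assumes "continuous_on UNIV f"
 shows "compact {c::nat => real. f c = r \<and> (\<forall>i\<in>S. \<bar>c i\<bar> \<le> R) \<and> (\<forall>i. i \<notin> S --> c i = 0)}"
  and "compact {c::nat => real. f c \<le> (r::real) \<and> (\<forall>i\<in>S. \<bar>c i\<bar> \<le> R) \<and> (\<forall>i. i \<notin> S --> c i = 0)}"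
proof -
 have "closed {c. f c = r}" "closed {c. f c \<le> r}"
  by (rule closed_Collect_eq closed_Collect_le; use assms in \<open>auto intro: continuous_intros\<close>)+
 thus "compact {c::nat => real. f c = r \<and> (\<forall>i\<in>S. \<bar>c i\<bar> \<le> R) \<and> (\<forall>i. i \<notin> S --> c i = 0)}"
  and "compact {c::nat => real. f c \<le> r \<and> (\<forall>i\<in>S. \<bar>c i\<bar> \<le> R) \<and> (\<forall>i. i \<notin> S --> c i = 0)}"
  using closed_Int_compact[OF _ compact_coordinate_box[of S R]] by (simp_all add: Collect_conj_eq)
qed

lemma compact_unit_sph: "compact (unit_sph n)"
proof -
 have "unit_sph n = {c. (\<Sum>i<n. c i ^ 2) = 1 \<and> (\<forall>i\<in>{..<n}. \<bar>c i\<bar> \<le> 1) \<and> (\<forall>i. i \<notin> {..<n} --> c i = 0)}"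
  using unit_sph_abs_le by (auto simp: unit_sph_def)
 moreover have "continuous_on UNIV (\<lambda>c::nat=>real. \<Sum>i<n. c i ^ 2)" by (intro continuous_intros continuous_on_coord)
 ultimately show ?thesis using compact_coordinate_sublevel(1)[of "\<lambda>c. \<Sum>i<n. c i ^ 2" 1 "{..<n}" 1] by simp
qed

definition sph_norm :: "nat => (nat => real) => real" where
 "sph_norm n y = sqrt (\<Sum>i<n. y i ^ 2)"

definition normalize_vec :: "nat => (nat => real) => (nat => real)" where
 "normalize_vec n y = (\<lambda>i. if i < n then y i / sph_norm n y else 0)"

lemma sph_norm_eq_0: "sph_norm n y = 0 \<longleftrightarrow> (\<forall>i<n. y i = 0)" by (auto simp: sph_norm_def sum_nonneg_eq_0_iff)

lemma sph_norm_nonneg: "sph_norm n y \<ge> 0" by (simp add: sph_norm_def sum_nonneg)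

lemma normalize_vec_in:
 assumes "\<exists>i<n. y i \<noteq> 0" shows "normalize_vec n y \<in> unit_sph n"
proof -
 have ne: "sph_norm n y \<noteq> 0" using assms sph_norm_eq_0 by blast
 have "(\<Sum>i<n. (y i / sph_norm n y)^2) = (\<Sum>i<n. y i ^ 2) / sph_norm n y ^2" by (simp add: power_divide sum_divide_distrib)
 also have "\<dots> = 1" using ne unfolding sph_norm_def by (simp add: sum_nonneg)
 finally show ?thesis by (simp add: unit_sph_def normalize_vec_def)
qed

lemma normalize_vec_uminus: "normalize_vec n (\<lambda>i. - y i) = (\<lambda>i. - normalize_vec n y i)" by (auto simp: normalize_vec_def sph_norm_def)

lemma normalize_vec_id: "y \<in> unit_sph n ==> normalize_vec n y = y" by (auto simp: normalize_vec_def sph_norm_def unit_sph_def fun_eq_iff)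

lemma continuous_on_normalize_vec:
 assumes c: "\<And>i. i < n ==> continuous_on S (\<lambda>x. f x i)" and ne: "\<And>x. x \<in> S ==> \<exists>i<n. f x i \<noteq> 0"
 shows "continuous_on S (\<lambda>x. normalize_vec n (f x))"
proof (rule continuous_on_coordinatewise_then_product)
 fix i
 have cn: "continuous_on S (\<lambda>x. sph_norm n (f x))" unfolding sph_norm_def by (intro continuous_intros c) auto
 show "continuous_on S (\<lambda>x. normalize_vec n (f x) i)"
 proof (cases "i < n")
  case True
  thus ?thesis unfolding normalize_vec_def by (simp, intro continuous_intros c cn) (use ne sph_norm_eq_0 in blast)+
 qed (simp add: normalize_vec_def)
qed

text \<open>The segment between the two maps avoids the origin, so it can be normalized to a homotopy in the sphere.\<close>

lemma degree_normalize_linear_homotopy: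
 assumes f: "\<And>i. i \<le> n ==> continuous_on (unit_sph (Suc n)) (\<lambda>x. f x i)"
  and g: "\<And>i. i \<le> n ==> continuous_on (unit_sph (Suc n)) (\<lambda>x. g x i)"
  and ne: "\<And>x t. x \<in> unit_sph (Suc n) ==> 0 \<le> t ==> t \<le> 1 ==>
    \<exists>i\<le>n. (1 - t) * f x i + t * g x i \<noteq> 0"
 shows "Brouwer_degree2 n (\<lambda>x. normalize_vec (Suc n) (f x)) = Brouwer_degree2 n (\<lambda>x. normalize_vec (Suc n) (g x))"
proof (rule Brouwer_degree2_homotopic)
 let ?S = "unit_sph (Suc n)"
 let ?h = "\<lambda>z. normalize_vec (Suc n) (\<lambda>i. (1 - fst z) * f (snd z) i + fst z * g (snd z) i)"
 have 1: "continuous_on ({0..1} \<times> ?S) ?h"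
 proof (rule continuous_on_normalize_vec)
  fix i assume i: "i < Suc n"
  have "continuous_on ({0..1::real} \<times> ?S) (\<lambda>z. f (snd z) i)"
   by (rule continuous_on_compose2[OF f]) (use i in \<open>auto intro: continuous_intros\<close>)
  moreover have "continuous_on ({0..1::real} \<times> ?S) (\<lambda>z. g (snd z) i)"
   by (rule continuous_on_compose2[OF g]) (use i in \<open>auto intro: continuous_intros\<close>)
  ultimately show "continuous_on ({0..1::real} \<times> ?S) (\<lambda>z. (1 - fst z) * f (snd z) i + fst z * g (snd z) i)" by (intro continuous_intros)
 qed (use ne in \<open>auto simp: less_Suc_eq_le\<close>)
 have 2: "?h ` ({0..1} \<times> ?S) \<subseteq> ?S" using ne by (auto intro!: normalize_vec_in simp: less_Suc_eq_le)
 show "homotopic_with (\<lambda>x. True) (nsphere n) (nsphere n) (\<lambda>x. normalize_vec (Suc n) (f x)) (\<lambda>x. normalize_vec (Suc n) (g x))"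
  unfolding homotopic_with_def nsphere_eq_unit_sph by (rule exI[of _ ?h]) (use 1 2 in auto)
qed

lemma unit_sph_big_coordinate:
 assumes x: "x \<in> unit_sph n" shows "\<exists>j<n. 1 / real n \<le> \<bar>x j\<bar>"
proof (rule ccontr)
 assume "\<not> ?thesis"
 hence *: "\<bar>x j\<bar> < 1 / real n" if "j < n" for j using that by force
 have n0: "n > 0" using x by (cases n) (auto simp: unit_sph_def)
 have "(\<Sum>i<n. x i ^ 2) < (\<Sum>i<n. 1 / real n)"
 proof (rule sum_strict_mono)
  fix i assume i: "i \<in> {..<n}"
  have "x i ^ 2 = \<bar>x i\<bar> * \<bar>x i\<bar>" by (simp add: power2_eq_square)
  also have "\<dots> \<le> \<bar>x i\<bar> * 1" using unit_sph_abs_le[OF x] by (intro mult_left_mono) auto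
  finally show "x i ^ 2 < 1 / real n" using *[of i] i by simp
 qed (use n0 in auto)
 thus False using x n0 by (simp add: unit_sph_def)
qed

text \<open>A large coordinate of a point of the sphere is, up to its sign, a Lipschitz function of the other
coordinates. This saves the one dimension on which the next lemma depends.\<close>

lemma unit_sph_coordinate_diff:
 assumes x: "x \<in> unit_sph n" and y: "y \<in> unit_sph n" and j: "j < n"
  and big: "1 / real n \<le> \<bar>x j\<bar>" "1 / real n \<le> \<bar>y j\<bar>" and sgn: "(0 \<le> x j) = (0 \<le> y j)"
  and close: "\<And>i. i < n ==> i \<noteq> j ==> \<bar>x i - y i\<bar> \<le> r" and r: "0 \<le> r"
 shows "\<bar>x j - y j\<bar> \<le> real n ^ 2 * r"
proof -
 have n0: "n > 0" using j by simp
 have "x j ^ 2 + (\<Sum>i\<in>{..<n}-{j}. x i ^ 2) = y j ^ 2 + (\<Sum>i\<in>{..<n}-{j}. y i ^ 2)"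
  using x y j sum.remove[of "{..<n}" j "\<lambda>i. x i ^ 2"] sum.remove[of "{..<n}" j "\<lambda>i. y i ^ 2"] by (simp add: unit_sph_def)
 hence "x j ^ 2 - y j ^ 2 = (\<Sum>i\<in>{..<n}-{j}. y i ^ 2 - x i ^ 2)" by (simp add: sum_subtractf)
 hence "\<bar>x j ^ 2 - y j ^ 2\<bar> \<le> (\<Sum>i\<in>{..<n}-{j}. \<bar>y i ^ 2 - x i ^ 2\<bar>)" by (metis sum_abs)
 also have "\<dots> \<le> (\<Sum>i\<in>{..<n}-{j}. 2 * r)"
 proof (rule sum_mono)
  fix i assume i: "i \<in> {..<n} - {j}"
  have "\<bar>y i ^ 2 - x i ^ 2\<bar> = \<bar>y i + x i\<bar> * \<bar>x i - y i\<bar>"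
   by (simp add: power2_eq_square square_diff_square_factored abs_mult abs_minus_commute)
  also have "\<dots> \<le> 2 * r" using close[of i] i unit_sph_abs_le[OF x, of i] unit_sph_abs_le[OF y, of i] by (intro mult_mono) auto
  finally show "\<bar>y i ^ 2 - x i ^ 2\<bar> \<le> 2 * r" .
 qed
 also have "\<dots> \<le> real n * (2 * r)" using r j by (simp add: mult_right_mono)
 finally have A: "\<bar>x j + y j\<bar> * \<bar>x j - y j\<bar> \<le> real n * (2 * r)" by (simp add: power2_eq_square square_diff_square_factored abs_mult)
 have "\<bar>x j + y j\<bar> \<ge> 2 / real n" using big sgn by (auto simp: field_simps abs_if split: if_splits)
 hence "2 / real n * \<bar>x j - y j\<bar> \<le> \<bar>x j + y j\<bar> * \<bar>x j - y j\<bar>" by (intro mult_right_mono) auto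
 with A have "2 / real n * \<bar>x j - y j\<bar> \<le> real n * (2 * r)" by linarith
 thus ?thesis using n0 by (simp add: field_simps power2_eq_square)
qed

text \<open>A Lipschitz image of a sphere of dimension \<open>n - 1\<close> in dimension \<open>n\<close> is a null set. A pigeonhole argument
shows this for all \<open>n\<close> inside one space of sequences: if all points of a grid with \<open>(Q + 1) ^ n\<close> nodes in
the small cube were hit, then preimages of different nodes would lie in different cells of a partition of
the sphere into at most \<open>Q ^ n\<close> cells.\<close>

lemma lipschitz_sphere_image_misses_small_point:
 fixes \<phi> :: "(nat => real) => nat => real"
 assumes A: "A \<subseteq> unit_sph n" and n0: "0 < n" and eps: "0 < \<epsilon>" and L: "0 \<le> L"
  and lip: "\<And>x y i r. x \<in> A ==> y \<in> A ==> i < n ==> (\<And>j. j < n ==> \<bar>x j - y j\<bar> \<le> r) ==> \<bar>\<phi> x i - \<phi> y i\<bar> \<le> L * r"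
 shows "\<exists>a. (\<forall>i<n. 0 \<le> a i \<and> a i \<le> \<epsilon>) \<and> (\<forall>x\<in>A. \<exists>i<n. \<phi> x i \<noteq> a i)"
proof (rule ccontr)
 assume "\<not> ?thesis"
 hence hit: "\<exists>x\<in>A. \<forall>i<n. \<phi> x i = a i" if "\<forall>i<n. 0 \<le> a i \<and> a i \<le> \<epsilon>" for a using that by blast
 \<comment> \<open>The cells have side \<open>1 / m\<close> with \<open>m = Q * B\<close>; the factor \<open>B\<close> makes their images smaller than the mesh \<open>\<epsilon> /
 Q\<close> of the grid. There are at most \<open>2 * n * (3 * m) ^ (n - 1)\<close> cells, and \<open>Q\<close> is chosen such that this equals
 \<open>Q ^ n\<close>.\<close>
 obtain B0 :: nat where B0: "L * real n ^ 2 / \<epsilon> < real B0" using reals_Archimedean2 by blast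
 define B where "B = Suc B0"
 define Q where "Q = 2 * n * (3 * B) ^ (n - 1)"
 define m where "m = Q * B"
 have B: "L * real n ^ 2 < \<epsilon> * real B" and Bpos: "B > 0" using B0 eps by (auto simp: B_def field_simps)
 have Qpos: "Q > 0" using n0 Bpos by (simp add: Q_def)
 have mpos: "m > 0" using Qpos Bpos by (simp add: m_def)
 define G where "G = ({..<n} \<rightarrow>\<^sub>E {0..Q})"
 define a where "a g i = \<epsilon> * real (g i) / real Q" for g :: "nat => nat" and i
 have ain: "\<forall>i<n. 0 \<le> a g i \<and> a g i \<le> \<epsilon>" if "g \<in> G" for g using that Qpos eps by (auto simp: G_def a_def PiE_iff field_simps)
 define X where "X g = (SOME x. x \<in> A \<and> (\<forall>i<n. \<phi> x i = a g i))" for g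
 have X: "X g \<in> A" "\<And>i. i < n ==> \<phi> (X g) i = a g i" if "g \<in> G" for g
  using someI_ex[of "\<lambda>x. x \<in> A \<and> (\<forall>i<n. \<phi> x i = a g i)"] hit[OF ain[OF that]] unfolding X_def by blast+
 \<comment> \<open>A cell is given by the index and the sign of a large coordinate and by the rounded other coordinates.\<close>
 define J where "J x = (SOME j. j < n \<and> 1 / real n \<le> \<bar>x j\<bar>)" for x :: "nat => real"
 have J: "J x < n" "1 / real n \<le> \<bar>x (J x)\<bar>" if "x \<in> A" for x
  using someI_ex[of "\<lambda>j. j < n \<and> 1 / real n \<le> \<bar>x j\<bar>"] unit_sph_big_coordinate[of x n] that A unfolding J_def by blast+
 define F where "F x = (\<lambda>i\<in>{..<n}. if i = J x then 0 else \<lfloor>x i * real m\<rfloor>)" for x :: "nat => real"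
 define T where "T = (SIGMA j:{..<n}. (UNIV::bool set) \<times> (PiE {..<n} (\<lambda>i. if i = j then {0} else {- int m..int m})))"
 define \<kappa> where "\<kappa> x = (J x, 0 \<le> x (J x), F x)" for x
 have \<kappa>T: "\<kappa> x \<in> T" if "x \<in> A" for x
 proof -
  have "- int m \<le> \<lfloor>x i * real m\<rfloor> \<and> \<lfloor>x i * real m\<rfloor> \<le> int m" for i
  proof -
   have "\<bar>x i\<bar> \<le> 1" using unit_sph_abs_le that A by blast
   hence "-1 * real m \<le> x i * real m" "x i * real m \<le> 1 * real m" by (intro mult_right_mono; force)+
   thus ?thesis by (simp add: floor_le_iff le_floor_iff)
  qed
  thus ?thesis using J[OF that] by (auto simp: \<kappa>_def T_def F_def PiE_iff)
 qed
 have "inj_on (\<lambda>g. \<kappa> (X g)) G"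
 proof (rule inj_onI, rule ccontr)
  fix g h assume g: "g \<in> G" and h: "h \<in> G" and eq: "\<kappa> (X g) = \<kappa> (X h)" and "g \<noteq> h"
  then obtain i where i: "i < n" "g i \<noteq> h i" by (metis G_def PiE_ext lessThan_iff)
  let ?x = "X g" and ?y = "X h"
  have Jeq: "J ?x = J ?y" and s: "(0 \<le> ?x (J ?x)) = (0 \<le> ?y (J ?x))" and Feq: "F ?x = F ?y" using eq by (auto simp: \<kappa>_def)
  have c: "\<bar>?x k - ?y k\<bar> \<le> 1 / real m" if "k < n" "k \<noteq> J ?x" for k
  proof -
   have "\<lfloor>?x k * real m\<rfloor> = \<lfloor>?y k * real m\<rfloor>" using fun_cong[OF Feq, of k] that Jeq by (simp add: F_def)
   hence "\<bar>?x k * real m - ?y k * real m\<bar> \<le> 1" by linarith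
   hence "\<bar>?x k - ?y k\<bar> * real m \<le> 1" by (simp add: left_diff_distrib[symmetric] abs_mult)
   thus ?thesis using mpos by (simp add: field_simps)
  qed
  have cJ: "\<bar>?x (J ?x) - ?y (J ?x)\<bar> \<le> real n ^ 2 * (1 / real m)"
  proof (rule unit_sph_coordinate_diff[where n=n])
   show "?x \<in> unit_sph n" "?y \<in> unit_sph n" using X g h A by auto
   show "J ?x < n" "1 / real n \<le> \<bar>?x (J ?x)\<bar>" using J X g by auto
   show "1 / real n \<le> \<bar>?y (J ?x)\<bar>" using J(2)[OF X(1)[OF h]] Jeq by simp
  qed (use s c in auto)
  have "\<bar>?x k - ?y k\<bar> \<le> real n ^ 2 / real m" if "k < n" for k
  proof (cases "k = J ?x")
   case False
   have "1 / real m \<le> real n ^ 2 / real m" using n0 mpos by (simp add: divide_right_mono)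
   thus ?thesis using c[OF that False] by linarith
  qed (use cJ in simp)
  hence "\<bar>\<phi> ?x i - \<phi> ?y i\<bar> \<le> L * (real n ^ 2 / real m)" using lip[OF X(1)[OF g] X(1)[OF h] i(1)] by blast
  also have "\<dots> = (L * real n ^ 2) / real m" by simp
  also have "\<dots> < (\<epsilon> * real B) / real m" using B mpos by (simp add: divide_strict_right_mono)
  also have "\<dots> = \<epsilon> / real Q" using Bpos by (simp add: m_def)
  finally have lt: "\<bar>a g i - a h i\<bar> < \<epsilon> / real Q" using X(2) g h i by simp
  have "\<bar>real (g i) - real (h i)\<bar> \<ge> 1" using i(2) by linarith
  hence "\<epsilon> / real Q * \<bar>real (g i) - real (h i)\<bar> \<ge> \<epsilon> / real Q * 1" using eps Qpos by (intro mult_left_mono) auto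
  moreover have "\<epsilon> / real Q * \<bar>real (g i) - real (h i)\<bar> = \<bar>\<epsilon> / real Q * (real (g i) - real (h i))\<bar>" using eps by (simp add: abs_mult)
  ultimately have "\<bar>a g i - a h i\<bar> \<ge> \<epsilon> / real Q" by (simp add: a_def diff_divide_distrib right_diff_distrib)
  thus False using lt by linarith
 qed
 moreover have "(\<lambda>g. \<kappa> (X g)) ` G \<subseteq> T" using \<kappa>T X by blast
 moreover have "finite T" unfolding T_def by (intro finite_SigmaI finite_cartesian_product finite_PiE) auto
 ultimately have "card G \<le> card T" by (rule card_inj_on_le)
 moreover have "card G = (Q + 1) ^ n" by (simp add: G_def card_PiE)
 moreover have "card T = 2 * n * (2 * m + 1) ^ (n - 1)"
 proof -
  have "card (PiE {..<n} (\<lambda>i. if i = j then {0} else {- int m..int m})) = (2 * m + 1) ^ (n - 1)" if "j < n" for j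
  proof -
   have "card (PiE {..<n} (\<lambda>i. if i = j then {0} else {- int m..int m}))
     = (\<Prod>i<n. card (if i = j then {0} else {- int m..int m}))" by (simp add: card_PiE)
   also have "\<dots> = (\<Prod>i\<in>{..<n}-{j}. card (if i = j then {0} else {- int m..int m}))" using that by (subst prod.remove[of _ j]) auto
   also have "\<dots> = (\<Prod>i\<in>{..<n}-{j}. 2 * m + 1)" by (rule prod.cong) auto
   also have "\<dots> = (2 * m + 1) ^ (n - 1)" using that by simp
   finally show ?thesis .
  qed
  moreover have "finite (PiE {..<n} (\<lambda>i. if i = j then {0} else {- int m..int m}))" for j by (intro finite_PiE) auto
  ultimately show ?thesis unfolding T_def by (subst card_SigmaI) (auto simp: card_cartesian_product card_UNIV_bool)
 qed
 ultimately have "(Q + 1) ^ n \<le> 2 * n * (2 * m + 1) ^ (n - 1)" by simp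
 also have "\<dots> \<le> 2 * n * (3 * m) ^ (n - 1)" using mpos by (intro mult_left_mono power_mono) auto
 also have "3 * m = Q * (3 * B)" by (simp add: m_def)
 also have "2 * n * (Q * (3 * B)) ^ (n - 1) = (2 * n * (3 * B) ^ (n - 1)) * Q ^ (n - 1)"
  by (subst power_mult_distrib[of Q "3 * B"]) (simp only: mult_ac)
 also have "\<dots> = Q * Q ^ (n - 1)" by (simp only: Q_def[symmetric])
 also have "\<dots> = Q ^ n" using n0 by (metis power_eq_if not_gr_zero)
 also have "\<dots> < (Q + 1) ^ n" using n0 by (intro power_strict_mono) auto
 finally show False by simp
qed

text \<open>The largest Lipschitz function with constant \<open>L\<close> below \<open>f\<close> is close to \<open>f\<close> for large \<open>L\<close>, by uniform
continuity. Its odd part is as close.\<close>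

lemma lipschitz_odd_approximation:
 fixes f :: "(nat => real) => real"
 assumes cont: "continuous_on (unit_sph n) f" and bd: "\<And>x. x \<in> unit_sph n ==> \<bar>f x\<bar> \<le> 1"
  and odd: "\<And>x. x \<in> unit_sph n ==> f (\<lambda>i. - x i) = - f x" and \<delta>: "0 < \<delta>"
 shows "\<exists>L g. 0 \<le> L \<and> (\<forall>x\<in>unit_sph n. \<forall>y\<in>unit_sph n. \<bar>g x - g y\<bar> \<le> L * (\<Sum>j<n. \<bar>x j - y j\<bar>)) \<and>
   (\<forall>x\<in>unit_sph n. \<bar>g x - f x\<bar> \<le> \<delta> \<and> g (\<lambda>i. - x i) = - g x)"
proof -
 let ?S = "unit_sph n"
 define d where "d x y = (\<Sum>j<n. \<bar>x j - y j\<bar>)" for x y :: "nat => real"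
 have d0: "0 \<le> d x y" and dxx: "d x x = 0" and dsym: "d x y = d y x" for x y by (auto simp: d_def sum_nonneg abs_minus_commute)
 have dtri: "d x z \<le> d x y + d y z" for x y z unfolding d_def sum.distrib[symmetric] by (intro sum_mono) linarith
 have "\<exists>r>0. \<forall>x\<in>?S. \<forall>y\<in>?S. \<bar>f x - f y\<bar> \<ge> \<delta> --> d x y \<ge> r"
 proof (cases "\<exists>z\<in>?S \<times> ?S. \<bar>f (fst z) - f (snd z)\<bar> \<ge> \<delta>")
  case True
  let ?K = "{z \<in> ?S \<times> ?S. \<bar>f (fst z) - f (snd z)\<bar> \<ge> \<delta>}"
  have cK: "compact (?S \<times> ?S)" by (intro compact_Times compact_unit_sph)
  have c1: "continuous_on (?S \<times> ?S) (\<lambda>z. f (fst z))" by (rule continuous_on_compose2[OF cont]) (auto intro: continuous_intros)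
  have c2: "continuous_on (?S \<times> ?S) (\<lambda>z. f (snd z))" by (rule continuous_on_compose2[OF cont]) (auto intro: continuous_intros)
  have "closedin (top_of_set (?S \<times> ?S)) ((?S \<times> ?S) \<inter> (\<lambda>z. \<bar>f (fst z) - f (snd z)\<bar>) -` {\<delta>..})"
   by (rule continuous_closedin_preimage[OF _ closed_atLeast])
    (rule continuous_on_rabs[OF continuous_on_diff[OF c1 c2]])
  hence "compact ((?S \<times> ?S) \<inter> (\<lambda>z. \<bar>f (fst z) - f (snd z)\<bar>) -` {\<delta>..})" using cK closedin_compact by blast
  moreover have "?K = (?S \<times> ?S) \<inter> (\<lambda>z. \<bar>f (fst z) - f (snd z)\<bar>) -` {\<delta>..}" by auto
  ultimately have K: "compact ?K" by simp
  have cd: "continuous_on ?K (\<lambda>z. d (fst z) (snd z))" unfolding d_def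
  proof (intro continuous_intros)
   fix j
   show "continuous_on ?K (\<lambda>z. fst z j)"
    by (rule continuous_on_compose2[OF continuous_on_coord[of UNIV]]) (auto intro: continuous_intros)
   show "continuous_on ?K (\<lambda>z. snd z j)"
    by (rule continuous_on_compose2[OF continuous_on_coord[of UNIV]]) (auto intro: continuous_intros)
  qed
  obtain z where z: "z \<in> ?K" and zmin: "\<And>w. w \<in> ?K ==> d (fst z) (snd z) \<le> d (fst w) (snd w)"
   using continuous_attains_inf[OF K _ cd] True by blast
  have "d (fst z) (snd z) \<noteq> 0"
  proof
   assume "d (fst z) (snd z) = 0"
   hence "fst z j = snd z j" for j using z by (cases "j < n") (auto simp: d_def sum_nonneg_eq_0_iff unit_sph_def)
   hence "fst z = snd z" by blast
   thus False using z \<delta> by simp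
  qed
  thus ?thesis using d0[of "fst z" "snd z"] zmin by (intro exI[of _ "d (fst z) (snd z)"]) fastforce
 next
  case False
  thus ?thesis by (intro exI[of _ 1]) auto
 qed
 then obtain r where r: "r > 0" and rc: "\<And>x y. x \<in> ?S ==> y \<in> ?S ==> d x y < r ==> \<bar>f x - f y\<bar> < \<delta>" by (meson not_le)
 \<comment> \<open>Points at distance at least \<open>r\<close> do not matter for the infimum, since \<open>L * r = 2\<close> bounds the oscillation of
 \<open>f\<close>.\<close>
 define L where "L = 2 / r"
 have L0: "0 \<le> L" using r by (simp add: L_def)
 define F where "F x = (INF y\<in>?S. f y + L * d x y)" for x
 have bdd: "bdd_below ((\<lambda>y. f y + L * d x y) ` ?S)" for x
 proof (rule bdd_belowI2[of _ "-1"])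
  fix y assume "y \<in> ?S" thus "-1 \<le> f y + L * d x y" using bd[of y] L0 d0[of x y] by (smt (verit) mult_nonneg_nonneg)
 qed
 have Flip: "F x \<le> F x' + L * d x x'" if "x \<in> ?S" "x' \<in> ?S" for x x'
 proof -
  have "F x - L * d x x' \<le> F x'" unfolding F_def[of x']
  proof (rule cINF_greatest)
   fix y assume y: "y \<in> ?S"
   have "F x \<le> f y + L * d x y" unfolding F_def by (rule cINF_lower[OF bdd y])
   also have "\<dots> \<le> f y + L * (d x x' + d x' y)" using L0 dtri by (intro add_left_mono mult_left_mono) auto
   finally show "F x - L * d x x' \<le> f y + L * d x' y" by (simp add: algebra_simps)
  qed (use that in auto)
  thus ?thesis by simp
 qed
 have Fle: "F x \<le> f x" if "x \<in> ?S" for x using cINF_lower[OF bdd that, of x] by (simp add: F_def dxx)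
 have Fge: "f x - \<delta> \<le> F x" if x: "x \<in> ?S" for x unfolding F_def
 proof (rule cINF_greatest)
  fix y assume y: "y \<in> ?S"
  show "f x - \<delta> \<le> f y + L * d x y"
  proof (cases "d x y < r")
   case True
   thus ?thesis using rc[OF x y] L0 d0[of x y] by (smt (verit) mult_nonneg_nonneg)
  next
   case False
   hence "L * d x y \<ge> L * r" using L0 by (intro mult_left_mono) auto
   hence "L * d x y \<ge> 2" using r by (simp add: L_def)
   thus ?thesis using bd[OF x] bd[OF y] \<delta> by linarith
  qed
 qed (use x in auto)
 define g where "g x = (F x - F (\<lambda>i. - x i)) / 2" for x
 have "\<bar>g x - g y\<bar> \<le> L * d x y" if x: "x \<in> ?S" and y: "y \<in> ?S" for x y
 proof -
  have dm: "d (\<lambda>i. - x i) (\<lambda>i. - y i) = d x y" unfolding d_def by (rule sum.cong) auto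
  have "F x \<le> F y + L * d x y" "F y \<le> F x + L * d x y"
   "F (\<lambda>i. - x i) \<le> F (\<lambda>i. - y i) + L * d x y" "F (\<lambda>i. - y i) \<le> F (\<lambda>i. - x i) + L * d x y"
   using Flip[OF x y] Flip[OF y x] Flip[OF unit_sph_uminus[OF x] unit_sph_uminus[OF y]]
    Flip[OF unit_sph_uminus[OF y] unit_sph_uminus[OF x]] dm dsym by auto
  thus ?thesis unfolding g_def by (simp add: abs_le_iff field_simps)
 qed
 moreover have "\<bar>g x - f x\<bar> \<le> \<delta>" if x: "x \<in> ?S" for x
  using Fle[OF x] Fge[OF x] Fle[OF unit_sph_uminus[OF x]] Fge[OF unit_sph_uminus[OF x]] odd[OF x]
  unfolding g_def by (simp add: abs_le_iff field_simps)
 moreover have "g (\<lambda>i. - x i) = - g x" for x by (simp add: g_def field_simps)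
 ultimately show ?thesis using L0 unfolding d_def by blast
qed

lemma continuous_on_if_coordinate_lipschitz:
 fixes g :: "(nat => real) => real"
 assumes "\<And>x y. x \<in> S ==> y \<in> S ==> \<bar>g x - g y\<bar> \<le> L * (\<Sum>j<n. \<bar>x j - y j\<bar>)"
 shows "continuous_on S g" unfolding continuous_on_def
proof
 fix x assume x: "x \<in> S"
 have t: "((\<lambda>y. L * (\<Sum>j<n. \<bar>y j - x j\<bar>)) \<longlongrightarrow> L * (\<Sum>j<n. \<bar>x j - x j\<bar>)) (at x within S)"
 proof (intro tendsto_intros)
  fix j show "((\<lambda>y. y j) \<longlongrightarrow> x j) (at x within S)" using continuous_on_coord[of S j] x unfolding continuous_on_def by blast
 qed
 have "((\<lambda>y. g y - g x) \<longlongrightarrow> 0) (at x within S)"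
 proof (rule Lim_null_comparison)
  show "\<forall>\<^sub>F y in at x within S. norm (g y - g x) \<le> L * (\<Sum>j<n. \<bar>y j - x j\<bar>)" using assms x by (auto simp: eventually_at_filter)
 qed (use t in simp)
 thus "(g \<longlongrightarrow> g x) (at x within S)" by (rule LIM_zero_cancel)
qed

text \<open>An odd map of the sphere of dimension 0 fixes or exchanges its two points.\<close>

lemma odd_map_unit_sph_1_degree:
 assumes cont: "continuous_on (unit_sph 1) f" and im: "f ` unit_sph 1 \<subseteq> unit_sph 1"
  and odd: "\<And>x. x \<in> unit_sph 1 ==> f (\<lambda>i. - x i) = (\<lambda>i. - f x i)"
 shows "odd (Brouwer_degree2 0 f)"
proof -
 define e where "e = (\<lambda>i::nat. if i = 0 then 1 else (0::real))"
 have mem: "x \<in> unit_sph 1 \<longleftrightarrow> x = e \<or> x = (\<lambda>i. - e i)" for x by (auto simp: unit_sph_def e_def fun_eq_iff power2_eq_1_iff)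
 have e: "e \<in> unit_sph 1" using mem by blast
 then consider "f e = e" | "f e = (\<lambda>i. - e i)" using im mem by blast
 thus ?thesis
 proof cases
  case 1
  hence "Brouwer_degree2 0 f = Brouwer_degree2 0 id" using odd[OF e] by (intro Brouwer_degree2_eq) (auto simp: mem[simplified])
  thus ?thesis by simp
 next
  case 2
  let ?r = "(\<lambda>x i. if i = 0 then -x i else x i) :: (nat => real) => (nat => real)"
  have "Brouwer_degree2 0 f = Brouwer_degree2 0 ?r" using odd[OF e] 2 by (intro Brouwer_degree2_eq) (auto simp: mem[simplified] e_def)
  thus ?thesis by (simp add: Brouwer_degree2_reflection)
 qed
qed

lemma unit_sph_mono: "m \<le> n ==> unit_sph m \<subseteq> unit_sph n"
proof
 fix x assume mn: "m \<le> n" and x: "x \<in> unit_sph m"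
 have "(\<Sum>i<n. x i ^ 2) = (\<Sum>i<m. x i ^ 2)" by (rule sum.mono_neutral_right) (use mn x in \<open>auto simp: unit_sph_def\<close>)
 thus "x \<in> unit_sph n" using x mn by (auto simp: unit_sph_def)
qed

lemma unit_sph_equator: "x \<in> unit_sph (Suc n) ==> x n = 0 ==> x \<in> unit_sph n"
 unfolding unit_sph_def by (auto simp: le_eq_less_or_eq[of n] Suc_le_eq)

text \<open>Borsuk's theorem. The inductive step \<open>Borsuk_odd_mapping_degree_step\<close> requires that the equator is mapped
into itself, and the proof deforms the given map to achieve this. On the equator a Lipschitz approximation
\<open>g\<close> misses some direction close to the pole. A shear moves this direction to the pole, and then the last
component can be damped to zero on the equator.\<close>

theorem odd_map_odd_degree:
 assumes "continuous_on (unit_sph (Suc n)) f" and "f ` unit_sph (Suc n) \<subseteq> unit_sph (Suc n)"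
  and "\<And>x. x \<in> unit_sph (Suc n) ==> f (\<lambda>i. - x i) = (\<lambda>i. - f x i)"
 shows "odd (Brouwer_degree2 n f)" using assms
proof (induction n arbitrary: f)
 case 0
 thus ?case using odd_map_unit_sph_1_degree by simp
next
 case (Suc m)
 define n where "n = Suc m"
 let ?S = "unit_sph (Suc n)"
 have fS: "f x \<in> ?S" if "x \<in> ?S" for x using Suc.prems(2) that by (auto simp: n_def)
 have fodd: "f (\<lambda>i. - x i) i = - f x i" if "x \<in> ?S" for x i using Suc.prems(3) that by (simp add: n_def)
 have fc: "continuous_on ?S (\<lambda>x. f x i)" for i using Suc.prems(1) continuous_on_product_then_coordinatewise by (simp add: n_def)
 define \<delta> where "\<delta> = 1 / (8 * real (Suc n))"
 have \<delta>: "0 < \<delta>" "\<delta> \<le> 1/16" by (auto simp: \<delta>_def n_def field_simps)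
 have "\<exists>L g. 0 \<le> L \<and> (\<forall>x\<in>?S. \<forall>y\<in>?S. \<bar>g x - g y\<bar> \<le> L * (\<Sum>j<Suc n. \<bar>x j - y j\<bar>)) \<and>
   (\<forall>x\<in>?S. \<bar>g x - f x i\<bar> \<le> \<delta> \<and> g (\<lambda>i. - x i) = - g x)" for i
  by (rule lipschitz_odd_approximation) (use fc unit_sph_abs_le[OF fS] fodd \<delta> in auto)
 hence "\<forall>i. \<exists>L g. 0 \<le> L \<and> (\<forall>x\<in>?S. \<forall>y\<in>?S. \<bar>g x - g y\<bar> \<le> L * (\<Sum>j<Suc n. \<bar>x j - y j\<bar>)) \<and>
   (\<forall>x\<in>?S. \<bar>g x - f x i\<bar> \<le> \<delta> \<and> g (\<lambda>i. - x i) = - g x)" by (rule allI)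
 from choice[OF this] obtain Li where "\<forall>i. \<exists>g. 0 \<le> Li i \<and> (\<forall>x\<in>?S. \<forall>y\<in>?S. \<bar>g x - g y\<bar> \<le> Li i * (\<Sum>j<Suc n. \<bar>x j - y j\<bar>)) \<and>
   (\<forall>x\<in>?S. \<bar>g x - f x i\<bar> \<le> \<delta> \<and> g (\<lambda>i. - x i) = - g x)" by (rule exE)
 from choice[OF this] obtain g where g: "\<forall>i. 0 \<le> Li i \<and> (\<forall>x\<in>?S. \<forall>y\<in>?S. \<bar>g i x - g i y\<bar> \<le> Li i * (\<Sum>j<Suc n. \<bar>x j - y j\<bar>)) \<and>
   (\<forall>x\<in>?S. \<bar>g i x - f x i\<bar> \<le> \<delta> \<and> g i (\<lambda>i. - x i) = - g i x)" by (rule exE)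
 have Li: "0 \<le> Li i" for i using g by blast
 have glip: "\<bar>g i x - g i y\<bar> \<le> Li i * (\<Sum>j<Suc n. \<bar>x j - y j\<bar>)" if "x \<in> ?S" "y \<in> ?S" for i x y using g that by blast
 have gf: "\<bar>g i x - f x i\<bar> \<le> \<delta>" and godd: "g i (\<lambda>i. - x i) = - g i x" if "x \<in> ?S" for i x using g that by blast+
 define L where "L = (\<Sum>i<Suc n. Li i)"
 have LiL: "Li i \<le> L" if "i < Suc n" for i using Li that unfolding L_def by (intro member_le_sum) auto
 have L0: "0 \<le> L" using LiL[of 0] Li[of 0] by simp
 \<comment> \<open>A vector of the unit sphere has a coordinate of size at least \<open>1 / (n + 1)\<close>.\<close>
 have big: "\<exists>i\<le>n. 8 * \<delta> \<le> \<bar>f x i\<bar>" if "x \<in> ?S" for x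
 proof -
  have "8 * \<delta> = 1 / real (Suc n)" unfolding \<delta>_def by (simp del: of_nat_Suc)
  thus ?thesis using unit_sph_big_coordinate[OF fS[OF that]] by (metis less_Suc_eq_le)
 qed
 have mS: "unit_sph n \<subseteq> ?S" by (rule unit_sph_mono) simp
 \<comment> \<open>On \<open>A\<close> the last component of \<open>g\<close> is not small, and \<open>\<phi>\<close> describes the direction of \<open>g x\<close>.\<close>
 define A where "A = {x \<in> unit_sph n. 4 * \<delta> \<le> \<bar>g n x\<bar>}"
 define \<phi> where "\<phi> x i = g i x / g n x" for x i
 have gbd: "\<bar>g i x\<bar> \<le> 2" if "x \<in> ?S" for x i using gf[OF that, of i] unit_sph_abs_le[OF fS[OF that], of i] \<delta> by linarith
 define L' where "L' = 4 * L * real (Suc n) / (4 * \<delta>) ^ 2"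
 have L'0: "0 \<le> L'" unfolding L'_def using L0 by (intro divide_nonneg_nonneg mult_nonneg_nonneg) auto
 have lip: "\<bar>\<phi> x i - \<phi> y i\<bar> \<le> L' * r" if x: "x \<in> A" and y: "y \<in> A" and i: "i < n"
   and r: "\<And>j. j < n ==> \<bar>x j - y j\<bar> \<le> r" for x y i r
 proof -
  have xS: "x \<in> ?S" and yS: "y \<in> ?S" using x y mS by (auto simp: A_def)
  have n0: "0 < n" by (simp add: n_def)
  have r0: "0 \<le> r" using r[OF n0] by linarith
  have "(\<Sum>j<Suc n. \<bar>x j - y j\<bar>) = (\<Sum>j<n. \<bar>x j - y j\<bar>)" using x y by (simp add: A_def unit_sph_def)
  also have "\<dots> \<le> (\<Sum>j<n. r)" using r by (intro sum_mono) auto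
  also have "\<dots> \<le> real (Suc n) * r" using r0 by (simp add: algebra_simps)
  finally have s: "(\<Sum>j<Suc n. \<bar>x j - y j\<bar>) \<le> real (Suc n) * r" .
  have gl: "\<bar>g k x - g k y\<bar> \<le> L * (real (Suc n) * r)" if "k \<le> n" for k
  proof -
   have "\<bar>g k x - g k y\<bar> \<le> Li k * (\<Sum>j<Suc n. \<bar>x j - y j\<bar>)" by (rule glip[OF xS yS])
   also have "\<dots> \<le> L * (real (Suc n) * r)"
    using that s LiL[of k] L0 by (intro mult_mono) (auto intro: sum_nonneg simp del: sum.lessThan_Suc)
   finally show ?thesis .
  qed
  have nz: "4 * \<delta> \<le> \<bar>g n x\<bar>" "4 * \<delta> \<le> \<bar>g n y\<bar>" using x y by (auto simp: A_def)
  hence nz': "g n x \<noteq> 0" "g n y \<noteq> 0" using \<delta> by auto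
  have "\<phi> x i - \<phi> y i = ((g i x - g i y) * g n y - g i y * (g n x - g n y)) / (g n x * g n y)" using nz' by (simp add: \<phi>_def field_simps)
  hence "\<bar>\<phi> x i - \<phi> y i\<bar> = \<bar>(g i x - g i y) * g n y - g i y * (g n x - g n y)\<bar> / (\<bar>g n x\<bar> * \<bar>g n y\<bar>)" by (simp add: abs_mult)
  also have "\<dots> \<le> (L * (real (Suc n) * r) * 2 + 2 * (L * (real (Suc n) * r))) / ((4 * \<delta>) * (4 * \<delta>))"
  proof (rule frac_le)
   have "\<bar>(g i x - g i y) * g n y - g i y * (g n x - g n y)\<bar> \<le> \<bar>g i x - g i y\<bar> * \<bar>g n y\<bar> + \<bar>g i y\<bar> * \<bar>g n x - g n y\<bar>"
    by (metis abs_mult abs_triangle_ineq4)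
   also have "\<dots> \<le> L * (real (Suc n) * r) * 2 + 2 * (L * (real (Suc n) * r))"
    using gl[of i] gl[of n] gbd[OF yS] i L0 r0 by (intro add_mono mult_mono) auto
   finally show "\<bar>(g i x - g i y) * g n y - g i y * (g n x - g n y)\<bar> \<le> L * (real (Suc n) * r) * 2 + 2 * (L * (real (Suc n) * r))" .
   show "4 * \<delta> * (4 * \<delta>) \<le> \<bar>g n x\<bar> * \<bar>g n y\<bar>" using nz \<delta> by (intro mult_mono) auto
  qed (use \<delta> L0 r0 in auto)
  also have "\<dots> = L' * r" by (simp add: L'_def power2_eq_square field_simps)
  finally show ?thesis .
 qed
 have "A \<subseteq> unit_sph n" "0 < n" by (auto simp: A_def n_def)
 hence "\<exists>a. (\<forall>i<n. 0 \<le> a i \<and> a i \<le> \<delta>) \<and> (\<forall>x\<in>A. \<exists>i<n. \<phi> x i \<noteq> a i)"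
  by (rule lipschitz_sphere_image_misses_small_point[OF _ _ \<delta>(1) L'0]) (rule lip)
 then obtain a where a: "\<And>i. i < n ==> 0 \<le> a i \<and> a i \<le> \<delta>" and miss: "\<And>x. x \<in> A ==> \<exists>i<n. \<phi> x i \<noteq> a i" by auto
 \<comment> \<open>\<open>G\<close> is the sheared map. The last component of \<open>H\<close> vanishes on the equator, where \<open>x n = 0\<close>.\<close>
 define G where "G x i = (if i < n then g i x - a i * g n x else if i = n then g n x else 0)" for x i
 define H where "H x i = (if i = n then \<bar>x n\<bar> * g n x else G x i)" for x :: "nat => real" and i
 have gc: "continuous_on ?S (g i)" for i by (rule continuous_on_if_coordinate_lipschitz[where L="Li i" and n="Suc n"]) (rule glip)
 have Gc: "continuous_on ?S (\<lambda>x. G x i)" for i unfolding G_def by (cases "i < n"; cases "i = n"; simp; intro continuous_intros gc)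
 have Hc: "continuous_on ?S (\<lambda>x. H x i)" for i unfolding H_def by (cases "i = n"; simp; intro continuous_intros gc Gc continuous_on_coord)
 have Gf: "\<bar>G x i - f x i\<bar> \<le> 3 * \<delta>" if x: "x \<in> ?S" and i: "i \<le> n" for x i
 proof (cases "i < n")
  case True
  have "\<bar>a i * g n x\<bar> \<le> \<delta> * 2" unfolding abs_mult using a[OF True] gbd[OF x, of n] by (intro mult_mono) auto
  moreover have "G x i - f x i = (g i x - f x i) - a i * g n x" using True by (simp add: G_def)
  ultimately show ?thesis using gf[OF x, of i] by linarith
 next
  case False
  thus ?thesis using gf[OF x, of i] i \<delta> by (simp add: G_def)
 qed
 have GN: "\<exists>i<n. G x i \<noteq> 0" if x: "x \<in> unit_sph n" for x
 proof (rule ccontr)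
  assume "\<not> ?thesis"
  hence z: "g i x = a i * g n x" if "i < n" for i using that by (auto simp: G_def)
  have xS: "x \<in> ?S" using x mS by blast
  obtain i where i: "i \<le> n" "8 * \<delta> \<le> \<bar>f x i\<bar>" using big[OF xS] by blast
  hence gi: "7 * \<delta> \<le> \<bar>g i x\<bar>" using gf[OF xS, of i] by linarith
  have "\<bar>g i x\<bar> \<le> \<bar>g n x\<bar>"
  proof (cases "i = n")
   case False
   hence i': "i < n" using i by simp
   have "\<bar>a i\<bar> * \<bar>g n x\<bar> \<le> 1 * \<bar>g n x\<bar>" using a[OF i'] \<delta> by (intro mult_right_mono) auto
   thus ?thesis using z[OF i'] by (simp add: abs_mult)
  qed simp
  hence gn: "4 * \<delta> \<le> \<bar>g n x\<bar>" using gi \<delta> by linarith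
  hence "x \<in> A" using x by (simp add: A_def)
  moreover have "\<phi> x i = a i" if "i < n" for i using z[OF that] gn \<delta> by (auto simp: \<phi>_def)
  ultimately show False using miss by blast
 qed
 have ne1: "\<exists>i\<le>n. (1 - t) * f x i + t * G x i \<noteq> 0" if x: "x \<in> ?S" and t: "0 \<le> t" "t \<le> 1" for x t
 proof -
  obtain i where i: "i \<le> n" "8 * \<delta> \<le> \<bar>f x i\<bar>" using big[OF x] by blast
  have "\<bar>t * (G x i - f x i)\<bar> \<le> 1 * (3 * \<delta>)" unfolding abs_mult using Gf[OF x i(1)] t by (intro mult_mono) auto
  moreover have "(1 - t) * f x i + t * G x i = f x i + t * (G x i - f x i)" by (simp add: algebra_simps)
  ultimately have "(1 - t) * f x i + t * G x i \<noteq> 0" using i \<delta> by linarith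
  thus ?thesis using i by blast
 qed
 have ne2: "\<exists>i\<le>n. (1 - t) * G x i + t * H x i \<noteq> 0" if x: "x \<in> ?S" and t: "0 \<le> t" "t \<le> 1" for x t
 proof (cases "\<exists>i<n. G x i \<noteq> 0")
  case True
  then obtain i where "i < n" "G x i \<noteq> 0" by blast
  thus ?thesis by (intro exI[of _ i]) (simp add: H_def algebra_simps)
 next
  case False
  hence xn: "x n \<noteq> 0" using GN[of x] unit_sph_equator[OF x] by blast
  have Gn: "G x n \<noteq> 0"
  proof -
   obtain i where "i \<le> n" "(1 - 1) * f x i + 1 * G x i \<noteq> 0" using ne1[OF x, of 1] by auto
   thus ?thesis using False by (cases "i = n") auto
  qed
  have "(1 - t) + t * \<bar>x n\<bar> > 0"
  proof (cases "t = 1")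
   case False
   thus ?thesis using t by (intro add_pos_nonneg) auto
  qed (use xn in simp)
  moreover have "(1 - t) * G x n + t * H x n = ((1 - t) + t * \<bar>x n\<bar>) * G x n" by (simp add: H_def G_def algebra_simps)
  ultimately show ?thesis using Gn by (intro exI[of _ n]) simp
 qed
 define N where "N x = normalize_vec (Suc n) (H x)" for x
 have Hne: "\<exists>i<Suc n. H x i \<noteq> 0" if "x \<in> ?S" for x using ne2[OF that, of 1] by (auto simp: less_Suc_eq_le)
 have "Brouwer_degree2 n f = Brouwer_degree2 n (\<lambda>x. normalize_vec (Suc n) (f x))"
  by (rule Brouwer_degree2_eq) (simp add: normalize_vec_id fS)
 also have "\<dots> = Brouwer_degree2 n (\<lambda>x. normalize_vec (Suc n) (G x))" by (rule degree_normalize_linear_homotopy) (use fc Gc ne1 in auto)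
 also have "\<dots> = Brouwer_degree2 n N" unfolding N_def by (rule degree_normalize_linear_homotopy) (use Gc Hc ne2 in auto)
 finally have deg: "Brouwer_degree2 n f = Brouwer_degree2 n N" .
 have Nc: "continuous_on ?S N" unfolding N_def by (rule continuous_on_normalize_vec) (use Hc Hne in auto)
 have Nim: "N ` ?S \<subseteq> ?S" using Hne by (auto simp: N_def normalize_vec_in)
 have Nodd: "N (\<lambda>i. - x i) = (\<lambda>i. - N x i)" if "x \<in> ?S" for x
 proof -
  have "H (\<lambda>i. - x i) = (\<lambda>i. - H x i)" using godd[OF that] by (auto simp: H_def G_def fun_eq_iff)
  thus ?thesis by (simp add: N_def normalize_vec_uminus)
 qed
 have Neq: "N ` unit_sph n \<subseteq> unit_sph n"
 proof
  fix y assume "y \<in> N ` unit_sph n"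
  then obtain x where x: "x \<in> unit_sph n" and y: "y = N x" by blast
  have "y \<in> ?S" using x y Nim mS by blast
  moreover have "y n = 0" using x y by (simp add: N_def normalize_vec_def H_def unit_sph_def)
  ultimately show "y \<in> unit_sph n" by (rule unit_sph_equator)
 qed
 have IH: "odd (Brouwer_degree2 m N)" by (rule Suc.IH) (use continuous_on_subset[OF Nc mS] Neq Nodd mS in \<open>auto simp: n_def\<close>)
 have "even (Brouwer_degree2 n N - Brouwer_degree2 (n - Suc 0) N)" by (rule Borsuk_odd_mapping_degree_step)
   (use Nc Nim Nodd Neq in \<open>auto simp: continuous_map_nsphere_iff n_def\<close>)
 thus ?case using IH deg by (simp add: n_def)
qed

text \<open>If \<open>d < k\<close>, the map padded with zeros and normalized is an odd map of the sphere into itself which is not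
surjective, so its degree is both odd and zero.\<close>

theorem Borsuk_Ulam_no_odd_map:
 fixes f :: "(nat => real) => nat => real"
 assumes cont: "\<And>i. i < d ==> continuous_on (unit_sph k) (\<lambda>x. f x i)"
  and ne: "\<And>x. x \<in> unit_sph k ==> \<exists>i<d. f x i \<noteq> 0"
  and odd: "\<And>x i. x \<in> unit_sph k ==> i < d ==> f (\<lambda>i. - x i) i = - f x i"
 shows "k \<le> d"
proof (rule ccontr)
 assume "\<not> k \<le> d"
 then obtain n where k: "k = Suc n" and dn: "d \<le> n" by (cases k) auto
 define F where "F x i = (if i < d then f x i else 0)" for x i
 define N where "N x = normalize_vec (Suc n) (F x)" for x
 have Fc: "continuous_on (unit_sph k) (\<lambda>x. F x i)" for i using cont by (cases "i < d") (auto simp: F_def)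
 have Fne: "\<exists>i<Suc n. F x i \<noteq> 0" if "x \<in> unit_sph k" for x using ne[OF that] dn by (fastforce simp: F_def)
 have Nc: "continuous_on (unit_sph k) N" unfolding N_def by (rule continuous_on_normalize_vec) (use Fc Fne in auto)
 have Nim: "N ` unit_sph k \<subseteq> unit_sph k" using Fne by (auto simp: N_def normalize_vec_in k)
 have Nodd: "N (\<lambda>i. - x i) = (\<lambda>i. - N x i)" if "x \<in> unit_sph k" for x
 proof -
  have "F (\<lambda>i. - x i) = (\<lambda>i. - F x i)" using odd[OF that] by (auto simp: F_def fun_eq_iff)
  thus ?thesis by (simp add: N_def normalize_vec_uminus)
 qed
 have "odd (Brouwer_degree2 n N)" by (rule odd_map_odd_degree) (use Nc Nim Nodd k in auto)
 moreover have "N ` unit_sph k \<noteq> unit_sph k"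
 proof
  assume eq: "N ` unit_sph k = unit_sph k"
  let ?e = "\<lambda>i. if i = n then 1 else (0::real)"
  have "?e \<in> unit_sph k" by (auto simp: unit_sph_def k if_distrib[of "\<lambda>t. t ^ 2"] cong: if_cong)
  hence "?e \<in> N ` unit_sph k" by (simp only: eq)
  then obtain x where x: "?e = N x" by (rule imageE)
  have "N x n = 1" by (simp flip: x)
  thus False using dn by (simp add: N_def normalize_vec_def F_def)
 qed
 hence "Brouwer_degree2 n N = 0" by (intro Brouwer_degree2_nonsurjective) (use Nc Nim k in \<open>auto simp: continuous_map_nsphere_iff\<close>)
 ultimately show False by simp
qed

section \<open>A minimax principle in finite dimension\<close>

definition unit_bll :: "nat => (nat => real) set" where
 "unit_bll n = {x. (\<Sum>i<n. x i ^ 2) \<le> 1 \<and> (\<forall>i\<ge>n. x i = 0)}"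

definition coord_space :: "nat set => (nat => real) set" where
 "coord_space S = {c. \<forall>i. i \<notin> S --> c i = 0}"

lemma compact_unit_bll: "compact (unit_bll n)"
proof -
 have "\<bar>x i\<bar> \<le> 1" if "(\<Sum>i<n. x i ^ 2) \<le> 1" "i < n" for x :: "nat => real" and i
 proof -
  have "x i ^ 2 \<le> (\<Sum>i<n. x i ^ 2)" using that by (intro member_le_sum) auto
  with that(1) have "x i ^ 2 \<le> 1" by linarith
  thus ?thesis by (simp add: abs_square_le_1)
 qed
 hence "unit_bll n = {c. (\<Sum>i<n. c i ^ 2) \<le> 1 \<and> (\<forall>i\<in>{..<n}. \<bar>c i\<bar> \<le> 1) \<and> (\<forall>i. i \<notin> {..<n} --> c i = 0)}" by (auto simp: unit_bll_def)
 moreover have "continuous_on UNIV (\<lambda>c::nat=>real. \<Sum>i<n. c i ^ 2)" by (intro continuous_intros continuous_on_coord)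
 ultimately show ?thesis using compact_coordinate_sublevel(2)[where f = "\<lambda>c. \<Sum>i<n. c i ^ 2" and r = 1 and S = "{..<n}" and R = 1] by simp
qed

lemma abs_coord_le_L2_set: "finite S ==> i \<in> S ==> \<bar>c i\<bar> \<le> L2_set c S" using member_le_L2_set[of S i "\<lambda>i. \<bar>c i\<bar>"] by (simp add: L2_set_def)

lemma continuous_on_L2_set:
 "(\<And>i. i \<in> S ==> continuous_on K (\<lambda>x. f x i)) ==> continuous_on K (\<lambda>x. L2_set (f x) S)"
 unfolding L2_set_def by (intro continuous_intros) auto

text \<open>A finite number of small explicit steps replaces the gradient flow, which need not be well defined for a
gradient that is only continuous. The steps fade out between the levels \<open>a1\<close> and \<open>a\<close>.\<close>

lemma descent_deformation:
 fixes E :: "(nat => real) => real" and g :: "(nat => real) => nat => real"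
  and \<gamma> :: "'k::topological_space => nat => real"
 assumes S: "finite S" and cE: "continuous_on (coord_space S) E"
  and cg: "\<And>i. i \<in> S ==> continuous_on (coord_space S) (\<lambda>c. g c i)"
  and descent: "\<And>R \<epsilon>. 0 < \<epsilon> ==> \<exists>s0>0. \<forall>c\<in>coord_space S. \<forall>w\<in>coord_space S. \<forall>s.
    L2_set c S \<le> R --> L2_set w S \<le> 1 --> 0 < s --> s \<le> s0 -->
    E (\<lambda>i. c i - s * w i) \<le> E c - s * (\<Sum>i\<in>S. g c i * w i) + s * \<epsilon>"
  and \<delta>: "0 < \<delta>" and slope: "\<And>c. c \<in> coord_space S ==> a \<le> E c ==> E c \<le> b ==> \<delta> \<le> L2_set (g c) S"
  and a: "a < a1" "a1 \<le> b"
  and K: "compact K" and c\<gamma>: "continuous_on K \<gamma>" and \<gamma>S: "\<gamma> ` K \<subseteq> coord_space S" and \<gamma>b: "\<And>x. x \<in> K ==> E (\<gamma> x) \<le> b"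
 shows "\<exists>\<gamma>'. continuous_on K \<gamma>' \<and> \<gamma>' ` K \<subseteq> coord_space S \<and> (\<forall>x\<in>K. E (\<gamma>' x) \<le> a1) \<and>
  (\<forall>x\<in>K. E (\<gamma> x) \<le> a --> \<gamma>' x = \<gamma> x)"
proof -
 let ?X = "coord_space S"
 define cut where "cut e = min 1 (max 0 ((e - a) / (a1 - a)))" for e
 have cut_01: "0 \<le> cut e" "cut e \<le> 1" for e by (auto simp: cut_def)
 have cut_0: "cut e = 0" if "e \<le> a" for e using divide_nonpos_pos[of "e - a" "a1 - a"] that a by (simp add: cut_def)
 have cut_1: "cut e = 1" if "a1 \<le> e" for e using that a by (auto simp: cut_def min_def max_def field_simps)
 have "continuous_on K (\<lambda>x. L2_set (\<gamma> x) S)" by (rule continuous_on_L2_set) (rule continuous_on_product_then_coordinatewise[OF c\<gamma>])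
 hence "bounded ((\<lambda>x. L2_set (\<gamma> x) S) ` K)" by (intro compact_imp_bounded compact_continuous_image K)
 then obtain R0 where R0': "\<forall>y\<in>(\<lambda>x. L2_set (\<gamma> x) S) ` K. norm y \<le> R0" using bounded_iff by blast
 have R0: "L2_set (\<gamma> x) S \<le> R0" if "x \<in> K" for x using R0' that by fastforce
 \<comment> \<open>The total length of the steps: descent at the rate \<open>\<delta> / 2\<close> over the length \<open>D\<close> leads from \<open>b\<close> below \<open>a1\<close>.\<close>
 define D where "D = 2 * (b - a1) / \<delta> + 1"
 have D: "D > 0" "D * \<delta> / 2 \<ge> b - a1" using a \<delta> by (auto simp: D_def field_simps intro: add_nonneg_pos)
 obtain s0 where s0: "s0 > 0" and ds: "\<And>c w s. c \<in> ?X ==> w \<in> ?X ==> L2_set c S \<le> R0 + D ==> L2_set w S \<le> 1 ==> 0 < s ==> s \<le> s0 ==>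
   E (\<lambda>i. c i - s * w i) \<le> E c - s * (\<Sum>i\<in>S. g c i * w i) + s * (\<delta> / 2)" using descent[of "\<delta> / 2" "R0 + D"] \<delta> by auto
 obtain N :: nat where N: "D / s0 < real N" using reals_Archimedean2 by blast
 hence N0: "N > 0" using D s0 by (metis divide_pos_pos gr0I of_nat_0 order_less_asym)
 define s where "s = D / real N"
 have s: "s > 0" "s \<le> s0" "real N * s = D" using N N0 D s0 by (auto simp: s_def field_simps)
 \<comment> \<open>The maximum keeps the normalized direction continuous where the gradient is small.\<close>
 define w where "w c = (\<lambda>i. if i \<in> S then g c i / max \<delta> (L2_set (g c) S) else 0)" for c
 define step where "step c = (\<lambda>i. c i - s * cut (E c) * w c i)" for c
 have wX: "w c \<in> ?X" for c by (auto simp: w_def coord_space_def)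
 have stepX: "step c \<in> ?X" if "c \<in> ?X" for c using that by (auto simp: step_def w_def coord_space_def)
 have Lw: "L2_set (w c) S = L2_set (g c) S / max \<delta> (L2_set (g c) S)" for c
 proof -
  have "L2_set (w c) S = L2_set (\<lambda>i. (1 / max \<delta> (L2_set (g c) S)) * g c i) S" unfolding w_def by (rule L2_set_cong) auto
  also have "\<dots> = 1 / max \<delta> (L2_set (g c) S) * L2_set (g c) S" using \<delta> by (subst L2_set_right_distrib[symmetric]) auto
  finally show ?thesis by simp
 qed
 have Lw1: "L2_set (w c) S \<le> 1" for c using \<delta> L2_set_nonneg[of "g c" S] by (simp add: Lw)
 have stepE: "E (step c) \<le> max a1 (E c - s * (\<delta> / 2)) \<and> E (step c) \<le> E c"
  if c: "c \<in> ?X" "L2_set c S \<le> R0 + D" "E c \<le> b" for c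
 proof (cases "cut (E c) = 0")
  case True
  hence "E c \<le> a1" using cut_1[of "E c"] by linarith
  moreover have "step c = c" using True by (simp add: step_def)
  ultimately show ?thesis by simp
 next
  case False
  hence Ea: "a \<le> E c" using cut_0[of "E c"] by linarith
  let ?s = "s * cut (E c)"
  have sc: "0 < ?s" "?s \<le> s" using False cut_01[of "E c"] s by (auto simp: mult_le_cancel_left2 zero_less_mult_iff)
  have sl: "\<delta> \<le> L2_set (g c) S" using slope c Ea by blast
  hence mx: "max \<delta> (L2_set (g c) S) = L2_set (g c) S" "L2_set (g c) S \<noteq> 0" using \<delta> by auto
  have "(\<Sum>i\<in>S. g c i * w c i) = (\<Sum>i\<in>S. (g c i)^2) / L2_set (g c) S" by (simp add: w_def mx sum_divide_distrib power2_eq_square)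
  also have "(\<Sum>i\<in>S. (g c i)^2) = L2_set (g c) S ^ 2" by (simp add: L2_set_def sum_nonneg)
  finally have gw: "(\<Sum>i\<in>S. g c i * w c i) = L2_set (g c) S" using mx by (simp add: power2_eq_square)
  have "E (step c) \<le> E c - ?s * L2_set (g c) S + ?s * (\<delta> / 2)" using ds[OF c(1) wX c(2) Lw1 sc(1), of c] sc s gw by (simp add: step_def)
  also have "\<dots> \<le> E c - ?s * \<delta> + ?s * (\<delta> / 2)" proof -
   have "?s * \<delta> \<le> ?s * L2_set (g c) S" using sl sc by (intro mult_left_mono) auto
   thus ?thesis by linarith
  qed
  finally have *: "E (step c) \<le> E c - ?s * (\<delta> / 2)" by (simp add: field_simps)
  show ?thesis
  proof (cases "a1 \<le> E c")
   case True
   have "0 \<le> s * (\<delta> / 2)" using s \<delta> by simp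
   thus ?thesis using * cut_1[OF True] by simp
  next
   case False
   moreover have "0 \<le> ?s * (\<delta> / 2)" using sc \<delta> by simp
   ultimately show ?thesis using * by linarith
  qed
 qed
 have stepL: "L2_set (step c) S \<le> L2_set c S + s" for c
 proof -
  have "L2_set (step c) S \<le> L2_set c S + L2_set (\<lambda>i. - (s * cut (E c)) * w c i) S"
   unfolding step_def using L2_set_triangle_ineq[of c "\<lambda>i. - (s * cut (E c)) * w c i" S] by simp
  also have "L2_set (\<lambda>i. - (s * cut (E c)) * w c i) S = L2_set (\<lambda>i. (s * cut (E c)) * w c i) S" by (simp add: L2_set_def)
  also have "\<dots> = (s * cut (E c)) * L2_set (w c) S" using s cut_01 by (subst L2_set_right_distrib[symmetric]) auto
  also have "\<dots> \<le> (s * 1) * 1" using s cut_01 Lw1 by (intro mult_mono) auto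
  finally show ?thesis by simp
 qed
 have stepc: "continuous_on ?X step"
 proof (rule continuous_on_coordinatewise_then_product)
  fix i
  have cg': "continuous_on ?X (\<lambda>c. L2_set (g c) S)" by (intro continuous_on_L2_set cg)
  have "continuous_on ?X (\<lambda>c. w c i)" unfolding w_def
   using \<delta> by (cases "i \<in> S"; simp; intro continuous_intros cg' cg) (auto simp: max_def)
  moreover have "continuous_on ?X (\<lambda>c. cut (E c))" unfolding cut_def using a by (intro continuous_intros cE) auto
  ultimately show "continuous_on ?X (\<lambda>c. step c i)" unfolding step_def by (intro continuous_intros continuous_on_coord)
 qed
 define \<Gamma> where "\<Gamma> j x = (step ^^ j) (\<gamma> x)" for j x
 have "continuous_on K (\<Gamma> j) \<and> (\<forall>x\<in>K. \<Gamma> j x \<in> ?X \<and> L2_set (\<Gamma> j x) S \<le> R0 + real j * s \<and> E (\<Gamma> j x) \<le> b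
   \<and> E (\<Gamma> j x) \<le> max a1 (b - real j * s * (\<delta> / 2)) \<and> (E (\<gamma> x) \<le> a --> \<Gamma> j x = \<gamma> x))" if "j \<le> N" for j using that
 proof (induction j)
  case 0
  thus ?case using c\<gamma> \<gamma>S \<gamma>b R0 by (auto simp: \<Gamma>_def le_max_iff_disj)
 next
  case (Suc j)
  hence IH: "continuous_on K (\<Gamma> j)" "\<And>x. x \<in> K ==> \<Gamma> j x \<in> ?X" "\<And>x. x \<in> K ==> L2_set (\<Gamma> j x) S \<le> R0 + real j * s"
    "\<And>x. x \<in> K ==> E (\<Gamma> j x) \<le> b" "\<And>x. x \<in> K ==> E (\<Gamma> j x) \<le> max a1 (b - real j * s * (\<delta> / 2))"
    "\<And>x. x \<in> K ==> E (\<gamma> x) \<le> a ==> \<Gamma> j x = \<gamma> x" by auto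
  have \<Gamma>S: "\<Gamma> (Suc j) x = step (\<Gamma> j x)" for x by (simp add: \<Gamma>_def)
  have "continuous_on K (\<Gamma> (Suc j))" unfolding \<Gamma>S by (rule continuous_on_compose2[OF stepc IH(1)]) (use IH(2) in auto)
  moreover have "\<Gamma> (Suc j) x \<in> ?X \<and> L2_set (\<Gamma> (Suc j) x) S \<le> R0 + real (Suc j) * s \<and> E (\<Gamma> (Suc j) x) \<le> b
   \<and> E (\<Gamma> (Suc j) x) \<le> max a1 (b - real (Suc j) * s * (\<delta> / 2)) \<and> (E (\<gamma> x) \<le> a --> \<Gamma> (Suc j) x = \<gamma> x)" if x: "x \<in> K" for x
  proof -
   have "real j * s \<le> real N * s" using Suc.prems s by (intro mult_right_mono) auto
   hence "L2_set (\<Gamma> j x) S \<le> R0 + D" using IH(3)[OF x] s by linarith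
   note st = stepE[OF IH(2)[OF x] this IH(4)[OF x]]
   have "max a1 (E (\<Gamma> j x) - s * (\<delta> / 2)) \<le> max a1 (b - real (Suc j) * s * (\<delta> / 2))"
   proof -
    have "s * (\<delta> / 2) \<ge> 0" using s \<delta> by simp
    thus ?thesis using IH(5)[OF x] by (auto simp: algebra_simps max_def split: if_splits)
   qed
   moreover have "step (\<gamma> x) = \<gamma> x" if "E (\<gamma> x) \<le> a" using cut_0[OF that] by (simp add: step_def)
   ultimately show ?thesis unfolding \<Gamma>S using st stepX[OF IH(2)[OF x]] stepL[of "\<Gamma> j x"] IH(3,4,6)[OF x] by (auto simp: algebra_simps)
  qed
  ultimately show ?case by blast
 qed
 from this[of N] have "continuous_on K (\<Gamma> N)" and "\<And>x. x \<in> K ==> \<Gamma> N x \<in> ?X" and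
   N2: "\<And>x. x \<in> K ==> E (\<Gamma> N x) \<le> max a1 (b - real N * s * (\<delta> / 2))" and "\<And>x. x \<in> K ==> E (\<gamma> x) \<le> a ==> \<Gamma> N x = \<gamma> x" by auto
 moreover have "E (\<Gamma> N x) \<le> a1" if "x \<in> K" for x using N2[OF that] s D by auto
 ultimately show ?thesis by (intro exI[of _ "\<Gamma> N"]) auto
qed

text \<open>At a zero of \<open>r\<close> the function \<open>u\<close> may have no limit, but it is bounded.\<close>

lemma continuous_on_zero_extension:
 fixes r u :: "'k::topological_space => real"
 assumes r: "continuous_on S r" and u: "continuous_on {x\<in>S. r x \<noteq> 0} u"
  and B: "\<And>x. x \<in> S ==> r x \<noteq> 0 ==> \<bar>u x\<bar> \<le> B"
 shows "continuous_on S (\<lambda>x. if r x = 0 then 0 else r x * u x)" unfolding continuous_on_def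
proof
 fix x assume x: "x \<in> S"
 let ?f = "\<lambda>x. if r x = 0 then 0 else r x * u x"
 have rt: "(r \<longlongrightarrow> r x) (at x within S)" using r x by (simp add: continuous_on_def)
 show "(?f \<longlongrightarrow> ?f x) (at x within S)"
 proof (cases "r x = 0")
  case True
  have "((\<lambda>y. \<bar>r y\<bar> * \<bar>B\<bar>) \<longlongrightarrow> \<bar>r x\<bar> * \<bar>B\<bar>) (at x within S)" by (intro tendsto_intros rt)
  hence t: "((\<lambda>y. \<bar>r y\<bar> * \<bar>B\<bar>) \<longlongrightarrow> 0) (at x within S)" using True by simp
  have "(?f \<longlongrightarrow> 0) (at x within S)"
  proof (rule Lim_null_comparison[OF _ t])
   show "\<forall>\<^sub>F y in at x within S. norm (?f y) \<le> \<bar>r y\<bar> * \<bar>B\<bar>" unfolding eventually_at_filter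
   proof (rule always_eventually, intro allI impI)
    fix y assume "y \<in> S"
    thus "norm (?f y) \<le> \<bar>r y\<bar> * \<bar>B\<bar>" using B[of y] by (auto simp: abs_mult intro!: mult_left_mono)
   qed
  qed
  thus ?thesis using True by simp
 next
  case False
  let ?S' = "{x\<in>S. r x \<noteq> 0}"
  have ev: "\<forall>\<^sub>F y in at x within S. r y \<noteq> 0" by (rule tendsto_imp_eventually_ne[OF rt False])
  have "continuous_on ?S' (\<lambda>x. r x * u x)" by (intro continuous_on_mult u continuous_on_subset[OF r]) auto
  hence t: "((\<lambda>x. r x * u x) \<longlongrightarrow> r x * u x) (at x within ?S')" using x False by (simp add: continuous_on_def)
  show ?thesis
  proof (rule topological_tendstoI)
   fix U assume U: "open U" "?f x \<in> U"
   hence "\<forall>\<^sub>F y in at x within ?S'. r y * u y \<in> U" using topological_tendstoD[OF t] False by simp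
   thus "\<forall>\<^sub>F y in at x within S. ?f y \<in> U" using ev unfolding eventually_at_filter by eventually_elim auto
  qed
 qed
qed

lemma continuous_on_cone:
 assumes ch: "continuous_on (unit_sph k) h"
 shows "continuous_on (unit_bll k) (\<lambda>x i. if sph_norm k x = 0 then 0 else sph_norm k x * (T * h (normalize_vec k x) i))"
proof (rule continuous_on_coordinatewise_then_product)
 fix i
 have chi: "continuous_on (unit_sph k) (\<lambda>x. T * h x i)" by (intro continuous_intros continuous_on_product_then_coordinatewise[OF ch])
 hence "bounded ((\<lambda>x. T * h x i) ` unit_sph k)" by (intro compact_imp_bounded compact_continuous_image compact_unit_sph)
 then obtain B where B: "\<forall>y\<in>(\<lambda>x. T * h x i) ` unit_sph k. norm y \<le> B" using bounded_iff by blast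
 have nv: "normalize_vec k x \<in> unit_sph k" if "sph_norm k x \<noteq> 0" for x using that by (intro normalize_vec_in) (simp add: sph_norm_eq_0)
 show "continuous_on (unit_bll k) (\<lambda>x. if sph_norm k x = 0 then 0 else sph_norm k x * (T * h (normalize_vec k x) i))"
 proof (rule continuous_on_zero_extension)
  show "continuous_on (unit_bll k) (sph_norm k)" unfolding sph_norm_def by (intro continuous_intros continuous_on_coord)
  have "continuous_on {x \<in> unit_bll k. sph_norm k x \<noteq> 0} (\<lambda>x. normalize_vec k x)"
   by (rule continuous_on_normalize_vec) (auto simp: sph_norm_eq_0 intro: continuous_on_coord)
  thus "continuous_on {x \<in> unit_bll k. sph_norm k x \<noteq> 0} (\<lambda>x. T * h (normalize_vec k x) i)"
   by (rule continuous_on_compose2[OF chi]) (use nv in auto)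
  show "\<bar>T * h (normalize_vec k x) i\<bar> \<le> B" if "sph_norm k x \<noteq> 0" for x using B nv[OF that] by fastforce
 qed
qed

lemma continuous_on_uminus_fun:
 fixes f :: "'k::topological_space => nat => real"
 shows "continuous_on A f ==> continuous_on A (\<lambda>x i. - f x i)"
 by (rule continuous_on_coordinatewise_then_product, rule continuous_on_minus,
   erule continuous_on_product_then_coordinatewise)

text \<open>The map is used on the upper hemisphere and its reflection on the lower one. They agree on the equator
because \<open>\<gamma>\<close> is odd there.\<close>

lemma hemisphere_gluing:
 fixes \<gamma> :: "(nat => real) => nat => real"
 assumes c\<gamma>: "continuous_on (unit_bll k) \<gamma>" and odd: "\<And>x. x \<in> unit_sph k ==> \<gamma> (\<lambda>i. - x i) = (\<lambda>i. - \<gamma> x i)"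
 shows "\<exists>H. continuous_on (unit_sph (Suc k)) H \<and> (\<forall>x\<in>unit_sph (Suc k). H (\<lambda>i. - x i) = (\<lambda>i. - H x i) \<and>
   (\<exists>y\<in>unit_bll k. H x = \<gamma> y \<or> H x = (\<lambda>i. - \<gamma> y i)))"
proof -
 define pr where "pr x = (\<lambda>i. if i < k then x i else 0)" for x :: "nat => real"
 have prB: "pr x \<in> unit_bll k" if "x \<in> unit_sph (Suc k)" for x
 proof -
  have "(\<Sum>i<k. pr x i ^ 2) = (\<Sum>i<k. x i ^ 2)" by (rule sum.cong) (auto simp: pr_def)
  also have "\<dots> \<le> 1"
  proof -
   have "(\<Sum>i<k. x i ^ 2) + x k ^ 2 = 1" using that by (simp add: unit_sph_def)
   thus ?thesis using zero_le_power2[of "x k"] by linarith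
  qed
  finally show ?thesis by (simp add: unit_bll_def pr_def)
 qed
 have prm: "pr (\<lambda>i. - x i) = (\<lambda>i. - pr x i)" for x by (auto simp: pr_def)
 have prc: "continuous_on A pr" for A
 proof (rule continuous_on_coordinatewise_then_product)
  show "continuous_on A (\<lambda>x. pr x i)" for i unfolding pr_def by (cases "i < k") (auto intro: continuous_on_coord)
 qed
 have prmB: "(\<lambda>i. - y i) \<in> unit_bll k" if "y \<in> unit_bll k" for y using that by (simp add: unit_bll_def)
 define H where "H x = (if x k \<ge> 0 then \<gamma> (pr x) else (\<lambda>i. - \<gamma> (\<lambda>j. - pr x j) i))" for x
 let ?S = "unit_sph (Suc k)"
 have agree: "\<gamma> (pr x) = (\<lambda>i. - \<gamma> (\<lambda>j. - pr x j) i)" if x: "x \<in> ?S" "x k = 0" for x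
 proof -
  have "x \<in> unit_sph k" using unit_sph_equator x by blast
  moreover from this have "pr x = x" by (auto simp: pr_def unit_sph_def)
  ultimately show ?thesis using odd[of x] by simp
 qed
 have "continuous_on ({x\<in>?S. x k \<ge> 0} \<union> {x\<in>?S. x k \<le> 0}) H"
 proof -
  have e1: "H x = \<gamma> (pr x)" if "x \<in> {x\<in>?S. x k \<ge> 0}" for x using that by (simp add: H_def)
  have e2: "H x = (\<lambda>i. - \<gamma> (\<lambda>j. - pr x j) i)" if "x \<in> {x\<in>?S. x k \<le> 0}" for x using that agree[of x] by (auto simp: H_def)
  have c1: "continuous_on {x\<in>?S. x k \<ge> 0} H"
  proof (subst continuous_on_cong[OF refl e1])
   show "continuous_on {x\<in>?S. x k \<ge> 0} (\<lambda>x. \<gamma> (pr x))" by (rule continuous_on_compose2[OF c\<gamma> prc]) (use prB in auto)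
  qed
  have c2: "continuous_on {x\<in>?S. x k \<le> 0} H"
  proof (subst continuous_on_cong[OF refl e2])
   have "continuous_on {x\<in>?S. x k \<le> 0} (\<lambda>x. \<gamma> (\<lambda>j. - pr x j))"
   proof (rule continuous_on_compose2[OF c\<gamma>])
    show "continuous_on {x\<in>?S. x k \<le> 0} (\<lambda>x j. - pr x j)" by (rule continuous_on_uminus_fun[OF prc])
   qed (use prB prmB in auto)
   thus "continuous_on {x\<in>?S. x k \<le> 0} (\<lambda>x i. - \<gamma> (\<lambda>j. - pr x j) i)" by (rule continuous_on_uminus_fun)
  qed
  have cl: "closed {x::nat=>real. x k \<ge> 0}" "closed {x::nat=>real. x k \<le> 0}"
   by (rule closed_Collect_le; intro continuous_on_const continuous_on_coord)+
  show ?thesis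
  proof (rule continuous_on_closed_Un[OF _ _ c1 c2])
   show "closed {x\<in>?S. x k \<ge> 0}" "closed {x\<in>?S. x k \<le> 0}"
    using cl compact_imp_closed[OF compact_unit_sph] by (simp_all add: Collect_conj_eq closed_Int)
  qed
 qed
 moreover have "{x\<in>?S. x k \<ge> 0} \<union> {x\<in>?S. x k \<le> 0} = ?S" by auto
 ultimately have "continuous_on ?S H" by simp
 moreover have "H (\<lambda>i. - x i) = (\<lambda>i. - H x i)" if "x \<in> ?S" for x using agree[OF that] by (auto simp: H_def prm)
 moreover have "\<exists>y\<in>unit_bll k. H x = \<gamma> y \<or> H x = (\<lambda>i. - \<gamma> y i)" if "x \<in> ?S" for x
  using prB[OF that] prmB[OF prB[OF that]] by (auto simp: H_def)
 ultimately show ?thesis by blast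
qed

text \<open>If the slope were at least \<open>\<delta>\<close> between the levels \<open>m - 2\<close> and \<open>b\<close>, the cone over \<open>T h\<close> could be deformed
below the level \<open>m\<close>, that is, into \<open>N\<close>, while its boundary stays fixed. The deformed cone and its reflection
form an odd image of a sphere of one dimension more in \<open>N\<close>, against \<open>no_lift\<close>.\<close>

theorem linking_almost_critical_point:
 fixes E :: "(nat => real) => real" and g :: "(nat => real) => nat => real"
 assumes S: "finite S" and cE: "continuous_on (coord_space S) E"
  and cg: "\<And>i. i \<in> S ==> continuous_on (coord_space S) (\<lambda>c. g c i)"
  and descent: "\<And>R \<epsilon>. 0 < \<epsilon> ==> \<exists>s0>0. \<forall>c\<in>coord_space S. \<forall>w\<in>coord_space S. \<forall>s.
    L2_set c S \<le> R --> L2_set w S \<le> 1 --> 0 < s --> s \<le> s0 -->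
    E (\<lambda>i. c i - s * w i) \<le> E c - s * (\<Sum>i\<in>S. g c i * w i) + s * \<epsilon>"
  and \<delta>: "0 < \<delta>"
  and h: "continuous_on (unit_sph k) h" "h ` unit_sph k \<subseteq> coord_space S"
   "\<And>x. x \<in> unit_sph k ==> h (\<lambda>i. - x i) = (\<lambda>i. - h x i)"
  and sym: "\<And>c. c \<in> N ==> (\<lambda>i. - c i) \<in> N"
  and no_lift: "\<And>H. continuous_on (unit_sph (Suc k)) H ==> H ` unit_sph (Suc k) \<subseteq> coord_space S \<inter> N ==>
    (\<And>x. x \<in> unit_sph (Suc k) ==> H (\<lambda>i. - x i) = (\<lambda>i. - H x i)) ==> False"
  and outside: "\<And>c. c \<in> coord_space S ==> c \<notin> N ==> m \<le> E c"
  and up: "\<And>x t. x \<in> unit_sph k ==> 0 \<le> t ==> E (\<lambda>i. t * h x i) \<le> b" "E (\<lambda>_. 0) \<le> b"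
  and T: "0 < T" "\<And>x. x \<in> unit_sph k ==> E (\<lambda>i. T * h x i) \<le> m - 2" and mb: "m \<le> b"
 shows "\<exists>c\<in>coord_space S. m - 2 \<le> E c \<and> E c \<le> b \<and> L2_set (g c) S < \<delta>"
proof (rule ccontr)
 assume "\<not> ?thesis"
 hence slope: "\<delta> \<le> L2_set (g c) S" if "c \<in> coord_space S" "m - 2 \<le> E c" "E c \<le> b" for c using that by (meson not_le)
 define \<gamma> where "\<gamma> x = (\<lambda>i. if sph_norm k x = 0 then 0 else sph_norm k x * (T * h (normalize_vec k x) i))" for x
 have c\<gamma>: "continuous_on (unit_bll k) \<gamma>" unfolding \<gamma>_def by (rule continuous_on_cone[OF h(1)])
 have nv: "normalize_vec k x \<in> unit_sph k" if "sph_norm k x \<noteq> 0" for x using that by (intro normalize_vec_in) (simp add: sph_norm_eq_0)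
 have \<gamma>X: "\<gamma> ` unit_bll k \<subseteq> coord_space S" using h(2) nv by (fastforce simp: \<gamma>_def coord_space_def)
 have \<gamma>b: "E (\<gamma> x) \<le> b" for x
 proof (cases "sph_norm k x = 0")
  case False
  hence "\<gamma> x = (\<lambda>i. (sph_norm k x * T) * h (normalize_vec k x) i)" by (auto simp: \<gamma>_def)
  thus ?thesis using up(1)[OF nv[OF False], of "sph_norm k x * T"] T(1) sph_norm_nonneg[of k x] by simp
 qed (use up(2) in \<open>simp add: \<gamma>_def\<close>)
 have sub: "unit_sph k \<subseteq> unit_bll k" by (auto simp: unit_sph_def unit_bll_def)
 have \<gamma>sph: "\<gamma> x = (\<lambda>i. T * h x i)" if "x \<in> unit_sph k" for x
  using that normalize_vec_id[OF that] by (auto simp: \<gamma>_def sph_norm_def unit_sph_def)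
 have "\<exists>\<gamma>'. continuous_on (unit_bll k) \<gamma>' \<and> \<gamma>' ` unit_bll k \<subseteq> coord_space S \<and> (\<forall>x\<in>unit_bll k. E (\<gamma>' x) \<le> m - 1) \<and>
  (\<forall>x\<in>unit_bll k. E (\<gamma> x) \<le> m - 2 --> \<gamma>' x = \<gamma> x)"
  by (rule descent_deformation[OF S cE cg descent \<delta> slope _ _ compact_unit_bll c\<gamma> \<gamma>X \<gamma>b]) (use mb in auto)
 then obtain \<gamma>' where \<gamma>': "continuous_on (unit_bll k) \<gamma>'" "\<gamma>' ` unit_bll k \<subseteq> coord_space S"
   "\<And>x. x \<in> unit_bll k ==> E (\<gamma>' x) \<le> m - 1" "\<And>x. x \<in> unit_bll k ==> E (\<gamma> x) \<le> m - 2 ==> \<gamma>' x = \<gamma> x" by blast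
 have \<gamma>'sph: "\<gamma>' x = (\<lambda>i. T * h x i)" if "x \<in> unit_sph k" for x using \<gamma>'(4)[of x] \<gamma>sph[OF that] T(2)[OF that] sub that by auto
 have \<gamma>'N: "\<gamma>' y \<in> coord_space S \<inter> N" if y: "y \<in> unit_bll k" for y using \<gamma>'(2,3) outside[of "\<gamma>' y"] y by fastforce
 have mN: "(\<lambda>i. - c i) \<in> coord_space S \<inter> N" if "c \<in> coord_space S \<inter> N" for c using that sym by (auto simp: coord_space_def)
 obtain H where H: "continuous_on (unit_sph (Suc k)) H" "\<And>x. x\<in>unit_sph (Suc k) ==> H (\<lambda>i. - x i) = (\<lambda>i. - H x i)"
   "\<And>x. x\<in>unit_sph (Suc k) ==> \<exists>y\<in>unit_bll k. H x = \<gamma>' y \<or> H x = (\<lambda>i. - \<gamma>' y i)"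
  using hemisphere_gluing[OF \<gamma>'(1)] \<gamma>'sph h(3) unit_sph_uminus by fastforce
 have "H ` unit_sph (Suc k) \<subseteq> coord_space S \<inter> N"
 proof
  fix z assume "z \<in> H ` unit_sph (Suc k)"
  then obtain x where "x \<in> unit_sph (Suc k)" "z = H x" by blast
  then obtain y where "y \<in> unit_bll k" "z = \<gamma>' y \<or> z = (\<lambda>i. - \<gamma>' y i)" using H(3) by blast
  thus "z \<in> coord_space S \<inter> N" using \<gamma>'N mN by blast
 qed
 thus False using no_lift[OF H(1)] H(2) by blast
qed

section \<open>Pointwise inequalities for powers of the norm\<close>

text \<open>By homogeneity it suffices to consider the unit sphere. There, \<open>F\<close> exceeds \<open>\<epsilon>\<close> only on a compact set on
which \<open>G\<close> has a positive minimum. All inequalities with a small factor \<open>\<epsilon>\<close> and a large constant that concern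
several vectors are instances of this.\<close>

lemma homogeneous_majorant:
 fixes F G :: "'c::euclidean_space => real"
 assumes cF: "continuous_on UNIV F" and cG: "continuous_on UNIV G" and r: "0 < r"
  and hF: "\<And>t z. 0 < t ==> F (t *\<^sub>R z) = t powr r * F z"
  and hG: "\<And>t z. 0 < t ==> G (t *\<^sub>R z) = t powr r * G z"
  and G0: "\<And>z. 0 \<le> G z" and zero: "\<And>z. G z = 0 ==> F z \<le> 0" and \<epsilon>: "0 < \<epsilon>"
 shows "\<exists>C\<ge>0. \<forall>z. F z \<le> \<epsilon> * norm z powr r + C * G z"
proof -
 let ?S = "sphere (0::'c) 1"
 have "\<exists>C\<ge>0. \<forall>z\<in>?S. F z \<le> \<epsilon> + C * G z"
 proof -
  let ?A = "?S \<inter> {z. \<epsilon> \<le> F z}"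
  have cA: "compact ?A" by (intro compact_Int_closed compact_sphere closed_Collect_le continuous_intros cF)
  show ?thesis
  proof (cases "?A = {}")
   case True
   thus ?thesis by (intro exI[of _ 0]) force
  next
   case False
   obtain a where a: "a \<in> ?A" "\<And>z. z \<in> ?A ==> G a \<le> G z" using continuous_attains_inf[OF cA False continuous_on_subset[OF cG]] by blast
   obtain b where b: "b \<in> ?A" "\<And>z. z \<in> ?A ==> F z \<le> F b" using continuous_attains_sup[OF cA False continuous_on_subset[OF cF]] by blast
   have Ga: "G a > 0" using a zero[of a] G0[of a] \<epsilon> by force
   have Fb: "F b \<ge> 0" using b \<epsilon> by auto
   show ?thesis
   proof (intro exI[of _ "F b / G a"] conjI ballI)
    fix z assume z: "z \<in> ?S"
    have nn: "0 \<le> F b / G a * G z" using Ga Fb G0[of z] by simp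
    show "F z \<le> \<epsilon> + F b / G a * G z"
    proof (cases "z \<in> ?A")
     case True
     have "F b = F b / G a * G a" using Ga by simp
     also have "\<dots> \<le> F b / G a * G z" using a(2)[OF True] Ga Fb by (intro mult_left_mono) auto
     finally show ?thesis using b(2)[OF True] \<epsilon> by linarith
    qed (use z nn in auto)
   qed (use Ga Fb in auto)
  qed
 qed
 then obtain C where C: "C \<ge> 0" "\<And>z. z \<in> ?S ==> F z \<le> \<epsilon> + C * G z" by blast
 have "F z \<le> \<epsilon> * norm z powr r + C * G z" for z
 proof (cases "z = 0")
  case True
  have "F 0 = 2 powr r * F 0" using hF[of 2 0] by simp
  moreover have "2 powr r > (1::real)" using r by simp
  ultimately have "F 0 = 0" using r by (auto simp: mult_cancel_right1)
  thus ?thesis using True C G0 by simp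
 next
  case False
  have "F z = norm z powr r * F (z /\<^sub>R norm z)" using hF[of "norm z" "z /\<^sub>R norm z"] False by simp
  also have "\<dots> \<le> norm z powr r * (\<epsilon> + C * G (z /\<^sub>R norm z))" using C(2)[of "z /\<^sub>R norm z"] False by (intro mult_left_mono) auto
  also have "\<dots> = \<epsilon> * norm z powr r + C * (norm z powr r * G (z /\<^sub>R norm z))" by (simp add: algebra_simps)
  also have "norm z powr r * G (z /\<^sub>R norm z) = G z" using hG[of "norm z" "z /\<^sub>R norm z"] False by simp
  finally show ?thesis .
 qed
 thus ?thesis using C(1) by blast
qed

lemma powr_sum_bound:
 fixes a b r :: real
 assumes "0 \<le> a" "0 \<le> b" "0 \<le> r"
 shows "(a + b) powr r \<le> 2 powr r * (a powr r + b powr r)"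
proof -
 have "(a + b) powr r \<le> (2 * max a b) powr r" using assms by (intro powr_mono2) auto
 also have "\<dots> = 2 powr r * max a b powr r" using assms by (simp add: powr_mult)
 also have "\<dots> \<le> 2 powr r * (a powr r + b powr r)" by (intro mult_left_mono) (auto simp: max_def)
 finally show ?thesis .
qed

lemma norm_Pair_powr_bound:
 assumes "0 \<le> r"
 shows "norm (x, y) powr r \<le> 2 powr r * (norm x powr r + norm y powr r)"
proof -
 have "norm (x, y) \<le> norm x + norm y" by (simp add: norm_Pair_le)
 hence "norm (x, y) powr r \<le> (norm x + norm y) powr r" using assms by (intro powr_mono2) auto
 also have "\<dots> \<le> 2 powr r * (norm x powr r + norm y powr r)" using assms by (intro powr_sum_bound) auto
 finally show ?thesis .
qed

lemma homogeneous_majorant_pair: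
 fixes F G :: "'c::euclidean_space => 'd::euclidean_space => real"
 assumes "continuous_on UNIV (\<lambda>z. F (fst z) (snd z))" "continuous_on UNIV (\<lambda>z. G (fst z) (snd z))" and r: "0 < r"
  and "\<And>t x y. 0 < t ==> F (t *\<^sub>R x) (t *\<^sub>R y) = t powr r * F x y" "\<And>t x y. 0 < t ==> G (t *\<^sub>R x) (t *\<^sub>R y) = t powr r * G x y"
  and "\<And>x y. 0 \<le> G x y" "\<And>x y. G x y = 0 ==> F x y \<le> 0" and \<epsilon>: "0 < \<epsilon>"
 shows "\<exists>C\<ge>0. \<forall>x y. F x y \<le> \<epsilon> * (norm x powr r + norm y powr r) + C * G x y"
proof -
 let ?e = "\<epsilon> / 2 powr r"
 obtain C where C: "C \<ge> 0" "\<And>z. F (fst z) (snd z) \<le> ?e * norm z powr r + C * G (fst z) (snd z)"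
  using homogeneous_majorant[of "\<lambda>z. F (fst z) (snd z)" "\<lambda>z. G (fst z) (snd z)" r ?e] assms by auto
 have "F x y \<le> \<epsilon> * (norm x powr r + norm y powr r) + C * G x y" for x y
 proof -
  have "?e * norm (x, y) powr r \<le> ?e * (2 powr r * (norm x powr r + norm y powr r))"
   using r \<epsilon> by (intro mult_left_mono norm_Pair_powr_bound) auto
  thus ?thesis using C(2)[of "(x, y)"] by simp
 qed
 thus ?thesis using C(1) by blast
qed

text \<open>The gradient of the function \<open>norm x powr r / r\<close>.\<close>

definition powmap :: "real => 'b::euclidean_space => 'b" where
 "powmap r x = norm x powr (r - 2) *\<^sub>R x"

lemma norm_powmap: "norm (powmap r x) = norm x powr (r - 1)"
proof (cases "x = 0")
 case False
 have "norm x powr (r - 1) = norm x powr ((r - 2) + 1)" by simp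
 also have "\<dots> = norm x powr (r - 2) * norm x" using False by (subst powr_add) simp
 finally show ?thesis by (simp add: powmap_def)
qed (simp add: powmap_def)

lemma powmap_self: "powmap r x \<bullet> x = norm x powr r"
proof (cases "x = 0")
 case False
 have "norm x powr r = norm x powr ((r - 2) + 2)" by simp
 also have "\<dots> = norm x powr (r - 2) * norm x powr 2" by (rule powr_add)
 also have "norm x powr 2 = x \<bullet> x" using False by (simp add: dot_square_norm)
 finally show ?thesis by (simp add: powmap_def)
qed (simp add: powmap_def)

lemma powmap_scaleR: "0 < t ==> powmap r (t *\<^sub>R x) = t powr (r - 1) *\<^sub>R powmap r x"
proof -
 assume t: "0 < t"
 have "t powr (r - 1) = t powr (r - 2) * t" using t powr_add[of t "r - 2" 1] by simp
 thus ?thesis using t by (simp add: powmap_def powr_mult)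
qed

lemma continuous_on_powmap:
 assumes r: "1 < r" shows "continuous_on UNIV (powmap r :: 'b::euclidean_space => 'b)"
proof -
 have "isCont (powmap r) x" for x :: 'b
 proof (cases "x = 0")
  case True
  have "((\<lambda>y::'b. norm y powr (r - 1)) \<longlongrightarrow> norm (0::'b) powr (r - 1)) (at 0)" using r by (intro tendsto_powr' tendsto_intros) auto
  hence "((\<lambda>y. norm (powmap r y)) \<longlongrightarrow> 0) (at (0::'b))" by (simp add: norm_powmap)
  hence "(powmap r \<longlongrightarrow> 0) (at (0::'b))" by (rule tendsto_norm_zero_cancel)
  thus ?thesis using True by (simp add: isCont_def powmap_def)
 next
  case False
  thus ?thesis unfolding powmap_def by (intro continuous_intros) auto
 qed
 thus ?thesis by (simp add: continuous_at_imp_continuous_on)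
qed

lemma powr_above_tangent_strict:
 fixes a b r :: real
 assumes r: "1 < r" and a: "0 < a" and b: "0 \<le> b" and ab: "a \<noteq> b"
 shows "a powr r + r * a powr (r - 1) * (b - a) < b powr r"
proof (cases "b = 0")
 case True
 have "a powr (r - 1) * a = a powr r" using a powr_add[of a "r - 1" 1] by simp
 hence "a powr r + r * a powr (r - 1) * (b - a) = (1 - r) * a powr r" using True by (simp add: algebra_simps)
 also have "\<dots> < 0" using r a by (simp add: mult_neg_pos)
 finally show ?thesis using True by simp
next
 case False
 hence b0: "0 < b" using b by simp
 have D: "((\<lambda>x. x powr r) has_real_derivative r * x powr (r - 1)) (at x)" if "0 < x" for x
  using that by (auto intro!: derivative_eq_intros)
 consider "a < b" | "b < a" using ab by linarith
 thus ?thesis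
 proof cases
  case 1
  obtain z where z: "a < z" "z < b" "b powr r - a powr r = (b - a) * (r * z powr (r - 1))"
   using MVT2[OF 1, of "\<lambda>x. x powr r" "\<lambda>x. r * x powr (r - 1)"] D a by auto
  have "a powr (r - 1) < z powr (r - 1)" using z a r by (intro powr_less_mono2) auto
  hence "(b - a) * (r * a powr (r - 1)) < (b - a) * (r * z powr (r - 1))" using 1 r by simp
  thus ?thesis using z(3) by (simp add: algebra_simps)
 next
  case 2
  obtain z where z: "b < z" "z < a" "a powr r - b powr r = (a - b) * (r * z powr (r - 1))"
   using MVT2[OF 2, of "\<lambda>x. x powr r" "\<lambda>x. r * x powr (r - 1)"] D b0 by auto
  have "z powr (r - 1) < a powr (r - 1)" using z b0 r by (intro powr_less_mono2) auto
  hence "(a - b) * (r * z powr (r - 1)) < (a - b) * (r * a powr (r - 1))" using 2 r by simp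
  thus ?thesis using z(3) by (simp add: algebra_simps)
 qed
qed

text \<open>The Cauchy-Schwarz inequality reduces the strict convexity of the power of the norm to that of a real
function; for vectors of equal norm the Cauchy-Schwarz inequality itself is strict.\<close>

lemma norm_powr_above_tangent_strict:
 fixes x y :: "'b::euclidean_space"
 assumes r: "1 < r" and xy: "x \<noteq> y"
 shows "norm x powr r + r * (powmap r x \<bullet> (y - x)) < norm y powr r"
proof (cases "x = 0")
 case True
 thus ?thesis using xy r by (simp add: powmap_def)
next
 case False
 let ?a = "norm x" and ?b = "norm y"
 have a: "?a > 0" using False by simp
 have p: "?a powr (r - 1) = ?a powr (r - 2) * ?a" using a powr_add[of ?a "r - 2" 1] by simp
 have e: "powmap r x \<bullet> (y - x) = ?a powr (r - 2) * (x \<bullet> y - ?a * ?a)"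
  by (simp add: powmap_def inner_diff_right dot_square_norm power2_eq_square right_diff_distrib)
 have e2: "?a powr (r - 1) * (?b - ?a) = ?a powr (r - 2) * (?a * ?b - ?a * ?a)" by (simp add: p algebra_simps)
 have CS: "x \<bullet> y \<le> ?a * ?b" by (rule norm_cauchy_schwarz)
 show ?thesis
 proof (cases "?a = ?b")
  case True
  have "x \<bullet> y < ?a * ?b"
  proof (rule ccontr)
   assume "\<not> ?thesis"
   hence "x \<bullet> y = ?a * ?b" using CS by simp
   hence eq: "x \<bullet> y = ?b * ?b" using True by simp
   have "(norm (x - y))^2 = x \<bullet> x - 2 * (x \<bullet> y) + y \<bullet> y"
    unfolding power2_norm_eq_inner by (simp add: inner_diff_left inner_diff_right inner_commute)
   also have "\<dots> = ?a ^ 2 - 2 * (?b * ?b) + ?b ^ 2" unfolding eq by (simp only: dot_square_norm)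
   also have "\<dots> = 0" by (simp add: True power2_eq_square)
   finally have "(norm (x - y))^2 = 0" .
   thus False using xy by simp
  qed
  hence "powmap r x \<bullet> (y - x) < 0" unfolding e using True a by (simp add: mult_pos_neg)
  thus ?thesis using True r by (simp add: mult_pos_neg)
 next
  case False
  have "powmap r x \<bullet> (y - x) \<le> ?a powr (r - 1) * (?b - ?a)" unfolding e e2 using CS by (intro mult_left_mono) auto
  hence "r * (powmap r x \<bullet> (y - x)) \<le> r * (?a powr (r - 1) * (?b - ?a))" using r by simp
  thus ?thesis using powr_above_tangent_strict[OF r a _ False] by (simp add: mult.assoc)
 qed
qed

lemma norm_powr_above_tangent:
 fixes x y :: "'b::euclidean_space"
 assumes r: "1 < r"
 shows "norm x powr r + r * (powmap r x \<bullet> (y - x)) \<le> norm y powr r"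
 using norm_powr_above_tangent_strict[OF r, of x y] by (cases "x = y") auto

definition convexity_gap :: "real => 'b::euclidean_space => 'b => real" where
 "convexity_gap r x y = norm x powr r / 2 + norm y powr r / 2 - norm ((1/2) *\<^sub>R (x + y)) powr r"

lemma convexity_gap_nonneg: "1 < r ==> 0 \<le> convexity_gap r x y"
 and convexity_gap_eq_0: "1 < r ==> convexity_gap r x y = 0 ==> x = y"
proof -
 assume r: "1 < r"
 let ?m = "(1/2) *\<^sub>R (x + y)"
 have s: "(x - ?m) + (y - ?m) = 0" by (simp add: algebra_simps flip: scaleR_add_left)
 have s': "powmap r ?m \<bullet> (x - ?m) + powmap r ?m \<bullet> (y - ?m) = 0" by (metis inner_add_right inner_zero_right s)
 have t: "r * (powmap r ?m \<bullet> (x - ?m)) + r * (powmap r ?m \<bullet> (y - ?m)) = 0" by (metis s' distrib_left mult_zero_right)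
 show "0 \<le> convexity_gap r x y" using norm_powr_above_tangent[OF r, of ?m x] norm_powr_above_tangent[OF r, of ?m y] t
  unfolding convexity_gap_def by argo
 assume "convexity_gap r x y = 0"
 hence "?m = x" using norm_powr_above_tangent_strict[OF r, of ?m x] norm_powr_above_tangent[OF r, of ?m y] t
  unfolding convexity_gap_def by argo
 hence "2 *\<^sub>R ?m = 2 *\<^sub>R x" by simp
 thus "x = y" by (simp add: scaleR_2)
qed

lemma norm_powr_scaleR: "0 < t ==> norm (t *\<^sub>R x) powr r = t powr r * norm x powr r" by (simp add: powr_mult)

lemma continuous_on_norm_powr:
 fixes f :: "'c::topological_space => 'b::real_normed_vector"
 shows "continuous_on S f ==> 0 < r ==> continuous_on S (\<lambda>x. norm (f x) powr r)" by (intro continuous_on_powr' continuous_intros) auto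

text \<open>This form of uniform convexity treats all exponents \<open>r > 1\<close> alike.\<close>

lemma uniform_convexity_pointwise:
 assumes r: "1 < r" and \<epsilon>: "0 < \<epsilon>"
 shows "\<exists>C\<ge>0. \<forall>x y::'b::euclidean_space. norm (x - y) powr r \<le> \<epsilon> * (norm x powr r + norm y powr r) + C * convexity_gap r x y"
proof (rule homogeneous_majorant_pair)
 have r0: "0 < r" using r by simp
 show "continuous_on UNIV (\<lambda>z::'b\<times>'b. norm (fst z - snd z) powr r)" by (intro continuous_on_norm_powr continuous_intros r0)
 show "continuous_on UNIV (\<lambda>z::'b\<times>'b. convexity_gap r (fst z) (snd z))"
  unfolding convexity_gap_def by (intro continuous_intros continuous_on_norm_powr r0) auto
 show "norm (t *\<^sub>R x - t *\<^sub>R y) powr r = t powr r * norm (x - y) powr r" if "0 < t" for t and x y :: 'b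
  using norm_powr_scaleR[OF that, of "x - y" r] by (simp add: scaleR_diff_right)
 show "convexity_gap r (t *\<^sub>R x) (t *\<^sub>R y) = t powr r * convexity_gap r x y" if "0 < t" for t and x y :: 'b
 proof -
  have "(1/2) *\<^sub>R (t *\<^sub>R x + t *\<^sub>R y) = t *\<^sub>R ((1/2) *\<^sub>R (x + y))" by (simp add: algebra_simps)
  thus ?thesis unfolding convexity_gap_def by (simp only: norm_powr_scaleR[OF that]) (simp add: algebra_simps)
 qed
 show "norm (x - y) powr r \<le> 0" if "convexity_gap r x y = 0" for x y :: 'b using convexity_gap_eq_0[OF r that] by simp
qed (use \<epsilon> r convexity_gap_nonneg in auto)

lemma powmap_inner_homogeneous:
 assumes t: "0 < t" shows "powmap r (t *\<^sub>R x) \<bullet> (t *\<^sub>R w) = t powr r * (powmap r x \<bullet> w)"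
proof -
 have "t powr (r - 1) * t = t powr r" using t powr_add[of t "r - 1" 1] by simp
 thus ?thesis using t by (simp add: powmap_scaleR mult_ac)
qed

lemma continuous_on_powmap_compose: "1 < r ==> continuous_on S f ==> continuous_on S (\<lambda>z. powmap r (f z :: 'b::euclidean_space))"
 by (rule continuous_on_compose2[OF continuous_on_powmap]) auto

lemma powmap_diff_pointwise:
 assumes r: "1 < r" and \<epsilon>: "0 < \<epsilon>"
 shows "\<exists>C\<ge>0. \<forall>x y w::'b::euclidean_space. \<bar>powmap r x \<bullet> w - powmap r y \<bullet> w\<bar> \<le>
   \<epsilon> * (norm x powr r + norm y powr r + norm w powr r) + C * norm (x - y) powr r"
proof -
 let ?e = "\<epsilon> / 2 powr r"
 have r0: "0 < r" using r by simp
 have "\<exists>C\<ge>0. \<forall>x (z::'b\<times>'b). \<bar>powmap r x \<bullet> snd z - powmap r (fst z) \<bullet> snd z\<bar> \<le> ?e * (norm x powr r + norm z powr r) + C * norm (x - fst z) powr r"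
 proof (rule homogeneous_majorant_pair)
  show "norm (t *\<^sub>R x - fst (t *\<^sub>R z)) powr r = t powr r * norm (x - fst z) powr r" if "0 < t" for t and x :: 'b and z :: "'b\<times>'b"
   using norm_powr_scaleR[OF that, of "x - fst z" r] by (simp add: scaleR_diff_right)
  show "\<bar>powmap r (t *\<^sub>R x) \<bullet> snd (t *\<^sub>R z) - powmap r (fst (t *\<^sub>R z)) \<bullet> snd (t *\<^sub>R z)\<bar>
    = t powr r * \<bar>powmap r x \<bullet> snd z - powmap r (fst z) \<bullet> snd z\<bar>" if "0 < t" for t and x :: 'b and z :: "'b\<times>'b"
   by (simp only: fst_scaleR snd_scaleR powmap_inner_homogeneous[OF that] right_diff_distrib[symmetric] abs_mult) simp
 qed (use \<epsilon> r r0 in \<open>auto intro!: continuous_on_norm_powr continuous_intros continuous_on_powmap_compose\<close>)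
 then obtain C where C: "C \<ge> 0" "\<And>x (z::'b\<times>'b). \<bar>powmap r x \<bullet> snd z - powmap r (fst z) \<bullet> snd z\<bar>
   \<le> ?e * (norm x powr r + norm z powr r) + C * norm (x - fst z) powr r" by blast
 show ?thesis
 proof (intro exI[of _ C] conjI allI C(1))
  fix x y w :: 'b
  have "1 * norm x powr r \<le> 2 powr r * norm x powr r" using r0 by (intro mult_right_mono) (auto simp: ge_one_powr_ge_zero)
  moreover have "norm (y, w) powr r \<le> 2 powr r * (norm y powr r + norm w powr r)" using r0 by (intro norm_Pair_powr_bound) auto
  ultimately have "norm x powr r + norm (y, w) powr r \<le> 2 powr r * (norm x powr r + norm y powr r + norm w powr r)"
   unfolding distrib_left by linarith
  hence "?e * (norm x powr r + norm (y, w) powr r) \<le> ?e * (2 powr r * (norm x powr r + norm y powr r + norm w powr r))"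
   using \<epsilon> by (intro mult_left_mono) auto
  thus "\<bar>powmap r x \<bullet> w - powmap r y \<bullet> w\<bar> \<le> \<epsilon> * (norm x powr r + norm y powr r + norm w powr r) + C * norm (x - y) powr r"
   using C(2)[of x "(y, w)"] by simp
 qed
qed

lemma powmap_inner_small_pointwise:
 assumes r: "1 < r" and \<epsilon>: "0 < \<epsilon>"
 shows "\<exists>C\<ge>0. \<forall>x w::'b::euclidean_space. \<bar>powmap r x \<bullet> w\<bar> \<le> \<epsilon> * norm x powr r + C * norm w powr r"
proof -
 have "\<exists>C\<ge>0. \<forall>x w::'b. \<bar>powmap r x \<bullet> w\<bar> \<le> \<epsilon> * (norm x powr r + norm w powr r) + C * norm w powr r" by (rule homogeneous_majorant_pair)
   (use \<epsilon> r in \<open>auto intro!: continuous_on_norm_powr continuous_intros continuous_on_powmap_compose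
    simp: norm_powr_scaleR powmap_inner_homogeneous abs_mult simp del: norm_scaleR inner_scaleR_right\<close>)
 then obtain C where C: "C \<ge> 0" "\<forall>x w::'b. \<bar>powmap r x \<bullet> w\<bar> \<le> \<epsilon> * (norm x powr r + norm w powr r) + C * norm w powr r" by blast
 thus ?thesis using \<epsilon> by (intro exI[of _ "\<epsilon> + C"]) (simp add: algebra_simps)
qed

section \<open>Power integrals and their derivatives\<close>

definition Lspace :: "'a measure => real => ('a => 'b::euclidean_space) set" where
 "Lspace M r = {u \<in> borel_measurable M. integrable M (\<lambda>x. norm (u x) powr r)}"

text \<open>The power \<open>r\<close> of the norm in \<open>L\<^sup>r\<close>. Convergence in norm is expressed by the convergence of \<open>pint\<close> of the
differences to zero.\<close>

definition pint :: "'a measure => real => ('a => 'b::euclidean_space) => real" where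
 "pint M r u = (LINT x|M. norm (u x) powr r)"

text \<open>The derivative of \<open>pint M r / r\<close> at \<open>u\<close> in the direction \<open>w\<close>.\<close>

definition pairing :: "'a measure => real => ('a => 'b::euclidean_space) => ('a => 'b) => real" where
 "pairing M r u w = (LINT x|M. powmap r (u x) \<bullet> w x)"

abbreviation pdist :: "'a measure => real => ('a => 'b::euclidean_space) => ('a => 'b) => real" where
 "pdist M r u v \<equiv> pint M r (\<lambda>x. u x - v x)"

lemma LspaceD:
 assumes "u \<in> Lspace M r"
 shows "u \<in> borel_measurable M" "integrable M (\<lambda>x. norm (u x) powr r)" using assms by (auto simp: Lspace_def)

lemma pint_nonneg: "0 \<le> pint M r u" by (simp add: pint_def)

lemma Lspace_lincomb:
 assumes u: "u \<in> Lspace M r" and v: "v \<in> Lspace M r" and r: "0 < r"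
 shows "(\<lambda>x. a *\<^sub>R u x + b *\<^sub>R v x) \<in> Lspace M r"
proof -
 note [measurable] = LspaceD(1)[OF u] LspaceD(1)[OF v]
 have "integrable M (\<lambda>x. norm (a *\<^sub>R u x + b *\<^sub>R v x) powr r)"
 proof (rule Bochner_Integration.integrable_bound)
  show "integrable M (\<lambda>x. 2 powr r * (\<bar>a\<bar> powr r * norm (u x) powr r + \<bar>b\<bar> powr r * norm (v x) powr r))"
   using LspaceD(2)[OF u] LspaceD(2)[OF v] by simp
  show "AE x in M. norm (norm (a *\<^sub>R u x + b *\<^sub>R v x) powr r) \<le> norm (2 powr r * (\<bar>a\<bar> powr r * norm (u x) powr r + \<bar>b\<bar> powr r * norm (v x) powr r))"
  proof (rule AE_I2)
   fix x
   have "norm (a *\<^sub>R u x + b *\<^sub>R v x) powr r \<le> (\<bar>a\<bar> * norm (u x) + \<bar>b\<bar> * norm (v x)) powr r"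
    using r norm_triangle_ineq[of "a *\<^sub>R u x" "b *\<^sub>R v x"] by (intro powr_mono2) auto
   also have "\<dots> \<le> 2 powr r * ((\<bar>a\<bar> * norm (u x)) powr r + (\<bar>b\<bar> * norm (v x)) powr r)" using r by (intro powr_sum_bound) auto
   finally show "norm (norm (a *\<^sub>R u x + b *\<^sub>R v x) powr r) \<le> norm (2 powr r * (\<bar>a\<bar> powr r * norm (u x) powr r + \<bar>b\<bar> powr r * norm (v x) powr r))"
    by (simp add: powr_mult)
  qed
 qed measurable
 thus ?thesis by (simp add: Lspace_def)
qed

lemma Lspace_add: "u \<in> Lspace M r ==> v \<in> Lspace M r ==> 0 < r ==> (\<lambda>x. u x + v x) \<in> Lspace M r"
 using Lspace_lincomb[of u M r v 1 1] by simp

lemma Lspace_diff: "u \<in> Lspace M r ==> v \<in> Lspace M r ==> 0 < r ==> (\<lambda>x. u x - v x) \<in> Lspace M r"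
 using Lspace_lincomb[of u M r v 1 "-1"] by simp

lemma Lspace_scaleR: "u \<in> Lspace M r ==> 0 < r ==> (\<lambda>x. a *\<^sub>R u x) \<in> Lspace M r" using Lspace_lincomb[of u M r u a 0] by simp

lemma pint_add_le:
 assumes u: "u \<in> Lspace M r" and v: "v \<in> Lspace M r" and r: "0 < r"
 shows "pint M r (\<lambda>x. u x + v x) \<le> 2 powr r * (pint M r u + pint M r v)"
proof -
 have "pint M r (\<lambda>x. u x + v x) \<le> (LINT x|M. 2 powr r * (norm (u x) powr r + norm (v x) powr r))" unfolding pint_def
 proof (rule integral_mono)
  fix x
  have "norm (u x + v x) powr r \<le> (norm (u x) + norm (v x)) powr r" using r norm_triangle_ineq by (intro powr_mono2) auto
  also have "\<dots> \<le> 2 powr r * (norm (u x) powr r + norm (v x) powr r)" using r by (intro powr_sum_bound) auto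
  finally show "norm (u x + v x) powr r \<le> 2 powr r * (norm (u x) powr r + norm (v x) powr r)" .
 qed (use LspaceD[OF u] LspaceD[OF v] LspaceD[OF Lspace_add[OF u v r]] in auto)
 also have "\<dots> = 2 powr r * (pint M r u + pint M r v)" using LspaceD[OF u] LspaceD[OF v] by (simp add: pint_def)
 finally show ?thesis .
qed

lemma pint_scaleR: "pint M r (\<lambda>x. a *\<^sub>R u x) = \<bar>a\<bar> powr r * pint M r u" by (simp add: pint_def powr_mult)

lemma pint_minus_commute: "pdist M r u v = pdist M r v u" by (simp add: pint_def norm_minus_commute)

lemma pairing_self: "pairing M r u u = pint M r u" by (simp add: pairing_def pint_def powmap_self)

lemma measurable_powmap [measurable]:
 "1 < r ==> (powmap r :: 'b::euclidean_space => 'b) \<in> borel_measurable borel"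
 by (intro borel_measurable_continuous_onI continuous_on_powmap)

lemma integrable_pairing:
 fixes u w :: "'a => 'b::euclidean_space"
 assumes u: "u \<in> Lspace M r" and w: "w \<in> Lspace M r" and r: "1 < r"
 shows "integrable M (\<lambda>x. powmap r (u x) \<bullet> w x)"
proof -
 note [measurable] = LspaceD(1)[OF u] LspaceD(1)[OF w] measurable_powmap[OF r]
 obtain C where C: "C \<ge> 0" "\<And>x w::'b. \<bar>powmap r x \<bullet> w\<bar> \<le> 1 * norm x powr r + C * norm w powr r"
  using powmap_inner_small_pointwise[OF r, of 1] by auto
 show ?thesis
 proof (rule Bochner_Integration.integrable_bound)
  show "integrable M (\<lambda>x. 1 * norm (u x) powr r + C * norm (w x) powr r)" using LspaceD(2)[OF u] LspaceD(2)[OF w] by simp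
  show "AE x in M. norm (powmap r (u x) \<bullet> w x) \<le> norm (1 * norm (u x) powr r + C * norm (w x) powr r)"
  proof (rule AE_I2)
   fix x
   show "norm (powmap r (u x) \<bullet> w x) \<le> norm (1 * norm (u x) powr r + C * norm (w x) powr r)"
    using C(2)[of "u x" "w x"] by (simp add: abs_le_iff)
  qed
 qed measurable
qed

lemma pairing_lincomb:
 assumes "u \<in> Lspace M r" "v \<in> Lspace M r" "w \<in> Lspace M r" "1 < r"
 shows "pairing M r u (\<lambda>x. a *\<^sub>R v x + b *\<^sub>R w x) = a * pairing M r u v + b * pairing M r u w"
 using integrable_pairing[of u M r v] integrable_pairing[of u M r w] assms by (simp add: pairing_def inner_add_right)

lemma pairing_diff:
 assumes "u \<in> Lspace M r" "v \<in> Lspace M r" "w \<in> Lspace M r" "1 < r"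
 shows "pairing M r u (\<lambda>x. v x - w x) = pairing M r u v - pairing M r u w" using pairing_lincomb[OF assms, of 1 "-1"] by simp

lemma pairing_scaleR_right:
 "pairing M r u (\<lambda>x. a *\<^sub>R v x) = a * pairing M r u v" by (simp add: pairing_def)

lemma pairing_scaleR_left:
 "0 < t ==> pairing M r (\<lambda>x. t *\<^sub>R u x) v = t powr (r - 1) * pairing M r u v" by (simp add: pairing_def powmap_scaleR)

lemma pairing_continuous:
 assumes r: "1 < r" and \<epsilon>: "0 < \<epsilon>"
 shows "\<exists>C\<ge>0. \<forall>u\<in>Lspace M r. \<forall>v\<in>Lspace M r. \<forall>w\<in>Lspace M r.
  \<bar>pairing M r u w - pairing M r v w\<bar> \<le>
   \<epsilon> * (pint M r u + pint M r v + pint M r w) + C * pint M r (\<lambda>x. u x - v x :: 'b::euclidean_space)"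
proof -
 obtain C where C: "C \<ge> 0" "\<And>x y w::'b. \<bar>powmap r x \<bullet> w - powmap r y \<bullet> w\<bar> \<le>
   \<epsilon> * (norm x powr r + norm y powr r + norm w powr r) + C * norm (x - y) powr r" using powmap_diff_pointwise[OF r \<epsilon>] by auto
 show ?thesis
 proof (intro exI[of _ C] conjI ballI C(1))
  fix u v w :: "'a => 'b" assume u: "u \<in> Lspace M r" and v: "v \<in> Lspace M r" and w: "w \<in> Lspace M r"
  have d: "(\<lambda>x. u x - v x) \<in> Lspace M r" using u v r by (intro Lspace_diff) auto
  note int = integrable_pairing[OF u w r] integrable_pairing[OF v w r]
  have "\<bar>pairing M r u w - pairing M r v w\<bar> = \<bar>LINT x|M. powmap r (u x) \<bullet> w x - powmap r (v x) \<bullet> w x\<bar>"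
   unfolding pairing_def using int by simp
  also have "\<dots> \<le> (LINT x|M. \<bar>powmap r (u x) \<bullet> w x - powmap r (v x) \<bullet> w x\<bar>)" by simp
  also have "\<dots> \<le> (LINT x|M. \<epsilon> * (norm (u x) powr r + norm (v x) powr r + norm (w x) powr r) + C * norm (u x - v x) powr r)"
   by (rule integral_mono) (use int LspaceD(2)[OF u] LspaceD(2)[OF v] LspaceD(2)[OF w] LspaceD(2)[OF d] C in auto)
  also have "\<dots> = \<epsilon> * (pint M r u + pint M r v + pint M r w) + C * pdist M r u v"
   unfolding pint_def using LspaceD(2)[OF u] LspaceD(2)[OF v] LspaceD(2)[OF w] LspaceD(2)[OF d] by simp
  finally show "\<bar>pairing M r u w - pairing M r v w\<bar> \<le>
   \<epsilon> * (pint M r u + pint M r v + pint M r w) + C * pdist M r u v" .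
 qed
qed

lemma pairing_small:
 assumes r: "1 < r" and \<epsilon>: "0 < \<epsilon>"
 shows "\<exists>C\<ge>0. \<forall>u\<in>Lspace M r. \<forall>w\<in>Lspace M r.
  \<bar>pairing M r u w\<bar> \<le> \<epsilon> * pint M r u + C * pint M r (w :: 'a => 'b::euclidean_space)"
proof -
 obtain C where C: "C \<ge> 0" "\<And>x w::'b. \<bar>powmap r x \<bullet> w\<bar> \<le> \<epsilon> * norm x powr r + C * norm w powr r"
  using powmap_inner_small_pointwise[OF r \<epsilon>] by auto
 show ?thesis
 proof (intro exI[of _ C] conjI ballI C(1))
  fix u w :: "'a => 'b" assume u: "u \<in> Lspace M r" and w: "w \<in> Lspace M r"
  have "\<bar>pairing M r u w\<bar> \<le> (LINT x|M. \<bar>powmap r (u x) \<bullet> w x\<bar>)" unfolding pairing_def by simp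
  also have "\<dots> \<le> (LINT x|M. \<epsilon> * norm (u x) powr r + C * norm (w x) powr r)"
   by (rule integral_mono) (use integrable_pairing[OF u w r] LspaceD(2)[OF u] LspaceD(2)[OF w] C in auto)
  also have "\<dots> = \<epsilon> * pint M r u + C * pint M r w" unfolding pint_def using LspaceD(2)[OF u] LspaceD(2)[OF w] by simp
  finally show "\<bar>pairing M r u w\<bar> \<le> \<epsilon> * pint M r u + C * pint M r w" .
 qed
qed

lemma pint_above_tangent:
 assumes r: "1 < r" and u: "u \<in> Lspace M r" and v: "v \<in> Lspace M r"
 shows "pint M r u + r * pairing M r u (\<lambda>x. v x - u x) \<le> pint M r v"
proof -
 have d: "(\<lambda>x. v x - u x) \<in> Lspace M r" using u v r by (intro Lspace_diff) auto
 have "pint M r u + r * pairing M r u (\<lambda>x. v x - u x) = (LINT x|M. norm (u x) powr r + r * (powmap r (u x) \<bullet> (v x - u x)))"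
  unfolding pint_def pairing_def using LspaceD(2)[OF u] integrable_pairing[OF u d r] by simp
 also have "\<dots> \<le> pint M r v" unfolding pint_def
  by (rule integral_mono) (use LspaceD(2)[OF u] LspaceD(2)[OF v] integrable_pairing[OF u d r] norm_powr_above_tangent[OF r] in auto)
 finally show ?thesis .
qed

lemma pint_uniformly_convex:
 assumes r: "1 < r" and \<epsilon>: "0 < \<epsilon>"
 shows "\<exists>C\<ge>0. \<forall>u\<in>Lspace M r. \<forall>v\<in>Lspace M r.
  pint M r (\<lambda>x. u x - v x :: 'b::euclidean_space) \<le> \<epsilon> * (pint M r u + pint M r v)
   + C * (pint M r u / 2 + pint M r v / 2 - pint M r (\<lambda>x. (1/2) *\<^sub>R (u x + v x)))"
proof -
 obtain C where C: "C \<ge> 0" "\<And>x y::'b. norm (x - y) powr r \<le> \<epsilon> * (norm x powr r + norm y powr r) + C * convexity_gap r x y"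
  using uniform_convexity_pointwise[OF r \<epsilon>] by auto
 show ?thesis
 proof (intro exI[of _ C] conjI ballI C(1))
  fix u v :: "'a => 'b" assume u: "u \<in> Lspace M r" and v: "v \<in> Lspace M r"
  have d: "(\<lambda>x. u x - v x) \<in> Lspace M r" using u v r by (intro Lspace_diff) auto
  have m: "(\<lambda>x. (1/2) *\<^sub>R (u x + v x)) \<in> Lspace M r" using u v r by (intro Lspace_scaleR Lspace_add) auto
  have "pdist M r u v \<le> (LINT x|M. \<epsilon> * (norm (u x) powr r + norm (v x) powr r) + C * convexity_gap r (u x) (v x))" unfolding pint_def
   by (rule integral_mono) (use LspaceD(2)[OF u] LspaceD(2)[OF v] LspaceD(2)[OF d] LspaceD(2)[OF m] C in \<open>auto simp: convexity_gap_def\<close>)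
  also have "\<dots> = \<epsilon> * (pint M r u + pint M r v) + C * (pint M r u / 2 + pint M r v / 2 - pint M r (\<lambda>x. (1/2) *\<^sub>R (u x + v x)))"
   unfolding pint_def convexity_gap_def using LspaceD(2)[OF u] LspaceD(2)[OF v] LspaceD(2)[OF m] by simp
  finally show "pdist M r u v \<le> \<epsilon> * (pint M r u + pint M r v)
   + C * (pint M r u / 2 + pint M r v / 2 - pint M r (\<lambda>x. (1/2) *\<^sub>R (u x + v x)))" .
 qed
qed

lemma pint_midpoint_le:
 assumes r: "1 < r" and u: "u \<in> Lspace M r" and v: "v \<in> Lspace M r"
 shows "pint M r (\<lambda>x. (1/2) *\<^sub>R (u x + v x)) \<le> pint M r u / 2 + pint M r v / 2"
proof -
 have m: "(\<lambda>x. (1/2) *\<^sub>R (u x + v x)) \<in> Lspace M r" using u v r by (intro Lspace_scaleR Lspace_add) auto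
 have "0 \<le> (LINT x|M. convexity_gap r (u x) (v x))" by (simp add: convexity_gap_nonneg r)
 also have "\<dots> = pint M r u / 2 + pint M r v / 2 - pint M r (\<lambda>x. (1/2) *\<^sub>R (u x + v x))"
  unfolding pint_def convexity_gap_def using LspaceD(2)[OF u] LspaceD(2)[OF v] LspaceD(2)[OF m] by simp
 finally show ?thesis by simp
qed

text \<open>Which term dominates depends on the position of \<open>t\<close> with respect to a threshold determined by \<open>\<epsilon>\<close>.\<close>

lemma powr_low_by_high:
 fixes t q p \<epsilon> :: real
 assumes "0 < q" "q < p" "0 < \<epsilon>"
 shows "\<exists>C\<ge>0. \<forall>t\<ge>0. t powr q \<le> \<epsilon> + C * t powr p" and "\<exists>C\<ge>0. \<forall>t\<ge>0. t powr q \<le> C + \<epsilon> * t powr p"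
proof -
 let ?s = "\<epsilon> powr (1 / q)"
 have s: "?s > 0" "?s powr q = \<epsilon>" using assms by (auto simp: powr_powr)
 show "\<exists>C\<ge>0. \<forall>t\<ge>0. t powr q \<le> \<epsilon> + C * t powr p"
 proof (intro exI[of _ "?s powr (q - p)"] conjI allI impI)
  fix t :: real assume t: "t \<ge> 0"
  show "t powr q \<le> \<epsilon> + ?s powr (q - p) * t powr p"
  proof (cases "t \<le> ?s")
   case True
   hence "t powr q \<le> ?s powr q" using t assms by (intro powr_mono2) auto
   moreover have "0 \<le> ?s powr (q - p) * t powr p" by simp
   ultimately show ?thesis using s by linarith
  next
   case False
   hence t1: "?s < t" by simp
   hence t: "0 < t" "?s < t" using s(1) by linarith+
   have "t powr (q - p) \<le> ?s powr (q - p)" using t s assms by (intro powr_mono2') auto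
   hence "t powr (q - p) * t powr p \<le> ?s powr (q - p) * t powr p" by (intro mult_right_mono) auto
   moreover have "t powr (q - p) * t powr p = t powr q" by (simp flip: powr_add)
   ultimately show ?thesis using assms by linarith
  qed
 qed simp
 let ?S = "\<epsilon> powr (1 / (q - p))"
 have S: "?S > 0" "?S powr (q - p) = \<epsilon>" using assms by (auto simp: powr_powr)
 show "\<exists>C\<ge>0. \<forall>t\<ge>0. t powr q \<le> C + \<epsilon> * t powr p"
 proof (intro exI[of _ "?S powr q"] conjI allI impI)
  fix t :: real assume t: "t \<ge> 0"
  show "t powr q \<le> ?S powr q + \<epsilon> * t powr p"
  proof (cases "t \<le> ?S")
   case True
   hence "t powr q \<le> ?S powr q" using t assms by (intro powr_mono2) auto
   moreover have "0 \<le> \<epsilon> * t powr p" using assms by simp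
   ultimately show ?thesis by linarith
  next
   case False
   hence t1: "?S < t" by simp
   hence t: "0 < t" "?S < t" using S(1) by linarith+
   have "t powr (q - p) \<le> ?S powr (q - p)" using t S assms by (intro powr_mono2') auto
   hence "t powr (q - p) * t powr p \<le> \<epsilon> * t powr p" using S by (intro mult_right_mono) auto
   moreover have "t powr (q - p) * t powr p = t powr q" by (simp flip: powr_add)
   ultimately show ?thesis by (smt (verit) powr_ge_zero)
  qed
 qed simp
qed

context finite_measure
begin

lemma Lspace_mono:
 assumes q: "0 < q" "q < p" and u: "u \<in> Lspace M p"
 shows "u \<in> Lspace M q"
proof -
 note [measurable] = LspaceD(1)[OF u]
 obtain C where C: "C \<ge> 0" "\<And>t. t \<ge> 0 ==> t powr q \<le> C + 1 * t powr p" using powr_low_by_high(2)[OF q, of 1] by auto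
 have "integrable M (\<lambda>x. norm (u x) powr q)"
 proof (rule Bochner_Integration.integrable_bound)
  show "integrable M (\<lambda>x. C + 1 * norm (u x) powr p)" using LspaceD(2)[OF u] by simp
  show "AE x in M. norm (norm (u x) powr q) \<le> norm (C + 1 * norm (u x) powr p)" using C by (auto intro!: AE_I2)
 qed measurable
 thus ?thesis by (simp add: Lspace_def)
qed

lemma pint_low_by_high:
 assumes q: "0 < q" "q < p" and \<epsilon>: "0 < \<epsilon>"
 shows "\<exists>C\<ge>0. \<forall>u\<in>Lspace M p. pint M q u \<le> \<epsilon> + C * pint M p (u :: 'a => 'b::euclidean_space)"
  and "\<exists>C\<ge>0. \<forall>u\<in>Lspace M p. pint M q u \<le> C + \<epsilon> * pint M p (u :: 'a => 'b::euclidean_space)"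
proof -
 let ?m = "measure M (space M)"
 have m1: "?m + 1 > 0" by (simp add: add_nonneg_pos)
 obtain C where C: "C \<ge> 0" "\<And>t. t \<ge> 0 ==> t powr q \<le> \<epsilon> / (?m + 1) + C * t powr p" using powr_low_by_high(1)[OF q, of "\<epsilon> / (?m + 1)"] \<epsilon> m1 by auto
 show "\<exists>C\<ge>0. \<forall>u\<in>Lspace M p. pint M q u \<le> \<epsilon> + C * pint M p (u :: 'a => 'b)"
 proof (intro exI[of _ C] conjI ballI C(1))
  fix u :: "'a => 'b" assume u: "u \<in> Lspace M p"
  have "pint M q u \<le> (LINT x|M. \<epsilon> / (?m + 1) + C * norm (u x) powr p)" unfolding pint_def
   by (rule integral_mono) (use LspaceD(2)[OF u] LspaceD(2)[OF Lspace_mono[OF q u]] C in auto)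
  also have "\<dots> = \<epsilon> * (?m / (?m + 1)) + C * pint M p u" unfolding pint_def using LspaceD(2)[OF u] by simp
  also have "\<dots> \<le> \<epsilon> * 1 + C * pint M p u" using \<epsilon> m1 by (intro add_right_mono mult_left_mono) auto
  finally show "pint M q u \<le> \<epsilon> + C * pint M p u" by simp
 qed
 obtain D where D: "D \<ge> 0" "\<And>t. t \<ge> 0 ==> t powr q \<le> D + \<epsilon> * t powr p" using powr_low_by_high(2)[OF q \<epsilon>] by auto
 show "\<exists>C\<ge>0. \<forall>u\<in>Lspace M p. pint M q u \<le> C + \<epsilon> * pint M p (u :: 'a => 'b)"
 proof (intro exI[of _ "D * ?m"] conjI ballI)
  fix u :: "'a => 'b" assume u: "u \<in> Lspace M p"
  have "pint M q u \<le> (LINT x|M. D + \<epsilon> * norm (u x) powr p)" unfolding pint_def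
   by (rule integral_mono) (use LspaceD(2)[OF u] LspaceD(2)[OF Lspace_mono[OF q u]] D in auto)
  also have "\<dots> = D * ?m + \<epsilon> * pint M p u" unfolding pint_def using LspaceD(2)[OF u] by simp
  finally show "pint M q u \<le> D * ?m + \<epsilon> * pint M p u" .
 qed (use D in simp)
qed

text \<open>Since the measure is finite, a subsequence converges almost everywhere by the theory of \<open>L\<^sup>1\<close>; Fatou's lemma
gives the convergence of the integrals.\<close>

lemma Lspace_complete:
 fixes u :: "nat => 'a => 'b::euclidean_space"
 assumes p: "1 < p" and u: "\<And>n. u n \<in> Lspace M p"
  and cauchy: "\<And>e. 0 < e ==> \<exists>N. \<forall>m\<ge>N. \<forall>n\<ge>N. pdist M p (u m) (u n) < e"
 shows "\<exists>v\<in>Lspace M p. (\<lambda>n. pdist M p (u n) v) \<longlonglongrightarrow> 0"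
proof -
 note [measurable] = LspaceD(1)[OF u]
 have p0: "0 < p" using p by simp
 have int1: "integrable M (u n)" for n using LspaceD(2)[OF Lspace_mono[of 1 p "u n"]] p u by (simp add: integrable_norm_iff)
 have "\<exists>N. \<forall>i\<ge>N. \<forall>j\<ge>N. LINT x|M. norm (u i x - u j x) < e" if e: "e > 0" for e
 proof -
  obtain C where C: "C \<ge> 0" "\<And>w::'a=>'b. w \<in> Lspace M p ==> pint M 1 w \<le> e / 2 + C * pint M p w"
   using pint_low_by_high(1)[of 1 p "e/2"] p e by auto
  obtain N where N: "\<And>m n. m \<ge> N ==> n \<ge> N ==> pdist M p (u m) (u n) < e / (2 * (C + 1))" using cauchy[of "e / (2 * (C + 1))"] e C by auto
  have "LINT x|M. norm (u i x - u j x) < e" if "i \<ge> N" "j \<ge> N" for i j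
  proof -
   have "pdist M 1 (u i) (u j) \<le> e / 2 + C * pdist M p (u i) (u j)" by (intro C(2) Lspace_diff u p0)
   also have "C * pdist M p (u i) (u j) \<le> (C + 1) * pdist M p (u i) (u j)" using pint_nonneg by (intro mult_right_mono) auto
   also have "\<dots> < (C + 1) * (e / (2 * (C + 1)))" using N[OF that] C by (intro mult_strict_left_mono) auto
   also have "\<dots> = e / 2" using C by (simp add: field_simps)
   finally show ?thesis by (simp add: pint_def)
  qed
  thus ?thesis by blast
 qed
 then obtain r where r: "strict_mono r" and AEc: "AE x in M. Cauchy (\<lambda>i. u (r i) x)" using cauchy_L1_AE_cauchy_subseq[of M u] int1 by blast
 define v where "v x = lim (\<lambda>i. u (r i) x)" for x
 have [measurable]: "v \<in> borel_measurable M" unfolding v_def by measurable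
 have AEl: "AE x in M. (\<lambda>i. u (r i) x) \<longlonglongrightarrow> v x"
  using AEc by eventually_elim (simp add: v_def convergent_LIMSEQ_iff[symmetric] Cauchy_convergent_iff)
 \<comment> \<open>Fatou's lemma, applied to the differences with a fixed late element of the sequence.\<close>
 have key: "(\<lambda>x. u n x - v x) \<in> Lspace M p \<and> pdist M p (u n) v \<le> e"
  if e: "e > 0" and N: "\<forall>m\<ge>N. \<forall>n\<ge>N. pdist M p (u m) (u n) < e" and n: "n \<ge> N" for e N n
 proof -
  let ?f = "\<lambda>i x. norm (u n x - u (r i) x) powr p"
  have fi: "integrable M (?f i)" for i using LspaceD(2)[OF Lspace_diff[OF u u p0]] .
  have "(\<integral>\<^sup>+x. ennreal (norm (u n x - v x) powr p) \<partial>M) = (\<integral>\<^sup>+x. liminf (\<lambda>i. ennreal (?f i x)) \<partial>M)"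
  proof (rule nn_integral_cong_AE)
   show "AE x in M. ennreal (norm (u n x - v x) powr p) = liminf (\<lambda>i. ennreal (?f i x))" using AEl
   proof eventually_elim
    fix x assume "(\<lambda>i. u (r i) x) \<longlonglongrightarrow> v x"
    hence "(\<lambda>i. ?f i x) \<longlonglongrightarrow> norm (u n x - v x) powr p" using p0 by (intro tendsto_powr' tendsto_intros) auto
    hence "(\<lambda>i. ennreal (?f i x)) \<longlonglongrightarrow> ennreal (norm (u n x - v x) powr p)" by (rule tendsto_ennrealI)
    thus "ennreal (norm (u n x - v x) powr p) = liminf (\<lambda>i. ennreal (?f i x))" by (rule lim_imp_Liminf[OF sequentially_bot, symmetric])
   qed
  qed
  also have "\<dots> \<le> liminf (\<lambda>i. \<integral>\<^sup>+x. ennreal (?f i x) \<partial>M)" by (rule nn_integral_liminf) measurable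
  also have "\<dots> \<le> ennreal e"
  proof -
   have ev: "\<forall>\<^sub>F i in sequentially. (\<integral>\<^sup>+x. ennreal (?f i x) \<partial>M) \<le> ennreal e" using eventually_ge_at_top[of N]
   proof eventually_elim
    fix i assume "N \<le> i"
    hence "N \<le> r i" using seq_suble[OF r, of i] by linarith
    hence "pdist M p (u n) (u (r i)) \<le> e" using N n by fastforce
    moreover have "(\<integral>\<^sup>+x. ennreal (?f i x) \<partial>M) = ennreal (pdist M p (u n) (u (r i)))"
     unfolding pint_def by (rule nn_integral_eq_integral[OF fi]) simp
    ultimately show "(\<integral>\<^sup>+x. ennreal (?f i x) \<partial>M) \<le> ennreal e" using e by (simp add: ennreal_leI)
   qed
   have "liminf (\<lambda>i. \<integral>\<^sup>+x. ennreal (?f i x) \<partial>M) \<le> limsup (\<lambda>i. \<integral>\<^sup>+x. ennreal (?f i x) \<partial>M)" by (rule Liminf_le_Limsup) simp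
   also have "\<dots> \<le> ennreal e" by (rule Limsup_bounded[OF ev])
   finally show ?thesis .
  qed
  finally have le: "(\<integral>\<^sup>+x. ennreal (norm (u n x - v x) powr p) \<partial>M) \<le> ennreal e" .
  hence fin: "(\<integral>\<^sup>+x. ennreal (norm (u n x - v x) powr p) \<partial>M) < \<infinity>" by (rule le_less_trans) simp
  have int: "integrable M (\<lambda>x. norm (u n x - v x) powr p)" by (rule integrableI_bounded) (use fin in auto)
  have "ennreal (pdist M p (u n) v) \<le> ennreal e" using le nn_integral_eq_integral[OF int] by (simp add: pint_def)
  thus ?thesis using int e by (simp add: Lspace_def)
 qed
 obtain N where N: "\<forall>m\<ge>N. \<forall>n\<ge>N. pdist M p (u m) (u n) < 1" using cauchy[of 1] by auto
 have "(\<lambda>x. u N x - v x) \<in> Lspace M p" using key[OF _ N, of N] by simp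
 from Lspace_diff[OF u[of N] this p0] have "v \<in> Lspace M p" by simp
 moreover have "(\<lambda>n. pdist M p (u n) v) \<longlonglongrightarrow> 0"
 proof (rule LIMSEQ_I)
  fix e :: real assume e: "0 < e"
  obtain N where N: "\<forall>m\<ge>N. \<forall>n\<ge>N. pdist M p (u m) (u n) < e / 2" using cauchy[of "e/2"] e by auto
  have "norm (pdist M p (u n) v - 0) < e" if "n \<ge> N" for n using key[OF _ N that] e pint_nonneg[of M p "\<lambda>x. u n x - v x"] by simp
  thus "\<exists>N. \<forall>n\<ge>N. norm (pdist M p (u n) v - 0) < e" by blast
 qed
 ultimately show ?thesis by blast
qed

end

section \<open>Convergence of power integrals\<close>

lemma mult_divide_cancel_pos: "0 < a ==> a * (b / a) = (b::real)" by simp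

lemma midpoint_arith:
 "a \<le> b / 2 + c / 2 ==> x + b - l \<le> d + \<delta> ==> y + c - m \<le> d + \<delta> ==> d \<le> z + a - n ==> n = l / 2 + m / 2 ==>
  x / 2 + y / 2 - z \<le> (\<delta>::real)" by (simp add: field_simps)

text \<open>The form in which the inequalities with a small factor and a large constant are used: the constant
multiplies a null sequence.\<close>

lemma null_sequence:
 fixes x y :: "nat => real"
 assumes y: "y \<longlonglongrightarrow> 0" "\<And>k. 0 \<le> y k" and x: "\<And>e. 0 < e ==> \<exists>C\<ge>0. \<forall>k. \<bar>x k\<bar> \<le> e * B + C * y k"
 shows "x \<longlonglongrightarrow> 0"
proof (rule LIMSEQ_I)
 fix e :: real assume e: "0 < e"
 let ?B = "\<bar>B\<bar> + 1"
 obtain C where C: "C \<ge> 0" "\<And>k. \<bar>x k\<bar> \<le> e / (2 * ?B) * B + C * y k" using x[of "e / (2 * ?B)"] e by auto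
 obtain N where N: "\<And>k. N \<le> k ==> y k < e / (2 * (C + 1))" using LIMSEQ_D[OF y(1), of "e / (2 * (C + 1))"] e C(1) by fastforce
 have "norm (x k - 0) < e" if k: "N \<le> k" for k
 proof -
  have "e / (2 * ?B) * B \<le> e / (2 * ?B) * ?B" using e by (intro mult_left_mono) auto
  also have "\<dots> = e / 2" by (simp add: field_simps)
  finally have 1: "e / (2 * ?B) * B \<le> e / 2" .
  have "C * y k \<le> (C + 1) * y k" using y(2) by (intro mult_right_mono) auto
  also have "\<dots> < (C + 1) * (e / (2 * (C + 1)))" using N[OF k] C by (intro mult_strict_left_mono) auto
  also have "\<dots> = e / 2" using C by (simp add: field_simps)
  finally have 2: "C * y k < e / 2" .
  show ?thesis unfolding real_norm_def diff_0_right by (rule le_less_trans[OF C(2)]) (use 1 2 in linarith)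
 qed
 thus "\<exists>N. \<forall>k\<ge>N. norm (x k - 0) < e" by blast
qed

lemma pairing_difference_null:
 fixes u w :: "nat => 'a => 'b::euclidean_space"
 assumes r: "1 < r" and u: "\<And>k. u k \<in> Lspace M r" and v: "v \<in> Lspace M r" and w: "\<And>k. w k \<in> Lspace M r"
  and lim: "(\<lambda>k. pdist M r (u k) v) \<longlonglongrightarrow> 0" and K: "\<And>k. pint M r (u k) \<le> K" "\<And>k. pint M r (w k) \<le> K"
 shows "(\<lambda>k. pairing M r (u k) (w k) - pairing M r v (w k)) \<longlonglongrightarrow> 0"
proof (rule null_sequence[OF lim pint_nonneg, where B = "K + pint M r v + K"])
 fix e :: real assume e: "0 < e"
 obtain C where C: "C \<ge> 0" "\<And>u v w::'a=>'b. u\<in>Lspace M r ==> v\<in>Lspace M r ==> w\<in>Lspace M r ==>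
  \<bar>pairing M r u w - pairing M r v w\<bar> \<le> e * (pint M r u + pint M r v + pint M r w) + C * pdist M r u v"
  using pairing_continuous[OF r e, of M] by auto
 have le: "e * (pint M r (u k) + pint M r v + pint M r (w k)) \<le> e * (K + pint M r v + K)" for k
  using K[of k] e by (intro mult_left_mono) auto
 show "\<exists>C\<ge>0. \<forall>k. \<bar>pairing M r (u k) (w k) - pairing M r v (w k)\<bar> \<le> e * (K + pint M r v + K) + C * pdist M r (u k) v"
  by (intro exI[of _ C] conjI allI C(1) order_trans[OF C(2)[OF u v w] add_right_mono[OF le]])
qed

lemma pairing_tendsto:
 fixes u :: "nat => 'a => 'b::euclidean_space"
 assumes "1 < r" "\<And>k. u k \<in> Lspace M r" "v \<in> Lspace M r"
  "(\<lambda>k. pdist M r (u k) v) \<longlonglongrightarrow> 0" "\<And>k. pint M r (u k) \<le> K" "w \<in> Lspace M r"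
 shows "(\<lambda>k. pairing M r (u k) w) \<longlonglongrightarrow> pairing M r v w"
 using pairing_difference_null[where u = u and w = "\<lambda>_. w" and K = "max K (pint M r w)", OF assms(1-3,6,4)] assms(5)
 by (simp add: LIM_zero_iff le_max_iff_disj)

lemma pairing_tendsto_right:
 fixes w :: "nat => 'a => 'b::euclidean_space"
 assumes r: "1 < r" and u: "u \<in> Lspace M r" and w: "\<And>k. w k \<in> Lspace M r" and v: "v \<in> Lspace M r"
  and lim: "(\<lambda>k. pdist M r (w k) v) \<longlonglongrightarrow> 0"
 shows "(\<lambda>k. pairing M r u (w k)) \<longlonglongrightarrow> pairing M r u v"
proof -
 have r0: "0 < r" using r by simp
 have "(\<lambda>k. pairing M r u (\<lambda>x. w k x - v x)) \<longlonglongrightarrow> 0"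
 proof (rule null_sequence[OF lim pint_nonneg])
  show "\<exists>C\<ge>0. \<forall>k. \<bar>pairing M r u (\<lambda>x. w k x - v x)\<bar> \<le> e * pint M r u + C * pdist M r (w k) v" if "0 < e" for e
   using pairing_small[OF r that, of M] u Lspace_diff[OF w v r0] by blast
 qed
 thus ?thesis unfolding pairing_diff[OF u w v r] by (rule LIM_zero_cancel)
qed

lemma pint_tendsto:
 fixes u :: "nat => 'a => 'b::euclidean_space"
 assumes r: "1 < r" and u: "\<And>k. u k \<in> Lspace M r" and v: "v \<in> Lspace M r"
  and lim: "(\<lambda>k. pdist M r (u k) v) \<longlonglongrightarrow> 0" and K: "\<And>k. pint M r (u k) \<le> K"
 shows "(\<lambda>k. pint M r (u k)) \<longlonglongrightarrow> pint M r v"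
 using tendsto_add[OF pairing_difference_null[where u = u and w = u, OF r u v u lim K K] pairing_tendsto_right[where w = u, OF r v u v lim]]
 by (simp add: pairing_self)

lemma (in finite_measure) pint_low_tendsto:
 fixes u :: "nat => 'a => 'b::euclidean_space"
 assumes q: "0 < q" "q < p" and u: "\<And>k. u k \<in> Lspace M p" and lim: "(\<lambda>k. pint M p (u k)) \<longlonglongrightarrow> 0"
 shows "(\<lambda>k. pint M q (u k)) \<longlonglongrightarrow> 0"
proof (rule null_sequence[OF lim pint_nonneg, where B = 1])
 show "\<exists>C\<ge>0. \<forall>k. \<bar>pint M q (u k)\<bar> \<le> e * 1 + C * pint M p (u k)" if "0 < e" for e
  using pint_low_by_high(1)[OF q that] u by (auto simp: pint_nonneg)
qed

lemma pairing_bounded: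
 assumes r: "1 < r"
 shows "\<exists>B\<ge>0. \<forall>u\<in>Lspace M r. \<forall>w\<in>Lspace M r. pint M r u \<le> K --> pint M r w \<le> K' -->
   \<bar>pairing M r u (w :: 'a => 'b::euclidean_space)\<bar> \<le> B"
proof -
 obtain C where C: "C \<ge> 0" "\<And>u w::'a=>'b. u\<in>Lspace M r ==> w\<in>Lspace M r ==> \<bar>pairing M r u w\<bar> \<le> 1 * pint M r u + C * pint M r w"
  using pairing_small[OF r, of 1 M] by auto
 show ?thesis
 proof (intro exI[of _ "\<bar>K\<bar> + C * \<bar>K'\<bar>"] conjI ballI impI)
  fix u w :: "'a=>'b" assume "u\<in>Lspace M r" "w\<in>Lspace M r" and K: "pint M r u \<le> K" "pint M r w \<le> K'"
  hence "\<bar>pairing M r u w\<bar> \<le> 1 * pint M r u + C * pint M r w" using C by blast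
  also have "\<dots> \<le> 1 * \<bar>K\<bar> + C * \<bar>K'\<bar>" using K C by (intro add_mono mult_left_mono) auto
  finally show "\<bar>pairing M r u w\<bar> \<le> \<bar>K\<bar> + C * \<bar>K'\<bar>" by simp
 qed (use C in simp)
qed

section \<open>Strong convergence of almost solutions\<close>

text \<open>The setting of the Galerkin method: an increasing family of linear spaces \<open>W n\<close>, whose elements are pairs of
a function and its gradient, with the Poincare inequality, compactness in \<open>L\<^sup>p\<close> and a bounded linear
functional \<open>f\<close>. Carrying the gradient along as a second component separates the variational argument from
the theory of weak derivatives.\<close>

locale pq_space = finite_measure M for M :: "'a measure" +
 fixes p q :: real and W :: "nat => (('a => real) \<times> ('a => 'b::euclidean_space)) set"
  and f :: "('a => real) => real" and CP Cf :: real
 assumes q1: "1 < q" and qp: "q < p"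
  and W_Lp: "\<And>u v n. (u, v) \<in> W n ==> u \<in> Lspace M p \<and> v \<in> Lspace M p"
  and W_mono: "\<And>m n. m \<le> n ==> W m \<subseteq> W n"
  and W_lin: "\<And>u v u' v' n a b. (u, v) \<in> W n ==> (u', v') \<in> W n ==>
    ((\<lambda>x. a *\<^sub>R u x + b *\<^sub>R u' x), (\<lambda>x. a *\<^sub>R v x + b *\<^sub>R v' x)) \<in> W n"
  and CP: "0 \<le> CP" and poincare: "\<And>u v n. (u, v) \<in> W n ==> pint M p u \<le> CP * pint M p v"
  and rellich: "\<And>u v K. (\<And>k::nat. \<exists>n. (u k, v k) \<in> W n) ==> (\<And>k. pint M p (v k) \<le> K) ==>
    \<exists>\<sigma>::nat=>nat. strict_mono \<sigma> \<and> (\<forall>e>0. \<exists>N. \<forall>k\<ge>N. \<forall>l\<ge>N. pdist M p (u (\<sigma> k)) (u (\<sigma> l)) < e)"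
  and f_lin: "\<And>u v u' v' n a b. (u, v) \<in> W n ==> (u', v') \<in> W n ==> f (\<lambda>x. a *\<^sub>R u x + b *\<^sub>R u' x) = a * f u + b * f u'"
  and Cf: "0 \<le> Cf" and f_bound: "\<And>u v n. (u, v) \<in> W n ==> \<bar>f u\<bar> \<le> Cf * pint M p v powr (1 / p)"
begin

lemma p1: "1 < p" using q1 qp by simp

lemma W_Lq: "(u, v) \<in> W n ==> u \<in> Lspace M q \<and> v \<in> Lspace M q"
 using W_Lp[of u v n] Lspace_mono[of q p u] Lspace_mono[of q p v] q1 qp by simp

lemma W_diff: "(u, v) \<in> W n ==> (u', v') \<in> W n ==> ((\<lambda>x. u x - u' x), (\<lambda>x. v x - v' x)) \<in> W n" using W_lin[of u v n u' v' 1 "-1"] by simp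

lemma W_scale: "(u, v) \<in> W n ==> ((\<lambda>x. a *\<^sub>R u x), (\<lambda>x. a *\<^sub>R v x)) \<in> W n" using W_lin[of u v n u v a 0] by simp

lemma W_mid: "(u, v) \<in> W n ==> (u', v') \<in> W n ==> ((\<lambda>x. (1/2) *\<^sub>R (u x + u' x)), (\<lambda>x. (1/2) *\<^sub>R (v x + v' x))) \<in> W n"
 using W_lin[of u v n u' v' "1/2" "1/2"] by (simp add: scaleR_add_right del: real_scaleR_def)

lemma W_common: "(u, v) \<in> W n ==> (u', v') \<in> W n' ==> \<exists>m. (u, v) \<in> W m \<and> (u', v') \<in> W m"
 using W_mono[of n "max n n'"] W_mono[of n' "max n n'"] by auto

lemma f_diff: "(u, v) \<in> W n ==> (u', v') \<in> W n ==> f (\<lambda>x. u x - u' x) = f u - f u'" using f_lin[of u v n u' v' 1 "-1"] by simp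

lemma f_scale: "(u, v) \<in> W n ==> f (\<lambda>x. a *\<^sub>R u x) = a * f u" using f_lin[of u v n u v a 0] by simp

lemma f_bounded: "(u, v) \<in> W n ==> pint M p v \<le> K ==> \<bar>f u\<bar> \<le> Cf * K powr (1 / p)"
 using f_bound[of u v n] mult_left_mono[OF powr_mono2[of "1 / p" "pint M p v" K] Cf] pint_nonneg[of M p v] p1 by simp

text \<open>No weak limits are taken. By compactness the functions converge to some \<open>u\<close>; with the terms of lower order
evaluated at this limit, the pairs are almost minimizers of a convex functional \<open>J\<close>, and uniform convexity
makes the gradients a Cauchy sequence. The coefficients \<open>s\<close> and \<open>r\<close> allow for two applications: they are 1
for the equation itself, and they tend to 0 when the equation is rescaled along a divergent sequence.\<close>

theorem almost_solutions_compact: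
 fixes u :: "nat => 'a => real" and v :: "nat => 'a => 'b" and m :: "nat => nat"
 assumes W0: "\<And>k. (u k, v k) \<in> W (m k)" and m0: "\<And>k. k \<le> m k" and K0: "\<And>k. pint M p (v k) \<le> K"
  and s0: "\<And>k. 0 \<le> s k" "s \<longlonglongrightarrow> s'" and c0: "c \<longlonglongrightarrow> c'" and r0: "r \<longlonglongrightarrow> r'" and \<eta>0: "\<eta> \<longlonglongrightarrow> 0"
  and eq0: "\<And>k wu wv. (wu, wv) \<in> W (m k) ==>
    \<bar>pairing M p (v k) wv + s k * pairing M q (v k) wv - c k * pairing M p (u k) wu - s k * \<beta> * pairing M q (u k) wu - r k * f wu\<bar>
     \<le> \<eta> k * (1 + pint M p wv)"
 shows "\<exists>(\<sigma>::nat=>nat) u' v'. strict_mono \<sigma> \<and> u' \<in> Lspace M p \<and> v' \<in> Lspace M p \<and>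
   (\<lambda>k. pdist M p (u (\<sigma> k)) u') \<longlonglongrightarrow> 0 \<and> (\<lambda>k. pdist M p (v (\<sigma> k)) v') \<longlonglongrightarrow> 0 \<and>
   (\<forall>n. \<forall>(wu, wv)\<in>W n. pairing M p v' wv + s' * pairing M q v' wv = c' * pairing M p u' wu + s' * \<beta> * pairing M q u' wu + r' * f wu)"
proof -
 have p0: "0 < p" and q0: "0 < q" using p1 q1 by auto
 have ex: "\<exists>n. (u k, v k) \<in> W n" for k using W0 by blast
 from rellich[of u v K, OF ex K0]
 obtain \<sigma> :: "nat => nat" where \<sigma>: "strict_mono \<sigma>" and cau: "\<forall>e>0. \<exists>N. \<forall>k\<ge>N. \<forall>l\<ge>N. pdist M p (u (\<sigma> k)) (u (\<sigma> l)) < e" by (elim exE conjE)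
 define U where "U k = u (\<sigma> k)" for k
 define V where "V k = v (\<sigma> k)" for k
 define n where "n k = m (\<sigma> k)" for k
 define S where "S k = s (\<sigma> k)" for k
 define c1 where "c1 k = c (\<sigma> k)" for k
 define R where "R k = r (\<sigma> k)" for k
 define \<eta>1 where "\<eta>1 k = \<eta> (\<sigma> k)" for k
 note defs = U_def V_def n_def S_def c1_def R_def \<eta>1_def
 have W1: "(U k, V k) \<in> W (n k)" and K1: "pint M p (V k) \<le> K" and S1: "0 \<le> S k" for k unfolding defs by (fact W0 K0 s0)+
 have n1: "W j \<subseteq> W (n k)" if "j \<le> k" for j k unfolding n_def using m0[of "\<sigma> k"] seq_suble[OF \<sigma>, of k] that by (intro W_mono) linarith
 have Sl: "S \<longlonglongrightarrow> s'" and cl: "c1 \<longlonglongrightarrow> c'" and Rl: "R \<longlonglongrightarrow> r'" and \<eta>l: "\<eta>1 \<longlonglongrightarrow> 0"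
  using LIMSEQ_subseq_LIMSEQ[OF _ \<sigma>] s0(2) c0 r0 \<eta>0 unfolding defs[abs_def] o_def by blast+
 have s'0: "0 \<le> s'" using LIMSEQ_le_const[OF Sl] S1 by blast
 define X where "X k wu wv = pairing M p (V k) wv + S k * pairing M q (V k) wv - c1 k * pairing M p (U k) wu - S k * \<beta> * pairing M q (U k) wu - R k * f wu" for k wu wv
 have Xb: "\<bar>X k wu wv\<bar> \<le> \<eta>1 k * (1 + pint M p wv)" if "(wu, wv) \<in> W (n k)" for k wu wv
  using eq0[of wu wv "\<sigma> k"] that unfolding X_def defs .
 have UL: "U k \<in> Lspace M p" "V k \<in> Lspace M p" "U k \<in> Lspace M q" "V k \<in> Lspace M q" for k using W_Lp[OF W1] W_Lq[OF W1] by auto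
 obtain u' where u': "u' \<in> Lspace M p" and ul: "(\<lambda>k. pdist M p (U k) u') \<longlonglongrightarrow> 0"
  using Lspace_complete[of p U, OF p1 UL(1)] cau unfolding U_def by blast
 have u'Q: "u' \<in> Lspace M q" using Lspace_mono[OF q0 qp u'] .
 have ulq: "(\<lambda>k. pdist M q (U k) u') \<longlonglongrightarrow> 0" by (rule pint_low_tendsto[OF q0 qp _ ul]) (intro Lspace_diff UL u' p0)
 obtain D where D: "\<And>w::'a=>'b. w \<in> Lspace M p ==> pint M q w \<le> D + 1 * pint M p w" using pint_low_by_high(2)[OF q0 qp, of 1] by auto
 obtain D' where D': "\<And>w::'a=>real. w \<in> Lspace M p ==> pint M q w \<le> D' + 1 * pint M p w" using pint_low_by_high(2)[OF q0 qp, of 1] by auto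
 \<comment> \<open>A bounded set of competitors that contains the pairs themselves and their midpoints.\<close>
 define A where "A = {(w, g). (\<exists>n. (w, g) \<in> W n) \<and> pint M p g \<le> K}"
 have UVA: "(U k, V k) \<in> A" for k using W1 K1 by (auto simp: A_def)
 define K' where "K' = CP * K"
 have AD: "pint M q g \<le> D + K" "pint M p w \<le> K'" "pint M q w \<le> D' + K'" "\<bar>f w\<bar> \<le> Cf * K powr (1 / p)"
  "w \<in> Lspace M p" "w \<in> Lspace M q" "g \<in> Lspace M p" "g \<in> Lspace M q" if wg: "(w, g) \<in> A" for w g
 proof -
  from wg obtain j where j: "(w, g) \<in> W j" and b: "pint M p g \<le> K" by (auto simp: A_def)
  show L: "w \<in> Lspace M p" "w \<in> Lspace M q" "g \<in> Lspace M p" "g \<in> Lspace M q" using W_Lp[OF j] W_Lq[OF j] by auto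
  show "pint M q g \<le> D + K" using D[OF L(3)] b by linarith
  show P: "pint M p w \<le> K'" unfolding K'_def using poincare[OF j] mult_left_mono[OF b CP] by linarith
  show "pint M q w \<le> D' + K'" using D'[OF L(1)] P by linarith
  show "\<bar>f w\<bar> \<le> Cf * K powr (1 / p)" by (rule f_bounded[OF j b])
 qed
 note UVD = AD[OF UVA]
 have pU: "(\<lambda>k. pairing M p (U k) w) \<longlonglongrightarrow> pairing M p u' w" if "w \<in> Lspace M p" for w
  by (rule pairing_tendsto[where u = U, OF p1 UL(1) u' ul UVD(2) that])
 have qU: "(\<lambda>k. pairing M q (U k) w) \<longlonglongrightarrow> pairing M q u' w" if "w \<in> Lspace M q" for w
  by (rule pairing_tendsto[where u = U, OF q1 UL(3) u'Q ulq UVD(3) that])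
 have pUU: "(\<lambda>k. pint M p (U k)) \<longlonglongrightarrow> pint M p u'" by (rule pint_tendsto[where u = U, OF p1 UL(1) u' ul UVD(2)])
 have qUU: "(\<lambda>k. pint M q (U k)) \<longlonglongrightarrow> pint M q u'" by (rule pint_tendsto[where u = U, OF q1 UL(3) u'Q ulq UVD(3)])
 have pu: "(\<lambda>k. pairing M p u' (U k)) \<longlonglongrightarrow> pint M p u'" unfolding pairing_self[of M p u', symmetric]
  by (rule pairing_tendsto_right[where w = U, OF p1 u' UL(1) u' ul])
 have qu: "(\<lambda>k. pairing M q u' (U k)) \<longlonglongrightarrow> pint M q u'" unfolding pairing_self[of M q u', symmetric]
  by (rule pairing_tendsto_right[where w = U, OF q1 u'Q UL(3) u'Q ulq])
 define Lin where "Lin w = c' * pairing M p u' w + s' * \<beta> * pairing M q u' w + r' * f w" for w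
 define J where "J w g = pint M p g / p + s' * (pint M q g / q) - Lin w" for w and g :: "'a => 'b"
 \<comment> \<open>The pairs almost minimize the convex functional \<open>J\<close>: convexity bounds the increment
  of \<open>J\<close> towards a fixed competitor by the residual of the equation in that direction.\<close>
 have almost_min: "\<forall>\<^sub>F k in sequentially. J (U k) (V k) \<le> J w g + \<epsilon>" if \<epsilon>: "0 < \<epsilon>" and wg: "(w, g) \<in> A" for \<epsilon> w g
 proof -
  note wgD = AD[OF wg]
  obtain j where j: "(w, g) \<in> W j" using wg by (auto simp: A_def)
  define Y where "Y k = (S k - s') * (pairing M q (V k) g - pint M q (V k)) + (r' - R k) * (f w - f (U k))
   + (c' * (pairing M p u' w - pairing M p u' (U k)) - c1 k * (pairing M p (U k) w - pint M p (U k)))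
   + (s' * \<beta> * (pairing M q u' w - pairing M q u' (U k)) - S k * \<beta> * (pairing M q (U k) w - pint M q (U k)))" for k
  define K2 where "K2 = 2 powr p * (pint M p g + K)"
  obtain B where B: "\<And>u w::'a=>'b. u \<in> Lspace M q ==> w \<in> Lspace M q ==> pint M q u \<le> D + K ==> pint M q w \<le> D + K ==> \<bar>pairing M q u w\<bar> \<le> B"
   using pairing_bounded[OF q1, of M "D + K" "D + K"] by blast
  have "\<bar>pairing M q (V k) g - pint M q (V k)\<bar> \<le> B + (D + K)" for k
   using B[OF UL(4) wgD(8) UVD(1) wgD(1), of k] UVD(1)[of k] pint_nonneg[of M q "V k"] by linarith
  hence y1: "(\<lambda>k. (S k - s') * (pairing M q (V k) g - pint M q (V k))) \<longlonglongrightarrow> 0"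
   using Sl by (intro lim_null_mult_right_bounded[where B = "B + (D + K)"]) (auto simp: LIM_zero)
  have "\<bar>f w - f (U k)\<bar> \<le> 2 * (Cf * K powr (1 / p))" for k using wgD(4) UVD(4)[of k] by linarith
  hence y2: "(\<lambda>k. (r' - R k) * (f w - f (U k))) \<longlonglongrightarrow> 0"
   using tendsto_diff[OF tendsto_const[of r'] Rl] by (intro lim_null_mult_right_bounded[where B = "2 * (Cf * K powr (1 / p))"]) auto
  have "Y \<longlonglongrightarrow> 0 + 0 + (c' * (pairing M p u' w - pint M p u') - c' * (pairing M p u' w - pint M p u'))
    + (s' * \<beta> * (pairing M q u' w - pint M q u') - s' * \<beta> * (pairing M q u' w - pint M q u'))"
   unfolding Y_def by (intro tendsto_intros y1 y2 pU[OF wgD(5)] qU[OF wgD(6)] pUU qUU pu qu cl Sl)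
  moreover have "(\<lambda>k. \<bar>\<eta>1 k\<bar> * (1 + K2)) \<longlonglongrightarrow> \<bar>0\<bar> * (1 + K2)" by (intro tendsto_intros \<eta>l)
  ultimately have "(\<lambda>k. Y k + \<bar>\<eta>1 k\<bar> * (1 + K2)) \<longlonglongrightarrow> 0" by (auto dest: tendsto_add)
  from order_tendstoD(2)[OF this \<epsilon>] eventually_ge_at_top[of j] show ?thesis
  proof eventually_elim
   case (elim k)
   have dW: "((\<lambda>x. w x - U k x), (\<lambda>x. g x - V k x)) \<in> W (n k)" using j n1[OF elim(2)] by (intro W_diff W1) blast
   have pd: "pairing M r z (\<lambda>x. a x - b x) = pairing M r z a - pairing M r z b"
    if "z \<in> Lspace M r" "a \<in> Lspace M r" "b \<in> Lspace M r" "1 < r" for r and z a b :: "'a => 'c::euclidean_space"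
    by (rule pairing_diff[OF that])
   have fd: "f (\<lambda>x. w x - U k x) = f w - f (U k)" using j n1[OF elim(2)] by (intro f_diff[OF _ W1]) blast
   have mV: "(\<lambda>x. - V k x) \<in> Lspace M p" using Lspace_scaleR[OF UL(2) p0, of "-1"] by simp
   have "pdist M p g (V k) \<le> 2 powr p * (pint M p g + pint M p (\<lambda>x. - V k x))" using pint_add_le[OF wgD(7) mV p0] by simp
   also have "\<dots> \<le> K2" unfolding K2_def using K1[of k] by (intro mult_left_mono add_left_mono) (simp_all add: pint_def)
   finally have "\<eta>1 k * (1 + pdist M p g (V k)) \<le> \<bar>\<eta>1 k\<bar> * (1 + K2)"
    using pint_nonneg[of M p "\<lambda>x. g x - V k x"] by (intro mult_mono) auto
   hence X: "\<bar>X k (\<lambda>x. w x - U k x) (\<lambda>x. g x - V k x)\<bar> \<le> \<bar>\<eta>1 k\<bar> * (1 + K2)" using Xb[OF dW] by linarith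
   have "pint M p (V k) + p * (pairing M p (V k) g - pint M p (V k)) \<le> pint M p g"
    using pint_above_tangent[OF p1 UL(2) wgD(7)] unfolding pd[OF UL(2) wgD(7) UL(2) p1] pairing_self .
   hence T1: "pairing M p (V k) g - pint M p (V k) \<le> pint M p g / p - pint M p (V k) / p" using p0 by (simp add: field_simps)
   have "pint M q (V k) + q * (pairing M q (V k) g - pint M q (V k)) \<le> pint M q g"
    using pint_above_tangent[OF q1 UL(4) wgD(8)] unfolding pd[OF UL(4) wgD(8) UL(4) q1] pairing_self .
   hence "pairing M q (V k) g - pint M q (V k) \<le> pint M q g / q - pint M q (V k) / q" using q0 by (simp add: field_simps)
   from mult_left_mono[OF this s'0] have T2: "s' * (pairing M q (V k) g - pint M q (V k)) \<le> s' * (pint M q g / q) - s' * (pint M q (V k) / q)"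
    by (simp add: right_diff_distrib)
   have "X k (\<lambda>x. w x - U k x) (\<lambda>x. g x - V k x) = (pairing M p (V k) g - pint M p (V k)) + s' * (pairing M q (V k) g - pint M q (V k)) + Y k - (Lin w - Lin (U k))"
    unfolding X_def Y_def Lin_def fd pd[OF UL(2) wgD(7) UL(2) p1] pd[OF UL(4) wgD(8) UL(4) q1] pd[OF UL(1) wgD(5) UL(1) p1] pd[OF UL(3) wgD(6) UL(3) q1]
     pairing_self by (simp add: algebra_simps)
   thus ?case using X T1 T2 elim(1) unfolding J_def by linarith
  qed
 qed
 obtain B1 where B1: "\<And>w::'a=>real. w \<in> Lspace M p ==> pint M p w \<le> K' ==> \<bar>pairing M p u' w\<bar> \<le> B1"
  using pairing_bounded[OF p1, of M "pint M p u'" K'] u' by blast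
 obtain B2 where B2: "\<And>w::'a=>real. w \<in> Lspace M q ==> pint M q w \<le> D' + K' ==> \<bar>pairing M q u' w\<bar> \<le> B2"
  using pairing_bounded[OF q1, of M "pint M q u'" "D' + K'"] u'Q by blast
 have Jlow: "- (\<bar>c'\<bar> * B1 + \<bar>s' * \<beta>\<bar> * B2 + \<bar>r'\<bar> * (Cf * K powr (1 / p))) \<le> J w g" if "(w, g) \<in> A" for w g
 proof -
  note z = AD[OF that]
  have "\<bar>c' * pairing M p u' w\<bar> \<le> \<bar>c'\<bar> * B1" "\<bar>s' * \<beta> * pairing M q u' w\<bar> \<le> \<bar>s' * \<beta>\<bar> * B2" "\<bar>r' * f w\<bar> \<le> \<bar>r'\<bar> * (Cf * K powr (1 / p))"
   unfolding abs_mult using B1[OF z(5,2)] B2[OF z(6,3)] z(4) by (intro mult_left_mono mult_nonneg_nonneg; simp)+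
  moreover have "0 \<le> pint M p g / p" "0 \<le> s' * (pint M q g / q)" using p0 q0 s'0 by (simp_all add: pint_nonneg)
  ultimately show ?thesis unfolding J_def Lin_def by linarith
 qed
 \<comment> \<open>The midpoint of two late pairs is a competitor, so \<open>J\<close> is not much smaller there; hence the convexity gap is
 small.\<close>
 define d where "d = Inf ((\<lambda>(w, g). J w g) ` A)"
 have bdd: "bdd_below ((\<lambda>(w, g). J w g) ` A)" using Jlow by (intro bdd_belowI2) auto
 have dJ: "d \<le> J w g" if "(w, g) \<in> A" for w g unfolding d_def using cINF_lower[OF bdd that] by simp
 have Jup: "\<forall>\<^sub>F k in sequentially. J (U k) (V k) \<le> d + \<epsilon>" if \<epsilon>: "\<epsilon> > 0" for \<epsilon>
 proof -
  have "d < d + \<epsilon> / 2" using \<epsilon> by simp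
  hence lt: "Inf ((\<lambda>(w, g). J w g) ` A) < d + \<epsilon> / 2" by (simp only: d_def)
  have ne: "(\<lambda>(w, g). J w g) ` A \<noteq> {}" using UVA by blast
  from cInf_lessD[OF ne lt] obtain y where "y \<in> (\<lambda>(w, g). J w g) ` A" "y < d + \<epsilon> / 2" by (rule bexE)
  then obtain w g where z: "(w, g) \<in> A" "J w g < d + \<epsilon> / 2" by auto
  have "0 < \<epsilon> / 2" using \<epsilon> by simp
  from almost_min[OF this z(1)] show ?thesis by eventually_elim (use z(2) in linarith)
 qed
 have "\<exists>N. \<forall>k\<ge>N. \<forall>l\<ge>N. pdist M p (V k) (V l) < e" if e: "e > 0" for e
 proof -
  define \<epsilon> where "\<epsilon> = e / (4 * (\<bar>K\<bar> + 1))"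
  have \<epsilon>: "\<epsilon> > 0" using e by (simp add: \<epsilon>_def)
  obtain C where C: "C \<ge> 0" "\<And>u v::'a=>'b. u\<in>Lspace M p ==> v\<in>Lspace M p ==>
   pdist M p u v \<le> \<epsilon> * (pint M p u + pint M p v) + C * (pint M p u / 2 + pint M p v / 2 - pint M p (\<lambda>x. (1/2) *\<^sub>R (u x + v x)))"
   using pint_uniformly_convex[OF p1 \<epsilon>, of M] by auto
  define \<delta> where "\<delta> = e / 4 / (p * (C + 1))"
  have \<delta>: "\<delta> > 0" using e C p0 by (simp add: \<delta>_def)
  obtain N where N: "\<And>k. k \<ge> N ==> J (U k) (V k) \<le> d + \<delta>" using Jup[OF \<delta>] by (auto simp: eventually_sequentially)
  have "pdist M p (V k) (V l) < e" if kl: "k \<ge> N" "l \<ge> N" for k l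
  proof -
   obtain j where j: "(U k, V k) \<in> W j" "(U l, V l) \<in> W j" using W_common[OF W1[of k] W1[of l]] by blast
   define mu mv where "mu = (\<lambda>x. (1/2) *\<^sub>R (U k x + U l x))" and "mv = (\<lambda>x. (1/2) *\<^sub>R (V k x + V l x))"
   have mp: "pint M p mv \<le> pint M p (V k) / 2 + pint M p (V l) / 2" and mq: "pint M q mv \<le> pint M q (V k) / 2 + pint M q (V l) / 2"
    unfolding mv_def by (rule pint_midpoint_le[OF p1 UL(2) UL(2)] pint_midpoint_le[OF q1 UL(4) UL(4)])+
   have "(mu, mv) \<in> A" unfolding A_def using W_mid[OF j] mp K1[of k] K1[of l] unfolding mu_def mv_def by fastforce
   hence dm: "d \<le> J mu mv" by (rule dJ)
   have mu: "mu = (\<lambda>x. (1/2) *\<^sub>R U k x + (1/2) *\<^sub>R U l x)" by (simp add: mu_def fun_eq_iff algebra_simps)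
   have Lm: "Lin mu = Lin (U k) / 2 + Lin (U l) / 2"
    unfolding Lin_def mu pairing_lincomb[OF u' UL(1) UL(1) p1] pairing_lincomb[OF u'Q UL(3) UL(3) q1] f_lin[OF j] by (simp add: field_simps)
   have "pint M q mv / q \<le> (pint M q (V k) / 2 + pint M q (V l) / 2) / q" using mq q0 by (intro divide_right_mono) auto
   from mult_left_mono[OF this s'0] have "s' * (pint M q mv / q) \<le> s' * (pint M q (V k) / q) / 2 + s' * (pint M q (V l) / q) / 2"
    by (simp add: add_divide_distrib distrib_left)
   hence "pint M p (V k) / p / 2 + pint M p (V l) / p / 2 - pint M p mv / p \<le> \<delta>"
    using N[OF kl(1)] N[OF kl(2)] dm Lm unfolding J_def by (rule midpoint_arith)
   hence "(pint M p (V k) / 2 + pint M p (V l) / 2 - pint M p mv) / p \<le> \<delta>" by (simp add: diff_divide_distrib add_divide_distrib)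
   hence gap: "pint M p (V k) / 2 + pint M p (V l) / 2 - pint M p mv \<le> p * \<delta>" using p0 by (simp add: field_simps)
   have "pdist M p (V k) (V l) \<le> \<epsilon> * (pint M p (V k) + pint M p (V l)) + C * (pint M p (V k) / 2 + pint M p (V l) / 2 - pint M p mv)"
    using C(2)[OF UL(2)[of k] UL(2)[of l]] by (simp add: mv_def)
   also have "\<dots> \<le> \<epsilon> * (2 * (\<bar>K\<bar> + 1)) + C * (p * \<delta>)" using \<epsilon> C gap K1[of k] K1[of l] by (intro add_mono mult_left_mono) auto
   also have "\<epsilon> * (2 * (\<bar>K\<bar> + 1)) = e / 2" by (simp add: \<epsilon>_def field_simps)
   also have "C * (p * \<delta>) \<le> (C + 1) * (p * \<delta>)" using p0 \<delta> by (intro mult_right_mono) auto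
   also have "(C + 1) * (p * \<delta>) = (p * (C + 1)) * (e / 4 / (p * (C + 1)))" unfolding \<delta>_def by (simp only: mult_ac)
   also have "\<dots> = e / 4" by (rule mult_divide_cancel_pos) (use C p0 in simp)
   finally show ?thesis using e by simp
  qed
  thus ?thesis by blast
 qed
 then obtain v' where v': "v' \<in> Lspace M p" and vl: "(\<lambda>k. pdist M p (V k) v') \<longlonglongrightarrow> 0" using Lspace_complete[of p V, OF p1 UL(2)] by blast
 have v'Q: "v' \<in> Lspace M q" using Lspace_mono[OF q0 qp v'] .
 have vlq: "(\<lambda>k. pdist M q (V k) v') \<longlonglongrightarrow> 0" by (rule pint_low_tendsto[OF q0 qp _ vl]) (intro Lspace_diff UL v' p0)
 have "pairing M p v' wv + s' * pairing M q v' wv = c' * pairing M p u' wu + s' * \<beta> * pairing M q u' wu + r' * f wu"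
  if w: "(wu, wv) \<in> W j" for j wu wv
 proof -
  have L: "wu \<in> Lspace M p" "wv \<in> Lspace M p" "wu \<in> Lspace M q" "wv \<in> Lspace M q" using W_Lp[OF w] W_Lq[OF w] by auto
  have l1: "(\<lambda>k. pairing M p (V k) wv) \<longlonglongrightarrow> pairing M p v' wv" by (rule pairing_tendsto[where u = V, OF p1 UL(2) v' vl K1 L(2)])
  have l2: "(\<lambda>k. pairing M q (V k) wv) \<longlonglongrightarrow> pairing M q v' wv" by (rule pairing_tendsto[where u = V, OF q1 UL(4) v'Q vlq UVD(1) L(4)])
  have lim: "(\<lambda>k. X k wu wv) \<longlonglongrightarrow> pairing M p v' wv + s' * pairing M q v' wv - c' * pairing M p u' wu - s' * \<beta> * pairing M q u' wu - r' * f wu"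
   unfolding X_def by (intro tendsto_intros l1 l2 pU qU L Sl cl Rl)
  have \<eta>l': "(\<lambda>k. \<eta>1 k * (1 + pint M p wv)) \<longlonglongrightarrow> 0" using tendsto_mult_left_zero[OF \<eta>l] .
  have "(\<lambda>k. X k wu wv) \<longlonglongrightarrow> 0"
  proof (rule Lim_null_comparison[OF _ \<eta>l'])
   show "\<forall>\<^sub>F k in sequentially. norm (X k wu wv) \<le> \<eta>1 k * (1 + pint M p wv)"
    using eventually_ge_at_top[of j] by eventually_elim (use w n1 Xb in \<open>force simp del: abs_le_iff\<close>)
  qed
  from LIMSEQ_unique[OF lim this] show ?thesis by linarith
 qed
 thus ?thesis using \<sigma> u' v' ul vl unfolding U_def V_def by blast
qed

end

section \<open>The a priori bound\<close>

context pq_space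
begin

definition lim_pair :: "('a => real) => ('a => 'b) => bool" where
 "lim_pair u v \<longleftrightarrow> u \<in> Lspace M p \<and> v \<in> Lspace M p \<and> (\<exists>U V. (\<forall>k::nat. \<exists>n. (U k, V k) \<in> W n) \<and>
   (\<lambda>k. pdist M p (U k) u) \<longlonglongrightarrow> 0 \<and> (\<lambda>k. pdist M p (V k) v) \<longlonglongrightarrow> 0)"

text \<open>Its critical points solve the equation with \<open>\<gamma>\<close> in place of \<open>\<alpha>\<close>.\<close>

definition energy :: "real => real => ('a => real) \<times> ('a => 'b) => real" where
 "energy \<gamma> \<beta> z = (pint M p (snd z) - \<gamma> * pint M p (fst z)) / p + (pint M q (snd z) - \<beta> * pint M q (fst z)) / q - f (fst z)"

text \<open>The derivative of the energy at \<open>z\<close> in the direction \<open>w\<close>.\<close>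

definition denergy :: "real => real => ('a => real) \<times> ('a => 'b) => ('a => real) \<times> ('a => 'b) => real" where
 "denergy \<gamma> \<beta> z w = pairing M p (snd z) (snd w) - \<gamma> * pairing M p (fst z) (fst w)
   + pairing M q (snd z) (snd w) - \<beta> * pairing M q (fst z) (fst w) - f (fst w)"

definition eigen_pair :: "real => ('a => real) => ('a => 'b) => bool" where
 "eigen_pair \<alpha> u v \<longleftrightarrow> lim_pair u v \<and> 0 < pint M p u \<and>
   (\<forall>n. \<forall>(wu, wv)\<in>W n. pairing M p v wv = \<alpha> * pairing M p u wu)"

lemma powr_inverse_le: "0 \<le> x ==> x powr (1 / p) \<le> 1 + x"
proof (cases "x \<le> 1")
 case True
 assume x: "0 \<le> x"
 have "x powr (1 / p) \<le> 1 powr (1 / p)" using True x p1 by (intro powr_mono2) auto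
 thus ?thesis using x by simp
next
 case False
 hence "x powr (1 / p) \<le> x powr 1" using p1 by (intro powr_mono) auto
 thus ?thesis using False by simp
qed

lemma powr_decay: "0 < a ==> filterlim t at_top sequentially ==> (\<lambda>k. t k powr (- a)) \<longlonglongrightarrow> (0::real)" by (rule tendsto_neg_powr) auto

text \<open>An almost critical point of stage \<open>k\<close>. The sign \<open>\<sigma>\<close> decides whether the energies are bounded above (\<open>\<sigma> = 1\<close>)
or below (\<open>\<sigma> = -1\<close>), uniformly in the stage.\<close>

definition critical :: "real => real => real => real => nat => nat => real => ('a => real) \<times> ('a => 'b) => bool" where
 "critical \<sigma> \<alpha> \<beta> C k n \<gamma> z \<longleftrightarrow> k \<le> n \<and> \<bar>\<gamma> - \<alpha>\<bar> \<le> 1 / real k \<and> z \<in> W n \<and> \<sigma> * energy \<gamma> \<beta> z \<le> C \<and>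
   (\<forall>w\<in>W n. \<bar>denergy \<gamma> \<beta> z w\<bar> \<le> 1 / real k * pint M p (snd w) powr (1 / p))"

lemma criticalD:
 assumes "critical \<sigma> \<alpha> \<beta> C k n \<gamma> z"
 shows "k \<le> n" "\<bar>\<gamma> - \<alpha>\<bar> \<le> 1 / real k" "z \<in> W n" "\<sigma> * energy \<gamma> \<beta> z \<le> C"
  "w \<in> W n ==> \<bar>denergy \<gamma> \<beta> z w\<bar> \<le> 1 / real k * pint M p (snd w) powr (1 / p)" using assms unfolding critical_def by blast+

lemma critical_mono:
 assumes c: "critical \<sigma> \<alpha> \<beta> C l n \<gamma> z" and k: "0 < k" "k \<le> l"
 shows "critical \<sigma> \<alpha> \<beta> C k n \<gamma> z"
proof -
 have le: "1 / real l \<le> 1 / real k" using k by (intro divide_left_mono) auto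
 have "\<bar>denergy \<gamma> \<beta> z w\<bar> \<le> 1 / real k * pint M p (snd w) powr (1 / p)" if "w \<in> W n" for w
  by (rule order_trans[OF criticalD(5)[OF c that] mult_right_mono[OF le]]) simp
 thus ?thesis unfolding critical_def using criticalD(1-4)[OF c] k le by (intro conjI ballI) auto
qed

lemma critical_sequence_coefficients:
 assumes c: "\<And>k. critical \<sigma> \<alpha> \<beta> C (Suc k) (n k) (\<gamma> k) (z k)"
 shows "(\<lambda>k. 1 / real (Suc k)) \<longlonglongrightarrow> 0" "\<gamma> \<longlonglongrightarrow> \<alpha>" "k \<le> n k" "(fst (z k), snd (z k)) \<in> W (n k)"
proof -
 show hl: "(\<lambda>k. 1 / real (Suc k)) \<longlonglongrightarrow> 0" by real_asymp
 have "(\<lambda>k. \<gamma> k - \<alpha>) \<longlonglongrightarrow> 0" by (rule Lim_null_comparison[OF _ hl]) (use criticalD(2)[OF c] in \<open>simp del: of_nat_Suc\<close>)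
 thus "\<gamma> \<longlonglongrightarrow> \<alpha>" by (rule LIM_zero_cancel)
 show "k \<le> n k" "(fst (z k), snd (z k)) \<in> W (n k)" using criticalD(1,3)[OF c[of k]] by auto
qed

text \<open>This is where the position of \<open>\<beta>\<close> enters. After division by the norms \<open>t k\<close> the terms with \<open>q\<close> and \<open>f\<close>
disappear in the limit, which is therefore an eigenpair. The bound on the energies, divided by the power \<open>q\<close>
of the norms, determines the sign of the terms with \<open>q\<close> at the eigenpair and contradicts \<open>H\<close>.\<close>

lemma critical_sequence_not_divergent:
 assumes \<sigma>: "\<sigma> = 1 \<or> \<sigma> = -1"
  and H: "\<And>u v. eigen_pair \<alpha> u v ==> 0 < \<sigma> * (pint M q v - \<beta> * pint M q u)"
  and c: "\<And>k. critical \<sigma> \<alpha> \<beta> C (Suc k) (n k) (\<gamma> k) (z k)" and zb: "\<And>k. real (Suc k) < pint M p (snd (z k))"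
 shows False
proof -
 note cs = critical_sequence_coefficients[where n = n and \<gamma> = \<gamma> and z = z, OF c]
 note hl = cs(1) and gl = cs(2) and nk = cs(3) and zW = cs(4)
  and zm = criticalD(3)[OF c] and zE = criticalD(4)[OF c] and zd = criticalD(5)[OF c]
 have p0: "0 < p" and q0: "0 < q" using p1 q1 by auto
 define t where "t k = pint M p (snd (z k)) powr (1 / p)" for k
 have tp: "t k powr p = pint M p (snd (z k))" for k using p0 pint_nonneg[of M p "snd (z k)"] by (simp add: t_def powr_powr)
 have t1: "1 \<le> t k" for k
 proof -
  have "1 \<le> pint M p (snd (z k))" using zb[of k] by simp
  hence "1 powr (1/p) \<le> pint M p (snd (z k)) powr (1 / p)" using p0 by (intro powr_mono2) auto
  thus ?thesis by (simp add: t_def)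
 qed
 have t0: "0 < t k" for k using t1[of k] by linarith
 have tinf: "filterlim t at_top sequentially"
 proof -
  have "filterlim (\<lambda>k. real (Suc k) powr (1 / p)) at_top sequentially" using p0 by real_asymp
  moreover have "real (Suc k) powr (1 / p) \<le> t k" for k unfolding t_def using less_imp_le[OF zb[of k]] p0 by (intro powr_mono2) auto
  ultimately show ?thesis by (intro filterlim_at_top_mono[of _ sequentially t]) auto
 qed
 define U where "U k = (\<lambda>x. inverse (t k) *\<^sub>R fst (z k) x)" for k
 define V where "V k = (\<lambda>x. inverse (t k) *\<^sub>R snd (z k) x)" for k
 have UVW: "(U k, V k) \<in> W (n k)" for k unfolding U_def V_def by (rule W_scale[OF zW])
 have it: "0 < inverse (t k)" for k using t0 by simp
 have V1: "pint M p (V k) = 1" for k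
 proof -
  have "pint M p (V k) = inverse (t k) powr p * t k powr p" unfolding V_def pint_scaleR tp using it[of k] by simp
  also have "\<dots> = 1" using t0[of k] by (simp flip: powr_mult)
  finally show ?thesis .
 qed
 have inv: "inverse (t k) powr a = t k powr (- a)" for k a using t0[of k] by (simp add: powr_minus inverse_powr)
 \<comment> \<open>The coefficients of the terms with \<open>q\<close> and with \<open>f\<close> in the rescaled equation.\<close>
 define s where "s k = t k powr (- (p - q))" for k
 define r where "r k = t k powr (- (p - 1))" for k
 have r1: "r k \<le> 1" for k using t1[of k] p1 powr_mono[of "- (p - 1)" 0 "t k"] by (simp add: r_def)
 have eqn: "\<bar>pairing M p (V k) wv + s k * pairing M q (V k) wv - \<gamma> k * pairing M p (U k) wu - s k * \<beta> * pairing M q (U k) wu - r k * f wu\<bar>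
   \<le> 1 / real (Suc k) * (1 + pint M p wv)" if w: "(wu, wv) \<in> W (n k)" for k wu wv
 proof -
  have P: "pairing M p (V k) wv = r k * pairing M p (snd (z k)) wv" "pairing M p (U k) wu = r k * pairing M p (fst (z k)) wu"
   unfolding V_def U_def by (simp_all only: pairing_scaleR_left[OF it] inv r_def)
  have Q: "s k * pairing M q (V k) wv = r k * pairing M q (snd (z k)) wv" "s k * pairing M q (U k) wu = r k * pairing M q (fst (z k)) wu"
  proof -
   have "s k * t k powr (- (q - 1)) = r k" by (simp add: s_def r_def flip: powr_add)
   thus "s k * pairing M q (V k) wv = r k * pairing M q (snd (z k)) wv" "s k * pairing M q (U k) wu = r k * pairing M q (fst (z k)) wu"
    unfolding V_def U_def by (simp_all only: pairing_scaleR_left[OF it] inv mult.assoc[symmetric])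
  qed
  have "pairing M p (V k) wv + s k * pairing M q (V k) wv - \<gamma> k * pairing M p (U k) wu - s k * \<beta> * pairing M q (U k) wu - r k * f wu
    = r k * denergy (\<gamma> k) \<beta> (z k) (wu, wv)"
  proof -
   have e: "s k * \<beta> * pairing M q (U k) wu = \<beta> * (s k * pairing M q (U k) wu)" by simp
   show ?thesis unfolding e P Q denergy_def by (simp add: algebra_simps)
  qed
  moreover have "\<bar>r k * denergy (\<gamma> k) \<beta> (z k) (wu, wv)\<bar> \<le> 1 * (1 / real (Suc k) * pint M p wv powr (1 / p))"
   unfolding abs_mult using r1[of k] zd[OF w] by (intro mult_mono) (simp_all add: r_def)
  moreover have "1 / real (Suc k) * pint M p wv powr (1 / p) \<le> 1 / real (Suc k) * (1 + pint M p wv)"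
   using powr_inverse_le[OF pint_nonneg] by (intro mult_left_mono) auto
  ultimately show ?thesis by linarith
 qed
 have sl: "s \<longlonglongrightarrow> 0" unfolding s_def using qp by (intro powr_decay tinf) auto
 have rl: "r \<longlonglongrightarrow> 0" unfolding r_def using p1 by (intro powr_decay tinf) auto
 have "\<exists>(\<tau>::nat=>nat) u' v'. strict_mono \<tau> \<and> u' \<in> Lspace M p \<and> v' \<in> Lspace M p \<and>
   (\<lambda>k. pdist M p (U (\<tau> k)) u') \<longlonglongrightarrow> 0 \<and> (\<lambda>k. pdist M p (V (\<tau> k)) v') \<longlonglongrightarrow> 0 \<and>
   (\<forall>n. \<forall>(wu, wv)\<in>W n. pairing M p v' wv + 0 * pairing M q v' wv = \<alpha> * pairing M p u' wu + 0 * \<beta> * pairing M q u' wu + 0 * f wu)"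
  by (rule almost_solutions_compact[where K = 1 and m = n and s = s and c = \<gamma> and r = r and \<eta> = "\<lambda>k. 1 / real (Suc k)"])
   (use UVW nk V1 sl rl hl gl eqn in \<open>auto simp: s_def\<close>)
 then obtain \<tau> :: "nat => nat" and u' v' where \<tau>: "strict_mono \<tau>" and uv': "u' \<in> Lspace M p" "v' \<in> Lspace M p"
  and ul: "(\<lambda>k. pdist M p (U (\<tau> k)) u') \<longlonglongrightarrow> 0" and vl: "(\<lambda>k. pdist M p (V (\<tau> k)) v') \<longlonglongrightarrow> 0"
  and eig: "\<forall>n. \<forall>(wu, wv)\<in>W n. pairing M p v' wv + 0 * pairing M q v' wv = \<alpha> * pairing M p u' wu + 0 * \<beta> * pairing M q u' wu + 0 * f wu"
  by (elim exE conjE)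
 have eig': "pairing M p v' wv = \<alpha> * pairing M p u' wu" if "(wu, wv) \<in> W n" for n wu wv using eig that by fastforce
 have UL: "U k \<in> Lspace M p" and VL: "V k \<in> Lspace M p" for k using W_Lp[OF UVW] by auto
 have UQ: "U k \<in> Lspace M q" and VQ: "V k \<in> Lspace M q" for k using W_Lq[OF UVW] by auto
 have u'Q: "u' \<in> Lspace M q" and v'Q: "v' \<in> Lspace M q" using Lspace_mono[OF q0 qp] uv' by auto
 have Ub: "pint M p (U k) \<le> CP" for k using poincare[OF UVW, of k] V1 by simp
 have pv: "pint M p v' = 1"
 proof -
  have "(\<lambda>k. pint M p (V (\<tau> k))) \<longlonglongrightarrow> pint M p v'"
   by (rule pint_tendsto[where K = 1 and u = "\<lambda>k. V (\<tau> k)", OF p1 VL uv'(2) vl]) (simp add: V1)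
  thus ?thesis by (simp add: V1 LIMSEQ_const_iff)
 qed
 have "pint M p v' = \<alpha> * pint M p u'"
 proof -
  have a: "(\<lambda>k. pairing M p v' (V (\<tau> k))) \<longlonglongrightarrow> pairing M p v' v'" by (rule pairing_tendsto_right[where w = "\<lambda>k. V (\<tau> k)", OF p1 uv'(2) VL uv'(2) vl])
  have "(\<lambda>k. pairing M p u' (U (\<tau> k))) \<longlonglongrightarrow> pairing M p u' u'" by (rule pairing_tendsto_right[where w = "\<lambda>k. U (\<tau> k)", OF p1 uv'(1) UL uv'(1) ul])
  hence "(\<lambda>k. \<alpha> * pairing M p u' (U (\<tau> k))) \<longlonglongrightarrow> \<alpha> * pairing M p u' u'" by (rule tendsto_mult_left)
  hence "(\<lambda>k. pairing M p v' (V (\<tau> k))) \<longlonglongrightarrow> \<alpha> * pairing M p u' u'" using eig'[OF UVW] by simp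
  from LIMSEQ_unique[OF a this] show ?thesis by (simp add: pairing_self)
 qed
 hence "pint M p u' \<noteq> 0" using pv by auto
 hence pu: "0 < pint M p u'" using pint_nonneg[of M p u'] by linarith
 have "lim_pair u' v'" unfolding lim_pair_def using uv' ul vl UVW by (intro conjI exI[of _ "\<lambda>k. U (\<tau> k)"] exI[of _ "\<lambda>k. V (\<tau> k)"]) auto
 hence "eigen_pair \<alpha> u' v'" using pu eig' by (auto simp: eigen_pair_def)
 hence pos: "0 < \<sigma> * (pint M q v' - \<beta> * pint M q u')" by (rule H)
 define h where "h k = \<sigma> * ((p / q - 1) * (pint M q (V k) - \<beta> * pint M q (U k)))" for k
 have ulq: "(\<lambda>k. pdist M q (U (\<tau> k)) u') \<longlonglongrightarrow> 0" by (rule pint_low_tendsto[OF q0 qp _ ul]) (intro Lspace_diff UL uv' p0)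
 have vlq: "(\<lambda>k. pdist M q (V (\<tau> k)) v') \<longlonglongrightarrow> 0" by (rule pint_low_tendsto[OF q0 qp _ vl]) (intro Lspace_diff VL uv' p0)
 obtain D where D: "D \<ge> 0" "\<And>w::'a=>'b. w \<in> Lspace M p ==> pint M q w \<le> D + 1 * pint M p w"
  using pint_low_by_high(2)[OF q0 qp, of 1] by auto
 obtain D' where D': "D' \<ge> 0" "\<And>w::'a=>real. w \<in> Lspace M p ==> pint M q w \<le> D' + 1 * pint M p w"
  using pint_low_by_high(2)[OF q0 qp, of 1] by auto
 have "(\<lambda>k. pint M q (V (\<tau> k))) \<longlonglongrightarrow> pint M q v'"
  by (rule pint_tendsto[where K = "D + 1" and u = "\<lambda>k. V (\<tau> k)", OF q1 VQ v'Q vlq]) (use D(2)[OF VL] V1 in simp)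
 moreover have "(\<lambda>k. pint M q (U (\<tau> k))) \<longlonglongrightarrow> pint M q u'"
 proof (rule pint_tendsto[where K = "D' + CP" and u = "\<lambda>k. U (\<tau> k)", OF q1 UQ u'Q ulq])
  show "pint M q (U (\<tau> k)) \<le> D' + CP" for k using D'(2)[OF UL, of "\<tau> k"] Ub[of "\<tau> k"] by simp
 qed
 ultimately have hlim: "(\<lambda>k. h (\<tau> k)) \<longlonglongrightarrow> \<sigma> * ((p / q - 1) * (pint M q v' - \<beta> * pint M q u'))" unfolding h_def by (intro tendsto_intros)
 have hbound: "h k \<le> p * \<bar>C\<bar> * t k powr (- q) + (1 + (p - 1) * Cf) * t k powr (- (q - 1))" for k
 proof -
  let ?z = "z k"
  have d: "\<bar>denergy (\<gamma> k) \<beta> ?z ?z\<bar> \<le> 1 * t k"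
  proof -
   have "\<bar>denergy (\<gamma> k) \<beta> ?z ?z\<bar> \<le> 1 / real (Suc k) * t k" using zd[OF zm] unfolding t_def by blast
   also have "\<dots> \<le> 1 * t k" using t0[of k] by (intro mult_right_mono) auto
   finally show ?thesis .
  qed
  have fb: "\<bar>f (fst ?z)\<bar> \<le> Cf * t k" using f_bound[OF zW] by (simp add: t_def)
  \<comment> \<open>In this combination of the energy and its derivative the terms with the power \<open>p\<close> cancel.\<close>
  have key: "(p / q - 1) * (pint M q (snd ?z) - \<beta> * pint M q (fst ?z)) = p * energy (\<gamma> k) \<beta> ?z - denergy (\<gamma> k) \<beta> ?z ?z + (p - 1) * f (fst ?z)"
   using p0 q0 by (simp add: energy_def denergy_def pairing_self field_simps)
  have "\<sigma> * ((p / q - 1) * (pint M q (snd ?z) - \<beta> * pint M q (fst ?z))) = p * (\<sigma> * energy (\<gamma> k) \<beta> ?z) + \<sigma> * (- denergy (\<gamma> k) \<beta> ?z ?z + (p - 1) * f (fst ?z))"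
   unfolding key by (simp add: algebra_simps)
  also have "\<dots> \<le> p * \<bar>C\<bar> + (t k + (p - 1) * (Cf * t k))"
  proof (rule add_mono)
   have "\<sigma> * energy (\<gamma> k) \<beta> ?z \<le> \<bar>C\<bar>" using zE[of k] by linarith
   thus "p * (\<sigma> * energy (\<gamma> k) \<beta> ?z) \<le> p * \<bar>C\<bar>" using p0 by (intro mult_left_mono) auto
   have "\<bar>(p - 1) * f (fst ?z)\<bar> \<le> (p - 1) * (Cf * t k)" using mult_left_mono[OF fb, of "p - 1"] p1 by (simp add: abs_mult)
   thus "\<sigma> * (- denergy (\<gamma> k) \<beta> ?z ?z + (p - 1) * f (fst ?z)) \<le> t k + (p - 1) * (Cf * t k)" using \<sigma> d by auto
  qed
  also have "\<dots> = p * \<bar>C\<bar> + (1 + (p - 1) * Cf) * t k" by (simp add: algebra_simps)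
  finally have A: "\<sigma> * ((p / q - 1) * (pint M q (snd ?z) - \<beta> * pint M q (fst ?z))) \<le> p * \<bar>C\<bar> + (1 + (p - 1) * Cf) * t k" .
  have "h k = t k powr (- q) * (\<sigma> * ((p / q - 1) * (pint M q (snd ?z) - \<beta> * pint M q (fst ?z))))"
  proof -
   have "\<bar>inverse (t k)\<bar> powr q = t k powr (- q)" using it[of k] inv by simp
   thus ?thesis unfolding h_def U_def V_def by (simp only: pint_scaleR) (simp add: algebra_simps)
  qed
  also have "\<dots> \<le> t k powr (- q) * (p * \<bar>C\<bar> + (1 + (p - 1) * Cf) * t k)" using A by (intro mult_left_mono) auto
  also have "\<dots> = p * \<bar>C\<bar> * t k powr (- q) + (1 + (p - 1) * Cf) * (t k powr (- q) * t k)" by (simp add: algebra_simps)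
  also have "t k powr (- q) * t k = t k powr (- (q - 1))" using t0[of k] powr_add[of "t k" "- q" 1] by simp
  finally show ?thesis .
 qed
 have tt: "filterlim (\<lambda>k. t (\<tau> k)) at_top sequentially" using filterlim_compose[OF tinf filterlim_subseq[OF \<tau>]] .
 have "(\<lambda>k. p * \<bar>C\<bar> * t (\<tau> k) powr (- q) + (1 + (p - 1) * Cf) * t (\<tau> k) powr (- (q - 1))) \<longlonglongrightarrow> p * \<bar>C\<bar> * 0 + (1 + (p - 1) * Cf) * 0"
  using q1 by (intro tendsto_add tendsto_mult tendsto_const powr_decay tt) auto
 hence "\<sigma> * ((p / q - 1) * (pint M q v' - \<beta> * pint M q u')) \<le> p * \<bar>C\<bar> * 0 + (1 + (p - 1) * Cf) * 0"
  by (rule LIMSEQ_le[OF hlim]) (use hbound in auto)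
 moreover have "(p / q - 1) * (\<sigma> * (pint M q v' - \<beta> * pint M q u')) > 0" using q0 qp by (intro mult_pos_pos[OF _ pos]) simp
 ultimately show False by (simp add: algebra_simps)
qed

text \<open>An unbounded sequence has a divergent subsequence, and this is again a sequence of almost critical points
because the conditions of later stages are stronger.\<close>

lemma critical_sequence_bounded:
 assumes \<sigma>: "\<sigma> = 1 \<or> \<sigma> = -1"
  and H: "\<And>u v. eigen_pair \<alpha> u v ==> 0 < \<sigma> * (pint M q v - \<beta> * pint M q u)"
  and c: "\<And>k. critical \<sigma> \<alpha> \<beta> C (Suc k) (n k) (\<gamma> k) (z k)"
 shows "\<exists>K. \<forall>k. pint M p (snd (z k)) \<le> K"
proof (rule ccontr)
 assume neg: "\<not> ?thesis"
 have "\<exists>i\<ge>k. real (Suc k) < pint M p (snd (z i))" for k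
 proof -
  have "\<not> (\<forall>i. pint M p (snd (z i)) \<le> real (Suc k) + (\<Sum>i<k. pint M p (snd (z i))))" using neg by blast
  then obtain i where i: "real (Suc k) + (\<Sum>i<k. pint M p (snd (z i))) < pint M p (snd (z i))" by (auto simp: not_le)
  have "k \<le> i"
  proof (rule ccontr)
   assume "\<not> k \<le> i"
   hence "pint M p (snd (z i)) \<le> (\<Sum>i<k. pint M p (snd (z i)))" by (intro member_le_sum) (auto simp: pint_nonneg)
   thus False using i by simp
  qed
  moreover have "0 \<le> (\<Sum>i<k. pint M p (snd (z i)))" by (intro sum_nonneg pint_nonneg)
  ultimately show ?thesis using i by (intro exI[of _ i] conjI) linarith+
 qed
 hence "\<forall>k. \<exists>i. k \<le> i \<and> real (Suc k) < pint M p (snd (z i))" by blast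
 from choice[OF this] obtain i where i: "\<forall>k. k \<le> i k \<and> real (Suc k) < pint M p (snd (z (i k)))" by (rule exE)
 show False
 proof (rule critical_sequence_not_divergent[where n = "\<lambda>k. n (i k)" and \<gamma> = "\<lambda>k. \<gamma> (i k)" and z = "\<lambda>k. z (i k)", OF \<sigma> H])
  show "critical \<sigma> \<alpha> \<beta> C (Suc k) (n (i k)) (\<gamma> (i k)) (z (i k))" for k by (rule critical_mono[OF c]) (use i in auto)
  show "real (Suc k) < pint M p (snd (z (i k)))" for k using i by blast
 qed
qed

text \<open>Once they are known to be bounded, the almost critical points converge strongly along a subsequence, so that
the equation passes to the limit.\<close>

theorem solution_from_critical_points:
 assumes \<sigma>: "\<sigma> = 1 \<or> \<sigma> = -1"
  and H: "\<And>u v. eigen_pair \<alpha> u v ==> 0 < \<sigma> * (pint M q v - \<beta> * pint M q u)"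
  and crit: "\<And>j. 0 < j ==> \<exists>n \<gamma> z. critical \<sigma> \<alpha> \<beta> C j n \<gamma> z"
 shows "\<exists>u v. lim_pair u v \<and> (\<forall>n. \<forall>(wu, wv)\<in>W n. pairing M p v wv + pairing M q v wv = \<alpha> * pairing M p u wu + \<beta> * pairing M q u wu + f wu)"
proof -
 have "\<forall>k. \<exists>n \<gamma> z. critical \<sigma> \<alpha> \<beta> C (Suc k) n \<gamma> z" using crit by blast
 from choice[OF this] obtain n where "\<forall>k. \<exists>\<gamma> z. critical \<sigma> \<alpha> \<beta> C (Suc k) (n k) \<gamma> z" by (rule exE)
 from choice[OF this] obtain \<gamma> where "\<forall>k. \<exists>z. critical \<sigma> \<alpha> \<beta> C (Suc k) (n k) (\<gamma> k) z" by (rule exE)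
 from choice[OF this] obtain z where "\<forall>k. critical \<sigma> \<alpha> \<beta> C (Suc k) (n k) (\<gamma> k) (z k)" by (rule exE)
 hence c: "critical \<sigma> \<alpha> \<beta> C (Suc k) (n k) (\<gamma> k) (z k)" for k by blast
 obtain K where K: "\<forall>k. pint M p (snd (z k)) \<le> K" using critical_sequence_bounded[where n = n and \<gamma> = \<gamma> and z = z, OF \<sigma> H c] by (rule exE)
 note cs = critical_sequence_coefficients[where n = n and \<gamma> = \<gamma> and z = z, OF c]
 have eqn: "\<bar>pairing M p (snd (z k)) wv + 1 * pairing M q (snd (z k)) wv - \<gamma> k * pairing M p (fst (z k)) wu - 1 * \<beta> * pairing M q (fst (z k)) wu - 1 * f wu\<bar>
   \<le> 1 / real (Suc k) * (1 + pint M p wv)" if w: "(wu, wv) \<in> W (n k)" for k wu wv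
 proof -
  have "\<bar>denergy (\<gamma> k) \<beta> (z k) (wu, wv)\<bar> \<le> 1 / real (Suc k) * pint M p wv powr (1 / p)" using criticalD(5)[OF c w] by simp
  also have "\<dots> \<le> 1 / real (Suc k) * (1 + pint M p wv)" using powr_inverse_le[OF pint_nonneg] by (intro mult_left_mono) auto
  finally show ?thesis by (simp add: denergy_def algebra_simps)
 qed
 have "\<exists>(\<tau>::nat=>nat) u' v'. strict_mono \<tau> \<and> u' \<in> Lspace M p \<and> v' \<in> Lspace M p \<and>
   (\<lambda>k. pdist M p (fst (z (\<tau> k))) u') \<longlonglongrightarrow> 0 \<and> (\<lambda>k. pdist M p (snd (z (\<tau> k))) v') \<longlonglongrightarrow> 0 \<and>
   (\<forall>n. \<forall>(wu, wv)\<in>W n. pairing M p v' wv + 1 * pairing M q v' wv = \<alpha> * pairing M p u' wu + 1 * \<beta> * pairing M q u' wu + 1 * f wu)"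
  by (rule almost_solutions_compact[where K = K and m = n and s = "\<lambda>_. 1" and c = \<gamma> and r = "\<lambda>_. 1" and \<eta> = "\<lambda>k. 1 / real (Suc k)"])
   (use K cs eqn in auto)
 then obtain \<tau> :: "nat => nat" and u' v' where uv': "u' \<in> Lspace M p" "v' \<in> Lspace M p"
  and ul: "(\<lambda>k. pdist M p (fst (z (\<tau> k))) u') \<longlonglongrightarrow> 0" and vl: "(\<lambda>k. pdist M p (snd (z (\<tau> k))) v') \<longlonglongrightarrow> 0"
  and eq: "\<forall>n. \<forall>(wu, wv)\<in>W n. pairing M p v' wv + 1 * pairing M q v' wv = \<alpha> * pairing M p u' wu + 1 * \<beta> * pairing M q u' wu + 1 * f wu"
  by (elim exE conjE)
 have "lim_pair u' v'" unfolding lim_pair_def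
  using uv' ul vl cs(4) by (intro conjI exI[of _ "\<lambda>k. fst (z (\<tau> k))"] exI[of _ "\<lambda>k. snd (z (\<tau> k))"]) auto
 thus ?thesis using eq by (intro exI[of _ u'] exI[of _ v']) auto
qed

end

section \<open>The energy on finite-dimensional spaces\<close>

text \<open>By convexity the error of the linear approximation lies between 0 and the change of the derivative along the
step, which is uniformly small on bounded sets.\<close>

lemma pint_uniformly_differentiable:
 assumes r: "1 < r" and B: "0 \<le> B" and \<epsilon>: "0 < \<epsilon>"
 shows "\<exists>s0>0. \<forall>u\<in>Lspace M r. \<forall>w\<in>Lspace M r. \<forall>s. pint M r u \<le> B --> pint M r w \<le> B --> 0 < s --> s \<le> s0 -->
   \<bar>pint M r (\<lambda>x. u x - s *\<^sub>R w x) - pint M r u + r * s * pairing M r u (w :: 'a => 'b::euclidean_space)\<bar> \<le> s * \<epsilon>"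
proof -
 have r0: "0 < r" using r by simp
 define B' where "B' = 2 powr r * (2 * B) + 2 * B + 1"
 have B': "B' > 0" using B by (simp add: B'_def add_nonneg_pos)
 define \<epsilon>1 where "\<epsilon>1 = \<epsilon> / (2 * r) / B'"
 have \<epsilon>1: "\<epsilon>1 > 0" using \<epsilon> r0 B' by (simp add: \<epsilon>1_def)
 obtain C where C: "C \<ge> 0" "\<And>u v w::'a=>'b. u\<in>Lspace M r ==> v\<in>Lspace M r ==> w\<in>Lspace M r ==>
  \<bar>pairing M r u w - pairing M r v w\<bar> \<le> \<epsilon>1 * (pint M r u + pint M r v + pint M r w) + C * pdist M r u v"
  using pairing_continuous[OF r \<epsilon>1, of M] by auto
 define s0 where "s0 = min 1 (\<epsilon> / (2 * r) / (C * B + 1))"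
 have CB: "0 < C * B + 1" using C B by (simp add: add_nonneg_pos)
 have s0: "s0 > 0" using \<epsilon> r0 CB by (simp add: s0_def)
 show ?thesis
 proof (intro exI[of _ s0] conjI ballI allI impI s0)
  fix u w :: "'a=>'b" and s
  assume u: "u \<in> Lspace M r" and w: "w \<in> Lspace M r" and uB: "pint M r u \<le> B" and wB: "pint M r w \<le> B" and s: "0 < s" "s \<le> s0"
  let ?y = "\<lambda>x. u x - s *\<^sub>R w x"
  have sw: "(\<lambda>x. s *\<^sub>R w x) \<in> Lspace M r" by (rule Lspace_scaleR[OF w r0])
  have y: "?y \<in> Lspace M r" by (rule Lspace_diff[OF u sw r0])
  have s1: "s \<le> 1" using s by (simp add: s0_def)
  have sr: "s powr r \<le> s" using powr_mono'[of 1 r s] s s1 r by simp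
  have sr1: "s powr r \<le> 1" using sr s1 by linarith
  have pw: "pint M r (\<lambda>x. s *\<^sub>R w x) = s powr r * pint M r w" using s by (simp add: pint_scaleR)
  have "pint M r ?y \<le> 2 powr r * (pint M r u + pint M r (\<lambda>x. (-s) *\<^sub>R w x))"
   using pint_add_le[OF u Lspace_scaleR[OF w r0, of "-s"] r0] by simp
  also have "pint M r (\<lambda>x. (-s) *\<^sub>R w x) = s powr r * pint M r w" using s unfolding pint_scaleR by simp
  also have "s powr r * pint M r w \<le> 1 * B" using sr1 wB pint_nonneg by (intro mult_mono) auto
  finally have yB: "pint M r ?y \<le> 2 powr r * (2 * B)" using uB by (smt (verit) mult_left_mono powr_ge_zero)
  have "pint M r u + r * pairing M r u (\<lambda>x. ?y x - u x) \<le> pint M r ?y" by (rule pint_above_tangent[OF r u y])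
  moreover have "pairing M r u (\<lambda>x. ?y x - u x) = - s * pairing M r u w" using pairing_scaleR_right[of M r u "-s" w] by simp
  ultimately have lo: "0 \<le> pint M r ?y - pint M r u + r * s * pairing M r u w" by simp
  have "pint M r ?y + r * pairing M r ?y (\<lambda>x. u x - ?y x) \<le> pint M r u" by (rule pint_above_tangent[OF r y u])
  moreover have "pairing M r ?y (\<lambda>x. u x - ?y x) = s * pairing M r ?y w" using pairing_scaleR_right[of M r ?y s w] by simp
  ultimately have "pint M r ?y - pint M r u + r * s * pairing M r u w \<le> r * s * (pairing M r u w - pairing M r ?y w)"
   by (simp add: algebra_simps)
  also have "\<dots> \<le> r * s * (\<epsilon> / r)"
  proof (rule mult_left_mono)
   have "\<bar>pairing M r u w - pairing M r ?y w\<bar> \<le> \<epsilon>1 * (pint M r u + pint M r ?y + pint M r w) + C * pint M r (\<lambda>x. u x - ?y x)"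
    by (rule C(2)[OF u y w])
   also have "\<epsilon>1 * (pint M r u + pint M r ?y + pint M r w) \<le> \<epsilon>1 * B'" using \<epsilon>1 uB wB yB by (intro mult_left_mono) (auto simp: B'_def)
   also have "\<epsilon>1 * B' = \<epsilon> / (2 * r)" using B' by (simp add: \<epsilon>1_def)
   also have "pint M r (\<lambda>x. u x - ?y x) = s powr r * pint M r w" using pw by simp
   also have "C * (s powr r * pint M r w) \<le> C * (s * B)" using C sr wB pint_nonneg s by (intro mult_left_mono mult_mono) auto
   also have "C * (s * B) \<le> (C * B + 1) * s" using s by (simp add: algebra_simps)
   also have "\<dots> \<le> (C * B + 1) * (\<epsilon> / (2 * r) / (C * B + 1))" using s CB by (intro mult_left_mono) (auto simp: s0_def)
   also have "\<dots> = \<epsilon> / (2 * r)" by (rule mult_divide_cancel_pos[OF CB])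
   finally show "pairing M r u w - pairing M r ?y w \<le> \<epsilon> / r" by (simp add: field_simps)
  qed (use r0 s in simp)
  also have "\<dots> = s * \<epsilon>" using r0 by simp
  finally show "\<bar>pint M r ?y - pint M r u + r * s * pairing M r u w\<bar> \<le> s * \<epsilon>" using lo by simp
 qed
qed

definition lincomb :: "nat set => (nat => 'a => 'b::real_vector) => (nat => real) => 'a => 'b" where
 "lincomb S v c = (\<lambda>x. \<Sum>i\<in>S. c i *\<^sub>R v i x)"

lemma lincomb_linear: "lincomb S v (\<lambda>i. a * c i + b * w i) = (\<lambda>x. a *\<^sub>R lincomb S v c x + b *\<^sub>R lincomb S v w x)"
 by (simp add: lincomb_def fun_eq_iff scaleR_add_left sum.distrib scaleR_sum_right)

lemma lincomb_diff: "lincomb S v (\<lambda>i. c i - w i) = (\<lambda>x. lincomb S v c x - lincomb S v w x)" using lincomb_linear[of S v 1 c "-1" w] by simp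

lemma lincomb_scale: "lincomb S v (\<lambda>i. a * c i) = (\<lambda>x. a *\<^sub>R lincomb S v c x)" using lincomb_linear[of S v a c 0 c] by simp

lemma lincomb_uminus: "lincomb S v (\<lambda>i. - c i) = (\<lambda>x. - lincomb S v c x)" using lincomb_scale[of S v "-1" c] by simp

lemma Lspace_zero: "(\<lambda>_. 0) \<in> Lspace M r" by (simp add: Lspace_def)

lemma Lspace_lincomb_sum:
 assumes v: "\<And>i. i \<in> S ==> v i \<in> Lspace M r" and r: "0 < r"
 shows "lincomb S v c \<in> Lspace M r"
proof (cases "finite S")
 case True
 thus ?thesis using v
 proof (induction S)
  case empty
  thus ?case by (simp add: lincomb_def Lspace_zero)
 next
  case (insert j S)
  have "lincomb (insert j S) v c = (\<lambda>x. c j *\<^sub>R v j x + lincomb S v c x)" using insert.hyps by (simp add: lincomb_def)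
  thus ?case using insert r by (auto intro!: Lspace_add Lspace_scaleR)
 qed
next
 case False
 thus ?thesis by (simp add: lincomb_def Lspace_zero)
qed

lemma pint_lincomb_bound:
 assumes S: "finite S" and v: "\<And>i. i \<in> S ==> v i \<in> Lspace M r" and r: "0 < r"
 shows "\<exists>C\<ge>0. \<forall>c. pint M r (lincomb S v c) \<le> C * L2_set c S powr r"
proof -
 have "\<exists>C\<ge>0. \<forall>c. (\<forall>i\<in>S. \<bar>c i\<bar> \<le> 1) --> pint M r (lincomb S v c) \<le> C" using S v
 proof (induction S)
  case empty
  thus ?case by (intro exI[of _ 0]) (simp add: lincomb_def pint_def)
 next
  case (insert j S)
  then obtain C where C: "C \<ge> 0" "\<And>c. (\<forall>i\<in>S. \<bar>c i\<bar> \<le> 1) ==> pint M r (lincomb S v c) \<le> C" by blast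
  show ?case
  proof (intro exI[of _ "2 powr r * (pint M r (v j) + C)"] conjI allI impI)
   fix c :: "nat => real" assume c: "\<forall>i\<in>insert j S. \<bar>c i\<bar> \<le> 1"
   have vj: "(\<lambda>x. c j *\<^sub>R v j x) \<in> Lspace M r" using insert r by (intro Lspace_scaleR) auto
   have l: "lincomb S v c \<in> Lspace M r" using insert r by (intro Lspace_lincomb_sum) auto
   have "\<bar>c j\<bar> powr r \<le> 1 powr r" using c r by (intro powr_mono2) auto
   hence "\<bar>c j\<bar> powr r * pint M r (v j) \<le> 1 * pint M r (v j)" using pint_nonneg by (intro mult_right_mono) auto
   hence "pint M r (\<lambda>x. c j *\<^sub>R v j x) \<le> pint M r (v j)" by (simp add: pint_scaleR)
   moreover have "pint M r (lincomb S v c) \<le> C" using C c by auto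
   moreover have "lincomb (insert j S) v c = (\<lambda>x. c j *\<^sub>R v j x + lincomb S v c x)" using insert.hyps by (simp add: lincomb_def)
   hence "pint M r (lincomb (insert j S) v c) \<le> 2 powr r * (pint M r (\<lambda>x. c j *\<^sub>R v j x) + pint M r (lincomb S v c))"
    using pint_add_le[OF vj l r] by simp
   ultimately show "pint M r (lincomb (insert j S) v c) \<le> 2 powr r * (pint M r (v j) + C)" by (smt (verit) mult_left_mono powr_ge_zero)
  qed (use C pint_nonneg[of M r "v j"] in simp)
 qed
 then obtain C where C: "C \<ge> 0" "\<And>c. (\<forall>i\<in>S. \<bar>c i\<bar> \<le> 1) ==> pint M r (lincomb S v c) \<le> C" by blast
 have "pint M r (lincomb S v c) \<le> C * L2_set c S powr r" for c
 proof (cases "L2_set c S = 0")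
  case True
  hence "c i = 0" if "i \<in> S" for i using that S by (simp add: L2_set_eq_0_iff)
  hence "lincomb S v c = (\<lambda>_. 0)" by (simp add: lincomb_def)
  thus ?thesis using True r by (simp add: pint_def)
 next
  case False
  let ?l = "L2_set c S"
  have l: "?l > 0" using False L2_set_nonneg[of c S] by linarith
  have "pint M r (lincomb S v (\<lambda>i. inverse ?l * c i)) \<le> C"
  proof (rule C(2), intro ballI)
   fix i assume "i \<in> S"
   hence "\<bar>c i\<bar> \<le> ?l" using S by (intro abs_coord_le_L2_set)
   thus "\<bar>inverse ?l * c i\<bar> \<le> 1" using l by (simp add: abs_mult field_simps)
  qed
  hence "inverse ?l powr r * pint M r (lincomb S v c) \<le> C" unfolding lincomb_scale pint_scaleR using l by simp
  hence "?l powr r * (inverse ?l powr r * pint M r (lincomb S v c)) \<le> ?l powr r * C" by (intro mult_left_mono) auto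
  moreover have "?l powr r * inverse ?l powr r = 1" using l by (simp flip: powr_mult)
  ultimately show ?thesis by (simp add: mult.commute flip: mult.assoc)
 qed
 thus ?thesis using C(1) by blast
qed

text \<open>The error of the linear approximation for a step of length \<open>s\<close> in the direction \<open>- w\<close>.\<close>

definition pint_remainder :: "'a measure => real => nat set => (nat => 'a => 'b::euclidean_space) => (nat => real) => (nat => real) => real => real" where
 "pint_remainder M r S v c w s = pint M r (lincomb S v (\<lambda>i. c i - s * w i)) - pint M r (lincomb S v c) + r * s * pairing M r (lincomb S v c) (lincomb S v w)"

lemma pint_lincomb_uniformly_differentiable:
 fixes v :: "nat => 'a => 'b::euclidean_space"
 assumes S: "finite S" and v: "\<And>i. i \<in> S ==> v i \<in> Lspace M r" and r: "1 < r" and \<epsilon>: "0 < \<epsilon>"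
 shows "\<exists>s0>0. \<forall>c w s. L2_set c S \<le> R --> L2_set w S \<le> R --> 0 < s --> s \<le> s0 -->
   \<bar>pint_remainder M r S v c w s\<bar> \<le> s * \<epsilon>"
proof -
 have r0: "0 < r" using r by simp
 have L: "lincomb S v c \<in> Lspace M r" for c using v r0 by (intro Lspace_lincomb_sum)
 obtain C where C: "C \<ge> 0" "\<And>c. pint M r (lincomb S v c) \<le> C * L2_set c S powr r" using pint_lincomb_bound[where v = v, OF S v r0] by blast
 have bd: "pint M r (lincomb S v c) \<le> C * R powr r" if "L2_set c S \<le> R" for c
  by (rule order_trans[OF C(2)]) (use that C(1) r0 in \<open>intro mult_left_mono powr_mono2; simp\<close>)
 have "0 \<le> C * R powr r" using C(1) by simp
 from pint_uniformly_differentiable[OF r this \<epsilon>, of M, where 'b = 'b]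
 obtain s0 where s0: "s0 > 0" "\<forall>u\<in>Lspace M r. \<forall>w\<in>Lspace M r. \<forall>s. pint M r u \<le> C * R powr r --> pint M r w \<le> C * R powr r --> 0 < s --> s \<le> s0 -->
   \<bar>pint M r (\<lambda>x. u x - s *\<^sub>R w x) - pint M r u + r * s * pairing M r u (w :: 'a => 'b)\<bar> \<le> s * \<epsilon>" by (elim exE conjE)
 have comb: "lincomb S v (\<lambda>i. c i - s * w i) = (\<lambda>x. lincomb S v c x - s *\<^sub>R lincomb S v w x)" for c w s
  using lincomb_linear[of S v 1 c "-s" w] by simp
 show ?thesis
 proof (intro exI[of _ s0] conjI allI impI s0(1))
  fix c w s assume "L2_set c S \<le> R" "L2_set w S \<le> R" "0 < s" "s \<le> s0"
  from s0(2)[rule_format, OF L L bd[OF this(1)] bd[OF this(2)] this(3,4)]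
  show "\<bar>pint_remainder M r S v c w s\<bar> \<le> s * \<epsilon>" unfolding pint_remainder_def comb .
 qed
qed

lemma lincomb_tendsto:
 fixes c :: "nat => nat => real"
 assumes S: "finite S" and v: "\<And>i. i \<in> S ==> v i \<in> Lspace M r" and r: "0 < r" and c: "c \<longlonglongrightarrow> a"
 shows "(\<lambda>k. pdist M r (lincomb S v (c k)) (lincomb S v a)) \<longlonglongrightarrow> 0"
  and "\<exists>K. \<forall>k. pint M r (lincomb S v (c k)) \<le> K"
proof -
 obtain C where C: "C \<ge> 0" "\<And>c. pint M r (lincomb S v c) \<le> C * L2_set c S powr r" using pint_lincomb_bound[where v = v, OF S v r] by blast
 have ci: "(\<lambda>k. c k i) \<longlonglongrightarrow> a i" for i using continuous_on_tendsto_compose[OF continuous_on_coord[of UNIV i] c] by simp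
 have "(\<lambda>k. L2_set (\<lambda>i. c k i - a i) S) \<longlonglongrightarrow> L2_set (\<lambda>i. a i - a i) S" unfolding L2_set_def by (intro tendsto_intros ci)
 hence "(\<lambda>k. L2_set (\<lambda>i. c k i - a i) S) \<longlonglongrightarrow> 0" by (simp add: L2_set_def)
 hence "(\<lambda>k. L2_set (\<lambda>i. c k i - a i) S powr r) \<longlonglongrightarrow> 0 powr r" using r by (intro tendsto_powr') auto
 hence "(\<lambda>k. C * L2_set (\<lambda>i. c k i - a i) S powr r) \<longlonglongrightarrow> C * 0 powr r" by (rule tendsto_mult_left)
 hence t: "(\<lambda>k. C * L2_set (\<lambda>i. c k i - a i) S powr r) \<longlonglongrightarrow> 0" using r by simp
 show "(\<lambda>k. pdist M r (lincomb S v (c k)) (lincomb S v a)) \<longlonglongrightarrow> 0"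
 proof (rule Lim_null_comparison[OF _ t], intro always_eventually allI)
  fix k
  show "norm (pdist M r (lincomb S v (c k)) (lincomb S v a)) \<le> C * L2_set (\<lambda>i. c k i - a i) S powr r"
   using C(2)[of "\<lambda>i. c k i - a i"] pint_nonneg[of M r "lincomb S v (\<lambda>i. c k i - a i)"] by (simp add: lincomb_diff)
 qed
 have "(\<lambda>k. L2_set (c k) S) \<longlonglongrightarrow> L2_set a S" unfolding L2_set_def by (intro tendsto_intros ci)
 hence "Bseq (\<lambda>k. L2_set (c k) S)" by (rule convergent_imp_Bseq[OF convergentI])
 then obtain K where K: "\<And>k. norm (L2_set (c k) S) \<le> K" unfolding Bseq_def by blast
 have "pint M r (lincomb S v (c k)) \<le> C * K powr r" for k
 proof -
  have "L2_set (c k) S powr r \<le> K powr r" using K[of k] r by (intro powr_mono2) auto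
  thus ?thesis using C(2)[of "c k"] mult_left_mono[OF _ C(1)] by (meson order_trans)
 qed
 thus "\<exists>K. \<forall>k. pint M r (lincomb S v (c k)) \<le> K" by blast
qed

lemma continuous_on_pint_lincomb:
 fixes v :: "nat => 'a => 'b::euclidean_space"
 assumes S: "finite S" and v: "\<And>i. i \<in> S ==> v i \<in> Lspace M r" and r: "1 < r" and w: "w \<in> Lspace M r"
 shows "continuous_on A (\<lambda>c. pdist M r (lincomb S v c) w)"
  and "continuous_on A (\<lambda>c. pairing M r (lincomb S v c) w)"
proof -
 have r0: "0 < r" using r by simp
 have L: "lincomb S v c \<in> Lspace M r" for c using v r0 by (intro Lspace_lincomb_sum)
 have L': "(\<lambda>x. lincomb S v c x - w x) \<in> Lspace M r" for c using L w r0 by (intro Lspace_diff)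
 show "continuous_on A (\<lambda>c. pdist M r (lincomb S v c) w)"
 proof (rule continuous_on_sequentiallyI)
  fix c :: "nat => nat => real" and a assume c: "c \<longlonglongrightarrow> a"
  note t = lincomb_tendsto[where v = v, OF S v r0 c]
  obtain K where K: "\<And>k. pint M r (lincomb S v (c k)) \<le> K" using t(2) by blast
  have K': "pdist M r (lincomb S v (c k)) w \<le> 2 powr r * (K + pint M r w)" for k
  proof -
   have mw: "(\<lambda>x. (-1) *\<^sub>R w x) \<in> Lspace M r" using w r0 by (intro Lspace_scaleR)
   have "pdist M r (lincomb S v (c k)) w \<le> 2 powr r * (pint M r (lincomb S v (c k)) + pint M r (\<lambda>x. (-1) *\<^sub>R w x))"
    using pint_add_le[OF L[of "c k"] mw r0] by simp
   also have "pint M r (\<lambda>x. (-1) *\<^sub>R w x) = pint M r w" unfolding pint_scaleR by simp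
   also have "2 powr r * (pint M r (lincomb S v (c k)) + pint M r w) \<le> 2 powr r * (K + pint M r w)"
    using K[of k] by (intro mult_left_mono) auto
   finally show ?thesis .
  qed
  show "(\<lambda>k. pdist M r (lincomb S v (c k)) w) \<longlonglongrightarrow> pdist M r (lincomb S v a) w"
   by (rule pint_tendsto[where u = "\<lambda>k x. lincomb S v (c k) x - w x" and K = "2 powr r * (K + pint M r w)", OF r L' L' _ K'])
    (use t(1) in simp)
 qed
 show "continuous_on A (\<lambda>c. pairing M r (lincomb S v c) w)"
 proof (rule continuous_on_sequentiallyI)
  fix c :: "nat => nat => real" and a assume c: "c \<longlonglongrightarrow> a"
  note t = lincomb_tendsto[where v = v, OF S v r0 c]
  obtain K where K: "\<And>k. pint M r (lincomb S v (c k)) \<le> K" using t(2) by blast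
  show "(\<lambda>k. pairing M r (lincomb S v (c k)) w) \<longlonglongrightarrow> pairing M r (lincomb S v a) w"
   by (rule pairing_tendsto[where u = "\<lambda>k. lincomb S v (c k)", OF r L L t(1) K w])
 qed
qed

lemma pairing_lincomb_sum:
 assumes S: "finite S" and v: "\<And>i. i \<in> S ==> v i \<in> Lspace M r" and r: "1 < r" and u: "u \<in> Lspace M r"
 shows "pairing M r u (lincomb S v c) = (\<Sum>i\<in>S. c i * pairing M r u (v i))"
proof -
 have "pairing M r u (lincomb S v c) = (LINT x|M. (\<Sum>i\<in>S. c i * (powmap r (u x) \<bullet> v i x)))"
  by (simp add: pairing_def lincomb_def inner_sum_right)
 also have "\<dots> = (\<Sum>i\<in>S. LINT x|M. c i * (powmap r (u x) \<bullet> v i x))"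
  by (rule Bochner_Integration.integral_sum) (use integrable_pairing[OF u v r] in auto)
 also have "\<dots> = (\<Sum>i\<in>S. c i * pairing M r u (v i))" by (simp add: pairing_def)
 finally show ?thesis .
qed

text \<open>The spaces \<open>W n\<close> are spanned by the pairs \<open>(e i, d i)\<close> with \<open>i < n\<close> in \<open>I\<close>. Linear independence of the
gradients makes the coefficients coordinates, to which the finite-dimensional minimax principle applies.\<close>

locale galerkin_basis = pq_space M p q W f CP Cf
 for M :: "'a measure" and p q :: real and W :: "nat => (('a => real) \<times> ('a => 'b::euclidean_space)) set"
  and f :: "('a => real) => real" and CP Cf :: real +
 fixes e :: "nat => 'a => real" and d :: "nat => 'a => 'b" and I :: "nat set"
 assumes W_eq: "\<And>n. W n = range (\<lambda>c. (lincomb (I \<inter> {..<n}) e c, lincomb (I \<inter> {..<n}) d c))"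
  and indep: "\<And>n c i. pint M p (lincomb (I \<inter> {..<n}) d c) = 0 ==> i \<in> I ==> i < n ==> c i = 0"
begin

abbreviation S :: "nat => nat set" where "S n \<equiv> I \<inter> {..<n}"
abbreviation U :: "nat => (nat => real) => 'a => real" where "U n \<equiv> lincomb (S n) e"
abbreviation D :: "nat => (nat => real) => 'a => 'b" where "D n \<equiv> lincomb (S n) d"

lemma finS: "finite (S n)" by simp

lemma UD_W: "(U n c, D n c) \<in> W n" by (auto simp: W_eq)

lemma lincomb_unit: "finite T ==> j \<in> T ==> lincomb T v (\<lambda>i. if i = j then 1 else 0) = v j"
proof
 fix x assume "finite T" "j \<in> T"
 have "lincomb T v (\<lambda>i. if i = j then 1 else 0) x = (\<Sum>i\<in>T. if i = j then v i x else 0)" unfolding lincomb_def by (rule sum.cong) auto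
 thus "lincomb T v (\<lambda>i. if i = j then 1 else 0) x = v j x" using \<open>finite T\<close> \<open>j \<in> T\<close> by simp
qed

lemma ed_W: "j \<in> S n ==> (e j, d j) \<in> W n"
proof -
 assume j: "j \<in> S n"
 let ?c = "\<lambda>i. if i = j then 1 else (0::real)"
 have "U n ?c = e j" "D n ?c = d j" using lincomb_unit[OF finS j] by blast+
 thus ?thesis using UD_W[of n ?c] by metis
qed

lemma ed_L: "j \<in> S n ==> e j \<in> Lspace M p" "j \<in> S n ==> d j \<in> Lspace M p"
 "j \<in> S n ==> e j \<in> Lspace M q" "j \<in> S n ==> d j \<in> Lspace M q" using W_Lp[OF ed_W] W_Lq[OF ed_W] by blast+

lemma UD_L: "U n c \<in> Lspace M p" "D n c \<in> Lspace M p" "U n c \<in> Lspace M q" "D n c \<in> Lspace M q" using W_Lp[OF UD_W] W_Lq[OF UD_W] by blast+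

lemma coord_space_mono: "n \<le> n' ==> coord_space (S n) \<subseteq> coord_space (S n')" by (auto simp: coord_space_def)

lemma lincomb_extend:
 assumes "n \<le> n'" "c \<in> coord_space (S n)" shows "lincomb (S n') v c = lincomb (S n) v c" unfolding lincomb_def
 by (intro ext sum.mono_neutral_right) (use assms in \<open>auto simp: coord_space_def\<close>)

lemma f_sum: "f (U n c) = (\<Sum>i\<in>S n. c i * f (e i))"
proof -
 have "(lincomb T e c, lincomb T d c) \<in> W n \<and> f (lincomb T e c) = (\<Sum>i\<in>T. c i * f (e i))" if "finite T" "T \<subseteq> S n" for T using that
 proof (induction T)
  case empty
  have "((\<lambda>x. 0 *\<^sub>R U n c x), (\<lambda>x. 0 *\<^sub>R D n c x)) \<in> W n" by (rule W_scale[OF UD_W])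
  moreover have "f (\<lambda>x. 0 *\<^sub>R U n c x) = 0 * f (U n c)" by (rule f_scale[OF UD_W])
  ultimately show ?case by (simp add: lincomb_def)
 next
  case (insert j T)
  have j: "(e j, d j) \<in> W n" using insert by (intro ed_W) auto
  have ih: "(lincomb T e c, lincomb T d c) \<in> W n" "f (lincomb T e c) = (\<Sum>i\<in>T. c i * f (e i))" using insert by auto
  have eqs: "lincomb (insert j T) v c = (\<lambda>x. c j *\<^sub>R v j x + 1 *\<^sub>R lincomb T v c x)" for v :: "nat => 'a => 'c::real_vector"
   using insert.hyps by (simp add: lincomb_def)
  show ?case unfolding eqs using W_lin[OF j ih(1), of "c j" 1] f_lin[OF j ih(1), of "c j" 1] ih(2) insert.hyps by simp
 qed
 from this[OF finS subset_refl] show ?thesis by blast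
qed

lemma denergy_sum: "(u, v) \<in> W m ==> denergy \<gamma> \<beta> (u, v) (U n w, D n w) = (\<Sum>i\<in>S n. w i * denergy \<gamma> \<beta> (u, v) (e i, d i))"
proof -
 assume uv: "(u, v) \<in> W m"
 note L = W_Lp[OF uv] W_Lq[OF uv]
 have "pairing M p v (D n w) = (\<Sum>i\<in>S n. w i * pairing M p v (d i))" "pairing M p u (U n w) = (\<Sum>i\<in>S n. w i * pairing M p u (e i))"
  "pairing M q v (D n w) = (\<Sum>i\<in>S n. w i * pairing M q v (d i))" "pairing M q u (U n w) = (\<Sum>i\<in>S n. w i * pairing M q u (e i))"
  by (rule pairing_lincomb_sum[OF finS]; use L ed_L p1 q1 in blast)+
 thus ?thesis unfolding denergy_def fst_conv snd_conv f_sum by (simp add: sum_subtractf sum.distrib sum_distrib_left algebra_simps)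
qed

definition En :: "nat => real => real => (nat => real) => real" where
 "En n \<gamma> \<beta> c = energy \<gamma> \<beta> (U n c, D n c)"

definition Gr :: "nat => real => real => (nat => real) => nat => real" where
 "Gr n \<gamma> \<beta> c i = denergy \<gamma> \<beta> (U n c, D n c) (e i, d i)"

lemma continuous_pint_UD:
 "continuous_on A (\<lambda>c. pint M p (U n c))" "continuous_on A (\<lambda>c. pint M p (D n c))"
 "continuous_on A (\<lambda>c. pint M q (U n c))" "continuous_on A (\<lambda>c. pint M q (D n c))"
proof -
 have "continuous_on A (\<lambda>c. pint M p (\<lambda>x. U n c x - 0))" "continuous_on A (\<lambda>c. pint M p (\<lambda>x. D n c x - 0))"
 "continuous_on A (\<lambda>c. pint M q (\<lambda>x. U n c x - 0))" "continuous_on A (\<lambda>c. pint M q (\<lambda>x. D n c x - 0))"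
  by (rule continuous_on_pint_lincomb(1)[OF finS]; use ed_L p1 q1 Lspace_zero in blast)+
 thus "continuous_on A (\<lambda>c. pint M p (U n c))" "continuous_on A (\<lambda>c. pint M p (D n c))"
 "continuous_on A (\<lambda>c. pint M q (U n c))" "continuous_on A (\<lambda>c. pint M q (D n c))" by simp_all
qed

lemma continuous_En: "continuous_on A (En n \<gamma> \<beta>)"
proof -
 have "continuous_on A (\<lambda>c. f (U n c))" unfolding f_sum by (intro continuous_intros continuous_on_coord)
 thus ?thesis unfolding En_def[abs_def] energy_def fst_conv snd_conv using p1 q1 by (intro continuous_intros continuous_pint_UD) auto
qed

lemma continuous_Gr: "i \<in> S n ==> continuous_on A (\<lambda>c. Gr n \<gamma> \<beta> c i)"
proof -
 assume i: "i \<in> S n"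
 have "continuous_on A (\<lambda>c. pairing M p (U n c) (e i))" "continuous_on A (\<lambda>c. pairing M p (D n c) (d i))"
  "continuous_on A (\<lambda>c. pairing M q (U n c) (e i))" "continuous_on A (\<lambda>c. pairing M q (D n c) (d i))"
  by (rule continuous_on_pint_lincomb(2)[OF finS]; use ed_L i p1 q1 in blast)+
 thus ?thesis unfolding Gr_def[abs_def] denergy_def fst_conv snd_conv by (intro continuous_intros)
qed

text \<open>The descent condition of the deformation lemma holds because each of the four power integrals in the energy
is uniformly differentiable on bounded sets.\<close>

lemma descent_En:
 assumes \<epsilon>: "0 < \<epsilon>"
 shows "\<exists>s0>0. \<forall>c\<in>coord_space (S n). \<forall>w\<in>coord_space (S n). \<forall>s. L2_set c (S n) \<le> R --> L2_set w (S n) \<le> 1 --> 0 < s --> s \<le> s0 -->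
    En n \<gamma> \<beta> (\<lambda>i. c i - s * w i) \<le> En n \<gamma> \<beta> c - s * (\<Sum>i\<in>S n. Gr n \<gamma> \<beta> c i * w i) + s * \<epsilon>"
proof -
 have p0: "0 < p" and q0: "0 < q" using p1 q1 by auto
 define R' where "R' = \<bar>R\<bar> + 1"
 define L where "L = 1 / p + \<bar>\<gamma>\<bar> / p + 1 / q + \<bar>\<beta>\<bar> / q"
 have L: "0 < L" using p0 q0 unfolding L_def by (intro add_pos_nonneg) auto
 define \<epsilon>1 where "\<epsilon>1 = \<epsilon> / L"
 have \<epsilon>1: "0 < \<epsilon>1" using \<epsilon> L by (simp add: \<epsilon>1_def)
 note ud = pint_lincomb_uniformly_differentiable[where R = R' and S = "S n", OF finS _ _ \<epsilon>1]
 note ex = ud[where v = d, OF ed_L(2)[where n = n] p1] ud[where v = e, OF ed_L(1)[where n = n] p1] ud[where v = d, OF ed_L(4)[where n = n] q1] ud[where v = e, OF ed_L(3)[where n = n] q1]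
 obtain s1 where s1: "s1 > 0" "\<forall>c w s. L2_set c (S n) \<le> R' --> L2_set w (S n) \<le> R' --> 0 < s --> s \<le> s1 --> \<bar>pint_remainder M p (S n) d c w s\<bar> \<le> s * \<epsilon>1" using ex(1) by blast
 obtain s2 where s2: "s2 > 0" "\<forall>c w s. L2_set c (S n) \<le> R' --> L2_set w (S n) \<le> R' --> 0 < s --> s \<le> s2 --> \<bar>pint_remainder M p (S n) e c w s\<bar> \<le> s * \<epsilon>1" using ex(2) by blast
 obtain s3 where s3: "s3 > 0" "\<forall>c w s. L2_set c (S n) \<le> R' --> L2_set w (S n) \<le> R' --> 0 < s --> s \<le> s3 --> \<bar>pint_remainder M q (S n) d c w s\<bar> \<le> s * \<epsilon>1" using ex(3) by blast
 obtain s4 where s4: "s4 > 0" "\<forall>c w s. L2_set c (S n) \<le> R' --> L2_set w (S n) \<le> R' --> 0 < s --> s \<le> s4 --> \<bar>pint_remainder M q (S n) e c w s\<bar> \<le> s * \<epsilon>1" using ex(4) by blast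
 show ?thesis
 proof (intro exI[of _ "min (min s1 s2) (min s3 s4)"] conjI ballI allI impI)
  show "0 < min (min s1 s2) (min s3 s4)" using s1 s2 s3 s4 by simp
  fix c w s assume c: "L2_set c (S n) \<le> R" and w: "L2_set w (S n) \<le> 1" and s: "0 < s" "s \<le> min (min s1 s2) (min s3 s4)"
  have R: "L2_set c (S n) \<le> R'" "L2_set w (S n) \<le> R'" using c w by (auto simp: R'_def)
  have x: "\<bar>pint_remainder M p (S n) d c w s\<bar> \<le> s * \<epsilon>1" "\<bar>pint_remainder M p (S n) e c w s\<bar> \<le> s * \<epsilon>1" "\<bar>pint_remainder M q (S n) d c w s\<bar> \<le> s * \<epsilon>1" "\<bar>pint_remainder M q (S n) e c w s\<bar> \<le> s * \<epsilon>1"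
   using s1(2) s2(2) s3(2) s4(2) R s by auto
  have fe: "f (U n (\<lambda>i. c i - s * w i)) = f (U n c) - s * f (U n w)" unfolding f_sum by (simp add: left_diff_distrib sum_subtractf sum_distrib_left mult.assoc)
  have gs: "(\<Sum>i\<in>S n. Gr n \<gamma> \<beta> c i * w i) = denergy \<gamma> \<beta> (U n c, D n c) (U n w, D n w)"
   unfolding denergy_sum[OF UD_W] Gr_def by (rule sum.cong) auto
  have "En n \<gamma> \<beta> (\<lambda>i. c i - s * w i) - En n \<gamma> \<beta> c + s * (\<Sum>i\<in>S n. Gr n \<gamma> \<beta> c i * w i)
    = pint_remainder M p (S n) d c w s / p - \<gamma> * (pint_remainder M p (S n) e c w s / p) + pint_remainder M q (S n) d c w s / q - \<beta> * (pint_remainder M q (S n) e c w s / q)"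
   unfolding gs En_def energy_def denergy_def fst_conv snd_conv fe pint_remainder_def using p0 q0 by (simp add: field_simps)
  also have "\<dots> \<le> s * \<epsilon>1 / p + \<bar>\<gamma>\<bar> * (s * \<epsilon>1 / p) + s * \<epsilon>1 / q + \<bar>\<beta>\<bar> * (s * \<epsilon>1 / q)"
  proof -
   have "pint_remainder M p (S n) d c w s / p \<le> s * \<epsilon>1 / p" "pint_remainder M q (S n) d c w s / q \<le> s * \<epsilon>1 / q" using x p0 q0 by (intro divide_right_mono; simp)+
   moreover have "\<bar>\<gamma> * (pint_remainder M p (S n) e c w s / p)\<bar> \<le> \<bar>\<gamma>\<bar> * (s * \<epsilon>1 / p)" "\<bar>\<beta> * (pint_remainder M q (S n) e c w s / q)\<bar> \<le> \<bar>\<beta>\<bar> * (s * \<epsilon>1 / q)"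
    unfolding abs_mult abs_divide using x p0 q0 by (intro mult_left_mono; simp add: divide_right_mono)+
   ultimately show ?thesis by linarith
  qed
  also have "\<dots> = s * (\<epsilon>1 * L)" by (simp add: L_def algebra_simps)
  also have "\<epsilon>1 * L = \<epsilon>" using L by (simp add: \<epsilon>1_def)
  finally show "En n \<gamma> \<beta> (\<lambda>i. c i - s * w i) \<le> En n \<gamma> \<beta> c - s * (\<Sum>i\<in>S n. Gr n \<gamma> \<beta> c i * w i) + s * \<epsilon>" by linarith
 qed
qed

text \<open>Any two norms on a finite-dimensional space are equivalent: by linear independence the norm of the gradient
is positive on the compact unit sphere of coordinates.\<close>

lemma coordinate_norm_bound: "\<exists>\<kappa>>0. \<forall>w. \<kappa> * L2_set w (S n) \<le> pint M p (D n w) powr (1 / p)"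
proof -
 have p0: "0 < p" using p1 by simp
 let ?K = "{c. L2_set c (S n) = 1 \<and> (\<forall>i\<in>S n. \<bar>c i\<bar> \<le> 1) \<and> (\<forall>i. i \<notin> S n --> c i = 0)}"
 have K: "compact ?K" by (rule compact_coordinate_sublevel(1)) (intro continuous_on_L2_set continuous_on_coord)
 have "\<exists>\<mu>>0. \<forall>c\<in>?K. \<mu> \<le> pint M p (D n c)"
 proof (cases "?K = {}")
  case True
  thus ?thesis by (intro exI[of _ 1]) auto
 next
  case False
  from continuous_attains_inf[OF K False continuous_pint_UD(2)[where n = n]]
  obtain a where a: "a \<in> ?K" and a': "\<forall>c\<in>?K. pint M p (D n a) \<le> pint M p (D n c)" by (rule bexE)
  have "pint M p (D n a) \<noteq> 0"
  proof
   assume "pint M p (D n a) = 0"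
   hence "a i = 0" if "i \<in> S n" for i using indep[of n a i] that by simp
   hence "L2_set a (S n) = 0" by (simp add: L2_set_eq_0_iff)
   thus False using a by simp
  qed
  hence "0 < pint M p (D n a)" using pint_nonneg[of M p "D n a"] by linarith
  thus ?thesis using a' by blast
 qed
 then obtain \<mu> where \<mu>: "\<mu> > 0" "\<forall>c\<in>?K. \<mu> \<le> pint M p (D n c)" by (elim exE conjE)
 have "\<mu> powr (1 / p) * L2_set w (S n) \<le> pint M p (D n w) powr (1 / p)" for w
 proof (cases "L2_set w (S n) = 0")
  case False
  let ?l = "L2_set w (S n)"
  have l: "?l > 0" using False L2_set_nonneg[of w "S n"] by linarith
  define c where "c = (\<lambda>i. if i \<in> S n then inverse ?l * w i else 0)"
  have "L2_set c (S n) = L2_set (\<lambda>i. inverse ?l * w i) (S n)" by (rule L2_set_cong) (auto simp: c_def)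
  also have "\<dots> = inverse ?l * ?l" using l by (subst L2_set_right_distrib[symmetric]) auto
  also have "\<dots> = 1" using l by simp
  finally have c1: "L2_set c (S n) = 1" .
  have "\<bar>c i\<bar> \<le> 1" if "i \<in> S n" for i using abs_coord_le_L2_set[OF finS that, of c] c1 by simp
  hence "c \<in> ?K" using c1 by (auto simp: c_def)
  with \<mu>(2) have "\<mu> \<le> pint M p (D n c)" by (rule bspec)
  also have "D n c = D n (\<lambda>i. inverse ?l * w i)" unfolding lincomb_def c_def by (intro ext sum.cong) auto
  also have "pint M p \<dots> = inverse ?l powr p * pint M p (D n w)" unfolding lincomb_scale pint_scaleR using l by simp
  finally have "?l powr p * \<mu> \<le> ?l powr p * (inverse ?l powr p * pint M p (D n w))" by (intro mult_left_mono) auto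
  moreover have "?l powr p * inverse ?l powr p = 1" using l by (simp flip: powr_mult)
  ultimately have "?l powr p * \<mu> \<le> pint M p (D n w)" by (simp flip: mult.assoc)
  hence "(?l powr p * \<mu>) powr (1 / p) \<le> pint M p (D n w) powr (1 / p)" using \<mu> p0 by (intro powr_mono2) auto
  moreover have "(?l powr p * \<mu>) powr (1 / p) = ?l * \<mu> powr (1 / p)" using l p0 \<mu> by (simp add: powr_mult powr_powr)
  ultimately show ?thesis by (simp add: mult.commute)
 qed simp
 thus ?thesis using \<mu> by (intro exI[of _ "\<mu> powr (1 / p)"]) auto
qed

end

section \<open>Index and linking\<close>

text \<open>Otherwise points can be chosen successively, each one far from all earlier ones. In the applications \<open>d\<close> is
a power integral of a difference, which is not a metric.\<close>

lemma finite_net: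
 fixes d :: "'x => 'x => real"
 assumes close: "\<And>s::nat => 'x. (\<And>n. s n \<in> T) ==> \<exists>m n. m < n \<and> d (s n) (s m) < e"
 shows "\<exists>F. finite F \<and> F \<subseteq> T \<and> (\<forall>x\<in>T. \<exists>y\<in>F. d x y < e)"
proof (rule ccontr)
 assume neg: "\<not> ?thesis"
 have H: "\<exists>x\<in>T. \<forall>y\<in>F. \<not> d x y < e" if "finite F" "F \<subseteq> T" for F
 proof (rule ccontr)
  assume "\<not> (\<exists>x\<in>T. \<forall>y\<in>F. \<not> d x y < e)"
  hence "finite F \<and> F \<subseteq> T \<and> (\<forall>x\<in>T. \<exists>y\<in>F. d x y < e)" using that by simp
  hence "\<exists>F. finite F \<and> F \<subseteq> T \<and> (\<forall>x\<in>T. \<exists>y\<in>F. d x y < e)" by (rule exI)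
  with neg show False by (rule notE)
 qed
 have "\<exists>s::nat => 'x. \<forall>n. (\<forall>m<n. s m \<in> T) --> s n \<in> T \<and> (\<forall>m<n. \<not> d (s n) (s m) < e)"
 proof (rule dependent_wf_choice[where R = less_than and P = "\<lambda>s n r. (\<forall>m<n. s m \<in> T) --> r \<in> T \<and> (\<forall>m<n. \<not> d r (s m) < e)"])
  show "\<exists>r. (\<forall>m<n. s m \<in> T) --> r \<in> T \<and> (\<forall>m<n. \<not> d r (s m) < e)" for n :: nat and s
  proof (cases "\<forall>m<n. s m \<in> T")
   case True
   hence "\<exists>x\<in>T. \<forall>y\<in>s ` {..<n}. \<not> d x y < e" by (intro H) auto
   thus ?thesis by auto
  qed blast
 qed auto
 then obtain s :: "nat => 'x" where s: "\<forall>n. (\<forall>m<n. s m \<in> T) --> s n \<in> T \<and> (\<forall>m<n. \<not> d (s n) (s m) < e)" by (rule exE)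
 have sT: "s n \<in> T" for n by (induction n rule: less_induct) (use s in blast)
 have "\<exists>m n. m < n \<and> d (s n) (s m) < e" by (rule close) (rule sT)
 then obtain m n where "m < n" "d (s n) (s m) < e" by (elim exE conjE)
 moreover have "\<not> d (s n) (s m) < e" if "m < n" for m n using s sT that by simp
 ultimately show False by simp
qed

context galerkin_basis
begin

text \<open>The set where the \<open>p\<close>-Rayleigh quotient is less than \<open>\<rho>\<close> has at least index \<open>k\<close>: it contains an odd image of
the sphere of dimension \<open>k - 1\<close>.\<close>

definition sphere_index :: "nat => nat => real => bool" where
 "sphere_index n k \<rho> \<longleftrightarrow> (\<exists>h. continuous_on (unit_sph k) h \<and> h ` unit_sph k \<subseteq> coord_space (S n) \<and>
   (\<forall>x\<in>unit_sph k. h (\<lambda>i. - x i) = (\<lambda>i. - h x i) \<and> pint M p (D n (h x)) < \<rho> * pint M p (U n (h x))))"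

lemma pint_uminus: "pint M r (\<lambda>x. - u x) = pint M r u" by (simp add: pint_def)

text \<open>By compactness a finite set of functions is a net for the normalized functions with Rayleigh quotient at
most \<open>\<rho>\<close>. A bump around each point of the net minus its reflection gives as many odd functions; they have no
common zero because a function of norm 1 is not close to a point and to its negative. By the theorem of
Borsuk and Ulam the net has at least \<open>k\<close> points.\<close>

lemma sphere_index_bounded: "\<exists>bnd. \<forall>n k. sphere_index n k \<rho> --> k \<le> bnd"
proof -
 let ?T = "{z. (\<exists>n. z \<in> W n) \<and> pint M p (fst z) = 1 \<and> pint M p (snd z) \<le> \<rho>}"
 have "\<exists>F. finite F \<and> F \<subseteq> ?T \<and> (\<forall>z\<in>?T. \<exists>y\<in>F. pdist M p (fst z) (fst y) < 1 / 2)"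
 proof (rule finite_net)
  fix s :: "nat => ('a => real) \<times> ('a => 'b)" assume s: "\<And>n. s n \<in> ?T"
  have ex: "\<exists>n. (fst (s k), snd (s k)) \<in> W n" and le: "pint M p (snd (s k)) \<le> \<rho>" for k using s[of k] by auto
  from rellich[of "\<lambda>k. fst (s k)" "\<lambda>k. snd (s k)" \<rho>, OF ex le]
  obtain \<sigma> :: "nat => nat" where \<sigma>: "strict_mono \<sigma>" and cau: "\<forall>e>0. \<exists>N. \<forall>k\<ge>N. \<forall>l\<ge>N. pdist M p (fst (s (\<sigma> k))) (fst (s (\<sigma> l))) < e"
   by (elim exE conjE)
  have half: "(0::real) < 1 / 2" by simp
  from cau[rule_format, OF half] obtain N where "\<forall>k\<ge>N. \<forall>l\<ge>N. pdist M p (fst (s (\<sigma> k))) (fst (s (\<sigma> l))) < 1 / 2" by (rule exE)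
  hence "pint M p (\<lambda>x. fst (s (\<sigma> (Suc N))) x - fst (s (\<sigma> N)) x) < 1 / 2" by simp
  moreover have "\<sigma> N < \<sigma> (Suc N)" using \<sigma> by (simp add: strict_mono_def)
  ultimately show "\<exists>m n. m < n \<and> pdist M p (fst (s n)) (fst (s m)) < 1 / 2" by (intro exI conjI)
 qed
 then obtain F where F: "finite F" "F \<subseteq> ?T" and netF: "\<forall>z\<in>?T. \<exists>y\<in>F. pdist M p (fst z) (fst y) < 1 / 2" by (elim exE conjE)
 obtain m and ys :: "nat => ('a => real) \<times> ('a => 'b)" where ys: "F = ys ` {i. i < m}" using finite_imp_nat_seg_image_inj_on[OF F(1)] by (elim exE conjE)
 define us where "us i = fst (ys i)" for i
 have us: "us i \<in> Lspace M p" if "i < m" for i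
 proof -
  have "ys i \<in> F" unfolding ys using that by (intro imageI) simp
  from subsetD[OF F(2) this] have "ys i \<in> ?T" .
  then obtain n where "(fst (ys i), snd (ys i)) \<in> W n" by auto
  from W_Lp[OF this] show ?thesis unfolding us_def by (rule conjunct1)
 qed
 have net: "\<exists>i<m. pdist M p u (us i) < 1 / 2" if "(u, v) \<in> W n" "pint M p u = 1" "pint M p v \<le> \<rho>" for n u v
 proof -
  have "(u, v) \<in> ?T" using that by auto
  from bspec[OF netF this] show ?thesis unfolding ys us_def by auto
 qed
 have p0: "0 < p" using p1 by simp
 have "k \<le> m" if idx: "sphere_index n k \<rho>" for n k
 proof -
  let ?S = "unit_sph k"
  obtain h where hc: "continuous_on ?S h" and hodd: "\<And>x. x \<in> ?S ==> h (\<lambda>i. - x i) = (\<lambda>i. - h x i)"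
   and hR: "\<And>x. x \<in> ?S ==> pint M p (D n (h x)) < \<rho> * pint M p (U n (h x))"
   using idx unfolding sphere_index_def by (elim exE conjE) blast
  have Upos: "0 < pint M p (U n (h x))" if "x \<in> ?S" for x
   using hR[OF that] pint_nonneg[of M p "D n (h x)"] pint_nonneg[of M p "U n (h x)"] by (cases "pint M p (U n (h x)) = 0") auto
  define t where "t x = pint M p (U n (h x)) powr (1 / p)" for x
  have tpos: "0 < t x" if "x \<in> ?S" for x using Upos[OF that] by (simp add: t_def)
  have tc: "continuous_on ?S t" unfolding t_def
  proof (rule continuous_on_powr')
   show "continuous_on ?S (\<lambda>x. pint M p (U n (h x)))" by (rule continuous_on_compose2[OF continuous_pint_UD(1)[of UNIV] hc]) simp
  qed (use Upos p0 in \<open>auto intro: less_imp_le continuous_on_const\<close>)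
  define g where "g x = (\<lambda>i. inverse (t x) * h x i)" for x
  have gc: "continuous_on ?S g"
  proof (rule continuous_on_coordinatewise_then_product)
   fix i show "continuous_on ?S (\<lambda>x. g x i)" unfolding g_def
    by (intro continuous_on_mult continuous_on_inverse tc continuous_on_product_then_coordinatewise[OF hc]) (use tpos in force)
  qed
  have todd: "t (\<lambda>i. - x i) = t x" if "x \<in> ?S" for x unfolding t_def hodd[OF that] lincomb_uminus pint_uminus by simp
  have godd: "g (\<lambda>i. - x i) = (\<lambda>i. - g x i)" if "x \<in> ?S" for x unfolding g_def hodd[OF that] todd[OF that] by simp
  have tp: "inverse (t x) powr p * pint M p (U n (h x)) = 1" if "x \<in> ?S" for x
  proof -
   have e: "t x powr p = pint M p (U n (h x))" using Upos[OF that] p0 by (simp add: t_def powr_powr)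
   have "inverse (t x) powr p * t x powr p = 1" using tpos[OF that] by (simp flip: powr_mult)
   thus ?thesis by (simp only: e)
  qed
  have g1: "pint M p (U n (g x)) = 1" if "x \<in> ?S" for x unfolding g_def lincomb_scale pint_scaleR using tp[OF that] tpos[OF that] by simp
  have g2: "pint M p (D n (g x)) \<le> \<rho>" if "x \<in> ?S" for x
  proof -
   have "pint M p (D n (g x)) = inverse (t x) powr p * pint M p (D n (h x))"
    unfolding g_def lincomb_scale pint_scaleR using tpos[OF that] by simp
   also have "\<dots> \<le> inverse (t x) powr p * (\<rho> * pint M p (U n (h x)))" using hR[OF that] by (intro mult_left_mono) auto
   also have "\<dots> = \<rho>" using tp[OF that] by (metis mult.left_commute mult.right_neutral)
   finally show ?thesis .
  qed
  \<comment> \<open>The first maximum is positive only near \<open>us i\<close> and the second only near \<open>- us i\<close>.\<close>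
  define \<Phi> where "\<Phi> x i = max 0 (1 / 2 - pdist M p (U n (g x)) (us i)) - max 0 (1 / 2 - pint M p (\<lambda>y. - U n (g x) y - us i y))" for x i
  show "k \<le> m"
  proof (rule Borsuk_Ulam_no_odd_map[of m k \<Phi>])
   fix i assume i: "i < m"
   have c1: "continuous_on ?S (\<lambda>x. pdist M p (U n (g x)) (us i))"
    by (rule continuous_on_compose2[OF continuous_on_pint_lincomb(1)[of "S n" e M p "us i" UNIV] gc]) (use ed_L p1 us[OF i] in auto)
   have gm: "continuous_on ?S (\<lambda>x i. - g x i)" by (rule continuous_on_uminus_fun[OF gc])
   have "continuous_on ?S (\<lambda>x. pint M p (\<lambda>y. U n (\<lambda>i. - g x i) y - us i y))"
    by (rule continuous_on_compose2[OF continuous_on_pint_lincomb(1)[of "S n" e M p "us i" UNIV] gm]) (use ed_L p1 us[OF i] in auto)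
   hence c2: "continuous_on ?S (\<lambda>x. pint M p (\<lambda>y. - U n (g x) y - us i y))" by (simp add: lincomb_uminus)
   show "continuous_on ?S (\<lambda>x. \<Phi> x i)" unfolding \<Phi>_def by (intro continuous_on_diff continuous_on_max continuous_on_const c1 c2)
  next
   fix x i assume x: "x \<in> ?S"
   show "\<Phi> (\<lambda>i. - x i) i = - \<Phi> x i" unfolding \<Phi>_def godd[OF x] lincomb_uminus by simp
  next
   fix x assume x: "x \<in> ?S"
   obtain i where i: "i < m" "pdist M p (U n (g x)) (us i) < 1 / 2" using net[OF UD_W g1[OF x] g2[OF x]] by blast
   have L1: "(\<lambda>y. U n (g x) y - us i y) \<in> Lspace M p" using UD_L us[OF i(1)] p0 by (intro Lspace_diff) auto
   have L2: "(\<lambda>y. - U n (g x) y - us i y) \<in> Lspace M p"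
    using Lspace_diff[OF Lspace_scaleR[OF UD_L(1) p0, of "-1"] us[OF i(1)] p0] by simp
   have "pint M p (\<lambda>y. (U n (g x) y - us i y) + (-1) *\<^sub>R (- U n (g x) y - us i y)) \<le>
     2 powr p * (pdist M p (U n (g x)) (us i) + pint M p (\<lambda>y. (-1) *\<^sub>R (- U n (g x) y - us i y)))"
    by (rule pint_add_le[OF L1 Lspace_scaleR[OF L2 p0] p0])
   also have "pint M p (\<lambda>y. (-1) *\<^sub>R (- U n (g x) y - us i y)) = pint M p (\<lambda>y. - U n (g x) y - us i y)" unfolding pint_scaleR by simp
   also have "(\<lambda>y. (U n (g x) y - us i y) + (-1) *\<^sub>R (- U n (g x) y - us i y)) = (\<lambda>y. 2 *\<^sub>R U n (g x) y)" by auto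
   also have "pint M p (\<lambda>y. 2 *\<^sub>R U n (g x) y) = 2 powr p" unfolding pint_scaleR g1[OF x] by simp
   finally have "2 powr p * 1 \<le> 2 powr p * (pdist M p (U n (g x)) (us i) + pint M p (\<lambda>y. - U n (g x) y - us i y))" by simp
   hence "1 \<le> pdist M p (U n (g x)) (us i) + pint M p (\<lambda>y. - U n (g x) y - us i y)" by (simp only: mult_le_cancel_left_pos powr_gt_zero)
   hence "\<Phi> x i \<noteq> 0" using i(2) unfolding \<Phi>_def by (simp add: max_def)
   thus "\<exists>i<m. \<Phi> x i \<noteq> 0" using i(1) by blast
  qed
 qed
 thus ?thesis by blast
qed

lemma sphere_index_zero: "sphere_index n 0 \<rho>" by (auto simp: sphere_index_def unit_sph_def intro!: exI[of _ "\<lambda>_ _. 0"])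

lemma growth_function:
 assumes \<kappa>: "0 < \<kappa>" and K: "0 \<le> K"
 shows "\<exists>B\<ge>0. \<forall>t\<ge>0. - \<kappa> * t powr p + K * t powr q + K * t \<le> B - \<kappa> / 2 * t powr p"
proof -
 have q0: "0 < q" using q1 by simp
 have e: "0 < \<kappa> / (4 * (K + 1))" using \<kappa> K by simp
 obtain C1 where C1: "C1 \<ge> 0" "\<And>t. t \<ge> 0 ==> t powr q \<le> C1 + \<kappa> / (4 * (K + 1)) * t powr p" using powr_low_by_high(2)[OF q0 qp e] by blast
 obtain C2 where C2: "C2 \<ge> 0" "\<And>t. t \<ge> 0 ==> t powr 1 \<le> C2 + \<kappa> / (4 * (K + 1)) * t powr p" using powr_low_by_high(2)[OF _ p1 e] by auto
 show ?thesis
 proof (intro exI[of _ "K * C1 + K * C2"] conjI allI impI)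
  fix t :: real assume t: "0 \<le> t"
  have KK: "K * (\<kappa> / (4 * (K + 1)) * t powr p) \<le> \<kappa> / 4 * t powr p"
  proof -
   have "K * (\<kappa> / (4 * (K + 1)) * t powr p) = (K / (K + 1)) * (\<kappa> / 4 * t powr p)" by simp
   also have "\<dots> \<le> 1 * (\<kappa> / 4 * t powr p)" using K \<kappa> by (intro mult_right_mono) auto
   finally show ?thesis by simp
  qed
  have "K * t powr q \<le> K * (C1 + \<kappa> / (4 * (K + 1)) * t powr p)" using C1(2)[OF t] K by (rule mult_left_mono)
  hence a: "K * t powr q \<le> K * C1 + \<kappa> / 4 * t powr p" using KK by (simp only: distrib_left)
  have "t = t powr 1" using t by simp
  hence "K * t \<le> K * (C2 + \<kappa> / (4 * (K + 1)) * t powr p)" using C2(2)[OF t] K by (intro mult_left_mono) linarith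
  hence b: "K * t \<le> K * C2 + \<kappa> / 4 * t powr p" using KK by (simp only: distrib_left)
  show "- \<kappa> * t powr p + K * t powr q + K * t \<le> K * C1 + K * C2 - \<kappa> / 2 * t powr p" using a b by (simp add: algebra_simps)
 qed (use K C1 C2 in simp)
qed

lemma energy_scale:
 assumes z: "(u, v) \<in> W n" and t: "0 \<le> t"
 shows "energy \<gamma> \<beta> (\<lambda>x. t *\<^sub>R u x, \<lambda>x. t *\<^sub>R v x) =
   t powr p * ((pint M p v - \<gamma> * pint M p u) / p) + t powr q * ((pint M q v - \<beta> * pint M q u) / q) - t * f u"
 unfolding energy_def fst_conv snd_conv pint_scaleR f_scale[OF z] using t by (simp add: algebra_simps diff_divide_distrib)

text \<open>Where the Rayleigh quotient is at least \<open>\<rho> > \<gamma>\<close>, the \<open>p\<close>-part of the energy is coercive and dominates the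
remaining terms.\<close>

lemma energy_lower_bound:
 assumes \<theta>: "0 < \<theta>"
 shows "\<exists>m\<le>0. \<forall>n u v \<gamma>. (u, v) \<in> W n --> \<gamma> \<le> \<rho> - \<theta> --> \<rho> * pint M p u \<le> pint M p v --> m \<le> energy \<gamma> \<beta> (u, v)"
proof -
 have p0: "0 < p" and q0: "0 < q" using p1 q1 by auto
 \<comment> \<open>The share of the gradient integral that remains after the subtraction of \<open>\<gamma>\<close> times the integral of \<open>u\<close>.\<close>
 define \<mu> where "\<mu> = min 1 (\<theta> / (\<bar>\<rho>\<bar> + 1))"
 have \<mu>: "0 < \<mu>" "\<mu> \<le> 1" "\<mu> * \<rho> \<le> \<theta>"
 proof -
  show "0 < \<mu>" "\<mu> \<le> 1" using \<theta> by (auto simp: \<mu>_def)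
  hence "\<mu> * \<rho> \<le> \<mu> * (\<bar>\<rho>\<bar> + 1)" by (intro mult_left_mono) auto
  also have "\<dots> \<le> \<theta> / (\<bar>\<rho>\<bar> + 1) * (\<bar>\<rho>\<bar> + 1)" by (intro mult_right_mono) (auto simp: \<mu>_def)
  also have "\<dots> = \<theta>" by simp
  finally show "\<mu> * \<rho> \<le> \<theta>" .
 qed
 define \<epsilon> where "\<epsilon> = \<mu> / p / (2 * (\<bar>\<beta>\<bar> / q * CP + Cf + 1))"
 have den: "\<bar>\<beta>\<bar> / q * CP + Cf + 1 > 0" using CP Cf q0 by (intro add_nonneg_pos add_nonneg_nonneg mult_nonneg_nonneg) auto
 have \<epsilon>: "0 < \<epsilon>" using \<mu> p0 den by (simp add: \<epsilon>_def)
 obtain C1 where C1: "C1 \<ge> 0" "\<forall>u\<in>Lspace M p. pint M q u \<le> C1 + \<epsilon> * pint M p (u :: 'a => real)"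
  using pint_low_by_high(2)[OF q0 qp \<epsilon>] by blast
 have ip: "0 < 1 / p" "1 / p < 1" using p1 by auto
 obtain C2 where C2: "C2 \<ge> 0" "\<forall>t\<ge>0. t powr (1 / p) \<le> C2 + \<epsilon> * t powr 1" using powr_low_by_high(2)[OF ip \<epsilon>] by blast
 show ?thesis
 proof (intro exI[of _ "- (\<bar>\<beta>\<bar> / q * C1 + Cf * C2)"] conjI allI impI)
  have "0 \<le> \<bar>\<beta>\<bar> / q * C1" "0 \<le> Cf * C2" using C1(1) C2(1) Cf q0 by simp_all
  thus "- (\<bar>\<beta>\<bar> / q * C1 + Cf * C2) \<le> 0" by linarith
  fix n u v \<gamma> assume z: "(u, v) \<in> W n" and g: "\<gamma> \<le> \<rho> - \<theta>" and R: "\<rho> * pint M p u \<le> pint M p v"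
  let ?A = "pint M p v" and ?B = "pint M p u"
  have AB: "0 \<le> ?A" "0 \<le> ?B" by (rule pint_nonneg)+
  have "\<gamma> * ?B \<le> (\<rho> - \<theta>) * ?B" using g AB by (intro mult_right_mono) auto
  moreover have "\<mu> * (?A - \<rho> * ?B) \<le> 1 * (?A - \<rho> * ?B)" using \<mu> R by (intro mult_right_mono) auto
  moreover have "(\<mu> * \<rho>) * ?B \<le> \<theta> * ?B" using \<mu> AB by (intro mult_right_mono) auto
  ultimately have "\<mu> * ?A \<le> ?A - \<gamma> * ?B" by (simp add: algebra_simps)
  hence a: "\<mu> / p * ?A \<le> (?A - \<gamma> * ?B) / p" using p0 by (simp add: field_simps)
  have "pint M q u \<le> C1 + \<epsilon> * ?B" using C1(2) W_Lp[OF z] by blast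
  also have "\<epsilon> * ?B \<le> \<epsilon> * (CP * ?A)" using poincare[OF z] \<epsilon> by (intro mult_left_mono) auto
  finally have "\<bar>\<beta>\<bar> / q * pint M q u \<le> \<bar>\<beta>\<bar> / q * (C1 + \<epsilon> * (CP * ?A))" using q0 by (intro mult_left_mono) auto
  moreover have "\<beta> * pint M q u \<le> \<bar>\<beta>\<bar> * pint M q u" by (intro mult_right_mono) (auto simp: pint_nonneg)
  hence "\<beta> * pint M q u / q \<le> \<bar>\<beta>\<bar> / q * pint M q u" using q0 by (simp add: divide_right_mono)
  moreover have "0 \<le> pint M q v / q" using q0 pint_nonneg by (intro divide_nonneg_pos) auto
  ultimately have b: "(pint M q v - \<beta> * pint M q u) / q \<ge> - (\<bar>\<beta>\<bar> / q * (C1 + \<epsilon> * (CP * ?A)))" unfolding diff_divide_distrib by linarith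
  have "\<bar>f u\<bar> \<le> Cf * ?A powr (1 / p)" by (rule f_bound[OF z])
  also have "\<dots> \<le> Cf * (C2 + \<epsilon> * ?A)" using C2(2)[rule_format, OF AB(1)] AB Cf by (intro mult_left_mono) auto
  finally have c: "f u \<le> Cf * (C2 + \<epsilon> * ?A)" by linarith
  have Xnn: "0 \<le> \<bar>\<beta>\<bar> / q * CP" using CP q0 by simp
  have d: "\<epsilon> * ((\<bar>\<beta>\<bar> / q * CP + Cf) * ?A) \<le> \<mu> / p * ?A"
  proof -
   have "\<epsilon> * (\<bar>\<beta>\<bar> / q * CP + Cf) \<le> \<epsilon> * (2 * (\<bar>\<beta>\<bar> / q * CP + Cf + 1))"
   proof (rule mult_left_mono)
    show "\<bar>\<beta>\<bar> / q * CP + Cf \<le> 2 * (\<bar>\<beta>\<bar> / q * CP + Cf + 1)" using Xnn Cf by argo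
   qed (use \<epsilon> in simp)
   also have "\<dots> = (2 * (\<bar>\<beta>\<bar> / q * CP + Cf + 1)) * (\<mu> / p / (2 * (\<bar>\<beta>\<bar> / q * CP + Cf + 1)))" unfolding \<epsilon>_def by (rule mult.commute)
   also have "\<dots> = \<mu> / p" by (rule mult_divide_cancel_pos) (use den in simp)
   finally show ?thesis using mult_right_mono[OF _ AB(1)] by (simp only: mult.assoc[symmetric])
  qed
  have "energy \<gamma> \<beta> (u, v) \<ge> \<mu> / p * ?A - \<bar>\<beta>\<bar> / q * (C1 + \<epsilon> * (CP * ?A)) - Cf * (C2 + \<epsilon> * ?A)"
   unfolding energy_def fst_conv snd_conv using a b c by linarith
  moreover have "\<bar>\<beta>\<bar> / q * (C1 + \<epsilon> * (CP * ?A)) + Cf * (C2 + \<epsilon> * ?A) = \<bar>\<beta>\<bar> / q * C1 + Cf * C2 + \<epsilon> * ((\<bar>\<beta>\<bar> / q * CP + Cf) * ?A)"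
   by (simp add: algebra_simps)
  ultimately show "- (\<bar>\<beta>\<bar> / q * C1 + Cf * C2) \<le> energy \<gamma> \<beta> (u, v)" using d by linarith
 qed
qed

text \<open>The minimax principle for the set \<open>N\<close> where the Rayleigh quotient is less than \<open>\<rho>\<close>. Its condition \<open>no_lift\<close>
is the failure of \<open>sphere_index\<close> for \<open>Suc k\<close>.\<close>

lemma linking_in_W:
 assumes h: "continuous_on (unit_sph k) h" "h ` unit_sph k \<subseteq> coord_space (S n)"
   "\<And>x. x \<in> unit_sph k ==> h (\<lambda>i. - x i) = (\<lambda>i. - h x i)"
  and \<kappa>: "0 < \<kappa>" and ray: "\<And>x t. x \<in> unit_sph k ==> 0 \<le> t ==> En n \<gamma> \<beta> (\<lambda>i. t * h x i) \<le> B - \<kappa> * t powr p"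
  and B: "0 \<le> B" and noidx: "\<not> sphere_index n (Suc k) \<rho>"
  and low: "\<And>u v. (u, v) \<in> W n ==> \<rho> * pint M p u \<le> pint M p v ==> m \<le> energy \<gamma> \<beta> (u, v)" and m0: "m \<le> 0" and \<eta>: "0 < \<eta>"
 shows "\<exists>z\<in>W n. m - 2 \<le> energy \<gamma> \<beta> z \<and> energy \<gamma> \<beta> z \<le> B \<and> (\<forall>w\<in>W n. \<bar>denergy \<gamma> \<beta> z w\<bar> \<le> \<eta> * pint M p (snd w) powr (1 / p))"
proof -
 have p0: "0 < p" using p1 by simp
 obtain c0 where c0: "c0 > 0" "\<And>w. c0 * L2_set w (S n) \<le> pint M p (D n w) powr (1 / p)" using coordinate_norm_bound[of n] by blast
 define N where "N = {c. pint M p (D n c) < \<rho> * pint M p (U n c)}"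
 \<comment> \<open>At the distance \<open>T\<close> along the rays the energy has dropped below \<open>m - 2\<close>.\<close>
 define T where "T = ((B - m + 2) / \<kappa> + 1) powr (1 / p)"
 have Tb: "(B - m + 2) / \<kappa> + 1 > 0" using B m0 \<kappa> by (intro add_nonneg_pos divide_nonneg_pos) auto
 have T: "0 < T" "T powr p = (B - m + 2) / \<kappa> + 1" using Tb p0 by (auto simp: T_def powr_powr)
 have "\<exists>c\<in>coord_space (S n). m - 2 \<le> En n \<gamma> \<beta> c \<and> En n \<gamma> \<beta> c \<le> B \<and> L2_set (Gr n \<gamma> \<beta> c) (S n) < c0 * \<eta>"
 proof (rule linking_almost_critical_point[where h = h and k = k and N = N and T = T])
  show "finite (S n)" by simp
  show "continuous_on (coord_space (S n)) (En n \<gamma> \<beta>)" by (rule continuous_En)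
  show "continuous_on (coord_space (S n)) (\<lambda>c. Gr n \<gamma> \<beta> c i)" if "i \<in> S n" for i by (rule continuous_Gr[OF that])
  show "\<exists>s0>0. \<forall>c\<in>coord_space (S n). \<forall>w\<in>coord_space (S n). \<forall>s. L2_set c (S n) \<le> R --> L2_set w (S n) \<le> 1 --> 0 < s --> s \<le> s0 -->
    En n \<gamma> \<beta> (\<lambda>i. c i - s * w i) \<le> En n \<gamma> \<beta> c - s * (\<Sum>i\<in>S n. Gr n \<gamma> \<beta> c i * w i) + s * \<epsilon>" if "0 < \<epsilon>" for R \<epsilon>
   by (rule descent_En[OF that])
  show "0 < c0 * \<eta>" using c0 \<eta> by simp
  show "continuous_on (unit_sph k) h" "h ` unit_sph k \<subseteq> coord_space (S n)" by fact+
  show "h (\<lambda>i. - x i) = (\<lambda>i. - h x i)" if "x \<in> unit_sph k" for x by (rule h(3)[OF that])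
  show "(\<lambda>i. - c i) \<in> N" if "c \<in> N" for c using that by (simp add: N_def lincomb_uminus pint_uminus)
  show False if H: "continuous_on (unit_sph (Suc k)) H" "H ` unit_sph (Suc k) \<subseteq> coord_space (S n) \<inter> N"
   "\<And>x. x \<in> unit_sph (Suc k) ==> H (\<lambda>i. - x i) = (\<lambda>i. - H x i)" for H
  proof -
   have "sphere_index n (Suc k) \<rho>" unfolding sphere_index_def by (intro exI[of _ H]) (use H in \<open>auto simp: N_def\<close>)
   thus False using noidx by blast
  qed
  show "m \<le> En n \<gamma> \<beta> c" if "c \<notin> N" for c unfolding En_def by (rule low[OF UD_W]) (use that in \<open>simp add: N_def\<close>)
  show "En n \<gamma> \<beta> (\<lambda>i. t * h x i) \<le> B" if "x \<in> unit_sph k" "0 \<le> t" for x t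
  proof -
   have "0 \<le> \<kappa> * t powr p" using \<kappa> by simp
   thus ?thesis using ray[OF that] by linarith
  qed
  show "En n \<gamma> \<beta> (\<lambda>_. 0) \<le> B"
  proof -
   have "U n (\<lambda>_. 0) = (\<lambda>_. 0)" "D n (\<lambda>_. 0) = (\<lambda>_. 0)" by (simp_all add: lincomb_def)
   moreover have "f (U n (\<lambda>_. 0)) = 0" unfolding f_sum by simp
   ultimately have "En n \<gamma> \<beta> (\<lambda>_. 0) = 0" by (simp add: En_def energy_def pint_def)
   thus ?thesis using B by simp
  qed
  show "0 < T" by (rule T)
  show "En n \<gamma> \<beta> (\<lambda>i. T * h x i) \<le> m - 2" if "x \<in> unit_sph k" for x
  proof -
   have "\<kappa> * T powr p = B - m + 2 + \<kappa>" unfolding T(2) using \<kappa> by (simp add: field_simps)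
   thus ?thesis using ray[OF that, of T] T \<kappa> by linarith
  qed
  show "m \<le> B" using B m0 by simp
 qed
 then obtain c where c: "m - 2 \<le> En n \<gamma> \<beta> c" "En n \<gamma> \<beta> c \<le> B" "L2_set (Gr n \<gamma> \<beta> c) (S n) < c0 * \<eta>" by blast
 show ?thesis
 proof (intro bexI[of _ "(U n c, D n c)"] conjI ballI UD_W)
  show "m - 2 \<le> energy \<gamma> \<beta> (U n c, D n c)" "energy \<gamma> \<beta> (U n c, D n c) \<le> B" using c by (auto simp: En_def)
  fix w assume "w \<in> W n"
  then obtain a where w: "w = (U n a, D n a)" by (auto simp: W_eq)
  have "\<bar>denergy \<gamma> \<beta> (U n c, D n c) w\<bar> = \<bar>\<Sum>i\<in>S n. a i * Gr n \<gamma> \<beta> c i\<bar>" unfolding w denergy_sum[OF UD_W] Gr_def ..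
  also have "\<dots> \<le> (\<Sum>i\<in>S n. \<bar>a i\<bar> * \<bar>Gr n \<gamma> \<beta> c i\<bar>)" by (rule order_trans[OF sum_abs]) (simp add: abs_mult)
  also have "\<dots> \<le> L2_set a (S n) * L2_set (Gr n \<gamma> \<beta> c) (S n)" by (rule L2_set_mult_ineq)
  also have "\<dots> \<le> L2_set a (S n) * (c0 * \<eta>)" using c by (intro mult_left_mono) auto
  also have "\<dots> = \<eta> * (c0 * L2_set a (S n))" by simp
  also have "\<dots> \<le> \<eta> * pint M p (snd w) powr (1 / p)" unfolding w snd_conv using c0(2)[of a] \<eta> by (intro mult_left_mono) auto
  finally show "\<bar>denergy \<gamma> \<beta> (U n c, D n c) w\<bar> \<le> \<eta> * pint M p (snd w) powr (1 / p)" .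
 qed
qed

text \<open>On the compact image of the sphere the \<open>p\<close>-part of the energy is negative with a margin, which survives a
small decrease of \<open>\<gamma>\<close>, and along rays the power \<open>p\<close> dominates. The constants are independent of \<open>\<gamma>\<close> and \<open>n\<close>,
so the resulting bounds on energies are uniform.\<close>

lemma ray_bound:
 assumes h: "continuous_on (unit_sph k) h" "h ` unit_sph k \<subseteq> coord_space (S n1)"
  and neg: "\<forall>x\<in>unit_sph k. pint M p (D n1 (h x)) < \<rho> * pint M p (U n1 (h x))"
 shows "\<exists>B \<kappa> \<delta>. 0 \<le> B \<and> 0 < \<kappa> \<and> 0 < \<delta> \<and> (\<forall>\<gamma>\<ge>\<rho> - \<delta>. \<forall>n\<ge>n1. \<forall>x\<in>unit_sph k. \<forall>t\<ge>0.
   En n \<gamma> \<beta> (\<lambda>i. t * h x i) \<le> B - \<kappa> * t powr p)"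
proof -
 let ?S = "unit_sph k" and ?A = "\<lambda>x. pint M p (D n1 (h x))" and ?B = "\<lambda>x. pint M p (U n1 (h x))"
 let ?Q = "\<lambda>x. (pint M q (D n1 (h x)) - \<beta> * pint M q (U n1 (h x))) / q"
 have p0: "0 < p" and q0: "0 < q" using p1 q1 by auto
 note c = continuous_on_compose2[OF continuous_pint_UD(1)[of UNIV] h(1)] continuous_on_compose2[OF continuous_pint_UD(2)[of UNIV] h(1)]
  continuous_on_compose2[OF continuous_pint_UD(3)[of UNIV] h(1)] continuous_on_compose2[OF continuous_pint_UD(4)[of UNIV] h(1)]
 have bdd: "\<exists>K. \<forall>x\<in>?S. \<bar>g x\<bar> \<le> K" if "continuous_on ?S g" for g :: "(nat => real) => real"
  using compact_imp_bounded[OF compact_continuous_image[OF that compact_unit_sph]] unfolding bounded_iff by auto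
 have "continuous_on ?S (\<lambda>x. \<bar>?Q x\<bar> + \<bar>f (U n1 (h x))\<bar> + ?B x)" unfolding f_sum
  by (intro continuous_on_add continuous_on_rabs continuous_on_divide continuous_on_diff continuous_on_sum continuous_on_mult continuous_on_const
    continuous_on_product_then_coordinatewise[OF h(1)] c) (use q0 in auto)
 from bdd[OF this] obtain K0 where K0: "\<forall>x\<in>?S. \<bar>\<bar>?Q x\<bar> + \<bar>f (U n1 (h x))\<bar> + ?B x\<bar> \<le> K0" by (rule exE)
 define K where "K = \<bar>K0\<bar>"
 have K: "0 \<le> K" "?Q x \<le> K" "\<bar>f (U n1 (h x))\<bar> \<le> K" "?B x \<le> K" if "x \<in> ?S" for x
  using bspec[OF K0 that] pint_nonneg[of M p "U n1 (h x)"] unfolding K_def by linarith+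
 have "\<exists>\<mu>>0. \<forall>x\<in>?S. \<mu> \<le> \<rho> * ?B x - ?A x"
 proof (cases "?S = {}")
  case True
  thus ?thesis by (intro exI[of _ 1]) auto
 next
  case False
  have "continuous_on ?S (\<lambda>x. \<rho> * ?B x - ?A x)" by (intro continuous_on_diff continuous_on_mult continuous_on_const c) auto
  from continuous_attains_inf[OF compact_unit_sph False this]
  obtain a where a: "a \<in> ?S" "\<forall>x\<in>?S. \<rho> * ?B a - ?A a \<le> \<rho> * ?B x - ?A x" by (rule bexE)
  thus ?thesis using bspec[OF neg a(1)] by (intro exI[of _ "\<rho> * ?B a - ?A a"]) auto
 qed
 then obtain \<mu> where \<mu>: "0 < \<mu>" "\<And>x. x \<in> ?S ==> \<mu> \<le> \<rho> * ?B x - ?A x" by blast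
 define \<kappa> where "\<kappa> = \<mu> / 2 / p"
 have \<kappa>: "0 < \<kappa>" using \<mu> p0 by (simp add: \<kappa>_def)
 have K00: "0 \<le> K" by (simp add: K_def)
 obtain B where B: "B \<ge> 0" "\<And>t. t \<ge> 0 ==> - \<kappa> * t powr p + K * t powr q + K * t \<le> B - \<kappa> / 2 * t powr p"
  using growth_function[OF \<kappa> K00] by blast
 show ?thesis
 proof (rule exI[of _ B], rule exI[of _ "\<kappa> / 2"], rule exI[of _ "\<mu> / (2 * (K + 1))"], intro conjI allI impI ballI B(1))
  show "0 < \<kappa> / 2" "0 < \<mu> / (2 * (K + 1))" using \<kappa> \<mu>(1) K00 by simp_all
  fix \<gamma> n x t assume g: "\<rho> - \<mu> / (2 * (K + 1)) \<le> \<gamma>" and n: "n1 \<le> n" and x: "x \<in> ?S" and t: "0 \<le> (t::real)"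
  have "(\<rho> - \<gamma>) * ?B x \<le> \<mu> / (2 * (K + 1)) * ?B x" using g by (intro mult_right_mono) (auto simp: pint_nonneg)
  also have "\<dots> \<le> \<mu> / (2 * (K + 1)) * (K + 1)" using K(4)[OF x] \<mu>(1) K00 by (intro mult_left_mono) auto
  also have "\<dots> = \<mu> / 2" using K00 by (simp add: field_simps)
  finally have "?A x - \<gamma> * ?B x \<le> - (\<mu> / 2)" using \<mu>(2)[OF x] by (simp add: left_diff_distrib)
  hence "(?A x - \<gamma> * ?B x) / p \<le> - \<kappa>" using p0 unfolding \<kappa>_def minus_divide_left by (intro divide_right_mono) auto
  hence "t powr p * ((?A x - \<gamma> * ?B x) / p) \<le> t powr p * (- \<kappa>)" by (intro mult_left_mono) auto
  moreover have "t powr q * ?Q x \<le> t powr q * K" using K(2)[OF x] by (intro mult_left_mono) auto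
  moreover have "- (t * f (U n1 (h x))) \<le> t * K" using mult_left_mono[of "- f (U n1 (h x))" K t] K(3)[OF x] t by auto
  ultimately have "energy \<gamma> \<beta> (\<lambda>y. t *\<^sub>R U n1 (h x) y, \<lambda>y. t *\<^sub>R D n1 (h x) y) \<le> - \<kappa> * t powr p + K * t powr q + K * t"
   unfolding energy_scale[OF UD_W t] by (simp add: mult.commute)
  moreover have "h x \<in> coord_space (S n1)" using h(2) x by blast
  ultimately show "En n \<gamma> \<beta> (\<lambda>i. t * h x i) \<le> B - \<kappa> / 2 * t powr p"
   using B(2)[OF t] unfolding En_def lincomb_scale by (simp add: lincomb_extend[OF n])
 qed
qed

lemma greatest_sphere_index:
 assumes "P 0" and "\<And>k. P k ==> k \<le> bnd"
 shows "\<exists>k::nat. P k \<and> \<not> P (Suc k)"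
proof (rule ccontr)
 assume "\<not> ?thesis"
 hence "P k" for k by (induction k) (use assms(1) in auto)
 from assms(2)[OF this[of "Suc bnd"]] show False by simp
qed

text \<open>Approximation with \<open>\<gamma> = \<alpha> - \<epsilon>\<close>. The sphere is chosen once, for the level \<open>\<alpha>\<close>, which bounds the energies
above by a constant \<open>B\<close> independent of \<open>\<epsilon>\<close>; the lower bound \<open>m\<close> depends on \<open>\<epsilon>\<close>.\<close>

theorem galerkin_solution_below:
 assumes H: "\<And>u v. eigen_pair \<alpha> u v ==> 0 < pint M q v - \<beta> * pint M q u"
 shows "\<exists>u v. lim_pair u v \<and> (\<forall>n. \<forall>(wu, wv)\<in>W n. pairing M p v wv + pairing M q v wv = \<alpha> * pairing M p u wu + \<beta> * pairing M q u wu + f wu)"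
proof -
 obtain bnd where bnd: "\<forall>n k. sphere_index n k \<alpha> --> k \<le> bnd" using sphere_index_bounded[of \<alpha>] by (rule exE)
 have "\<exists>k. (\<exists>n. sphere_index n k \<alpha>) \<and> \<not> (\<exists>n. sphere_index n (Suc k) \<alpha>)"
  by (rule greatest_sphere_index[where bnd = bnd]) (use bnd sphere_index_zero in blast)+
 then obtain k n1 where idx: "sphere_index n1 k \<alpha>" and noidx: "\<And>n. \<not> sphere_index n (Suc k) \<alpha>" by blast
 obtain h where hc: "continuous_on (unit_sph k) h" and hS: "h ` unit_sph k \<subseteq> coord_space (S n1)" and hodd: "\<And>x. x \<in> unit_sph k ==> h (\<lambda>i. - x i) = (\<lambda>i. - h x i)"
   and hR: "\<forall>x\<in>unit_sph k. pint M p (D n1 (h x)) < \<alpha> * pint M p (U n1 (h x))"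
  using idx unfolding sphere_index_def by (elim exE conjE) blast
 obtain B \<kappa> \<delta> where B: "0 \<le> B" "0 < \<kappa>" "0 < \<delta>" and ray: "\<forall>\<gamma>\<ge>\<alpha> - \<delta>. \<forall>n\<ge>n1. \<forall>x\<in>unit_sph k. \<forall>t\<ge>0. En n \<gamma> \<beta> (\<lambda>i. t * h x i) \<le> B - \<kappa> * t powr p"
  using ray_bound[OF hc hS hR, of \<beta>] by (elim exE conjE)
 show ?thesis
 proof (rule solution_from_critical_points[where \<sigma> = 1 and C = B])
  show "0 < 1 * (pint M q v - \<beta> * pint M q u)" if "eigen_pair \<alpha> u v" for u v using H[OF that] by simp
  fix j :: nat assume j: "0 < j"
  define \<epsilon> where "\<epsilon> = min (1 / real j) \<delta>"
  have \<epsilon>: "0 < \<epsilon>" "\<epsilon> \<le> 1 / real j" "\<epsilon> \<le> \<delta>" using j B by (auto simp: \<epsilon>_def)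
  define n where "n = max j n1"
  have n: "j \<le> n" "n1 \<le> n" by (auto simp: n_def)
  from energy_lower_bound[OF \<epsilon>(1), of \<alpha> \<beta>] obtain m where m: "m \<le> 0" "\<forall>n u v \<gamma>. (u, v) \<in> W n --> \<gamma> \<le> \<alpha> - \<epsilon> --> \<alpha> * pint M p u \<le> pint M p v --> m \<le> energy \<gamma> \<beta> (u, v)"
   by (elim exE conjE)
  have "\<exists>z\<in>W n. m - 2 \<le> energy (\<alpha> - \<epsilon>) \<beta> z \<and> energy (\<alpha> - \<epsilon>) \<beta> z \<le> B \<and> (\<forall>w\<in>W n. \<bar>denergy (\<alpha> - \<epsilon>) \<beta> z w\<bar> \<le> 1 / real j * pint M p (snd w) powr (1 / p))"
  proof (rule linking_in_W[OF hc _ hodd B(2) _ B(1) noidx _ m(1)])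
   show "h ` unit_sph k \<subseteq> coord_space (S n)" using hS coord_space_mono[OF n(2)] by blast
   show "En n (\<alpha> - \<epsilon>) \<beta> (\<lambda>i. t * h x i) \<le> B - \<kappa> * t powr p" if "x \<in> unit_sph k" "0 \<le> t" for x t using ray n(2) that \<epsilon>(3) by simp
   show "m \<le> energy (\<alpha> - \<epsilon>) \<beta> (u, v)" if "(u, v) \<in> W n" "\<alpha> * pint M p u \<le> pint M p v" for u v
    using m(2)[rule_format, OF that(1) order_refl that(2)] .
   show "0 < 1 / real j" using j by simp
  qed
  then obtain z where "z \<in> W n" "energy (\<alpha> - \<epsilon>) \<beta> z \<le> B" "\<forall>w\<in>W n. \<bar>denergy (\<alpha> - \<epsilon>) \<beta> z w\<bar> \<le> 1 / real j * pint M p (snd w) powr (1 / p)" by (elim bexE conjE)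
  hence "critical 1 \<alpha> \<beta> B j n (\<alpha> - \<epsilon>) z" unfolding critical_def using n(1) \<epsilon> by (intro conjI) simp_all
  thus "\<exists>n \<gamma> z. critical 1 \<alpha> \<beta> B j n \<gamma> z" by (intro exI)
 qed simp
qed

text \<open>Approximation with \<open>\<gamma> = \<alpha> + \<epsilon>\<close>. The roles are exchanged: the level \<open>\<alpha> + \<epsilon>0\<close> is fixed, which bounds the
energies below by a constant independent of \<open>\<epsilon>\<close>, and the sphere depends on \<open>\<epsilon>\<close>. Its dimension is one that
occurs at every level above \<open>\<alpha>\<close>, while the next one does not occur at the level \<open>\<alpha> + \<epsilon>0\<close>.\<close>

theorem galerkin_solution_above:
 assumes H: "\<And>u v. eigen_pair \<alpha> u v ==> pint M q v - \<beta> * pint M q u < 0"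
 shows "\<exists>u v. lim_pair u v \<and> (\<forall>n. \<forall>(wu, wv)\<in>W n. pairing M p v wv + pairing M q v wv = \<alpha> * pairing M p u wu + \<beta> * pairing M q u wu + f wu)"
proof -
 obtain bnd where bnd: "\<forall>n k. sphere_index n k (\<alpha> + 1) --> k \<le> bnd" using sphere_index_bounded[of "\<alpha> + 1"] by (rule exE)
 have "\<exists>k. (\<forall>\<epsilon>>0. \<exists>n. sphere_index n k (\<alpha> + \<epsilon>)) \<and> \<not> (\<forall>\<epsilon>>0. \<exists>n. sphere_index n (Suc k) (\<alpha> + \<epsilon>))"
 proof (rule greatest_sphere_index[where bnd = bnd])
  show "\<forall>\<epsilon>>0. \<exists>n. sphere_index n 0 (\<alpha> + \<epsilon>)" using sphere_index_zero by blast
  show "k \<le> bnd" if "\<forall>\<epsilon>>0. \<exists>n. sphere_index n k (\<alpha> + \<epsilon>)" for k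
  proof -
   have "\<exists>n. sphere_index n k (\<alpha> + 1)" by (rule that[rule_format]) simp
   thus ?thesis using bnd by blast
  qed
 qed
 then obtain k \<epsilon>0 where idx: "\<And>\<epsilon>. \<epsilon> > 0 ==> \<exists>n. sphere_index n k (\<alpha> + \<epsilon>)" and \<epsilon>0: "\<epsilon>0 > 0" and noidx: "\<And>n. \<not> sphere_index n (Suc k) (\<alpha> + \<epsilon>0)" by blast
 have \<epsilon>02: "\<epsilon>0 / 2 > 0" using \<epsilon>0 by simp
 from energy_lower_bound[OF \<epsilon>02, of "\<alpha> + \<epsilon>0" \<beta>] obtain m where m: "m \<le> 0"
  "\<forall>n u v \<gamma>. (u, v) \<in> W n --> \<gamma> \<le> \<alpha> + \<epsilon>0 - \<epsilon>0 / 2 --> (\<alpha> + \<epsilon>0) * pint M p u \<le> pint M p v --> m \<le> energy \<gamma> \<beta> (u, v)" by (elim exE conjE)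
 show ?thesis
 proof (rule solution_from_critical_points[where \<sigma> = "-1" and C = "2 - m"])
  show "0 < -1 * (pint M q v - \<beta> * pint M q u)" if "eigen_pair \<alpha> u v" for u v using H[OF that] by simp
  fix j :: nat assume j: "0 < j"
  define \<epsilon> where "\<epsilon> = min (1 / real j) (\<epsilon>0 / 2)"
  have \<epsilon>: "0 < \<epsilon>" "\<epsilon> \<le> 1 / real j" "\<epsilon> \<le> \<epsilon>0 / 2" using j \<epsilon>0 by (auto simp: \<epsilon>_def)
  obtain n1 where "sphere_index n1 k (\<alpha> + \<epsilon>)" using idx[OF \<epsilon>(1)] by blast
  then obtain h where hc: "continuous_on (unit_sph k) h" and hS: "h ` unit_sph k \<subseteq> coord_space (S n1)" and hodd: "\<And>x. x \<in> unit_sph k ==> h (\<lambda>i. - x i) = (\<lambda>i. - h x i)"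
    and hR: "\<forall>x\<in>unit_sph k. pint M p (D n1 (h x)) < (\<alpha> + \<epsilon>) * pint M p (U n1 (h x))"
   unfolding sphere_index_def by (elim exE conjE) blast
  obtain B \<kappa> \<delta> where B: "0 \<le> B" "0 < \<kappa>" "0 < \<delta>" and ray: "\<forall>\<gamma>\<ge>\<alpha> + \<epsilon> - \<delta>. \<forall>n\<ge>n1. \<forall>x\<in>unit_sph k. \<forall>t\<ge>0. En n \<gamma> \<beta> (\<lambda>i. t * h x i) \<le> B - \<kappa> * t powr p"
   using ray_bound[OF hc hS hR, of \<beta>] by (elim exE conjE)
  define n where "n = max j n1"
  have n: "j \<le> n" "n1 \<le> n" by (auto simp: n_def)
  have "\<exists>z\<in>W n. m - 2 \<le> energy (\<alpha> + \<epsilon>) \<beta> z \<and> energy (\<alpha> + \<epsilon>) \<beta> z \<le> B \<and> (\<forall>w\<in>W n. \<bar>denergy (\<alpha> + \<epsilon>) \<beta> z w\<bar> \<le> 1 / real j * pint M p (snd w) powr (1 / p))"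
  proof (rule linking_in_W[OF hc _ hodd B(2) _ B(1) noidx _ m(1)])
   show "h ` unit_sph k \<subseteq> coord_space (S n)" using hS coord_space_mono[OF n(2)] by blast
   show "En n (\<alpha> + \<epsilon>) \<beta> (\<lambda>i. t * h x i) \<le> B - \<kappa> * t powr p" if "x \<in> unit_sph k" "0 \<le> t" for x t using ray n(2) that B(3) by simp
   show "m \<le> energy (\<alpha> + \<epsilon>) \<beta> (u, v)" if "(u, v) \<in> W n" "(\<alpha> + \<epsilon>0) * pint M p u \<le> pint M p v" for u v
    using m(2)[rule_format, OF that(1) _ that(2)] \<epsilon>(3) by simp
   show "0 < 1 / real j" using j by simp
  qed
  then obtain z where "z \<in> W n" "m - 2 \<le> energy (\<alpha> + \<epsilon>) \<beta> z" "\<forall>w\<in>W n. \<bar>denergy (\<alpha> + \<epsilon>) \<beta> z w\<bar> \<le> 1 / real j * pint M p (snd w) powr (1 / p)" by (elim bexE conjE)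
  hence "critical (- 1) \<alpha> \<beta> (2 - m) j n (\<alpha> + \<epsilon>) z" unfolding critical_def using n(1) \<epsilon> by (intro conjI) simp_all
  thus "\<exists>n \<gamma> z. critical (- 1) \<alpha> \<beta> (2 - m) j n \<gamma> z" by (intro exI)
 qed simp
qed

end

section \<open>Smooth functions with compact support\<close>

lemma Ck_on_Suc_D:
 assumes "Ck_on (Suc k) UNIV f"
 shows "f differentiable (at x)" "b \<in> Basis ==> Ck_on k UNIV (\<lambda>x. frechet_derivative f (at x) b)" using assms by auto

lemma Ck_on_mono: "Ck_on (Suc k) UNIV f ==> Ck_on k UNIV (f :: 'a::euclidean_space => real)"
proof (induction k arbitrary: f)
 case 0
 thus ?case by (auto intro!: differentiable_imp_continuous_on simp: differentiable_on_def differentiable_at_withinI)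
next
 case (Suc k)
 thus ?case by (metis Ck_on.simps(2))
qed

lemma frechet_derivative_lincomb:
 assumes "f differentiable (at x)" "g differentiable (at x)"
 shows "frechet_derivative (\<lambda>x. a * f x + b * g x) (at x) = (\<lambda>h. a * frechet_derivative f (at x) h + b * frechet_derivative g (at x) h :: real)"
proof -
 have "(f has_derivative frechet_derivative f (at x)) (at x)" "(g has_derivative frechet_derivative g (at x)) (at x)"
  using assms frechet_derivative_works by blast+
 hence "((\<lambda>x. a * f x + b * g x) has_derivative (\<lambda>h. a * frechet_derivative f (at x) h + b * frechet_derivative g (at x) h)) (at x)"
  by (auto intro!: derivative_eq_intros)
 thus ?thesis by (rule frechet_derivative_at[symmetric])
qed

lemma frechet_derivative_times:
 assumes "f differentiable (at x)" "g differentiable (at x)"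
 shows "frechet_derivative (\<lambda>x. f x * g x) (at x) = (\<lambda>h. f x * frechet_derivative g (at x) h + frechet_derivative f (at x) h * g x :: real)"
proof -
 have "(f has_derivative frechet_derivative f (at x)) (at x)" "(g has_derivative frechet_derivative g (at x)) (at x)"
  using assms frechet_derivative_works by blast+
 hence "((\<lambda>x. f x * g x) has_derivative (\<lambda>h. f x * frechet_derivative g (at x) h + frechet_derivative f (at x) h * g x)) (at x)"
  by (auto intro!: derivative_eq_intros)
 thus ?thesis by (rule frechet_derivative_at[symmetric])
qed

lemma Ck_on_lincomb:
 "Ck_on k UNIV f ==> Ck_on k UNIV g ==> Ck_on k UNIV (\<lambda>x::'a::euclidean_space. a * f x + b * g x)"
proof (induction k arbitrary: f g)
 case 0
 thus ?case by (auto intro!: continuous_intros)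
next
 case (Suc k)
 note d = Ck_on_Suc_D(1)[OF Suc.prems(1)] Ck_on_Suc_D(1)[OF Suc.prems(2)]
 have "(\<lambda>x. a * f x + b * g x) differentiable (at x)" for x using d by (intro derivative_intros) auto
 thus ?case using Suc.IH Suc.prems by (simp add: frechet_derivative_lincomb[OF d])
qed

lemma Ck_on_times:
 "Ck_on k UNIV f ==> Ck_on k UNIV g ==> Ck_on k UNIV (\<lambda>x::'a::euclidean_space. f x * g x)"
proof (induction k arbitrary: f g)
 case 0
 thus ?case by (auto intro!: continuous_intros)
next
 case (Suc k)
 note d = Ck_on_Suc_D(1)[OF Suc.prems(1)] Ck_on_Suc_D(1)[OF Suc.prems(2)]
 have "(\<lambda>x. f x * g x) differentiable (at x)" for x using d by (intro derivative_intros) auto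
 moreover have "Ck_on k UNIV (\<lambda>x. f x * frechet_derivative g (at x) b + frechet_derivative f (at x) b * g x)" if "b \<in> Basis" for b
  using Ck_on_lincomb[OF Suc.IH[OF Ck_on_mono[OF Suc.prems(1)] Ck_on_Suc_D(2)[OF Suc.prems(2) that]]
    Suc.IH[OF Ck_on_Suc_D(2)[OF Suc.prems(1) that] Ck_on_mono[OF Suc.prems(2)]], of 1 1] by simp
 ultimately show ?case by (simp add: frechet_derivative_times[OF d])
qed

lemma Ck_on_const: "Ck_on k UNIV (\<lambda>x::'a::euclidean_space. c)" by (induction k arbitrary: c) auto

lemma Ck_on_prod: "finite B ==> (\<And>b. b \<in> B ==> Ck_on k UNIV (F b)) ==> Ck_on k UNIV (\<lambda>x::'a::euclidean_space. \<Prod>b\<in>B. F b x)"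
 by (induction B rule: finite_induct) (auto intro!: Ck_on_const Ck_on_times)

text \<open>The functions \<open>P (1 / t) * exp (- 1 / t)\<close> with polynomials \<open>P\<close>, extended by 0, are closed under
differentiation. This makes their smoothness an induction over the order.\<close>

definition flat_exp :: "real poly => real => real" where
 "flat_exp P t = (if t \<le> 0 then 0 else poly P (1 / t) * exp (- (1 / t)))"

lemma flat_exp_tendsto_0: "(flat_exp P \<longlongrightarrow> 0) (at 0)"
proof -
 have "((\<lambda>s. poly P s * exp (- s)) \<longlongrightarrow> 0) at_top"
 proof -
  have "((\<lambda>s. \<Sum>i\<le>Polynomial.degree P. Polynomial.coeff P i * (s ^ i / exp s)) \<longlongrightarrow> (\<Sum>i\<le>Polynomial.degree P. Polynomial.coeff P i * 0)) at_top"
   by (intro tendsto_sum tendsto_mult tendsto_const tendsto_power_div_exp_0)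
  moreover have "(\<Sum>i\<le>Polynomial.degree P. Polynomial.coeff P i * (s ^ i / exp s)) = poly P s * exp (- s)" for s :: real
   unfolding poly_altdef sum_distrib_right by (intro sum.cong refl) (simp add: exp_minus field_simps)
  ultimately show ?thesis by simp
 qed
 hence "((\<lambda>t. poly P (inverse t) * exp (- inverse t)) \<longlongrightarrow> 0) (at_right 0)" by (rule filterlim_compose[OF _ filterlim_inverse_at_top_right])
 moreover have "\<forall>\<^sub>F t in at_right (0::real). poly P (inverse t) * exp (- inverse t) = flat_exp P t"
  unfolding eventually_at_filter by (auto simp: flat_exp_def field_simps)
 ultimately have r: "(flat_exp P \<longlongrightarrow> 0) (at_right 0)" by (rule Lim_transform_eventually)
 have "\<forall>\<^sub>F t in at_left (0::real). 0 = flat_exp P t" unfolding eventually_at_filter by (auto simp: flat_exp_def)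
 hence "(flat_exp P \<longlongrightarrow> 0) (at_left 0)" by (rule Lim_transform_eventually[OF tendsto_const])
 with r show ?thesis by (simp add: filterlim_split_at_real)
qed

text \<open>In terms of \<open>s = 1 / t\<close>, the derivative of \<open>P s * exp (- s)\<close> with respect to \<open>t\<close> is \<open>s\<^sup>2 * (P s - P' s) *
exp (- s)\<close>.\<close>

definition flat_deriv :: "real poly => real poly" where
 "flat_deriv P = [:0, 0, 1:] * (P - pderiv P)"

lemma DERIV_flat_exp: "(flat_exp P has_real_derivative flat_exp (flat_deriv P) t) (at t)"
proof -
 consider "t < 0" | "t = 0" | "t > 0" by linarith
 thus ?thesis
 proof cases
  case 1
  have "((\<lambda>_. 0) has_real_derivative 0) (at t)" by simp
  hence "(flat_exp P has_real_derivative 0) (at t)"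
   by (rule has_field_derivative_transform_within_open[of _ _ _ "{..<0}"]) (use 1 in \<open>auto simp: flat_exp_def\<close>)
  thus ?thesis using 1 by (simp add: flat_exp_def)
 next
  case 2
  have "((\<lambda>h. flat_exp ([:0, 1:] * P) h) \<longlongrightarrow> 0) (at 0)" by (rule flat_exp_tendsto_0)
  moreover have "\<forall>\<^sub>F h in at 0. flat_exp ([:0, 1:] * P) h = (flat_exp P (0 + h) - flat_exp P 0) / h"
   unfolding eventually_at_filter by (auto simp: flat_exp_def field_simps)
  ultimately have "((\<lambda>h. (flat_exp P (0 + h) - flat_exp P 0) / h) \<longlongrightarrow> 0) (at 0)" by (rule Lim_transform_eventually)
  thus ?thesis using 2 by (simp add: DERIV_def flat_exp_def)
 next
  case 3
  have "((\<lambda>t. poly P (1 / t) * exp (- (1 / t))) has_real_derivative flat_exp (flat_deriv P) t) (at t)"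
   using 3 by (auto intro!: derivative_eq_intros DERIV_chain2[OF poly_DERIV] simp: flat_exp_def flat_deriv_def field_simps power2_eq_square)
  thus ?thesis by (rule has_field_derivative_transform_within_open[of _ _ _ "{0<..}"]) (use 3 in \<open>auto simp: flat_exp_def\<close>)
 qed
qed

lemma Ck_on_flat_exp_affine: "Ck_on k UNIV (\<lambda>x::'a::euclidean_space. flat_exp P (x \<bullet> v + c))"
proof (induction k arbitrary: P)
 case 0
 have "isCont (flat_exp P) t" for t by (rule DERIV_isCont[OF DERIV_flat_exp])
 hence "continuous_on UNIV (flat_exp P)" by (simp add: continuous_at_imp_continuous_on)
 thus ?case by (auto intro!: continuous_on_compose2[of UNIV "flat_exp P"] continuous_intros)
next
 case (Suc k)
 have D: "((\<lambda>x::'a. flat_exp P (x \<bullet> v + c)) has_derivative (\<lambda>h. flat_exp (flat_deriv P) (x \<bullet> v + c) * (h \<bullet> v))) (at x)" for x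
 proof -
  have 1: "((\<lambda>x::'a. x \<bullet> v + c) has_derivative (\<lambda>h. h \<bullet> v)) (at x)" by (auto intro!: derivative_eq_intros)
  have 2: "(flat_exp P has_derivative (\<lambda>h. flat_exp (flat_deriv P) (x \<bullet> v + c) * h)) (at (x \<bullet> v + c))"
   using DERIV_flat_exp[of P "x \<bullet> v + c"] unfolding has_field_derivative_def by simp
  show ?thesis by (rule has_derivative_compose[OF 1 2])
 qed
 have "(\<lambda>x::'a. flat_exp P (x \<bullet> v + c)) differentiable (at x)" for x using D differentiable_def by blast
 moreover have "frechet_derivative (\<lambda>x::'a. flat_exp P (x \<bullet> v + c)) (at x) b = (b \<bullet> v) * flat_exp (flat_deriv P) (x \<bullet> v + c) + 0 * 0" for x b
  using frechet_derivative_at[OF D, of x] by (metis add.right_neutral mult.commute mult_zero_left)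
 ultimately show ?case using Ck_on_lincomb[OF Suc.IH[of "flat_deriv P"] Ck_on_const[of k 0], of _ 0] by simp
qed

text \<open>As \<open>n\<close> tends to infinity, these smooth functions converge to the indicator function of the open box.\<close>

definition box_bump :: "'a::euclidean_space => 'a => real => 'a => real" where
 "box_bump a b n x = (\<Prod>i\<in>Basis. flat_exp 1 (n * (x \<bullet> i - a \<bullet> i)) * flat_exp 1 (n * (b \<bullet> i - x \<bullet> i)))"

lemma Ck_on_box_bump: "Ck_on k UNIV (box_bump a b n)"
proof -
 have "Ck_on k UNIV (\<lambda>x. \<Prod>i\<in>Basis. flat_exp 1 (x \<bullet> (n *\<^sub>R i) + (- n * (a \<bullet> i))) * flat_exp 1 (x \<bullet> ((- n) *\<^sub>R i) + n * (b \<bullet> i)))"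
  by (intro Ck_on_prod Ck_on_times Ck_on_flat_exp_affine) simp
 moreover have "(\<lambda>x. \<Prod>i\<in>Basis. flat_exp 1 (x \<bullet> (n *\<^sub>R i) + (- n * (a \<bullet> i))) * flat_exp 1 (x \<bullet> ((- n) *\<^sub>R i) + n * (b \<bullet> i))) = box_bump a b n"
  unfolding box_bump_def by (intro ext prod.cong) (auto simp: algebra_simps)
 ultimately show ?thesis by simp
qed

lemma flat_exp_1_bounds: "0 \<le> flat_exp 1 t" "flat_exp 1 t \<le> 1" by (auto simp: flat_exp_def)

lemma box_bump_bounds: "0 \<le> box_bump a b n x" "box_bump a b n x \<le> 1"
 unfolding box_bump_def by (auto intro!: prod_nonneg prod_le_1 mult_le_one simp: flat_exp_1_bounds)

lemma box_bump_outside: "0 < n ==> x \<notin> box a b ==> box_bump a b n x = 0"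
proof -
 assume n: "0 < n" and x: "x \<notin> box a b"
 then obtain i where i: "i \<in> Basis" "x \<bullet> i \<le> a \<bullet> i \<or> b \<bullet> i \<le> x \<bullet> i" by (auto simp: box_def not_less)
 hence "n * (x \<bullet> i - a \<bullet> i) \<le> 0 \<or> n * (b \<bullet> i - x \<bullet> i) \<le> 0" using n by (auto simp: mult_le_0_iff)
 thus ?thesis unfolding box_bump_def using i by (intro prod_zero) (auto simp: flat_exp_def)
qed

lemma box_bump_tendsto: "(\<lambda>n. box_bump a b (real (Suc n)) x) \<longlonglongrightarrow> indicator (box a b) x"
proof (cases "x \<in> box a b")
 case True
 have f: "(\<lambda>n. flat_exp 1 (real (Suc n) * t)) \<longlonglongrightarrow> 1" if "t > 0" for t
 proof -
  have "(\<lambda>n. exp (- (1 / (real (Suc n) * t)))) \<longlonglongrightarrow> 1" using that by real_asymp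
  moreover have "flat_exp 1 (real (Suc n) * t) = exp (- (1 / (real (Suc n) * t)))" for n
  proof -
   have "0 < real (Suc n) * t" using that by (intro mult_pos_pos) auto
   hence "\<not> real (Suc n) * t \<le> 0" by linarith
   thus ?thesis unfolding flat_exp_def by (simp only: if_False poly_1 mult_1)
  qed
  ultimately show ?thesis by simp
 qed
 have "(\<lambda>n. box_bump a b (real (Suc n)) x) \<longlonglongrightarrow> (\<Prod>i\<in>(Basis::'a set). 1 * 1)"
  unfolding box_bump_def by (intro tendsto_prod tendsto_mult f) (use True in \<open>auto simp: box_def\<close>)
 thus ?thesis using True by simp
next
 case False
 thus ?thesis using box_bump_outside[OF _ False] by simp
qed

lemma box_bump_test_function:
 assumes "cbox a b \<subseteq> \<Omega>" "0 < n" shows "box_bump a b n \<in> test_functions \<Omega>"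
proof -
 have "box_bump a b n x = 0" if "x \<notin> cbox a b" for x using box_bump_outside[OF assms(2)] box_subset_cbox[of a b] that by blast
 thus ?thesis unfolding test_functions_def using assms by (auto simp: Ck_on_box_bump intro!: exI[of _ "cbox a b"])
qed

section \<open>Test functions and their gradients\<close>

definition grad :: "('a::euclidean_space => real) => 'a => 'a" where
 "grad \<phi> x = (\<Sum>b\<in>Basis. frechet_derivative \<phi> (at x) b *\<^sub>R b)"

lemma grad_inner_Basis: "b \<in> Basis ==> grad \<phi> x \<bullet> b = frechet_derivative \<phi> (at x) b" by (simp add: grad_def)

lemma test_functions_lincomb:
 assumes "\<phi> \<in> test_functions \<Omega>" "\<psi> \<in> test_functions \<Omega>"
 shows "(\<lambda>x. a * \<phi> x + b * \<psi> x) \<in> test_functions \<Omega>"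
proof -
 obtain K L where "compact K" "K \<subseteq> \<Omega>" "\<forall>x. x \<notin> K --> \<phi> x = 0" "compact L" "L \<subseteq> \<Omega>" "\<forall>x. x \<notin> L --> \<psi> x = 0"
  using assms unfolding test_functions_def by blast
 hence "compact (K \<union> L) \<and> K \<union> L \<subseteq> \<Omega> \<and> (\<forall>x. x \<notin> K \<union> L --> a * \<phi> x + b * \<psi> x = 0)" by auto
 thus ?thesis using assms Ck_on_lincomb unfolding test_functions_def by blast
qed

lemma zero_test_function: "(\<lambda>x. 0) \<in> test_functions \<Omega>" unfolding test_functions_def by (auto intro!: exI[of _ "{}"] Ck_on_const)

lemma test_functionD:
 assumes "\<phi> \<in> test_functions \<Omega>"
 shows "\<phi> differentiable (at x)" "continuous_on UNIV \<phi>" "x \<notin> \<Omega> ==> \<phi> x = 0"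
  "b \<in> Basis ==> (\<lambda>x. frechet_derivative \<phi> (at x) b) \<in> test_functions \<Omega>"
  "(\<phi> has_derivative (\<lambda>h. grad \<phi> x \<bullet> h)) (at x)"
proof -
 have C: "Ck_on k UNIV \<phi>" for k using assms by (auto simp: test_functions_def)
 show d: "\<phi> differentiable (at x)" for x using C[of 1] by auto
 show "continuous_on UNIV \<phi>" using C[of 0] by simp
 obtain K where K: "compact K" "K \<subseteq> \<Omega>" "\<And>x. x \<notin> K ==> \<phi> x = 0" using assms by (auto simp: test_functions_def)
 show "x \<notin> \<Omega> ==> \<phi> x = 0" using K by blast
 have z: "frechet_derivative \<phi> (at x) b = 0" if "x \<notin> K" for x b
 proof -
  have "((\<lambda>_. 0) has_derivative (\<lambda>_. 0)) (at x)" by simp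
  hence "(\<phi> has_derivative (\<lambda>_. 0)) (at x)" by (rule has_derivative_transform_within_open[of _ _ _ UNIV "- K"])
    (use K that in \<open>auto simp: compact_imp_closed open_Compl\<close>)
  thus ?thesis using frechet_derivative_at by metis
 qed
 show "b \<in> Basis ==> (\<lambda>x. frechet_derivative \<phi> (at x) b) \<in> test_functions \<Omega>" unfolding test_functions_def using C[of "Suc _"] z K by auto
 have f: "(\<phi> has_derivative frechet_derivative \<phi> (at x)) (at x)" using d frechet_derivative_works by blast
 have lin: "linear (frechet_derivative \<phi> (at x))" using d linear_frechet_derivative by blast
 have "frechet_derivative \<phi> (at x) h = grad \<phi> x \<bullet> h" for h
 proof -
  have "frechet_derivative \<phi> (at x) h = frechet_derivative \<phi> (at x) (\<Sum>b\<in>Basis. (h \<bullet> b) *\<^sub>R b)" by (simp add: euclidean_representation)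
  also have "\<dots> = (\<Sum>b\<in>Basis. (h \<bullet> b) * frechet_derivative \<phi> (at x) b)" using lin by (simp add: linear_sum linear_cmul)
  also have "\<dots> = grad \<phi> x \<bullet> h" unfolding grad_def inner_sum_left by (intro sum.cong) (auto simp: inner_commute)
  finally show ?thesis .
 qed
 hence "frechet_derivative \<phi> (at x) = (\<lambda>h. grad \<phi> x \<bullet> h)" by blast
 thus "(\<phi> has_derivative (\<lambda>h. grad \<phi> x \<bullet> h)) (at x)" using f by simp
qed

lemma grad_lincomb:
 assumes "\<phi> \<in> test_functions \<Omega>" "\<psi> \<in> test_functions \<Omega>"
 shows "grad (\<lambda>x. a * \<phi> x + b * \<psi> x) = (\<lambda>x. a *\<^sub>R grad \<phi> x + b *\<^sub>R grad \<psi> x)"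
 using frechet_derivative_lincomb[OF test_functionD(1)[OF assms(1)] test_functionD(1)[OF assms(2)]]
 by (simp add: grad_def fun_eq_iff scaleR_add_left sum.distrib scaleR_sum_right)

lemma continuous_on_grad: "\<phi> \<in> test_functions \<Omega> ==> continuous_on UNIV (grad \<phi>)"
 unfolding grad_def[abs_def] using test_functionD(2)[OF test_functionD(4)] by (intro continuous_intros) blast

lemma grad_outside: "\<phi> \<in> test_functions \<Omega> ==> x \<notin> \<Omega> ==> grad \<phi> x = 0" unfolding grad_def
proof (intro sum.neutral ballI)
 fix b :: 'a assume "\<phi> \<in> test_functions \<Omega>" "x \<notin> \<Omega>" "b \<in> Basis"
 hence "frechet_derivative \<phi> (at x) b = 0" using test_functionD(3)[OF test_functionD(4)] by blast
 thus "frechet_derivative \<phi> (at x) b *\<^sub>R b = 0" by simp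
qed

lemma test_function_bounded:
 assumes "\<phi> \<in> test_functions \<Omega>" shows "\<exists>B. \<forall>x. \<bar>\<phi> x\<bar> \<le> B"
proof -
 obtain K where K: "compact K" "\<And>x. x \<notin> K ==> \<phi> x = 0" using assms by (auto simp: test_functions_def)
 have "compact (\<phi> ` K)" using K test_functionD(2)[OF assms] by (intro compact_continuous_image) (auto intro: continuous_on_subset)
 then obtain B where "\<forall>y\<in>\<phi> ` K. norm y \<le> B" using compact_imp_bounded bounded_iff by blast
 hence "\<bar>\<phi> x\<bar> \<le> max B 0" for x using K(2)[of x] by (cases "x \<in> K") (auto simp: le_max_iff_disj)
 thus ?thesis by blast
qed

lemma grad_bounded:
 assumes "\<phi> \<in> test_functions \<Omega>" shows "\<exists>B\<ge>0. \<forall>x. norm (grad \<phi> x) \<le> B"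
proof -
 have "\<forall>b\<in>Basis. \<exists>B. \<forall>x. \<bar>frechet_derivative \<phi> (at x) b\<bar> \<le> B" using test_function_bounded[OF test_functionD(4)[OF assms]] by blast
 from bchoice[OF this] obtain B where B: "\<forall>b\<in>Basis. \<forall>x. \<bar>frechet_derivative \<phi> (at x) b\<bar> \<le> B b" by blast
 have "norm (grad \<phi> x) \<le> (\<Sum>b\<in>Basis. B b)" for x unfolding grad_def by (rule order_trans[OF norm_sum]) (use B in \<open>auto intro!: sum_mono\<close>)
 thus ?thesis using norm_ge_zero order_trans by blast
qed

section \<open>Integrals of test functions\<close>

text \<open>Sobolev functions are integrated over \<open>\<Omega>\<close> with the completed measure, whereas translations and Fubini are
best used with \<open>lborel\<close>. For functions that vanish outside \<open>\<Omega>\<close> there is no difference.\<close>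

lemma lebesgue_on_lborel:
 fixes g :: "'a::euclidean_space => 'c::{banach, second_countable_topology}"
 assumes \<Omega>: "\<Omega> \<in> sets borel" and g: "g \<in> borel_measurable borel" and z: "\<And>x. x \<notin> \<Omega> ==> g x = 0"
 shows "(LINT x|lebesgue_on \<Omega>. g x) = (LINT x|lborel. g x)"
  and "integrable (lebesgue_on \<Omega>) g \<longleftrightarrow> integrable lborel g"
proof -
 have e: "(\<lambda>x. indicat_real \<Omega> x *\<^sub>R g x) = g" using z by (auto simp: indicator_def)
 have \<Omega>': "\<Omega> \<inter> space lebesgue \<in> sets lebesgue" using \<Omega> by auto
 show "(LINT x|lebesgue_on \<Omega>. g x) = (LINT x|lborel. g x)"
  using integral_restrict_space[OF \<Omega>', of g] e integral_completion[of g lborel] g by simp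
 show "integrable (lebesgue_on \<Omega>) g \<longleftrightarrow> integrable lborel g"
  using integrable_restrict_space[OF \<Omega>', of g] e integrable_completion[of g lborel] g by simp
qed

lemma pint_lebesgue_on:
 fixes g :: "'a::euclidean_space => 'c::euclidean_space"
 assumes "\<Omega> \<in> sets borel" "g \<in> borel_measurable borel" "\<And>x. x \<notin> \<Omega> ==> g x = 0"
 shows "pint (lebesgue_on \<Omega>) r g = pint lborel r g" unfolding pint_def by (rule lebesgue_on_lborel(1)[OF assms(1)]) (use assms in auto)

lemma lborel_shift:
 fixes g :: "'a::euclidean_space => 'c::{banach, second_countable_topology}"
 assumes "g \<in> borel_measurable borel"
 shows "(LINT x|lborel. g (x + z)) = (LINT x|lborel. g x)"
  and "integrable lborel (\<lambda>x. g (x + z)) \<longleftrightarrow> integrable lborel g"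
proof -
 have d: "distr lborel borel ((+) z) = (lborel :: 'a measure)" by (rule lborel_distr_plus)
 show "(LINT x|lborel. g (x + z)) = (LINT x|lborel. g x)"
  using integral_distr[of "(+) z" lborel borel g] assms unfolding d by (simp add: add.commute)
 show "integrable lborel (\<lambda>x. g (x + z)) \<longleftrightarrow> integrable lborel g"
  using integrable_distr_eq[of "(+) z" lborel borel g] assms unfolding d by (simp add: add.commute)
qed

lemma bounded_imp_subset_cball:
 fixes S :: "'a::euclidean_space set"
 assumes "bounded S" shows "\<exists>R. S \<subseteq> cball 0 R" using assms unfolding bounded_iff by (auto simp: subset_iff)

lemma integrable_bounded_support:
 fixes g :: "'a::euclidean_space => 'c::{banach, second_countable_topology}"
 assumes g: "g \<in> borel_measurable borel" and S: "bounded S" and z: "\<And>x. x \<notin> S ==> g x = 0" and B: "\<And>x. norm (g x) \<le> B"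
 shows "integrable lborel g"
proof -
 obtain R where R: "S \<subseteq> cball 0 R" using bounded_imp_subset_cball[OF S] by (elim exE)
 show ?thesis
 proof (rule integrableI_bounded_set[where A = "cball 0 R" and B = B])
  show "emeasure lborel (cball (0::'a) R) < \<infinity>" by (rule emeasure_bounded_finite) simp
  show "AE x in lborel. x \<in> cball 0 R --> norm (g x) \<le> B" using B by simp
  show "AE x in lborel. x \<notin> cball 0 R --> g x = 0" using z R by (intro AE_I2) blast
 qed (use g in auto)
qed

lemma measurable_test:
 "\<phi> \<in> test_functions \<Omega> ==> \<phi> \<in> borel_measurable borel" by (intro borel_measurable_continuous_onI test_functionD(2))

lemma measurable_grad:
 "\<phi> \<in> test_functions \<Omega> ==> grad \<phi> \<in> borel_measurable borel" by (intro borel_measurable_continuous_onI continuous_on_grad)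

text \<open>Jensen's inequality, by integrating the inequality for the tangent at the mean.\<close>

lemma weighted_jensen:
 fixes w :: "'a => 'c::euclidean_space"
 assumes p: "1 < p" and k0: "\<And>y. 0 \<le> k y" and k: "integrable M k" "0 < (LINT y|M. k y)"
  and kw: "integrable M (\<lambda>y. k y *\<^sub>R w y)" and kp: "integrable M (\<lambda>y. k y * norm (w y) powr p)"
 shows "norm ((1 / (LINT y|M. k y)) *\<^sub>R (LINT y|M. k y *\<^sub>R w y)) powr p
  \<le> (1 / (LINT y|M. k y)) * (LINT y|M. k y * norm (w y) powr p)"
proof -
 define \<mu> where "\<mu> = (LINT y|M. k y)"
 define a where "a = (1 / \<mu>) *\<^sub>R (LINT y|M. k y *\<^sub>R w y)"
 have \<mu>: "0 < \<mu>" using k by (simp add: \<mu>_def)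
 have i: "integrable M (\<lambda>y. k y * norm a powr p + p * (powmap p a \<bullet> (k y *\<^sub>R w y) - k y * (powmap p a \<bullet> a)))"
  by (intro Bochner_Integration.integrable_add integrable_mult_left integrable_mult_right
    Bochner_Integration.integrable_diff integrable_inner_right k kw)
 have "(LINT y|M. k y * norm a powr p + p * (powmap p a \<bullet> (k y *\<^sub>R w y) - k y * (powmap p a \<bullet> a)))
   = \<mu> * norm a powr p + p * (powmap p a \<bullet> (LINT y|M. k y *\<^sub>R w y) - \<mu> * (powmap p a \<bullet> a))"
  by (simp only: Bochner_Integration.integral_add Bochner_Integration.integral_diff integral_mult_left_zero integral_mult_right_zero
    integral_inner_right k kw \<mu>_def integrable_mult_left integrable_mult_right integrable_inner_right
    Bochner_Integration.integrable_diff)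
 also have "(LINT y|M. k y *\<^sub>R w y) = \<mu> *\<^sub>R a" using \<mu> by (simp add: a_def)
 finally have "(LINT y|M. k y * norm a powr p + p * (powmap p a \<bullet> (k y *\<^sub>R w y) - k y * (powmap p a \<bullet> a))) = \<mu> * norm a powr p" by simp
 moreover have "(LINT y|M. k y * norm a powr p + p * (powmap p a \<bullet> (k y *\<^sub>R w y) - k y * (powmap p a \<bullet> a)))
   \<le> (LINT y|M. k y * norm (w y) powr p)"
 proof (rule integral_mono[OF i kp])
  fix y
  have "k y * (norm a powr p + p * (powmap p a \<bullet> (w y - a))) \<le> k y * norm (w y) powr p"
   by (intro mult_left_mono norm_powr_above_tangent[OF p] k0)
  thus "k y * norm a powr p + p * (powmap p a \<bullet> (k y *\<^sub>R w y) - k y * (powmap p a \<bullet> a)) \<le> k y * norm (w y) powr p"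
   by (simp add: inner_diff_right algebra_simps)
 qed
 ultimately show ?thesis using \<mu> unfolding \<mu>_def[symmetric] a_def[symmetric] by (simp add: field_simps)
qed

lemma integrable_test:
 assumes "bounded \<Omega>" "\<phi> \<in> test_functions \<Omega>" shows "integrable lborel \<phi>"
proof -
 obtain B where B: "\<forall>x. \<bar>\<phi> x\<bar> \<le> B" using test_function_bounded[OF assms(2)] by blast
 show ?thesis by (rule integrable_bounded_support[of _ \<Omega> B]) (use assms B test_functionD(3) measurable_test in auto)
qed

text \<open>Averaging over parallel segments preserves the integral, by Fubini and translation invariance.\<close>

lemma bounded_support_on_segments:
 fixes h :: "'a::euclidean_space => real"
 assumes h[measurable]: "h \<in> borel_measurable borel" and S: "bounded S" and z: "\<And>x. x \<notin> S ==> h x = 0" and B: "\<And>x. norm (h x) \<le> B"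
 shows "integrable lborel (\<lambda>x. LINT t|lborel. indicator {0..1::real} t * h (x + t *\<^sub>R v))"
  and "(LINT x|lborel. LINT t|lborel. indicator {0..1::real} t * h (x + t *\<^sub>R v)) = (LINT x|lborel. h x)"
proof -
 obtain R where R: "S \<subseteq> cball 0 R" using bounded_imp_subset_cball[OF S] by (elim exE)
 let ?f = "\<lambda>(x, t). indicator {0..1::real} t * h (x + t *\<^sub>R v)"
 have i: "integrable (lborel \<Otimes>\<^sub>M lborel) ?f" unfolding lborel_prod
 proof (rule integrable_bounded_support[where S = "cball 0 (R + norm v) \<times> {0..1}" and B = B])
  show "?f y = 0" if y: "y \<notin> cball 0 (R + norm v) \<times> {0..1}" for y
  proof (cases "snd y \<in> {0..1}")
   case True
   have "norm (fst y) \<le> norm (fst y + snd y *\<^sub>R v) + norm (snd y *\<^sub>R v)"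
    using norm_triangle_ineq4[of "fst y + snd y *\<^sub>R v" "snd y *\<^sub>R v"] by simp
   moreover have "norm (snd y *\<^sub>R v) \<le> norm v" using True by (simp add: mult_left_le_one_le)
   moreover have "R + norm v < norm (fst y)" using y True by (cases y) auto
   ultimately have "fst y + snd y *\<^sub>R v \<notin> cball 0 R" by simp
   hence "h (fst y + snd y *\<^sub>R v) = 0" using R by (intro z) blast
   thus ?thesis by (simp add: split_beta)
  qed (simp add: split_beta)
  show "norm (?f y) \<le> B" for y using B[of "fst y + snd y *\<^sub>R v"] by (auto simp: split_beta indicator_def intro: order_trans[OF abs_ge_zero])
 qed (auto intro: bounded_Times simp: borel_prod[symmetric])
 show "integrable lborel (\<lambda>x. LINT t|lborel. indicator {0..1::real} t * h (x + t *\<^sub>R v))" using lborel_pair.integrable_fst'[OF i] by simp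
 show "(LINT x|lborel. LINT t|lborel. indicator {0..1::real} t * h (x + t *\<^sub>R v)) = (LINT x|lborel. h x)"
  using lborel_pair.Fubini_integral[OF i] lborel_shift(1)[OF h] by simp
qed

lemma test_function_increment:
 assumes \<phi>: "\<phi> \<in> test_functions \<Omega>"
 shows "has_bochner_integral lborel (\<lambda>t. indicator {0..1} t * (grad \<phi> (x + t *\<^sub>R z) \<bullet> z)) (\<phi> (x + z) - \<phi> x)"
proof -
 have d: "((\<lambda>t. \<phi> (x + t *\<^sub>R z)) has_real_derivative grad \<phi> (x + t *\<^sub>R z) \<bullet> z) (at t)" for t
 proof -
  have "((\<lambda>t::real. x + t *\<^sub>R z) has_derivative (\<lambda>t. t *\<^sub>R z)) (at t)" by (auto intro!: derivative_eq_intros)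
  from has_derivative_compose[OF this test_functionD(5)[OF \<phi>]] show ?thesis
   unfolding has_field_derivative_def by (simp add: mult_commute_abs)
 qed
 have "continuous_on UNIV (\<lambda>t. grad \<phi> (x + t *\<^sub>R z) \<bullet> z)"
  by (intro continuous_intros continuous_on_compose2[OF continuous_on_grad[OF \<phi>]]) auto
 hence "isCont (\<lambda>t. grad \<phi> (x + t *\<^sub>R z) \<bullet> z) t" for t by (simp add: continuous_on_eq_continuous_at)
 from has_bochner_integral_FTC_Icc_real[OF _ d this, of 0 1] show ?thesis by (simp add: mult.commute)
qed

text \<open>Averaged over segments in the direction \<open>b\<close>, the derivative becomes the increment \<open>\<phi> (x + b) - \<phi> x\<close>, whose
integral is zero by translation invariance.\<close>

lemma integral_partial_derivative_zero:
 assumes \<Omega>: "bounded \<Omega>" and \<phi>: "\<phi> \<in> test_functions \<Omega>" and b: "b \<in> Basis"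
 shows "(LINT x|lborel. frechet_derivative \<phi> (at x) b) = 0"
proof -
 note d = test_functionD(4)[OF \<phi> b]
 obtain B where B: "\<forall>x. \<bar>frechet_derivative \<phi> (at x) b\<bar> \<le> B" using test_function_bounded[OF d] by blast
 have "(LINT x|lborel. frechet_derivative \<phi> (at x) b) = (LINT x|lborel. LINT t|lborel. indicator {0..1::real} t * frechet_derivative \<phi> (at (x + t *\<^sub>R b)) b)"
  by (rule bounded_support_on_segments(2)[OF measurable_test[OF d] \<Omega>, symmetric]) (use B test_functionD(3)[OF d] in auto)
 also have "\<dots> = (LINT x|lborel. \<phi> (x + b) - \<phi> x)"
  using has_bochner_integral_integral_eq[OF test_function_increment[OF \<phi>, of _ b]] by (simp add: grad_inner_Basis[OF b])
 also have "\<dots> = 0" using lborel_shift[OF measurable_test[OF \<phi>]] integrable_test[OF \<Omega> \<phi>] by simp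
 finally show ?thesis .
qed

lemma test_functions_times:
 assumes "\<phi> \<in> test_functions \<Omega>" "\<psi> \<in> test_functions \<Omega>"
 shows "(\<lambda>x. \<phi> x * \<psi> x) \<in> test_functions \<Omega>"
 proof -
 obtain K where K: "compact K" "K \<subseteq> \<Omega>" "\<forall>x. x \<notin> K --> \<phi> x = 0" using assms(1) unfolding test_functions_def by blast
 have "\<forall>k. Ck_on k UNIV (\<lambda>x. \<phi> x * \<psi> x)" using assms unfolding test_functions_def by (blast intro: Ck_on_times)
 thus ?thesis unfolding test_functions_def using K by auto
qed

lemma test_function_is_weak_gradient:
 assumes \<Omega>: "open \<Omega>" "bounded \<Omega>" and \<phi>: "\<phi> \<in> test_functions \<Omega>"
 shows "is_weak_gradient \<Omega> \<phi> (grad \<phi>)" unfolding is_weak_gradient_def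
proof (intro conjI ballI)
 have loc: "locally_integrable \<Omega> g" if "continuous_on UNIV g" for g :: "'a => 'c::euclidean_space" unfolding locally_integrable_def
 proof (intro allI impI)
  fix K assume K: "compact K \<and> K \<subseteq> \<Omega>"
  have "set_integrable lborel K g"
   using K that by (intro borel_integrable_compact[unfolded set_integrable_def[symmetric]]) (auto intro: continuous_on_subset)
  moreover have "K \<in> sets borel" using K by (simp add: compact_imp_closed borel_closed)
  moreover have "g \<in> borel_measurable borel" using that by (rule borel_measurable_continuous_onI)
  ultimately show "integrable (lebesgue_on K) g" by (simp add: integrable_restrict_space set_integrable_def integrable_completion)
 qed
 show "locally_integrable \<Omega> \<phi>" "locally_integrable \<Omega> (grad \<phi>)" using loc test_functionD(2)[OF \<phi>] continuous_on_grad[OF \<phi>] by blast+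
 fix \<psi> b assume \<psi>: "\<psi> \<in> test_functions \<Omega>" and b: "b \<in> (Basis::'a set)"
 have \<Omega>b: "\<Omega> \<in> sets borel" using \<Omega> by simp
 have t1: "(\<lambda>x. \<phi> x * frechet_derivative \<psi> (at x) b) \<in> test_functions \<Omega>" "(\<lambda>x. frechet_derivative \<phi> (at x) b * \<psi> x) \<in> test_functions \<Omega>"
  using test_functions_times[OF \<phi> test_functionD(4)[OF \<psi> b]] test_functions_times[OF test_functionD(4)[OF \<phi> b] \<psi>] by auto
 have "frechet_derivative (\<lambda>x. \<phi> x * \<psi> x) (at x) b = \<phi> x * frechet_derivative \<psi> (at x) b + frechet_derivative \<phi> (at x) b * \<psi> x" for x
  using frechet_derivative_times[OF test_functionD(1)[OF \<phi>] test_functionD(1)[OF \<psi>]] by simp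
 hence "0 = (LINT x|lborel. \<phi> x * frechet_derivative \<psi> (at x) b + frechet_derivative \<phi> (at x) b * \<psi> x)"
  using integral_partial_derivative_zero[OF \<Omega>(2) test_functions_times[OF \<phi> \<psi>] b] by simp
 also have "\<dots> = (LINT x|lborel. \<phi> x * frechet_derivative \<psi> (at x) b) + (LINT x|lborel. frechet_derivative \<phi> (at x) b * \<psi> x)"
  by (intro Bochner_Integration.integral_add integrable_test[OF \<Omega>(2)] t1)
 finally have "(LINT x|lborel. \<phi> x * frechet_derivative \<psi> (at x) b) = - (LINT x|lborel. frechet_derivative \<phi> (at x) b * \<psi> x)" by simp
 moreover have "(LINT x|lebesgue_on \<Omega>. \<phi> x * frechet_derivative \<psi> (at x) b) = (LINT x|lborel. \<phi> x * frechet_derivative \<psi> (at x) b)"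
  using lebesgue_on_lborel(1)[OF \<Omega>b measurable_test[OF t1(1)]] test_functionD(3)[OF t1(1)] by blast
 moreover have "(LINT x|lebesgue_on \<Omega>. frechet_derivative \<phi> (at x) b * \<psi> x) = (LINT x|lborel. frechet_derivative \<phi> (at x) b * \<psi> x)"
  using lebesgue_on_lborel(1)[OF \<Omega>b measurable_test[OF t1(2)]] test_functionD(3)[OF t1(2)] by blast
 ultimately show "(LINT x|lebesgue_on \<Omega>. \<phi> x * frechet_derivative \<psi> (at x) b) = - (LINT x|lebesgue_on \<Omega>. (grad \<phi> x \<bullet> b) * \<psi> x)"
  by (simp add: grad_inner_Basis[OF b])
qed

section \<open>Translation estimate and Poincare inequality\<close>

text \<open>The increment is the integral of the derivative over the segment from \<open>x\<close> to \<open>x + z\<close>; Jensen's inequality is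
applied there and the result is integrated over \<open>x\<close>.\<close>

lemma test_function_translation:
 assumes p: "1 < p" and \<Omega>: "bounded \<Omega>" and \<phi>: "\<phi> \<in> test_functions \<Omega>"
 shows "pint lborel p (\<lambda>x. \<phi> (x + z) - \<phi> x) \<le> norm z powr p * pint lborel p (grad \<phi>)"
proof -
 obtain B where B: "\<And>x. norm (grad \<phi> x) \<le> B" using grad_bounded[OF \<phi>] by blast
 let ?h = "\<lambda>x. norm (grad \<phi> x) powr p" and ?J = "\<lambda>t. indicat_real {0..1} t"
 have [measurable]: "grad \<phi> \<in> borel_measurable borel" by (rule measurable_grad[OF \<phi>])
 have hB: "norm (?h x) \<le> B powr p" for x using B[of x] p by (simp add: powr_mono2)
 have seg: "integrable lborel (\<lambda>x. LINT t|lborel. ?J t * ?h (x + t *\<^sub>R z))"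
  "(LINT x|lborel. LINT t|lborel. ?J t * ?h (x + t *\<^sub>R z)) = pint lborel p (grad \<phi>)"
  using bounded_support_on_segments[where h = ?h and v = z, OF _ \<Omega> _ hB] grad_outside[OF \<phi>] by (auto simp: pint_def)
 have le: "norm (\<phi> (x + z) - \<phi> x) powr p \<le> norm z powr p * (LINT t|lborel. ?J t * ?h (x + t *\<^sub>R z))" for x
 proof -
  let ?v = "LINT t|lborel. ?J t *\<^sub>R grad \<phi> (x + t *\<^sub>R z)"
  have i: "integrable lborel (\<lambda>t. ?J t *\<^sub>R grad \<phi> (x + t *\<^sub>R z))"
   by (rule integrable_bounded_support[of _ "{0..1}" B]) (use B order_trans[OF norm_ge_zero B] in \<open>auto simp: indicator_def\<close>)
  have ih: "integrable lborel (\<lambda>t. ?J t * ?h (x + t *\<^sub>R z))"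
   by (rule integrable_bounded_support[of _ "{0..1}" "B powr p"]) (use hB in \<open>auto simp: indicator_def\<close>)
  have "\<phi> (x + z) - \<phi> x = ?v \<bullet> z"
   using has_bochner_integral_integral_eq[OF test_function_increment[OF \<phi>, of x z]] integral_inner_left[where c = z, OF i] by simp
  hence "norm (\<phi> (x + z) - \<phi> x) powr p \<le> (norm z * norm ?v) powr p"
   using Cauchy_Schwarz_ineq2[of ?v z] p by (intro powr_mono2) (auto simp: mult.commute)
  also have "\<dots> \<le> norm z powr p * (LINT t|lborel. ?J t * ?h (x + t *\<^sub>R z))"
   using weighted_jensen[OF p, of ?J lborel "\<lambda>t. grad \<phi> (x + t *\<^sub>R z)"] i ih by (simp add: powr_mult mult_left_mono)
  finally show ?thesis .
 qed
 have "pint lborel p (\<lambda>x. \<phi> (x + z) - \<phi> x) \<le> (LINT x|lborel. norm z powr p * (LINT t|lborel. ?J t * ?h (x + t *\<^sub>R z)))"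
  unfolding pint_def by (rule integral_mono') (use seg le in auto)
 thus ?thesis using seg by simp
qed

text \<open>A translation by \<open>3 R\<close> makes the supports of \<open>\<phi>\<close> and its translate disjoint, so the translation estimate
bounds \<open>\<phi>\<close> itself.\<close>

lemma poincare_test:
 assumes p: "1 < p" and R: "0 < R" "\<Omega> \<subseteq> cball 0 R" and \<phi>: "\<phi> \<in> test_functions \<Omega>"
 shows "pint lborel p \<phi> \<le> (3 * R) powr p * pint lborel p (grad \<phi>)"
proof -
 have \<Omega>: "bounded \<Omega>" by (rule bounded_subset[OF bounded_cball R(2)])
 obtain b :: 'a where b: "b \<in> Basis" using nonempty_Basis by blast
 let ?z = "(3 * R) *\<^sub>R b"
 have nz: "norm ?z = 3 * R" using R b by simp
 have p0: "0 < p" using p by simp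
 obtain B where B: "\<And>x. \<bar>\<phi> x\<bar> \<le> B" using test_function_bounded[OF \<phi>] by blast
 have m: "\<phi> \<in> borel_measurable borel" by (rule measurable_test[OF \<phi>])
 have mp: "(\<lambda>x. \<bar>\<phi> x\<bar> powr p) \<in> borel_measurable borel" using m by measurable
 have i: "integrable lborel (\<lambda>x. \<bar>\<phi> x\<bar> powr p)" by (rule integrable_bounded_support[OF mp \<Omega>, where B = "B powr p"])
   (use test_functionD(3)[OF \<phi>] B p0 in \<open>auto intro!: powr_mono2\<close>)
 have e: "\<bar>\<phi> (x + ?z) - \<phi> x\<bar> powr p = \<bar>\<phi> (x + ?z)\<bar> powr p + \<bar>\<phi> x\<bar> powr p" for x
 proof -
  have "\<phi> (x + ?z) = 0 \<or> \<phi> x = 0"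
  proof (rule ccontr)
   assume "\<not> ?thesis"
   hence "x + ?z \<in> \<Omega>" "x \<in> \<Omega>" using test_functionD(3)[OF \<phi>] by blast+
   hence "norm (x + ?z) \<le> R" "norm x \<le> R" using R by auto
   hence "norm ?z \<le> 2 * R" using norm_triangle_ineq4[of "x + ?z" x] by simp
   thus False using nz R by simp
  qed
  thus ?thesis using p0 by auto
 qed
 have "pint lborel p \<phi> \<le> pint lborel p \<phi> + pint lborel p \<phi>" using pint_nonneg[of lborel p \<phi>] by simp
 also have "\<dots> = (LINT x|lborel. \<bar>\<phi> (x + ?z)\<bar> powr p) + (LINT x|lborel. \<bar>\<phi> x\<bar> powr p)"
  unfolding pint_def using lborel_shift(1)[OF mp, of ?z] by simp
 also have "\<dots> = pint lborel p (\<lambda>x. \<phi> (x + ?z) - \<phi> x)" unfolding pint_def real_norm_def e using i lborel_shift(2)[OF mp, of ?z] by simp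
 also have "\<dots> \<le> (3 * R) powr p * pint lborel p (grad \<phi>)" using test_function_translation[OF p \<Omega> \<phi>, of ?z] unfolding nz .
 finally show ?thesis .
qed

section \<open>Compactness from uniform translation estimates\<close>

definition lattice_pt :: "nat => 'a::euclidean_space => 'a" where
 "lattice_pt m x = (\<Sum>b\<in>Basis. of_int \<lfloor>real (Suc m) * (x \<bullet> b)\<rfloor> *\<^sub>R b)"

definition same_cell :: "nat => 'a::euclidean_space => 'a => real" where
 "same_cell m x y = indicator {lattice_pt m x} (lattice_pt m y)"

definition cell_average :: "nat => ('a::euclidean_space => 'c::euclidean_space) => 'a => 'c" where
 "cell_average m u x = (1 / (LINT y|lborel. same_cell m x y)) *\<^sub>R (LINT y|lborel. same_cell m x y *\<^sub>R u y)"

lemma lattice_pt_inner: "b \<in> Basis ==> lattice_pt m x \<bullet> b = of_int \<lfloor>real (Suc m) * (x \<bullet> b)\<rfloor>"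
 by (simp add: lattice_pt_def inner_sum_left inner_Basis if_distrib sum.delta cong: if_cong)

lemma countable_lattice: "countable (\<Union>m. range (lattice_pt m :: 'a::euclidean_space => 'a))"
proof -
 have "lattice_pt m x \<in> (\<lambda>g. \<Sum>b\<in>Basis. of_int (g b) *\<^sub>R b) ` (Basis \<rightarrow>\<^sub>E (UNIV :: int set))" for m and x :: 'a
 proof (rule image_eqI)
  show "lattice_pt m x = (\<Sum>b\<in>Basis. of_int (restrict (\<lambda>b. \<lfloor>real (Suc m) * (x \<bullet> b)\<rfloor>) Basis b) *\<^sub>R b)"
   by (simp add: lattice_pt_def del: of_nat_Suc)
 qed auto
 hence "(\<Union>m. range (lattice_pt m :: 'a => 'a)) \<subseteq> (\<lambda>g. \<Sum>b\<in>Basis. of_int (g b) *\<^sub>R b) ` (Basis \<rightarrow>\<^sub>E (UNIV :: int set))" by blast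
 thus ?thesis by (rule countable_subset) (intro countable_image countable_PiE finite_Basis; simp)
qed

lemma measurable_lattice_pt [measurable]: "lattice_pt m \<in> borel_measurable borel" unfolding lattice_pt_def[abs_def] by measurable

lemma measurable_same_cell [measurable]: "(\<lambda>(x, y). same_cell m x y) \<in> borel_measurable (borel \<Otimes>\<^sub>M borel)"
proof -
 have "same_cell m x y = indicator {0} (lattice_pt m y - lattice_pt m x)" for x y :: 'a by (simp add: same_cell_def indicator_def)
 thus ?thesis by simp
qed

lemma same_cell_bounds: "0 \<le> same_cell m x y" "same_cell m x y \<le> 1" by (auto simp: same_cell_def indicator_def)

lemma same_cell_close:
 fixes x y :: "'a::euclidean_space"
 assumes "same_cell m x y \<noteq> 0" shows "norm (y - x) \<le> real DIM('a) / real (Suc m)"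
proof -
 have e: "lattice_pt m x = lattice_pt m y" using assms by (simp add: same_cell_def indicator_def split: if_splits)
 have "\<bar>(y - x) \<bullet> b\<bar> \<le> 1 / real (Suc m)" if b: "b \<in> Basis" for b
 proof -
  have "\<lfloor>real (Suc m) * (x \<bullet> b)\<rfloor> = \<lfloor>real (Suc m) * (y \<bullet> b)\<rfloor>"
   using arg_cong[OF e, of "\<lambda>z. z \<bullet> b"] unfolding lattice_pt_inner[OF b] by (simp only: of_int_eq_iff)
  hence "\<bar>real (Suc m) * (y \<bullet> b) - real (Suc m) * (x \<bullet> b)\<bar> \<le> 1" by linarith
  hence "real (Suc m) * \<bar>(y - x) \<bullet> b\<bar> \<le> 1" by (simp add: inner_diff_left abs_mult flip: right_diff_distrib del: of_nat_Suc)
  thus ?thesis by (simp add: field_simps del: of_nat_Suc)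
 qed
 hence "(\<Sum>b\<in>Basis. \<bar>(y - x) \<bullet> b\<bar>) \<le> (\<Sum>b\<in>(Basis::'a set). 1 / real (Suc m))" by (rule sum_mono)
 thus ?thesis using norm_le_l1[of "y - x"] by simp
qed

lemma cell_volume:
 fixes x :: "'a::euclidean_space"
 shows "integrable lborel (same_cell m x)" "(1 / real (Suc m)) ^ DIM('a) \<le> (LINT y|lborel. same_cell m x y)"
proof -
 let ?s = "real (Suc m)"
 have [measurable]: "same_cell m x \<in> borel_measurable borel" unfolding same_cell_def[abs_def] by measurable
 show i: "integrable lborel (same_cell m x)"
 proof (rule integrable_bounded_support[where S = "cball x (real DIM('a) / ?s)" and B = 1])
  show "same_cell m x y = 0" if "y \<notin> cball x (real DIM('a) / ?s)" for y
   using that same_cell_close[of m x y] by (auto simp: dist_norm norm_minus_commute simp del: of_nat_Suc)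
  show "norm (same_cell m x y) \<le> 1" for y using same_cell_bounds[of m x y] by simp
 qed auto
 let ?a = "(1 / ?s) *\<^sub>R lattice_pt m x"
 let ?B = "box ?a (?a + (1 / ?s) *\<^sub>R One)"
 have in_cell: "lattice_pt m y = lattice_pt m x" if "y \<in> ?B" for y
 proof (rule euclidean_eqI)
  fix b :: 'a assume b: "b \<in> Basis"
  have "?a \<bullet> b < y \<bullet> b" "y \<bullet> b < (?a + (1 / ?s) *\<^sub>R One) \<bullet> b" using that b by (auto simp: mem_box)
  hence "lattice_pt m x \<bullet> b < ?s * (y \<bullet> b)" "?s * (y \<bullet> b) < lattice_pt m x \<bullet> b + 1"
   using b by (simp_all add: inner_add_left field_simps del: of_nat_Suc)
  hence "\<lfloor>?s * (y \<bullet> b)\<rfloor> = \<lfloor>?s * (x \<bullet> b)\<rfloor>" unfolding lattice_pt_inner[OF b] by linarith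
  thus "lattice_pt m y \<bullet> b = lattice_pt m x \<bullet> b" by (simp add: lattice_pt_inner[OF b] del: of_nat_Suc)
 qed
 have "measure lborel ?B = (1 / ?s) ^ DIM('a)" by (subst measure_lborel_box) (simp_all add: inner_add_left prod_constant del: of_nat_Suc)
 moreover have "measure lborel ?B = (LINT y|lborel. indicator ?B y)" by simp
 moreover have "(LINT y|lborel. indicator ?B y) \<le> (LINT y|lborel. same_cell m x y)"
 proof (rule integral_mono'[OF i])
  show "indicat_real ?B y \<le> same_cell m x y" for y using in_cell[of y] by (auto simp: indicator_def same_cell_def)
 qed (rule same_cell_bounds)
 ultimately show "(1 / ?s) ^ DIM('a) \<le> (LINT y|lborel. same_cell m x y)" by simp
qed

lemma cell_volume_inverse:
 fixes x :: "'a::euclidean_space"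
 shows "0 < (LINT y|lborel. same_cell m x y)" "1 / (LINT y|lborel. same_cell m x y) \<le> real (Suc m) ^ DIM('a)"
proof -
 have a: "0 < (1 / real (Suc m)) ^ DIM('a)" by simp
 thus b: "0 < (LINT y|lborel. same_cell m x y)" using cell_volume(2)[of m x] by linarith
 have "1 / (LINT y|lborel. same_cell m x y) \<le> 1 / (1 / real (Suc m)) ^ DIM('a)"
  using cell_volume(2)[of m x] a b by (intro divide_left_mono) auto
 thus "1 / (LINT y|lborel. same_cell m x y) \<le> real (Suc m) ^ DIM('a)" by (simp add: power_one_over del: of_nat_Suc)
qed

lemma measurable_cell_average:
 fixes u :: "'a::euclidean_space => 'c::euclidean_space"
 assumes [measurable]: "u \<in> borel_measurable borel" shows "cell_average m u \<in> borel_measurable borel"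
proof -
 have [measurable]: "(\<lambda>x. LINT y|lborel. same_cell m x y) \<in> borel_measurable borel"
  by (rule lborel.borel_measurable_lebesgue_integral) simp
 have [measurable]: "(\<lambda>x. LINT y|lborel. same_cell m x y *\<^sub>R u y) \<in> borel_measurable borel"
  by (rule lborel.borel_measurable_lebesgue_integral) simp
 show ?thesis unfolding cell_average_def[abs_def] by measurable
qed

lemma cell_jensen:
 fixes u :: "'a::euclidean_space => 'c::euclidean_space"
 assumes p: "1 < p" and u: "u \<in> borel_measurable borel" "\<And>x. norm (u x) \<le> B"
 shows "norm (c - cell_average m u x) powr p \<le> real (Suc m) ^ DIM('a) * (LINT y|lborel. same_cell m x y * norm (c - u y) powr p)"
proof -
 let ?\<mu> = "LINT y|lborel. same_cell m x y"
 note [measurable] = u(1)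
 have [measurable]: "same_cell m x \<in> borel_measurable borel" unfolding same_cell_def[abs_def] by measurable
 have z: "same_cell m x y = 0" if "y \<notin> cball x (real DIM('a) / real (Suc m))" for y
  using that same_cell_close[of m x y] by (auto simp: dist_norm norm_minus_commute simp del: of_nat_Suc)
 have iu: "integrable lborel (\<lambda>y. same_cell m x y *\<^sub>R u y)"
 proof (rule integrable_bounded_support[where S = "cball x (real DIM('a) / real (Suc m))" and B = B])
  show "norm (same_cell m x y *\<^sub>R u y) \<le> B" for y
   using mult_mono[OF same_cell_bounds(2)[of m x y] u(2)[of y]] same_cell_bounds(1)[of m x y] by simp
 qed (use z in auto)
 have ic: "integrable lborel (\<lambda>y. same_cell m x y *\<^sub>R (c - u y))"
  unfolding scaleR_diff_right by (intro Bochner_Integration.integrable_diff integrable_scaleR_left cell_volume iu)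
 have ip: "integrable lborel (\<lambda>y. same_cell m x y * norm (c - u y) powr p)"
 proof (rule integrable_bounded_support[where S = "cball x (real DIM('a) / real (Suc m))" and B = "(norm c + B) powr p"])
  show "norm (same_cell m x y * norm (c - u y) powr p) \<le> (norm c + B) powr p" for y
  proof -
   have "norm (c - u y) \<le> norm c + B" using norm_triangle_ineq4[of c "u y"] u(2)[of y] by linarith
   hence "norm (c - u y) powr p \<le> (norm c + B) powr p" using p by (intro powr_mono2) auto
   thus ?thesis using mult_mono[OF same_cell_bounds(2)[of m x y]] same_cell_bounds(1)[of m x y] by fastforce
  qed
 qed (use z in auto)
 have "(1 / ?\<mu>) *\<^sub>R (LINT y|lborel. same_cell m x y *\<^sub>R (c - u y)) = (1 / ?\<mu>) *\<^sub>R (?\<mu> *\<^sub>R c - (LINT y|lborel. same_cell m x y *\<^sub>R u y))"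
  unfolding scaleR_diff_right
  by (subst Bochner_Integration.integral_diff) (intro integrable_scaleR_left cell_volume iu | simp only: integral_scaleR_left cell_volume scaleR_diff_right)+
 also have "\<dots> = c - cell_average m u x"
  using cell_volume_inverse(1)[of m x] unfolding cell_average_def scaleR_diff_right scaleR_scaleR by simp
 finally have "norm (c - cell_average m u x) powr p \<le> (1 / ?\<mu>) * (LINT y|lborel. same_cell m x y * norm (c - u y) powr p)"
  using weighted_jensen[OF p same_cell_bounds(1) cell_volume(1) cell_volume_inverse(1) ic ip] by simp
 also have "\<dots> \<le> real (Suc m) ^ DIM('a) * (LINT y|lborel. same_cell m x y * norm (c - u y) powr p)"
  by (intro mult_right_mono cell_volume_inverse Bochner_Integration.integral_nonneg)
   (simp add: same_cell_bounds)
 finally show ?thesis .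
qed

lemma integrable_bounded_support_powr:
 fixes g :: "'a::euclidean_space => 'c::euclidean_space"
 assumes p: "0 < p" and g: "g \<in> borel_measurable borel" "\<And>x. norm (g x) \<le> B" and z: "\<And>x. x \<notin> cball 0 R ==> g x = 0"
 shows "integrable lborel (\<lambda>x. norm (g x) powr p)"
proof (rule integrable_bounded_support[where S = "cball 0 R" and B = "B powr p"])
 note [measurable] = g(1)
 show "(\<lambda>x. norm (g x) powr p) \<in> borel_measurable borel" by measurable
 show "norm (norm (g x) powr p) \<le> B powr p" for x using g(2)[of x] p by (auto intro: powr_mono2)
qed (use z p in auto)

text \<open>By Jensen's inequality on a cell the error is bounded by an average of the translation differences with
shifts of at most \<open>\<delta>\<close>, a bound for the diameter of a cell.\<close>

lemma cell_average_close:
 fixes u :: "'a::euclidean_space => 'c::euclidean_space"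
 assumes p: "1 < p" and u: "u \<in> borel_measurable borel" "\<And>x. norm (u x) \<le> B" "\<And>x. x \<notin> cball 0 R ==> u x = 0"
  and L: "0 \<le> L" and tr: "\<And>z. pint lborel p (\<lambda>x. u (x + z) - u x) \<le> L * norm z powr p"
 shows "pdist lborel p u (cell_average m u)
  \<le> measure lborel (cball (0::'a) (real DIM('a))) * L * (real DIM('a) / real (Suc m)) powr p"
proof -
 let ?N = "real DIM('a)" and ?s = "real (Suc m)"
 define \<delta> where "\<delta> = ?N / ?s"
 have \<delta>: "0 \<le> \<delta>" by (simp add: \<delta>_def)
 have p0: "0 < p" using p by simp
 note [measurable] = u(1)
 \<comment> \<open>Integrated over the shift \<open>z\<close>, it bounds the error at \<open>x\<close>; integrated over \<open>x\<close>, it is a translation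
 difference.\<close>
 define F where "F = (\<lambda>x z. indicat_real {..\<delta>} (norm z) * norm (u (x + z) - u x) powr p)"
 have le2: "norm (u y - u x) powr p \<le> (2 * B) powr p" for x y
  using norm_triangle_ineq4[of "u y" "u x"] u(2)[of x] u(2)[of y] p0 by (intro powr_mono2) auto
 have iF: "integrable (lborel \<Otimes>\<^sub>M lborel) (\<lambda>(x, z). F x z)" unfolding lborel_prod
 proof (rule integrable_bounded_support[where S = "cball 0 (R + \<delta>) \<times> cball 0 \<delta>" and B = "(2 * B) powr p"])
  have "(\<lambda>(x, z). F x z) \<in> borel_measurable (borel \<Otimes>\<^sub>M borel)" unfolding F_def by measurable
  thus "(\<lambda>(x, z). F x z) \<in> borel_measurable borel" by (simp only: borel_prod)
  show "bounded (cball (0::'a) (R + \<delta>) \<times> cball (0::'a) \<delta>)" by (intro bounded_Times bounded_cball)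
  show "(case y of (x, z) => F x z) = 0" if "y \<notin> cball 0 (R + \<delta>) \<times> cball 0 \<delta>" for y
  proof -
   obtain x z where y: "y = (x, z)" by force
   show ?thesis
   proof (cases "norm z \<le> \<delta>")
    case True
    hence "R + \<delta> < norm x" using that y by auto
    moreover have "norm x \<le> norm (x + z) + norm z" using norm_triangle_ineq4[of "x + z" z] by simp
    ultimately have "R < norm x" "R < norm (x + z)" using True \<delta> by linarith+
    hence "u x = 0" "u (x + z) = 0" using u(3) by auto
    thus ?thesis by (simp add: y F_def)
   qed (simp add: y F_def)
  qed
  show "norm (case y of (x, z) => F x z) \<le> (2 * B) powr p" for y using le2 by (auto simp: F_def indicator_def split: prod.split)
 qed
 have pt: "norm (u x - cell_average m u x) powr p \<le> ?s ^ DIM('a) * (LINT z|lborel. F x z)" for x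
 proof -
  have "(LINT y|lborel. same_cell m x y * norm (u x - u y) powr p) \<le> (LINT y|lborel. F x (y + - x))"
  proof (rule integral_mono')
   have "integrable lborel (F x)"
   proof (rule integrable_bounded_support[where S = "cball 0 \<delta>" and B = "(2 * B) powr p"])
    show "F x \<in> borel_measurable borel" unfolding F_def by measurable
    show "norm (F x y) \<le> (2 * B) powr p" for y using le2 by (auto simp: F_def indicator_def)
   qed (auto simp: F_def)
   moreover have "F x \<in> borel_measurable borel" unfolding F_def by measurable
   ultimately show "integrable lborel (\<lambda>y. F x (y + - x))" by (simp add: lborel_shift(2)[where z = "- x"] del: add_uminus_conv_diff)
   show "same_cell m x y * norm (u x - u y) powr p \<le> F x (y + - x)" for y
   proof (cases "same_cell m x y = 0")
    case False
    hence "norm (y - x) \<le> \<delta>" unfolding \<delta>_def by (rule same_cell_close)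
    moreover have "same_cell m x y * norm (u x - u y) powr p \<le> norm (u x - u y) powr p"
     by (intro mult_left_le_one_le same_cell_bounds) auto
    ultimately show ?thesis by (simp add: F_def norm_minus_commute[of "u x"])
   qed (simp add: F_def)
   show "0 \<le> F x (y + - x)" for y by (simp add: F_def)
  qed
  also have "\<dots> = (LINT z|lborel. F x z)"
  proof (rule lborel_shift(1))
   show "F x \<in> borel_measurable borel" unfolding F_def by measurable
  qed
  finally have "?s ^ DIM('a) * (LINT y|lborel. same_cell m x y * norm (u x - u y) powr p) \<le> ?s ^ DIM('a) * (LINT z|lborel. F x z)"
   by (intro mult_left_mono) auto
  thus ?thesis using cell_jensen[OF p u(1,2), of "u x" m x] by linarith
 qed
 have "pdist lborel p u (cell_average m u) \<le> (LINT x|lborel. ?s ^ DIM('a) * (LINT z|lborel. F x z))" unfolding pint_def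
 proof (rule integral_mono')
  show "integrable lborel (\<lambda>x. ?s ^ DIM('a) * (LINT z|lborel. F x z))"
   using lborel_pair.integrable_fst[OF iF] by (intro integrable_mult_right) simp
  show "0 \<le> ?s ^ DIM('a) * (LINT z|lborel. F x z)" for x
   by (intro mult_nonneg_nonneg Bochner_Integration.integral_nonneg) (auto simp: F_def)
 qed (rule pt)
 also have "\<dots> = ?s ^ DIM('a) * (LINT z|lborel. LINT x|lborel. F x z)" using lborel_pair.Fubini_integral[OF iF] by simp
 finally have le: "pdist lborel p u (cell_average m u) \<le> ?s ^ DIM('a) * (LINT z|lborel. LINT x|lborel. F x z)" .
 have "(LINT z|lborel. LINT x|lborel. F x z) \<le> (LINT z|lborel. indicator (cball (0::'a) \<delta>) z * (L * \<delta> powr p))"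
 proof (rule integral_mono')
  show "integrable lborel (\<lambda>z. indicator (cball (0::'a) \<delta>) z * (L * \<delta> powr p))"
   by (intro integrable_mult_left integrable_real_indicator emeasure_bounded_finite) auto
  show "(LINT x|lborel. F x z) \<le> indicator (cball 0 \<delta>) z * (L * \<delta> powr p)" for z
  proof -
   have "(LINT x|lborel. F x z) = indicator (cball 0 \<delta>) z * pint lborel p (\<lambda>x. u (x + z) - u x)"
    unfolding F_def pint_def by (simp add: indicator_def)
   also have "\<dots> \<le> indicator (cball 0 \<delta>) z * (L * \<delta> powr p)"
   proof (cases "norm z \<le> \<delta>")
    case True
    hence "norm z powr p \<le> \<delta> powr p" using p by (intro powr_mono2) auto
    hence "L * norm z powr p \<le> L * \<delta> powr p" using L by (rule mult_left_mono)
    thus ?thesis using tr[of z] True by simp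
   qed simp
   finally show ?thesis .
  qed
  show "0 \<le> indicator (cball 0 \<delta>) z * (L * \<delta> powr p)" for z :: 'a using L by simp
 qed
 also have "(LINT z|lborel. indicator (cball (0::'a) \<delta>) z * (L * \<delta> powr p)) = measure lborel (cball (0::'a) \<delta>) * (L * \<delta> powr p)" by simp
 also have "measure lborel (cball (0::'a) \<delta>) = (1 / ?s) ^ DIM('a) * measure lborel (cball (0::'a) ?N)"
  by (simp add: content_cball \<delta>_def power_divide)
 finally have "?s ^ DIM('a) * (LINT z|lborel. LINT x|lborel. F x z) \<le> ?s ^ DIM('a) * ((1 / ?s) ^ DIM('a) * measure lborel (cball (0::'a) ?N) * (L * \<delta> powr p))"
  by (rule mult_left_mono) simp
 with le have "pdist lborel p u (cell_average m u)
   \<le> ?s ^ DIM('a) * ((1 / ?s) ^ DIM('a) * measure lborel (cball (0::'a) ?N) * (L * \<delta> powr p))" by (rule order_trans)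
 also have "\<dots> = measure lborel (cball (0::'a) ?N) * L * \<delta> powr p" by (simp add: power_one_over field_simps del: of_nat_Suc)
 finally show ?thesis by (simp add: \<delta>_def)
qed

lemma cell_average_bound:
 fixes u :: "'a::euclidean_space => 'c::euclidean_space"
 assumes p: "1 < p" and u: "u \<in> borel_measurable borel" "\<And>x. norm (u x) \<le> B" "\<And>x. x \<notin> cball 0 R ==> u x = 0"
 shows "norm (cell_average m u x) powr p \<le> real (Suc m) ^ DIM('a) * pint lborel p u"
  and "x \<notin> cball 0 (R + real DIM('a)) ==> cell_average m u x = 0"
proof -
 have p0: "0 < p" using p by simp
 have "norm (cell_average m u x) powr p \<le> real (Suc m) ^ DIM('a) * (LINT y|lborel. same_cell m x y * norm (u y) powr p)"
  using cell_jensen[OF p u(1,2), of 0 m x] by simp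
 also have "\<dots> \<le> real (Suc m) ^ DIM('a) * pint lborel p u" unfolding pint_def
 proof (intro mult_left_mono integral_mono')
  show "integrable lborel (\<lambda>x. norm (u x) powr p)" by (rule integrable_bounded_support_powr[OF p0 u])
  show "same_cell m x y * norm (u y) powr p \<le> norm (u y) powr p" for y
   using same_cell_bounds[of m x y] by (intro mult_left_le_one_le) auto
 qed auto
 finally show "norm (cell_average m u x) powr p \<le> real (Suc m) ^ DIM('a) * pint lborel p u" .
 assume x: "x \<notin> cball 0 (R + real DIM('a))"
 have "same_cell m x y *\<^sub>R u y = 0" for y
 proof (rule ccontr)
  assume n: "same_cell m x y *\<^sub>R u y \<noteq> 0"
  hence "norm (y - x) \<le> real DIM('a) / real (Suc m)" using same_cell_close[of m x y] by auto
  moreover have "real DIM('a) / real (Suc m) \<le> real DIM('a)" by (simp add: field_simps)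
  moreover have "norm y \<le> R" using n u(3)[of y] by force
  moreover have "norm x \<le> norm y + norm (y - x)" using norm_triangle_ineq4[of y "y - x"] by simp
  ultimately have "norm x \<le> R + real DIM('a)" by linarith
  thus False using x by simp
 qed
 hence "(\<lambda>y. same_cell m x y *\<^sub>R u y) = (\<lambda>y. 0)" by (rule ext)
 thus "cell_average m u x = 0" by (simp only: cell_average_def) simp
qed

text \<open>The criterion of Kolmogorov and Riesz. The cell averages of all scales are determined by countably many
numbers, so they converge along a diagonal subsequence. By the translation estimate they are close to the
functions, uniformly in the sequence.\<close>

lemma translation_compactness:
 fixes u :: "nat => 'a::euclidean_space => 'c::euclidean_space"
 assumes p: "1 < p" and u: "\<And>k. u k \<in> borel_measurable borel" "\<And>k. \<exists>B. \<forall>x. norm (u k x) \<le> B"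
   "\<And>k x. x \<notin> cball 0 R ==> u k x = 0" "\<And>k. pint lborel p (u k) \<le> K"
  and L: "0 \<le> L" and tr: "\<And>k z. pint lborel p (\<lambda>x. u k (x + z) - u k x) \<le> L * norm z powr p"
 shows "\<exists>\<sigma>::nat=>nat. strict_mono \<sigma> \<and>
  (\<forall>e>0. \<exists>N. \<forall>k\<ge>N. \<forall>l\<ge>N. pdist lborel p (u (\<sigma> k)) (u (\<sigma> l)) < e)"
proof -
 have p0: "0 < p" using p by simp
 note [measurable] = u(1) measurable_cell_average[OF u(1)]
 obtain B where "\<forall>k x. norm (u k x) \<le> B k" using choice[of "\<lambda>k B. \<forall>x. norm (u k x) \<le> B"] u(2) by blast
 hence B: "\<And>k x. norm (u k x) \<le> B k" by blast
 have iup: "integrable lborel (\<lambda>x. norm (u k x) powr p)" for k by (rule integrable_bounded_support_powr[OF p0 u(1) B u(3)])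
 have iu: "integrable lborel (u k)" for k by (rule integrable_bounded_support[OF u(1) bounded_cball u(3) B])
 \<comment> \<open>The integral of \<open>u k\<close> over the cell of scale \<open>m\<close> with label \<open>\<xi>\<close>.\<close>
 define F where "F = (\<lambda>k (m, \<xi>). LINT y|lborel. indicat_real {\<xi>} (lattice_pt m y) *\<^sub>R u k y)"
 have Fb: "norm (F k i) \<le> measure lborel (cball (0::'a) R) + K" for k i
 proof -
  obtain m \<xi> where i: "i = (m, \<xi>)" by force
  have "norm (F k i) \<le> (LINT y|lborel. indicat_real (cball 0 R) y + norm (u k y) powr p)" unfolding F_def i prod.case
  proof (rule order_trans[OF Bochner_Integration.integral_norm_bound integral_mono'])
   show "integrable lborel (\<lambda>y. indicat_real (cball 0 R) y + norm (u k y) powr p)"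
    by (intro Bochner_Integration.integrable_add iup integrable_real_indicator emeasure_bounded_finite) auto
   show "norm (indicat_real {\<xi>} (lattice_pt m y) *\<^sub>R u k y) \<le> indicat_real (cball 0 R) y + norm (u k y) powr p" for y
   proof (cases "y \<in> cball 0 R")
    case True
    have "norm (u k y) \<le> 1 + norm (u k y) powr p"
    proof (cases "norm (u k y) \<le> 1")
     case True thus ?thesis by (simp add: add_increasing2)
    next
     case False
     hence "norm (u k y) powr 1 \<le> norm (u k y) powr p" using p by (intro powr_mono) auto
     thus ?thesis using False by simp
    qed
    thus ?thesis using True by (simp add: indicator_def)
   next
    case False thus ?thesis using u(3)[of y k] by simp
   qed
   show "0 \<le> indicat_real (cball 0 R) y + norm (u k y) powr p" for y by simp
  qed
  also have "\<dots> = measure lborel (cball (0::'a) R) + pint lborel p (u k)" unfolding pint_def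
   by (subst Bochner_Integration.integral_add) (auto intro!: iup integrable_real_indicator emeasure_bounded_finite)
  finally show ?thesis using u(4)[of k] by linarith
 qed
 have "countable ((UNIV :: nat set) \<times> (\<Union>m. range (lattice_pt m :: 'a => 'a)))" by (intro countable_SIGMA countable_lattice) simp
 then obtain \<sigma> :: "nat => nat" where \<sigma>: "strict_mono \<sigma>"
  and conv: "\<And>i. i \<in> UNIV \<times> (\<Union>m. range (lattice_pt m)) ==> \<exists>l. (\<lambda>n. F (\<sigma> n) i) \<longlonglongrightarrow> l"
  using function_convergent_subsequence[where f = F, OF _ Fb] by blast
 define A where "A = (\<lambda>m k. cell_average m (u (\<sigma> k)))"
 define w where "w = (\<lambda>m x. lim (\<lambda>k. A m k x))"
 define D where "D = (\<lambda>m. (real (Suc m) ^ DIM('a) * K) powr (1 / p))"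
 have Alim: "(\<lambda>k. A m k x) \<longlonglongrightarrow> w m x" for m x
 proof -
  obtain l where "(\<lambda>k. F (\<sigma> k) (m, lattice_pt m x)) \<longlonglongrightarrow> l" using conv[of "(m, lattice_pt m x)"] by auto
  moreover have "A m k x = (1 / (LINT y|lborel. same_cell m x y)) *\<^sub>R F (\<sigma> k) (m, lattice_pt m x)" for k
   by (simp add: A_def cell_average_def F_def same_cell_def)
  ultimately have "(\<lambda>k. A m k x) \<longlonglongrightarrow> (1 / (LINT y|lborel. same_cell m x y)) *\<^sub>R l" by (auto intro!: tendsto_intros)
  thus ?thesis unfolding w_def by (simp add: limI)
 qed
 have AD: "norm (A m k x) \<le> D m" for m k x
 proof -
  have "norm (A m k x) powr p \<le> real (Suc m) ^ DIM('a) * K" unfolding A_def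
   by (rule order_trans[OF cell_average_bound(1)[OF p u(1) B u(3)] mult_left_mono[OF u(4)]]) auto
  hence "(norm (A m k x) powr p) powr (1 / p) \<le> D m" unfolding D_def using p0 by (intro powr_mono2) auto
  thus ?thesis using p0 by (simp add: powr_powr)
 qed
 have wD: "norm (w m x) \<le> D m" for m x by (rule LIMSEQ_le_const2[OF tendsto_norm[OF Alim]]) (use AD in auto)
 have A0: "A m k x = 0" if "x \<notin> cball 0 (R + real DIM('a))" for m k x unfolding A_def using cell_average_bound(2)[OF p u(1) B u(3) that] .
 have w0: "w m x = 0" if "x \<notin> cball 0 (R + real DIM('a))" for m x using A0[OF that] by (simp add: w_def)
 have [measurable]: "A m k \<in> borel_measurable borel" for m k unfolding A_def by measurable
 have [measurable]: "w m \<in> borel_measurable borel" for m by (rule borel_measurable_LIMSEQ_metric[of "A m"]) (simp_all add: Alim)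
 have uL: "u k \<in> Lspace lborel p" for k unfolding Lspace_def using iup by simp
 have AL: "A m k \<in> Lspace lborel p" for m k
  unfolding Lspace_def using integrable_bounded_support_powr[where g = "A m k", OF p0 _ AD A0] by simp
 have wL: "w m \<in> Lspace lborel p" for m unfolding Lspace_def using integrable_bounded_support_powr[where g = "w m", OF p0 _ wD w0] by simp
 have Aw: "(\<lambda>k. pdist lborel p (A m k) (w m)) \<longlonglongrightarrow> 0" for m
 proof -
  have "(\<lambda>k. LINT x|lborel. norm (A m k x - w m x) powr p) \<longlonglongrightarrow> (LINT x|lborel. (0::'c) \<bullet> w m x)"
  proof (rule integral_dominated_convergence[where w = "\<lambda>x. indicator (cball 0 (R + real DIM('a))) x * (2 * D m) powr p"])
   show "integrable lborel (\<lambda>x. indicator (cball (0::'a) (R + real DIM('a))) x * (2 * D m) powr p)"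
    by (intro integrable_mult_left integrable_real_indicator emeasure_bounded_finite) auto
   show "AE x in lborel. (\<lambda>k. norm (A m k x - w m x) powr p) \<longlonglongrightarrow> 0 \<bullet> w m x"
   proof (intro AE_I2)
    fix x
    have "(\<lambda>k. norm (A m k x - w m x) powr p) \<longlonglongrightarrow> norm (w m x - w m x) powr p" using p0 by (intro tendsto_powr' tendsto_intros Alim) auto
    thus "(\<lambda>k. norm (A m k x - w m x) powr p) \<longlonglongrightarrow> 0 \<bullet> w m x" by simp
   qed
   show "AE x in lborel. norm (norm (A m k x - w m x) powr p) \<le> indicator (cball 0 (R + real DIM('a))) x * (2 * D m) powr p" for k
   proof (intro AE_I2)
    fix x
    have "norm (A m k x - w m x) powr p \<le> (2 * D m) powr p"
     using norm_triangle_ineq4[of "A m k x" "w m x"] AD[of m k x] wD[of m x] p0 by (intro powr_mono2) auto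
    thus "norm (norm (A m k x - w m x) powr p) \<le> indicator (cball 0 (R + real DIM('a))) x * (2 * D m) powr p"
     using A0[of x m k] w0[of x m] by (cases "x \<in> cball 0 (R + real DIM('a))") simp_all
   qed
  qed measurable
  thus ?thesis by (simp add: pint_def)
 qed
 define V where "V = measure lborel (cball (0::'a) (real DIM('a))) * L"
 have close: "pdist lborel p (u (\<sigma> k)) (A m k) \<le> V * (real DIM('a) / real (Suc m)) powr p" for m k
  unfolding A_def V_def by (rule cell_average_close[OF p u(1) B u(3) L tr])
 define C where "C = (2::real) powr p"
 have C1: "1 \<le> C" using p by (simp add: C_def ge_one_powr_ge_zero)
 have tri: "pdist lborel p g h \<le> C * (pdist lborel p g j + pdist lborel p j h)"
  if "g \<in> Lspace lborel p" "h \<in> Lspace lborel p" "j \<in> Lspace lborel p" for g h j :: "'a => 'c"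
  using pint_add_le[OF Lspace_diff[OF that(1,3) p0] Lspace_diff[OF that(3,2) p0] p0] by (simp add: C_def)
 show ?thesis
 proof (intro exI[of _ \<sigma>] conjI \<sigma> allI impI)
  fix e :: real assume e: "0 < e"
  have "(\<lambda>m. V * (real DIM('a) / real (Suc m)) powr p) \<longlonglongrightarrow> V * 0 powr p"
   using p0 by (intro tendsto_intros tendsto_powr' LIMSEQ_Suc[OF lim_const_over_n]) auto
  hence "eventually (\<lambda>m. V * (real DIM('a) / real (Suc m)) powr p < e / (4 * C ^ 2)) sequentially"
   using e C1 by (intro order_tendstoD(2)) auto
  then obtain m where m: "V * (real DIM('a) / real (Suc m)) powr p < e / (4 * C ^ 2)" by (auto dest: eventually_happens)
  have "eventually (\<lambda>k. pdist lborel p (A m k) (w m) < e / (4 * C ^ 2)) sequentially" using e C1 by (intro order_tendstoD(2)[OF Aw]) auto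
  then obtain N where N: "\<And>k. k \<ge> N ==> pdist lborel p (A m k) (w m) < e / (4 * C ^ 2)" by (auto simp: eventually_sequentially)
  have uw: "pdist lborel p (u (\<sigma> k)) (w m) < e / (2 * C)" if "k \<ge> N" for k
  proof -
   have "pdist lborel p (u (\<sigma> k)) (w m) \<le> C * (pdist lborel p (u (\<sigma> k)) (A m k) + pdist lborel p (A m k) (w m))"
    by (rule tri[OF uL wL AL])
   also have "\<dots> < C * (e / (4 * C ^ 2) + e / (4 * C ^ 2))" using close[of k m] m N[OF that] C1 by (intro mult_strict_left_mono) auto
   also have "\<dots> = e / (2 * C)" using C1 by (simp add: field_simps power2_eq_square)
   finally show ?thesis .
  qed
  show "\<exists>N. \<forall>k\<ge>N. \<forall>l\<ge>N. pdist lborel p (u (\<sigma> k)) (u (\<sigma> l)) < e"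
  proof (intro exI[of _ N] allI impI)
   fix k l assume kl: "N \<le> k" "N \<le> l"
   have "pdist lborel p (u (\<sigma> k)) (u (\<sigma> l)) \<le> C * (pdist lborel p (u (\<sigma> k)) (w m) + pdist lborel p (w m) (u (\<sigma> l)))"
    by (rule tri[OF uL uL wL])
   also have "\<dots> < C * (e / (2 * C) + e / (2 * C))"
    using uw[OF kl(1)] uw[OF kl(2)] C1 unfolding pint_minus_commute[of lborel p "w m"] by (intro mult_strict_left_mono) auto
   also have "\<dots> = e" using C1 by simp
   finally show "pdist lborel p (u (\<sigma> k)) (u (\<sigma> l)) < e" .
  qed
 qed
qed

section \<open>Compactness and separability for test functions\<close>

lemma grad_in_Lspace:
 assumes \<Omega>: "bounded \<Omega>" and \<phi>: "\<phi> \<in> test_functions \<Omega>" and p: "0 < p"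
 shows "\<phi> \<in> Lspace lborel p" "grad \<phi> \<in> Lspace lborel p"
proof -
 obtain R where R: "\<Omega> \<subseteq> cball 0 R" using bounded_imp_subset_cball[OF \<Omega>] by (elim exE)
 obtain B where B: "\<And>x. norm (\<phi> x) \<le> B" using test_function_bounded[OF \<phi>] by auto
 obtain D where D: "\<And>x. norm (grad \<phi> x) \<le> D" using grad_bounded[OF \<phi>] by blast
 have "\<phi> x = 0" "grad \<phi> x = 0" if "x \<notin> cball 0 R" for x using that R test_functionD(3)[OF \<phi>] grad_outside[OF \<phi>] by blast+
 thus "\<phi> \<in> Lspace lborel p" "grad \<phi> \<in> Lspace lborel p"
  unfolding Lspace_def using integrable_bounded_support_powr[OF p measurable_test[OF \<phi>] B]
   integrable_bounded_support_powr[OF p measurable_grad[OF \<phi>] D] measurable_test[OF \<phi>] measurable_grad[OF \<phi>] by auto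
qed

lemma test_functions_rellich:
 fixes \<phi> :: "nat => 'a::euclidean_space => real"
 assumes p: "1 < p" and R: "0 < R" "\<Omega> \<subseteq> cball 0 R"
  and \<phi>: "\<And>k. \<phi> k \<in> test_functions \<Omega>" and K: "\<And>k. pint lborel p (grad (\<phi> k)) \<le> K"
 shows "\<exists>\<sigma>::nat=>nat. strict_mono \<sigma> \<and>
  (\<forall>e>0. \<exists>N. \<forall>k\<ge>N. \<forall>l\<ge>N. pdist lborel p (\<phi> (\<sigma> k)) (\<phi> (\<sigma> l)) < e)"
proof (rule translation_compactness[where L = K, OF p])
 have \<Omega>: "bounded \<Omega>" by (rule bounded_subset[OF bounded_cball R(2)])
 show "0 \<le> K" using order_trans[OF pint_nonneg K] by blast
 show "\<phi> k \<in> borel_measurable borel" for k by (rule measurable_test[OF \<phi>])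
 show "\<exists>B. \<forall>x. norm (\<phi> k x) \<le> B" for k using test_function_bounded[OF \<phi>] by simp
 show "\<phi> k x = 0" if "x \<notin> cball 0 R" for k x using that R test_functionD(3)[OF \<phi>] by blast
 show "pint lborel p (\<phi> k) \<le> (3 * R) powr p * K" for k by (rule order_trans[OF poincare_test[OF p R \<phi>] mult_left_mono[OF K]]) simp
 show "pint lborel p (\<lambda>x. \<phi> k (x + z) - \<phi> k x) \<le> K * norm z powr p" for k z
  using order_trans[OF test_function_translation[OF p \<Omega> \<phi>] mult_left_mono[OF K]] by (simp add: mult.commute)
qed

lemma norm_powr_le_sum_Basis:
 fixes v :: "'a::euclidean_space"
 assumes p: "0 < p"
 shows "norm v powr p \<le> real DIM('a) powr p * (\<Sum>b\<in>Basis. \<bar>v \<bullet> b\<bar> powr p)"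
proof -
 define m where "m = Max ((\<lambda>b. \<bar>v \<bullet> b\<bar>) ` Basis)"
 have "m \<in> (\<lambda>b. \<bar>v \<bullet> b\<bar>) ` Basis" unfolding m_def by (intro Max_in) auto
 then obtain b0 where b0: "b0 \<in> Basis" "m = \<bar>v \<bullet> b0\<bar>" by blast
 have m: "\<bar>v \<bullet> b\<bar> \<le> m" if "b \<in> Basis" for b unfolding m_def using that by (intro Max_ge) auto
 have "norm v \<le> (\<Sum>b\<in>Basis. \<bar>v \<bullet> b\<bar>)" by (rule norm_le_l1)
 also have "\<dots> \<le> (\<Sum>b\<in>(Basis::'a set). m)" by (rule sum_mono) (rule m)
 finally have "norm v powr p \<le> (real DIM('a) * m) powr p" using p by (intro powr_mono2) auto
 also have "\<dots> = real DIM('a) powr p * \<bar>v \<bullet> b0\<bar> powr p" by (simp add: powr_mult b0)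
 also have "\<bar>v \<bullet> b0\<bar> powr p \<le> (\<Sum>b\<in>Basis. \<bar>v \<bullet> b\<bar> powr p)" using b0 by (intro member_le_sum) auto
 finally show ?thesis by simp
qed

lemma grad_translation:
 fixes \<phi> :: "'a::euclidean_space => real"
 assumes p: "1 < p" and \<Omega>: "bounded \<Omega>" and \<phi>: "\<phi> \<in> test_functions \<Omega>"
  and K: "\<And>b. b \<in> Basis ==> pint lborel p (grad (\<lambda>x. frechet_derivative \<phi> (at x) b)) \<le> K"
 shows "pint lborel p (\<lambda>x. grad \<phi> (x + z) - grad \<phi> x) \<le> (real DIM('a) powr p * (real DIM('a) * K)) * norm z powr p"
proof -
 have p0: "0 < p" using p by simp
 let ?D = "\<lambda>b x. frechet_derivative \<phi> (at x) b"
 have t: "?D b \<in> test_functions \<Omega>" if "b \<in> Basis" for b using test_functionD(4)[OF \<phi> that] .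
 have sh: "(\<lambda>x. u (x + z)) \<in> Lspace lborel p" if "u \<in> Lspace lborel p" for u :: "'a => real"
 proof -
  have m [measurable]: "u \<in> borel_measurable borel" and i: "integrable lborel (\<lambda>x. norm (u x) powr p)"
   using that unfolding Lspace_def by auto
  have "(\<lambda>x. norm (u x) powr p) \<in> borel_measurable borel" by measurable
  from lborel_shift(2)[OF this, of z] i show ?thesis unfolding Lspace_def by simp
 qed
 have i: "integrable lborel (\<lambda>x. \<bar>?D b (x + z) - ?D b x\<bar> powr p)" if "b \<in> Basis" for b
  using LspaceD(2)[OF Lspace_diff[OF sh[OF grad_in_Lspace(1)[OF \<Omega> t[OF that] p0]] grad_in_Lspace(1)[OF \<Omega> t[OF that] p0] p0]] by simp
 have "pint lborel p (\<lambda>x. grad \<phi> (x + z) - grad \<phi> x)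
   \<le> (LINT x|lborel. real DIM('a) powr p * (\<Sum>b\<in>Basis. \<bar>?D b (x + z) - ?D b x\<bar> powr p))" unfolding pint_def
 proof (rule integral_mono')
  show "integrable lborel (\<lambda>x. real DIM('a) powr p * (\<Sum>b\<in>Basis. \<bar>?D b (x + z) - ?D b x\<bar> powr p))"
   by (intro integrable_mult_right Bochner_Integration.integrable_sum i)
  show "norm (grad \<phi> (x + z) - grad \<phi> x) powr p \<le> real DIM('a) powr p * (\<Sum>b\<in>Basis. \<bar>?D b (x + z) - ?D b x\<bar> powr p)" for x
  proof -
   have "(\<Sum>b\<in>Basis. \<bar>(grad \<phi> (x + z) - grad \<phi> x) \<bullet> b\<bar> powr p) = (\<Sum>b\<in>Basis. \<bar>?D b (x + z) - ?D b x\<bar> powr p)"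
    by (rule sum.cong) (simp_all add: inner_diff_left grad_inner_Basis)
   thus ?thesis using norm_powr_le_sum_Basis[OF p0, of "grad \<phi> (x + z) - grad \<phi> x"] by simp
  qed
 qed (simp add: sum_nonneg)
 also have "\<dots> = real DIM('a) powr p * (\<Sum>b\<in>Basis. pint lborel p (\<lambda>x. ?D b (x + z) - ?D b x))"
  unfolding pint_def by (simp add: Bochner_Integration.integral_sum i)
 also have "\<dots> \<le> real DIM('a) powr p * (\<Sum>b\<in>(Basis::'a set). norm z powr p * K)"
 proof (intro mult_left_mono sum_mono)
  fix b :: 'a assume b: "b \<in> Basis"
  show "pint lborel p (\<lambda>x. ?D b (x + z) - ?D b x) \<le> norm z powr p * K"
   by (rule order_trans[OF test_function_translation[OF p \<Omega> t[OF b]] mult_left_mono[OF K[OF b]]]) simp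
 qed simp
 finally show ?thesis by (simp add: mult_ac)
qed

text \<open>The test functions with gradient and second derivatives bounded by \<open>K\<close> in \<open>L\<^sup>p\<close> have finite nets with
respect to the gradient norm, by the same compactness criterion applied to gradients. The union of such nets
over all integers \<open>K\<close> and all radii \<open>1 / (n + 1)\<close> is countable and dense.\<close>

lemma test_functions_separable:
 fixes \<Omega> :: "'a::euclidean_space set"
 assumes p: "1 < p" and \<Omega>: "bounded \<Omega>"
 shows "\<exists>\<phi>. (\<forall>i::nat. \<phi> i \<in> test_functions \<Omega>) \<and>
  (\<forall>\<psi>\<in>test_functions \<Omega>. \<forall>e>0. \<exists>i. pdist lborel p (grad \<psi>) (grad (\<phi> i)) < e)"
proof -
 obtain R where R: "\<Omega> \<subseteq> cball 0 R" using bounded_imp_subset_cball[OF \<Omega>] by (elim exE)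
 let ?d = "\<lambda>\<phi> \<psi>. pdist lborel p (grad \<phi>) (grad \<psi>)"
 define T where "T = (\<lambda>K. {\<phi>\<in>test_functions \<Omega>. pint lborel p (grad \<phi>) \<le> K \<and>
   (\<forall>b\<in>Basis. pint lborel p (grad (\<lambda>x. frechet_derivative \<phi> (at x) b)) \<le> K)})"
 define good where "good = (\<lambda>K e F. finite F \<and> F \<subseteq> T K \<and> (\<forall>x\<in>T K. \<exists>y\<in>F. ?d x y < e))"
 have net: "\<exists>F. good K e F" if e: "0 < e" for K e unfolding good_def
 proof (rule finite_net)
  fix s :: "nat => 'a => real" assume s: "\<And>n. s n \<in> T K"
  have st: "s n \<in> test_functions \<Omega>" and sK: "pint lborel p (grad (s n)) \<le> K"
   and sb: "b \<in> Basis ==> pint lborel p (grad (\<lambda>x. frechet_derivative (s n) (at x) b)) \<le> K" for n b using s[of n] unfolding T_def by auto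
  have "\<exists>\<sigma>::nat=>nat. strict_mono \<sigma> \<and>
    (\<forall>e>0. \<exists>N. \<forall>k\<ge>N. \<forall>l\<ge>N. pdist lborel p (grad (s (\<sigma> k))) (grad (s (\<sigma> l))) < e)"
  proof (rule translation_compactness[OF p])
   have K0: "0 \<le> K" using order_trans[OF pint_nonneg sK] by blast
   show "grad (s k) \<in> borel_measurable borel" for k by (rule measurable_grad[OF st])
   show "\<exists>B. \<forall>x. norm (grad (s k) x) \<le> B" for k using grad_bounded[OF st] by blast
   show "grad (s k) x = 0" if "x \<notin> cball 0 R" for k x using that R grad_outside[OF st] by blast
   show "pint lborel p (grad (s k)) \<le> K" for k by (rule sK)
   show "pint lborel p (\<lambda>x. grad (s k) (x + z) - grad (s k) x) \<le> (real DIM('a) powr p * (real DIM('a) * K)) * norm z powr p" for k z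
    by (rule grad_translation[OF p \<Omega> st sb])
   show "0 \<le> real DIM('a) powr p * (real DIM('a) * K)" using K0 by simp
  qed
  then obtain \<sigma> :: "nat => nat" where \<sigma>: "strict_mono \<sigma>" and
   c: "\<forall>e>0. \<exists>N. \<forall>k\<ge>N. \<forall>l\<ge>N. ?d (s (\<sigma> k)) (s (\<sigma> l)) < e" by (elim exE conjE)
  obtain N where N: "\<forall>k\<ge>N. \<forall>l\<ge>N. ?d (s (\<sigma> k)) (s (\<sigma> l)) < e" using c[rule_format, OF e] by (rule exE)
  have "?d (s (\<sigma> (Suc N))) (s (\<sigma> N)) < e" using N by simp
  moreover have "\<sigma> N < \<sigma> (Suc N)" using \<sigma> by (simp add: strict_mono_def)
  ultimately show "\<exists>m n. m < n \<and> ?d (s n) (s m) < e" by blast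
 qed
 define F where "F = (\<lambda>K e. SOME F. good K e F)"
 have "good K e (F K e)" if "0 < e" for K e unfolding F_def by (rule someI_ex) (rule net[OF that])
 hence F: "finite (F K e)" "F K e \<subseteq> T K" "x \<in> T K ==> \<exists>y\<in>F K e. ?d x y < e" if "0 < e" for K e x using that unfolding good_def by blast+
 define Q where "Q = insert (\<lambda>x. 0) (\<Union>k::nat. \<Union>n::nat. F (real k) (1 / real (Suc n)))"
 have "countable (F (real k) (1 / real (Suc n)))" for k n by (rule countable_finite[OF F(1)]) simp
 hence "countable Q" unfolding Q_def by (intro countable_insert countable_UN countableI_type)
 hence rQ: "range (from_nat_into Q) = Q" by (intro range_from_nat_into) (auto simp: Q_def)
 show ?thesis
 proof (intro exI[of _ "from_nat_into Q"] conjI allI ballI impI)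
  fix i
  have "F (real k) (1 / real (Suc n)) \<subseteq> test_functions \<Omega>" for k n
   using F(2)[of "1 / real (Suc n)" "real k"] unfolding T_def by (auto simp del: of_nat_Suc)
  hence "Q \<subseteq> test_functions \<Omega>" unfolding Q_def using zero_test_function by auto
  thus "from_nat_into Q i \<in> test_functions \<Omega>" using rQ by blast
 next
  fix \<psi> e assume \<psi>: "\<psi> \<in> test_functions \<Omega>" and e: "0 < (e::real)"
  define K where "K = pint lborel p (grad \<psi>) + (\<Sum>b\<in>Basis. pint lborel p (grad (\<lambda>x. frechet_derivative \<psi> (at x) b)))"
  obtain k :: nat where k: "K \<le> real k" using real_arch_simple by blast
  have "\<psi> \<in> T (real k)" unfolding T_def
  proof (intro CollectI conjI \<psi> ballI)
   show "pint lborel p (grad \<psi>) \<le> real k" using k sum_nonneg[of Basis "\<lambda>b. pint lborel p (grad (\<lambda>x. frechet_derivative \<psi> (at x) b))"]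
    by (simp add: K_def pint_nonneg)
   fix b :: 'a assume "b \<in> Basis"
   hence "pint lborel p (grad (\<lambda>x. frechet_derivative \<psi> (at x) b)) \<le> (\<Sum>b\<in>Basis. pint lborel p (grad (\<lambda>x. frechet_derivative \<psi> (at x) b)))"
    by (intro member_le_sum) (auto simp: pint_nonneg)
   thus "pint lborel p (grad (\<lambda>x. frechet_derivative \<psi> (at x) b)) \<le> real k"
    using k pint_nonneg[of lborel p "grad \<psi>"] by (simp add: K_def)
  qed
  moreover obtain n where n: "1 / real (Suc n) < e" using nat_approx_posE[OF e] by blast
  ultimately obtain y where y: "y \<in> F (real k) (1 / real (Suc n))" "?d \<psi> y < 1 / real (Suc n)"
   using F(3)[of "1 / real (Suc n)" \<psi> "real k"] by (auto simp del: of_nat_Suc)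
  have "y \<in> Q" unfolding Q_def using y(1) by (auto simp del: of_nat_Suc)
  hence "y \<in> range (from_nat_into Q)" by (simp only: rQ)
  then obtain i where "y = from_nat_into Q i" by (elim imageE)
  thus "\<exists>i. ?d \<psi> (from_nat_into Q i) < e" using y n by (intro exI[of _ i]) simp
 qed
qed

section \<open>Extracting a basis from a sequence\<close>

text \<open>Discarding the functions that are combinations of earlier ones leaves an independent family with the same
spans. Keeping the indices avoids a renumbering of the sequence.\<close>

definition fresh_indices :: "(nat => 'a => real) => nat set" where
 "fresh_indices e = {i. \<forall>c. e i \<noteq> lincomb {..<i} e c}"

lemma lincomb_fresh:
 "\<exists>c'. lincomb (fresh_indices e \<inter> {..<n}) e c' = lincomb {..<n} e c"
proof (induction n arbitrary: c)
 case 0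
 thus ?case by (simp add: lincomb_def)
next
 case (Suc n)
 have s: "lincomb {..<Suc n} e c = (\<lambda>x. lincomb {..<n} e c x + c n *\<^sub>R e n x)" by (simp add: lincomb_def)
 show ?case
 proof (cases "n \<in> fresh_indices e")
  case True
  obtain c' where c': "lincomb (fresh_indices e \<inter> {..<n}) e c' = lincomb {..<n} e c" using Suc.IH[of c] by (rule exE)
  have "fresh_indices e \<inter> {..<Suc n} = insert n (fresh_indices e \<inter> {..<n})" using True by (auto simp: less_Suc_eq)
  hence "lincomb (fresh_indices e \<inter> {..<Suc n}) e (c'(n := c n)) = (\<lambda>x. c n *\<^sub>R e n x + lincomb (fresh_indices e \<inter> {..<n}) e (c'(n := c n)) x)"
   by (simp add: lincomb_def)
  also have "lincomb (fresh_indices e \<inter> {..<n}) e (c'(n := c n)) = lincomb (fresh_indices e \<inter> {..<n}) e c'"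
   unfolding lincomb_def by (intro ext sum.cong) auto
  finally show ?thesis unfolding s c' by (intro exI[of _ "c'(n := c n)"]) (simp add: add.commute)
 next
  case False
  then obtain a where a: "e n = lincomb {..<n} e a" by (auto simp: fresh_indices_def)
  have "lincomb {..<Suc n} e c = lincomb {..<n} e (\<lambda>i. 1 * c i + c n * a i)" unfolding s lincomb_linear a[symmetric] by simp
  moreover have "fresh_indices e \<inter> {..<Suc n} = fresh_indices e \<inter> {..<n}" using False by (auto simp: less_Suc_eq)
  ultimately show ?thesis using Suc.IH by simp
 qed
qed

lemma fresh_independent:
 assumes z: "lincomb (fresh_indices e \<inter> {..<n}) e c = (\<lambda>x. 0)" and i: "i \<in> fresh_indices e" "i < n"
 shows "c i = 0"
proof (rule ccontr)
 assume "c i \<noteq> 0"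
 define J where "J = {j \<in> fresh_indices e \<inter> {..<n}. c j \<noteq> 0}"
 define m where "m = Max J"
 have J: "finite J" "i \<in> J" using i \<open>c i \<noteq> 0\<close> by (auto simp: J_def)
 hence m: "m \<in> J" "\<And>j. j \<in> J ==> j \<le> m" unfolding m_def by (auto intro: Max_in Max_ge)
 have e: "(\<Sum>j\<in>J. c j * e j x) = 0" for x
 proof -
  have "(\<Sum>j\<in>J. c j * e j x) = (\<Sum>j\<in>fresh_indices e \<inter> {..<n}. c j * e j x)" by (rule sum.mono_neutral_left) (auto simp: J_def)
  thus ?thesis using fun_cong[OF z, of x] by (simp add: lincomb_def)
 qed
 have "e m x = (\<Sum>j<m. (if j \<in> J then - c j / c m else 0) *\<^sub>R e j x)" for x
 proof -
  have "(\<Sum>j<m. (if j \<in> J then - c j / c m else 0) *\<^sub>R e j x) = (\<Sum>j\<in>J - {m}. (- c j / c m) * e j x)"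
   using m(2) J(1) by (intro sum.mono_neutral_cong_right) (auto simp: less_le)
  also have "\<dots> = - (\<Sum>j\<in>J - {m}. c j * e j x) / c m" by (simp add: sum_divide_distrib sum_negf)
  also have "(\<Sum>j\<in>J - {m}. c j * e j x) = - (c m * e m x)" using e[of x] sum.remove[OF J(1) m(1), of "\<lambda>j. c j * e j x"] by simp
  finally show ?thesis using m(1) by (simp add: J_def)
 qed
 hence "e m = lincomb {..<m} e (\<lambda>j. if j \<in> J then - c j / c m else 0)" by (auto simp: lincomb_def)
 thus False using m(1) by (auto simp: J_def fresh_indices_def)
qed

section \<open>Uniqueness of weak gradients\<close>

lemma integrable_times_test:
 fixes g \<phi> :: "'a::euclidean_space => real"
 assumes \<Omega>: "open \<Omega>" and g: "locally_integrable \<Omega> g" and \<phi>: "\<phi> \<in> test_functions \<Omega>"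
 shows "integrable (lebesgue_on \<Omega>) (\<lambda>x. g x * \<phi> x)"
proof -
 obtain K where K: "compact K" "K \<subseteq> \<Omega>" "\<And>x. x \<notin> K ==> \<phi> x = 0" using \<phi> by (auto simp: test_functions_def)
 obtain B where B: "\<And>x. \<bar>\<phi> x\<bar> \<le> B" using test_function_bounded[OF \<phi>] by blast
 have "integrable (lebesgue_on K) g" using g K by (auto simp: locally_integrable_def)
 hence i: "integrable lebesgue (\<lambda>x. indicator K x *\<^sub>R g x)"
  using K(1) by (subst (asm) integrable_restrict_space) (auto simp: compact_imp_closed)
 have m: "\<phi> \<in> borel_measurable lebesgue" using measurable_test[OF \<phi>] by (simp add: measurable_completion)
 have iB: "integrable lebesgue (\<lambda>x. B * indicator K x *\<^sub>R g x)" using i by (rule integrable_mult_right)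
 have "integrable lebesgue (\<lambda>x. indicator K x *\<^sub>R g x * \<phi> x)"
 proof (rule Bochner_Integration.integrable_bound[OF iB])
  show "(\<lambda>x. indicator K x *\<^sub>R g x * \<phi> x) \<in> borel_measurable lebesgue"
   using borel_measurable_integrable[OF i] m by (rule borel_measurable_times)
  show "AE x in lebesgue. norm (indicator K x *\<^sub>R g x * \<phi> x) \<le> norm (B * indicator K x *\<^sub>R g x)"
   using B by (intro AE_I2) (auto simp: indicator_def abs_mult mult.commute intro!: mult_right_mono order_trans[OF B])
 qed
 moreover have "(\<lambda>x. indicator K x *\<^sub>R g x * \<phi> x) = (\<lambda>x. indicator \<Omega> x *\<^sub>R (g x * \<phi> x))"
  using K(2,3) by (intro ext) (auto simp: indicator_def)
 ultimately have "integrable lebesgue (\<lambda>x. indicator \<Omega> x *\<^sub>R (g x * \<phi> x))" by (simp only:)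
 thus ?thesis using \<Omega> by (subst integrable_restrict_space) auto
qed

text \<open>The bumps are test functions that approximate the indicator function of the box, and dominated convergence
applies.\<close>

lemma integral_zero_on_boxes:
 fixes g :: "'a::euclidean_space => real"
 assumes \<Omega>: "open \<Omega>" and g: "locally_integrable \<Omega> g"
  and z: "\<And>\<phi>. \<phi> \<in> test_functions \<Omega> ==> (LINT x|lebesgue_on \<Omega>. g x * \<phi> x) = 0"
  and ab: "cbox a b \<subseteq> \<Omega>"
 shows "(LINT x|lebesgue. indicator (box a b) x * g x) = 0"
proof -
 have "integrable (lebesgue_on (cbox a b)) g" using g ab by (auto simp: locally_integrable_def)
 hence i: "integrable lebesgue (\<lambda>x. indicator (cbox a b) x *\<^sub>R g x)" by (subst (asm) integrable_restrict_space) auto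
 let ?\<phi> = "\<lambda>n. box_bump a b (real (Suc n))"
 have t: "?\<phi> n \<in> test_functions \<Omega>" for n by (rule box_bump_test_function[OF ab]) simp
 have m: "?\<phi> n \<in> borel_measurable lebesgue" for n using measurable_test[OF t] by (simp add: measurable_completion)
 have out: "?\<phi> n x = 0" if "x \<notin> cbox a b" for n x using box_bump_outside[of "real (Suc n)" x a b] box_subset_cbox[of a b] that by auto
 have "(\<lambda>n. LINT x|lebesgue. indicator (cbox a b) x *\<^sub>R g x * ?\<phi> n x) \<longlonglongrightarrow> (LINT x|lebesgue. indicator (cbox a b) x *\<^sub>R g x * indicator (box a b) x)"
 proof (rule integral_dominated_convergence[where w = "\<lambda>x. \<bar>indicator (cbox a b) x *\<^sub>R g x\<bar>"])
  show "(\<lambda>x. indicat_real (cbox a b) x *\<^sub>R g x * indicat_real (box a b) x) \<in> borel_measurable lebesgue"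
   using borel_measurable_integrable[OF i] by (intro borel_measurable_times borel_measurable_indicator) auto
  show "(\<lambda>x. indicat_real (cbox a b) x *\<^sub>R g x * ?\<phi> n x) \<in> borel_measurable lebesgue" for n
   using borel_measurable_integrable[OF i] m by (rule borel_measurable_times)
  show "integrable lebesgue (\<lambda>x. \<bar>indicat_real (cbox a b) x *\<^sub>R g x\<bar>)" using i by (rule integrable_abs)
  show "AE x in lebesgue. (\<lambda>n. indicat_real (cbox a b) x *\<^sub>R g x * ?\<phi> n x) \<longlonglongrightarrow> indicat_real (cbox a b) x *\<^sub>R g x * indicat_real (box a b) x"
   by (intro AE_I2 tendsto_mult tendsto_const box_bump_tendsto)
  show "AE x in lebesgue. norm (indicat_real (cbox a b) x *\<^sub>R g x * ?\<phi> n x) \<le> \<bar>indicat_real (cbox a b) x *\<^sub>R g x\<bar>" for n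
  proof (intro AE_I2)
   fix x
   show "norm (indicat_real (cbox a b) x *\<^sub>R g x * ?\<phi> n x) \<le> \<bar>indicat_real (cbox a b) x *\<^sub>R g x\<bar>"
    using box_bump_bounds[of a b "real (Suc n)" x] by (simp add: abs_mult mult_left_le del: of_nat_Suc)
  qed
 qed
 moreover have "(LINT x|lebesgue. indicator (cbox a b) x *\<^sub>R g x * ?\<phi> n x) = 0" for n
 proof -
  have "(\<lambda>x. indicator (cbox a b) x *\<^sub>R g x * ?\<phi> n x) = (\<lambda>x. indicator \<Omega> x *\<^sub>R (g x * ?\<phi> n x))"
   using out[of _ n] ab by (intro ext) (auto simp: indicator_def)
  hence "(LINT x|lebesgue. indicator (cbox a b) x *\<^sub>R g x * ?\<phi> n x) = (LINT x|lebesgue_on \<Omega>. g x * ?\<phi> n x)"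
   using \<Omega> by (subst integral_restrict_space) auto
  thus ?thesis using z[OF t[of n]] by simp
 qed
 moreover have "(\<lambda>x. indicator (cbox a b) x *\<^sub>R g x * indicator (box a b) x) = (\<lambda>x. indicator (box a b) x * g x)"
  using box_subset_cbox[of a b] by (intro ext) (auto simp: indicator_def)
 ultimately show ?thesis by (simp only: LIMSEQ_const_iff)
qed

text \<open>The fundamental lemma of the calculus of variations. The integrals over boxes vanish; since boxes are stable
under intersections and generate the Borel sets, the integrals over all Borel sets vanish.\<close>

lemma zero_if_orthogonal_to_test_functions:
 fixes g :: "'a::euclidean_space => real"
 assumes \<Omega>: "open \<Omega>" and g: "locally_integrable \<Omega> g"
  and z: "\<And>\<phi>. \<phi> \<in> test_functions \<Omega> ==> (LINT x|lebesgue_on \<Omega>. g x * \<phi> x) = 0"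
 shows "AE x in lebesgue_on \<Omega>. g x = 0"
proof -
 have box0: "AE x in lebesgue. x \<in> cbox a b --> g x = 0" if ab: "cbox a b \<subseteq> \<Omega>" for a b
 proof -
  define G where "G = (\<lambda>x. indicator (box a b) x * g x)"
  have "integrable (lebesgue_on (cbox a b)) g" using g ab by (auto simp: locally_integrable_def)
  hence i0: "integrable lebesgue (\<lambda>x. indicator (cbox a b) x *\<^sub>R g x)" by (subst (asm) integrable_restrict_space) auto
  have "integrable lebesgue (\<lambda>x. indicator (box a b) x *\<^sub>R (indicator (cbox a b) x *\<^sub>R g x))"
   by (rule integrable_mult_indicator[OF _ i0]) auto
  moreover have "indicator (box a b) x *\<^sub>R (indicator (cbox a b) x *\<^sub>R g x) = G x" for x
   using box_subset_cbox[of a b] by (auto simp: indicator_def G_def)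
  ultimately have iG: "integrable lebesgue G" by simp
  \<comment> \<open>A Borel representative is needed for the argument with generators of the Borel sets.\<close>
  obtain h where h: "h \<in> borel_measurable lborel" "AE x in lborel. G x = h x"
   using completion_ex_borel_measurable_real[OF borel_measurable_integrable[OF iG]] by blast
  have Gh: "AE x in lebesgue. G x = h x" using h(2) by (rule AE_completion)
  have hm: "h \<in> borel_measurable lebesgue" using h(1) by (simp add: measurable_completion)
  have ihl: "integrable lebesgue h" by (rule integrable_cong_AE_imp[OF iG hm]) (use Gh in auto)
  hence ih: "integrable lborel h" using integrable_completion[OF h(1)] by simp
  have ic: "(LINT x|lborel. indicator A x *\<^sub>R h x) = (LINT x|lebesgue. indicator A x * G x)" if A: "A \<in> sets borel" for A
  proof -
   have "(LINT x|lborel. indicator A x *\<^sub>R h x) = (LINT x|lebesgue. indicator A x *\<^sub>R h x)"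
    by (rule integral_completion[symmetric]) (use h(1) A in measurable)
   also have "\<dots> = (LINT x|lebesgue. indicator A x * G x)"
   proof (rule integral_cong_AE)
    have Al: "A \<in> sets lebesgue" using A by auto
    show "(\<lambda>x. indicat_real A x *\<^sub>R h x) \<in> borel_measurable lebesgue" using hm Al by measurable
    show "(\<lambda>x. indicat_real A x * G x) \<in> borel_measurable lebesgue" using borel_measurable_integrable[OF iG] Al by measurable
   qed (use Gh in auto)
   finally show ?thesis .
  qed
  have A0: "(LINT x|lborel. indicator A x *\<^sub>R h x) = 0" if "A \<in> sets borel" for A
  proof -
   let ?B = "range (\<lambda>(a, b). box a b :: 'a set)"
   have ii: "integrable lborel (\<lambda>x. indicator A x *\<^sub>R h x)" if "A \<in> sets borel" for A :: "'a set"
    by (rule integrable_mult_indicator[OF _ ih]) (use that in simp)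
   have "Int_stable ?B" by (auto simp: Int_stable_def box_Int_box)
   moreover have "?B \<subseteq> Pow UNIV" by auto
   moreover have "A \<in> sigma_sets UNIV ?B" using that unfolding borel_eq_box by simp
   ultimately show ?thesis
   proof (induction rule: sigma_sets_induct_disjoint)
    case (basic A)
    then obtain c d where A: "A = box c d" by auto
    define a' b' where "a' = (\<Sum>i\<in>Basis. max (c \<bullet> i) (a \<bullet> i) *\<^sub>R i)" and "b' = (\<Sum>i\<in>Basis. min (d \<bullet> i) (b \<bullet> i) *\<^sub>R i)"
    have ab': "box c d \<inter> box a b = box a' b'" by (simp add: box_Int_box a'_def b'_def)
    have "(LINT x|lborel. indicator A x *\<^sub>R h x) = (LINT x|lebesgue. indicator A x * G x)" by (rule ic) (simp add: A)
    also have "\<dots> = (LINT x|lebesgue. indicator (box a' b') x * g x)"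
     by (rule Bochner_Integration.integral_cong) (auto simp: A G_def ab'[symmetric] indicator_def)
    also have "\<dots> = 0"
    proof (cases "box a' b' = {}")
     case False
     hence "cbox a' b' = closure (box a' b')" by (simp add: closure_box)
     also have "\<dots> \<subseteq> cbox a b" using ab' box_subset_cbox[of a b] by (intro closure_minimal) auto
     finally show ?thesis using integral_zero_on_boxes[OF \<Omega> g z] ab by blast
    qed simp
    finally show ?case .
   next
    case empty
    thus ?case by simp
   next
    case (compl A)
    have Ab: "A \<in> sets borel" using compl(1) unfolding borel_eq_box by simp
    have U: "(LINT x|lborel. h x) = 0"
    proof -
     have "(LINT x|lborel. h x) = (LINT x|lborel. indicator UNIV x *\<^sub>R h x)" by simp
     also have "\<dots> = (LINT x|lebesgue. indicator (box a b) x * g x)" by (subst ic) (simp_all add: G_def)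
     also have "\<dots> = 0" by (rule integral_zero_on_boxes[OF \<Omega> g z ab])
     finally show ?thesis .
    qed
    have "(LINT x|lborel. indicator (UNIV - A) x *\<^sub>R h x) = (LINT x|lborel. h x - indicator A x *\<^sub>R h x)"
     by (rule Bochner_Integration.integral_cong) (auto simp: indicator_def)
    also have "\<dots> = (LINT x|lborel. h x) - (LINT x|lborel. indicator A x *\<^sub>R h x)"
     by (rule Bochner_Integration.integral_diff[OF ih ii[OF Ab]])
    also have "\<dots> = 0" using U compl(2) by simp
    finally show ?case .
   next
    case (union A)
    have Ab: "A i \<in> sets borel" for i
    proof -
     have "A i \<in> sigma_sets UNIV ?B" using union(2) by blast
     thus ?thesis unfolding borel_eq_box by simp
    qed
    have "(LINT x:(\<Union>i. A i)|lborel. h x) = suminf (\<lambda>i. LINT x:A i|lborel. h x)"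
    proof (rule lebesgue_integral_countable_add)
     show "A i \<in> sets lborel" for i using Ab by simp
     show "A i \<inter> A j = {}" if "i \<noteq> j" for i j using union(1) that by (auto simp: disjoint_family_on_def)
     show "set_integrable lborel (\<Union>i. A i) h" unfolding set_integrable_def using Ab by (intro ii) auto
    qed
    thus ?case using union(3) by (simp add: set_lebesgue_integral_def)
   qed
  qed
  have "AE x in lborel. h x = 0" by (rule density_unique_real[OF ih]) (use A0 in \<open>auto simp: set_lebesgue_integral_def\<close>)
  hence "AE x in lebesgue. h x = 0" by (rule AE_completion)
  moreover have "AE x in lebesgue. x \<notin> cbox a b - box a b"
   using negligible_frontier_interval[of a b] by (intro AE_not_in) (simp add: negligible_iff_null_sets)
  ultimately show ?thesis using Gh
  proof eventually_elim
   case (elim x)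
   thus ?case by (auto simp: G_def indicator_def split: if_splits)
  qed
 qed
 obtain D where D: "countable D" "D \<subseteq> Pow \<Omega>" "\<And>X. X \<in> D ==> \<exists>a b. X = cbox a b" "\<Union>D = \<Omega>"
  by (rule open_countable_Union_open_cbox[OF \<Omega>]) (rule that; assumption)
 have "AE x in lebesgue. \<forall>X\<in>D. x \<in> X --> g x = 0"
 proof (subst AE_ball_countable[OF D(1)], rule ballI)
  fix X assume X: "X \<in> D"
  then obtain a b where "X = cbox a b" using D(3) by blast
  thus "AE x in lebesgue. x \<in> X --> g x = 0" using box0[of a b] X D(2) by blast
 qed
 hence "AE x in lebesgue. x \<in> \<Omega> --> g x = 0"
 proof eventually_elim
  case (elim x)
  show ?case
  proof
   assume "x \<in> \<Omega>"
   then obtain X where "X \<in> D" "x \<in> X" using D(4) by auto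
   thus "g x = 0" using elim by blast
  qed
 qed
 thus ?thesis using \<Omega> by (subst AE_restrict_space_iff) auto
qed

lemma weak_gradient_unique:
 assumes \<Omega>: "open \<Omega>" and G: "is_weak_gradient \<Omega> u G" "is_weak_gradient \<Omega> u H"
 shows "AE x in lebesgue_on \<Omega>. G x = H x"
proof -
 have "AE x in lebesgue_on \<Omega>. G x \<bullet> b - H x \<bullet> b = 0" if b: "b \<in> Basis" for b
 proof (rule zero_if_orthogonal_to_test_functions[OF \<Omega>])
  have l: "locally_integrable \<Omega> (\<lambda>x. G x \<bullet> b)" "locally_integrable \<Omega> (\<lambda>x. H x \<bullet> b)"
   using G by (auto simp: is_weak_gradient_def locally_integrable_def)
  thus "locally_integrable \<Omega> (\<lambda>x. G x \<bullet> b - H x \<bullet> b)" by (auto simp: locally_integrable_def)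
  fix \<phi> assume \<phi>: "\<phi> \<in> test_functions \<Omega>"
  have "(LINT x|lebesgue_on \<Omega>. (G x \<bullet> b) * \<phi> x) = (LINT x|lebesgue_on \<Omega>. (H x \<bullet> b) * \<phi> x)"
  proof -
   have "(LINT x|lebesgue_on \<Omega>. u x * frechet_derivative \<phi> (at x) b) = - (LINT x|lebesgue_on \<Omega>. (G x \<bullet> b) * \<phi> x)"
    using G(1) \<phi> b unfolding is_weak_gradient_def by blast
   moreover have "(LINT x|lebesgue_on \<Omega>. u x * frechet_derivative \<phi> (at x) b) = - (LINT x|lebesgue_on \<Omega>. (H x \<bullet> b) * \<phi> x)"
    using G(2) \<phi> b unfolding is_weak_gradient_def by blast
   ultimately show ?thesis by simp
  qed
  thus "(LINT x|lebesgue_on \<Omega>. (G x \<bullet> b - H x \<bullet> b) * \<phi> x) = 0"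
   using integrable_times_test[OF \<Omega> l(1) \<phi>] integrable_times_test[OF \<Omega> l(2) \<phi>] by (simp add: left_diff_distrib)
 qed
 hence "AE x in lebesgue_on \<Omega>. \<forall>b\<in>Basis. G x \<bullet> b - H x \<bullet> b = 0" by (subst AE_ball_countable) (auto intro: countable_finite)
 thus ?thesis by eventually_elim (auto intro: euclidean_eqI)
qed

text \<open>Any convenient weak gradient can be used in place of the one selected by \<open>SOME\<close>.\<close>

lemma weak_grad_eq:
 assumes \<Omega>: "open \<Omega>" and G: "is_weak_gradient \<Omega> u G"
 shows "is_weak_gradient \<Omega> u (weak_grad \<Omega> u)" "AE x in lebesgue_on \<Omega>. weak_grad \<Omega> u x = G x"
proof -
 show "is_weak_gradient \<Omega> u (weak_grad \<Omega> u)" unfolding weak_grad_def by (rule someI[of "is_weak_gradient \<Omega> u", OF G])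
 from weak_gradient_unique[OF \<Omega> this G] show "AE x in lebesgue_on \<Omega>. weak_grad \<Omega> u x = G x" .
qed

section \<open>The closure of the test functions\<close>

locale bounded_open_set =
 fixes \<Omega> :: "'a::euclidean_space set" and p :: real
 assumes open_\<Omega>: "open \<Omega>" and bounded_\<Omega>: "bounded \<Omega>" and p1: "1 < p"
begin

abbreviation M :: "'a measure" where "M \<equiv> lebesgue_on \<Omega>"

lemma \<Omega>_sets: "\<Omega> \<in> sets borel" "\<Omega> \<inter> space lebesgue \<in> sets lebesgue" "\<Omega> \<in> sets lebesgue" using open_\<Omega> by auto

lemma p0: "0 < p" using p1 by simp

sublocale finite_measure M by (rule finite_measure_lebesgue_on) (rule lmeasurable_open[OF bounded_\<Omega> open_\<Omega>])

text \<open>A function of \<open>W01p\<close> together with its weak gradient, described only by the convergence of integrals. The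
equivalence with the original definition is shown in \<open>test_limit_imp_W01p\<close> and \<open>W01p_imp_test_limit\<close>.\<close>

definition test_limit :: "('a => real) => ('a => 'a) => bool" where
 "test_limit u G \<longleftrightarrow> u \<in> Lspace M p \<and> G \<in> Lspace M p \<and> (\<exists>\<phi>. (\<forall>n::nat. \<phi> n \<in> test_functions \<Omega>) \<and>
   (\<lambda>n. pdist M p (\<phi> n) u) \<longlonglongrightarrow> 0 \<and> (\<lambda>n. pdist M p (grad (\<phi> n)) G) \<longlonglongrightarrow> 0)"

lemma Lspace_restrict:
 assumes "g \<in> Lspace lborel r" "\<And>x. x \<notin> \<Omega> ==> g x = 0"
 shows "g \<in> Lspace M r"
proof -
 have m: "g \<in> borel_measurable borel" and i: "integrable lborel (\<lambda>x. norm (g x) powr r)" using assms(1) by (auto simp: Lspace_def)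
 have "(\<lambda>x. norm (g x) powr r) \<in> borel_measurable borel" using m by measurable
 from lebesgue_on_lborel(2)[OF \<Omega>_sets(1) this] assms(2) i
 have "integrable M (\<lambda>x. norm (g x) powr r)" by simp
 moreover have "g \<in> borel_measurable M" using m by (intro measurable_restrict_space1 measurable_completion) simp
 ultimately show ?thesis by (simp add: Lspace_def)
qed

lemma test_Lspace:
 assumes "\<phi> \<in> test_functions \<Omega>" shows "\<phi> \<in> Lspace M p" "grad \<phi> \<in> Lspace M p"
 using grad_in_Lspace[OF bounded_\<Omega> assms p0] Lspace_restrict test_functionD(3)[OF assms] grad_outside[OF assms] by blast+

lemma pint_test:
 assumes "\<phi> \<in> test_functions \<Omega>" shows "pint M p \<phi> = pint lborel p \<phi>" "pint M p (grad \<phi>) = pint lborel p (grad \<phi>)"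
 using pint_lebesgue_on[OF \<Omega>_sets(1) measurable_test[OF assms] test_functionD(3)[OF assms]]
  pint_lebesgue_on[OF \<Omega>_sets(1) measurable_grad[OF assms] grad_outside[OF assms]] by auto

lemma test_diff:
 assumes "\<phi> \<in> test_functions \<Omega>" "\<psi> \<in> test_functions \<Omega>"
 shows "(\<lambda>x. \<phi> x - \<psi> x) \<in> test_functions \<Omega>" "grad (\<lambda>x. \<phi> x - \<psi> x) = (\<lambda>x. grad \<phi> x - grad \<psi> x)"
 using test_functions_lincomb[OF assms, of 1 "-1"] grad_lincomb[OF assms, of 1 "-1"] by simp_all

lemma Lspace_locally_integrable:
 fixes u :: "'a => 'c::euclidean_space"
 assumes u: "u \<in> Lspace M p" shows "locally_integrable \<Omega> u" unfolding locally_integrable_def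
proof (intro allI impI)
 fix K assume K: "compact K \<and> K \<subseteq> \<Omega>"
 have "u \<in> Lspace M 1" by (rule Lspace_mono[OF _ p1 u]) simp
 hence "integrable M u" by (auto simp: Lspace_def integrable_norm_iff)
 hence "integrable lebesgue (\<lambda>x. indicator \<Omega> x *\<^sub>R u x)" using \<Omega>_sets by (subst (asm) integrable_restrict_space) auto
 hence "integrable lebesgue (\<lambda>x. indicator K x *\<^sub>R (indicator \<Omega> x *\<^sub>R u x))"
  using K by (intro integrable_mult_indicator[where A = K]) (auto simp: compact_imp_closed)
 moreover have "(\<lambda>x. indicator K x *\<^sub>R (indicator \<Omega> x *\<^sub>R u x)) = (\<lambda>x. indicator K x *\<^sub>R u x)"
  using K by (intro ext) (auto simp: indicator_def)
 ultimately have "integrable lebesgue (\<lambda>x. indicator K x *\<^sub>R u x)" by (simp only:)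
 thus "integrable (lebesgue_on K) u" using K by (subst integrable_restrict_space) (auto simp: compact_imp_closed)
qed

lemma integral_inner_tendsto:
 fixes w :: "nat => 'a => 'c::euclidean_space"
 assumes w: "\<And>n. w n \<in> Lspace M p" and l: "l \<in> Lspace M p" and lim: "(\<lambda>n. pdist M p (w n) l) \<longlonglongrightarrow> 0"
  and v: "v \<in> borel_measurable M" "\<And>x. norm (v x) \<le> B"
 shows "(\<lambda>n. LINT x|M. w n x \<bullet> v x) \<longlonglongrightarrow> (LINT x|M. l x \<bullet> v x)"
proof -
 have i1: "integrable M (\<lambda>x. norm (g x))" if "g \<in> Lspace M p" for g :: "'a => 'c" using LspaceD(2)[OF Lspace_mono[OF _ p1 that]] by simp
 have le: "\<bar>g x \<bullet> v x\<bar> \<le> B * norm (g x)" for g :: "'a => 'c" and x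
  using Cauchy_Schwarz_ineq2[of "g x" "v x"] mult_left_mono[OF v(2)[of x] norm_ge_zero[of "g x"]] by (simp add: mult.commute)
 have i: "integrable M (\<lambda>x. g x \<bullet> v x)" if g: "g \<in> Lspace M p" for g
 proof (rule Bochner_Integration.integrable_bound[OF integrable_mult_right[OF i1[OF g]]])
  show "(\<lambda>x. g x \<bullet> v x) \<in> borel_measurable M" using LspaceD(1)[OF g] v(1) by (rule borel_measurable_inner)
  show "AE x in M. norm (g x \<bullet> v x) \<le> norm (B * norm (g x))" using le[of g] by (intro AE_I2) (force intro: order_trans[OF _ abs_ge_self])
 qed
 have d: "(\<lambda>x. w n x - l x) \<in> Lspace M p" for n by (rule Lspace_diff[OF w l p0])
 have lim1: "(\<lambda>n. B * pdist M 1 (w n) l) \<longlonglongrightarrow> B * 0" by (intro tendsto_mult tendsto_const pint_low_tendsto[OF _ p1 d lim]) simp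
 have "(\<lambda>n. (LINT x|M. w n x \<bullet> v x) - (LINT x|M. l x \<bullet> v x)) \<longlonglongrightarrow> 0"
 proof (rule Lim_null_comparison[OF _ lim1[unfolded mult_zero_right]], rule always_eventually, rule allI)
  fix n
  have "norm ((LINT x|M. w n x \<bullet> v x) - (LINT x|M. l x \<bullet> v x)) = norm (LINT x|M. (w n x - l x) \<bullet> v x)"
   using i[OF w[of n]] i[OF l] by (simp add: inner_diff_left)
  also have "\<dots> \<le> (LINT x|M. \<bar>(w n x - l x) \<bullet> v x\<bar>)" by simp
  also have "\<dots> \<le> (LINT x|M. B * norm (w n x - l x))"
   using i[OF d[of n]] i1[OF d[of n]] le[of "\<lambda>x. w n x - l x"] by (intro integral_mono) auto
  also have "\<dots> = B * pdist M 1 (w n) l" by (simp add: pint_def)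
  finally show "norm ((LINT x|M. w n x \<bullet> v x) - (LINT x|M. l x \<bullet> v x)) \<le> B * pdist M 1 (w n) l" .
 qed
 thus ?thesis by (simp add: LIM_zero_iff)
qed

lemma test_limit_is_weak_gradient:
 assumes "test_limit u G" shows "is_weak_gradient \<Omega> u G"
proof -
 obtain \<phi> where u: "u \<in> Lspace M p" "G \<in> Lspace M p" and \<phi>: "\<And>n::nat. \<phi> n \<in> test_functions \<Omega>"
  and l: "(\<lambda>n. pdist M p (\<phi> n) u) \<longlonglongrightarrow> 0" "(\<lambda>n. pdist M p (grad (\<phi> n)) G) \<longlonglongrightarrow> 0" using assms unfolding test_limit_def by blast
 show ?thesis unfolding is_weak_gradient_def
 proof (intro conjI ballI Lspace_locally_integrable u)
  fix \<psi> b assume \<psi>: "\<psi> \<in> test_functions \<Omega>" and b: "b \<in> (Basis :: 'a set)"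
  let ?d = "\<lambda>x. frechet_derivative \<psi> (at x) b"
  have d: "?d \<in> test_functions \<Omega>" by (rule test_functionD(4)[OF \<psi> b])
  obtain B where B: "\<And>x. \<bar>?d x\<bar> \<le> B" using test_function_bounded[OF d] by blast
  obtain C where C: "\<And>x. \<bar>\<psi> x\<bar> \<le> C" using test_function_bounded[OF \<psi>] by blast
  have md: "?d \<in> borel_measurable M" and m\<psi>: "\<psi> \<in> borel_measurable M"
   using LspaceD(1)[OF test_Lspace(1)[OF d]] LspaceD(1)[OF test_Lspace(1)[OF \<psi>]] by auto
  have mb: "(\<lambda>x. \<psi> x *\<^sub>R b) \<in> borel_measurable M" using m\<psi> by measurable
  have nb: "norm (\<psi> x *\<^sub>R b) \<le> C" for x using C[of x] b by simp
  have nd: "norm (?d x) \<le> B" for x using B[of x] by simp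
  have "(\<lambda>n. LINT x|M. \<phi> n x \<bullet> ?d x) \<longlonglongrightarrow> (LINT x|M. u x \<bullet> ?d x)" by (rule integral_inner_tendsto[OF test_Lspace(1)[OF \<phi>] u(1) l(1) md nd])
  moreover have "(\<lambda>n. - (LINT x|M. grad (\<phi> n) x \<bullet> (\<psi> x *\<^sub>R b))) \<longlonglongrightarrow> - (LINT x|M. G x \<bullet> (\<psi> x *\<^sub>R b))"
   by (intro tendsto_minus integral_inner_tendsto[OF test_Lspace(2)[OF \<phi>] u(2) l(2) mb nb])
  moreover have "(LINT x|M. \<phi> n x \<bullet> ?d x) = - (LINT x|M. grad (\<phi> n) x \<bullet> (\<psi> x *\<^sub>R b))" for n
   using test_function_is_weak_gradient[OF open_\<Omega> bounded_\<Omega> \<phi>[of n]] \<psi> b unfolding is_weak_gradient_def by (simp add: mult.commute)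
  ultimately have "(LINT x|M. u x \<bullet> ?d x) = - (LINT x|M. G x \<bullet> (\<psi> x *\<^sub>R b))" using LIMSEQ_unique by simp
  thus "(LINT x|M. u x * ?d x) = - (LINT x|M. (G x \<bullet> b) * \<psi> x)" by (simp add: mult.commute)
 qed
qed

lemma is_weak_gradient_diff:
 assumes u: "is_weak_gradient \<Omega> u G" and v: "is_weak_gradient \<Omega> v H"
 shows "is_weak_gradient \<Omega> (\<lambda>x. u x - v x) (\<lambda>x. G x - H x)" unfolding is_weak_gradient_def
proof (intro conjI ballI)
 have l: "locally_integrable \<Omega> u" "locally_integrable \<Omega> v" "locally_integrable \<Omega> G" "locally_integrable \<Omega> H"
  using u v by (auto simp: is_weak_gradient_def)
 thus "locally_integrable \<Omega> (\<lambda>x. u x - v x)" "locally_integrable \<Omega> (\<lambda>x. G x - H x)" by (auto simp: locally_integrable_def)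
 fix \<psi> b assume \<psi>: "\<psi> \<in> test_functions \<Omega>" and b: "b \<in> (Basis :: 'a set)"
 let ?d = "\<lambda>x. frechet_derivative \<psi> (at x) b"
 have lb: "locally_integrable \<Omega> (\<lambda>x. G x \<bullet> b)" "locally_integrable \<Omega> (\<lambda>x. H x \<bullet> b)" using l by (auto simp: locally_integrable_def)
 note i = integrable_times_test[OF open_\<Omega> l(1) test_functionD(4)[OF \<psi> b]] integrable_times_test[OF open_\<Omega> l(2) test_functionD(4)[OF \<psi> b]]
  integrable_times_test[OF open_\<Omega> lb(1) \<psi>] integrable_times_test[OF open_\<Omega> lb(2) \<psi>]
 have "(LINT x|M. u x * ?d x) = - (LINT x|M. (G x \<bullet> b) * \<psi> x)" "(LINT x|M. v x * ?d x) = - (LINT x|M. (H x \<bullet> b) * \<psi> x)"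
  using u v \<psi> b unfolding is_weak_gradient_def by blast+
 thus "(LINT x|M. (u x - v x) * ?d x) = - (LINT x|M. ((G x - H x) \<bullet> b) * \<psi> x)" using i by (simp add: left_diff_distrib inner_diff_left)
qed

text \<open>Measurability is preserved under changes on null sets because Lebesgue measure is complete.\<close>

lemma measurable_cong_AE:
 fixes G H :: "'a => 'c::euclidean_space"
 assumes G: "G \<in> borel_measurable M" and e: "AE x in M. G x = H x" shows "H \<in> borel_measurable M"
proof -
 have "(\<lambda>x. indicator \<Omega> x *\<^sub>R G x) \<in> borel_measurable lebesgue" using G \<Omega>_sets(2) by (simp add: borel_measurable_restrict_space_iff)
 moreover have "AE x in lebesgue. x \<in> \<Omega> --> G x = H x" using e \<Omega>_sets(2) by (simp add: AE_restrict_space_iff)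
 hence "AE x in lebesgue. indicator \<Omega> x *\<^sub>R G x = indicator \<Omega> x *\<^sub>R H x" by eventually_elim (auto simp: indicator_def)
 ultimately have "(\<lambda>x. indicator \<Omega> x *\<^sub>R H x) \<in> borel_measurable lebesgue" by (rule borel_measurable_AE)
 thus ?thesis using \<Omega>_sets(2) by (simp add: borel_measurable_restrict_space_iff)
qed

lemma Lspace_cong_AE:
 fixes G H :: "'a => 'c::euclidean_space"
 assumes G: "G \<in> Lspace M r" and e: "AE x in M. G x = H x"
 shows "H \<in> Lspace M r" "pint M r H = pint M r G"
proof -
 have m: "G \<in> borel_measurable M" "H \<in> borel_measurable M" using LspaceD(1)[OF G] measurable_cong_AE[OF _ e] by auto
 have e': "AE x in M. norm (H x) powr r = norm (G x) powr r" using e by eventually_elim simp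
 have m': "(\<lambda>x. norm (H x) powr r) \<in> borel_measurable M" "(\<lambda>x. norm (G x) powr r) \<in> borel_measurable M" using m by measurable
 from integrable_cong_AE[OF m' e'] integral_cong_AE[OF m' e']
 show "pint M r H = pint M r G" "H \<in> Lspace M r" unfolding pint_def Lspace_def using m LspaceD(2)[OF G] by auto
qed

lemma Lp_norm_powr: "Lp_norm p \<Omega> u powr p = pint M p u"
 using pint_nonneg[of M p u] p0 by (simp add: Lp_norm_def pint_def[symmetric] powr_powr)

lemma W1p_norm_minus_test:
 assumes w: "is_weak_gradient \<Omega> u G" and G: "G \<in> Lspace M p" and \<phi>: "\<phi> \<in> test_functions \<Omega>"
 shows "W1p_norm p \<Omega> (\<lambda>x. u x - \<phi> x) = (pdist M p \<phi> u + pdist M p (grad \<phi>) G) powr (1 / p)"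
proof -
 have "is_weak_gradient \<Omega> (\<lambda>x. u x - \<phi> x) (\<lambda>x. G x - grad \<phi> x)"
  by (rule is_weak_gradient_diff[OF w test_function_is_weak_gradient[OF open_\<Omega> bounded_\<Omega> \<phi>]])
 from weak_grad_eq(2)[OF open_\<Omega> this] have "AE x in M. G x - grad \<phi> x = weak_grad \<Omega> (\<lambda>x. u x - \<phi> x) x" by eventually_elim simp
 from Lspace_cong_AE(2)[OF Lspace_diff[OF G test_Lspace(2)[OF \<phi>] p0] this]
 show ?thesis unfolding W1p_norm_def Lp_norm_powr by (simp add: pint_minus_commute[of M p u] pint_minus_commute[of M p G])
qed

lemma test_limit_imp_W01p:
 assumes "test_limit u G" shows "u \<in> W01p p \<Omega>" "AE x in M. weak_grad \<Omega> u x = G x"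
proof -
 obtain \<phi> where u: "u \<in> Lspace M p" "G \<in> Lspace M p" and \<phi>: "\<And>n::nat. \<phi> n \<in> test_functions \<Omega>"
  and l: "(\<lambda>n. pdist M p (\<phi> n) u) \<longlonglongrightarrow> 0" "(\<lambda>n. pdist M p (grad (\<phi> n)) G) \<longlonglongrightarrow> 0" using assms unfolding test_limit_def by blast
 have w: "is_weak_gradient \<Omega> u G" by (rule test_limit_is_weak_gradient[OF assms])
 show "AE x in M. weak_grad \<Omega> u x = G x" by (rule weak_grad_eq(2)[OF open_\<Omega> w])
 have "u \<in> W1p p \<Omega>" unfolding W1p_def Lp_space_def using u w unfolding Lspace_def by blast
 moreover have "(\<lambda>n. W1p_norm p \<Omega> (\<lambda>x. u x - \<phi> n x)) \<longlonglongrightarrow> 0"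
 proof -
  note W1p_norm_minus_test[OF w u(2) \<phi>]
  moreover have "(\<lambda>n. (pdist M p (\<phi> n) u + pdist M p (grad (\<phi> n)) G) powr (1 / p)) \<longlonglongrightarrow> (0 + 0) powr (1 / p)"
   using p0 by (intro tendsto_powr' tendsto_add l tendsto_const) (auto intro!: always_eventually add_nonneg_nonneg simp: pint_nonneg)
  ultimately show ?thesis by simp
 qed
 ultimately show "u \<in> W01p p \<Omega>" unfolding W01p_def using \<phi> by blast
qed

lemma W01p_imp_test_limit:
 assumes "u \<in> W01p p \<Omega>" shows "test_limit u (weak_grad \<Omega> u)"
proof -
 obtain \<phi> G where u: "u \<in> Lspace M p" and G: "G \<in> Lspace M p" and w: "is_weak_gradient \<Omega> u G" and \<phi>: "\<And>n::nat. \<phi> n \<in> test_functions \<Omega>"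
  and l: "(\<lambda>n. W1p_norm p \<Omega> (\<lambda>x. u x - \<phi> n x)) \<longlonglongrightarrow> 0" using assms unfolding W01p_def W1p_def Lp_space_def Lspace_def by blast
 let ?G = "weak_grad \<Omega> u"
 have wg: "is_weak_gradient \<Omega> u ?G" "AE x in M. ?G x = G x" by (rule weak_grad_eq[OF open_\<Omega> w])+
 have G': "?G \<in> Lspace M p" by (rule Lspace_cong_AE(1)[OF G]) (use wg(2) in \<open>simp add: eq_commute\<close>)
 note n = W1p_norm_minus_test[OF wg(1) G' \<phi>]
 have "(\<lambda>n. W1p_norm p \<Omega> (\<lambda>x. u x - \<phi> n x) powr p) \<longlonglongrightarrow> 0 powr p" using p0 by (intro tendsto_powr' l tendsto_const) (auto simp: W1p_norm_def)
 hence s: "(\<lambda>n. pdist M p (\<phi> n) u + pint M p (\<lambda>x. grad (\<phi> n) x - ?G x)) \<longlonglongrightarrow> 0"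
  unfolding n using p0 by (simp add: powr_powr pint_nonneg add_nonneg_nonneg)
 have "(\<lambda>n. pdist M p (\<phi> n) u) \<longlonglongrightarrow> 0" "(\<lambda>n. pint M p (\<lambda>x. grad (\<phi> n) x - ?G x)) \<longlonglongrightarrow> 0"
  by (rule tendsto_sandwich[OF _ _ tendsto_const s]; simp add: pint_nonneg)+
 thus ?thesis unfolding test_limit_def using u G' \<phi> by blast
qed

lemma test_limit_test: "\<phi> \<in> test_functions \<Omega> ==> test_limit \<phi> (grad \<phi>)"
 unfolding test_limit_def using test_Lspace p0 by (intro conjI exI[of _ "\<lambda>_. \<phi>"]) (auto simp: pint_def)

lemma test_W01p: "\<phi> \<in> test_functions \<Omega> ==> \<phi> \<in> W01p p \<Omega>" by (rule test_limit_imp_W01p(1)[OF test_limit_test])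

end

section \<open>The Galerkin scheme in the Sobolev space\<close>

definition galerkin_space :: "(nat => 'a::euclidean_space => real) => nat => (('a => real) \<times> ('a => 'a)) set" where
 "galerkin_space \<phi> n = range (\<lambda>c. (lincomb (fresh_indices \<phi> \<inter> {..<n}) \<phi> c, lincomb (fresh_indices \<phi> \<inter> {..<n}) (\<lambda>i. grad (\<phi> i)) c))"

lemma lincomb_test_functions:
 assumes \<phi>: "\<And>i. \<phi> i \<in> test_functions \<Omega>" and S: "finite S"
 shows "lincomb S \<phi> c \<in> test_functions \<Omega> \<and> grad (lincomb S \<phi> c) = lincomb S (\<lambda>i. grad (\<phi> i)) c" using S
proof (induction S rule: finite_induct)
 case empty
 have "grad (\<lambda>x. 0 * \<phi> 0 x + 0 * \<phi> 0 x) = (\<lambda>x. 0 *\<^sub>R grad (\<phi> 0) x + 0 *\<^sub>R grad (\<phi> 0) x)" by (rule grad_lincomb[OF \<phi> \<phi>])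
 thus ?case by (simp add: lincomb_def zero_test_function)
next
 case (insert i S)
 have "lincomb (insert i S) \<phi> c = (\<lambda>x. c i * \<phi> i x + 1 * lincomb S \<phi> c x)" using insert by (simp add: lincomb_def fun_eq_iff)
 moreover have "lincomb (insert i S) (\<lambda>i. grad (\<phi> i)) c = (\<lambda>x. c i *\<^sub>R grad (\<phi> i) x + 1 *\<^sub>R lincomb S (\<lambda>i. grad (\<phi> i)) c x)"
  using insert by (simp add: lincomb_def fun_eq_iff)
 ultimately show ?case
  using test_functions_lincomb[OF \<phi>[of i], of "lincomb S \<phi> c" "c i" 1] grad_lincomb[OF \<phi>[of i], of "lincomb S \<phi> c" "c i" 1] insert.IH by simp
qed

lemma galerkin_spaceD:
 assumes "\<And>i. \<phi> i \<in> test_functions \<Omega>" "(u, v) \<in> galerkin_space \<phi> n"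
 shows "u \<in> test_functions \<Omega>" "v = grad u"
 using assms(2) lincomb_test_functions[where \<phi> = \<phi>, OF assms(1), of "fresh_indices \<phi> \<inter> {..<n}"] by (auto simp: galerkin_space_def)

lemma galerkin_space_mono:
 assumes "m \<le> n" shows "galerkin_space \<phi> m \<subseteq> galerkin_space \<phi> n"
proof
 fix z assume "z \<in> galerkin_space \<phi> m"
 then obtain c where z: "z = (lincomb (fresh_indices \<phi> \<inter> {..<m}) \<phi> c, lincomb (fresh_indices \<phi> \<inter> {..<m}) (\<lambda>i. grad (\<phi> i)) c)"
  by (auto simp: galerkin_space_def)
 have e: "lincomb (fresh_indices \<phi> \<inter> {..<m}) w c = lincomb (fresh_indices \<phi> \<inter> {..<n}) w (\<lambda>i. if i < m then c i else 0)" for w :: "nat => 'a => 'c::real_vector"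
  unfolding lincomb_def using assms by (intro ext sum.mono_neutral_cong_left) auto
 show "z \<in> galerkin_space \<phi> n" unfolding z galerkin_space_def by (rule range_eqI) (rule arg_cong2[where f = Pair, OF e e])
qed

lemma galerkin_space_contains:
 assumes \<phi>: "\<And>i. \<phi> i \<in> test_functions \<Omega>" shows "(\<phi> i, grad (\<phi> i)) \<in> galerkin_space \<phi> (Suc i)"
proof -
 obtain c where c: "lincomb (fresh_indices \<phi> \<inter> {..<Suc i}) \<phi> c = lincomb {..<Suc i} \<phi> (\<lambda>j. if j = i then 1 else 0)"
  using lincomb_fresh by blast
 also have "\<dots> = \<phi> i" by (simp add: lincomb_def fun_eq_iff)
 finally have "lincomb (fresh_indices \<phi> \<inter> {..<Suc i}) \<phi> c = \<phi> i" .
 moreover from this have "lincomb (fresh_indices \<phi> \<inter> {..<Suc i}) (\<lambda>i. grad (\<phi> i)) c = grad (\<phi> i)"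
  using lincomb_test_functions[where \<phi> = \<phi>, OF \<phi>, of "fresh_indices \<phi> \<inter> {..<Suc i}" c] by simp
 ultimately show ?thesis unfolding galerkin_space_def by (intro image_eqI[of _ _ c]) auto
qed

context bounded_open_set
begin

lemma enclosing_radius: "\<exists>R. 0 < R \<and> \<Omega> \<subseteq> cball 0 R"
proof -
 obtain R where "\<Omega> \<subseteq> cball 0 R" using bounded_imp_subset_cball[OF bounded_\<Omega>] by (rule exE)
 hence "\<Omega> \<subseteq> cball 0 (max R 1)" by auto
 thus ?thesis by (intro exI[of _ "max R 1"]) simp
qed

text \<open>By the Poincare inequality \<open>\<phi>\<close> is zero almost everywhere, hence everywhere by continuity. This is what turns
the linear independence of test functions into that of their gradients in \<open>L\<^sup>p\<close>.\<close>

lemma test_function_pint_zero: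
 assumes \<phi>: "\<phi> \<in> test_functions \<Omega>" and z: "pint M p (grad \<phi>) = 0" shows "\<phi> = (\<lambda>x. 0)"
proof -
 obtain R where R: "0 < R" "\<Omega> \<subseteq> cball 0 R" using enclosing_radius by (elim exE conjE)
 have "pint lborel p \<phi> \<le> 0" using poincare_test[OF p1 R \<phi>] z pint_test[OF \<phi>] by simp
 hence "pint lborel p \<phi> = 0" by (rule antisym[OF _ pint_nonneg])
 hence "(LINT x|lborel. norm (\<phi> x) powr p) = 0" by (simp only: pint_def)
 hence "AE x in lborel. norm (\<phi> x) powr p = 0"
  using integral_nonneg_eq_0_iff_AE[of lborel "\<lambda>x. norm (\<phi> x) powr p"] LspaceD(2)[OF grad_in_Lspace(1)[OF bounded_\<Omega> \<phi> p0]] by simp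
 hence "AE x in lebesgue. x \<notin> {x. \<phi> x \<noteq> 0}" by (intro AE_completion) (auto elim: eventually_mono)
 hence "negligible {x. \<phi> x \<noteq> 0}" unfolding negligible_iff_null_sets completion.null_sets_iff_AE by simp
 moreover have "open {x. \<phi> x \<noteq> 0}" by (intro open_Collect_neq continuous_on_const test_functionD(2)[OF \<phi>])
 ultimately have "{x. \<phi> x \<noteq> 0} = {}" using open_not_negligible by blast
 thus ?thesis by auto
qed

lemma dual_properties:
 assumes f: "f \<in> W01p_dual p \<Omega>"
 shows "u \<in> W01p p \<Omega> ==> v \<in> W01p p \<Omega> ==> f (\<lambda>x. a * u x + b * v x) = a * f u + b * f v"
  and "\<exists>C\<ge>0. \<forall>u G. test_limit u G --> \<bar>f u\<bar> \<le> C * pint M p G powr (1 / p)"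
  and "test_limit u G ==> test_limit (\<lambda>x. a * u x) (\<lambda>x. a *\<^sub>R G x)"
proof -
 show sc: "test_limit (\<lambda>x. a * u x) (\<lambda>x. a *\<^sub>R G x)" if t: "test_limit u G" for u G a
 proof -
  obtain \<phi> where u: "u \<in> Lspace M p" "G \<in> Lspace M p" and \<phi>: "\<And>n::nat. \<phi> n \<in> test_functions \<Omega>"
   and l: "(\<lambda>n. pdist M p (\<phi> n) u) \<longlonglongrightarrow> 0" "(\<lambda>n. pdist M p (grad (\<phi> n)) G) \<longlonglongrightarrow> 0" using t unfolding test_limit_def by blast
  have s: "(\<lambda>x. a * \<phi> n x) \<in> test_functions \<Omega>" "grad (\<lambda>x. a * \<phi> n x) = (\<lambda>x. a *\<^sub>R grad (\<phi> n) x)" for n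
   using test_functions_lincomb[OF \<phi> \<phi>, of a n 0 n] grad_lincomb[OF \<phi> \<phi>, of a n 0 n] by simp_all
  have "(\<lambda>n. \<bar>a\<bar> powr p * pdist M p (\<phi> n) u) \<longlonglongrightarrow> \<bar>a\<bar> powr p * 0"
   "(\<lambda>n. \<bar>a\<bar> powr p * pdist M p (grad (\<phi> n)) G) \<longlonglongrightarrow> \<bar>a\<bar> powr p * 0" by (intro tendsto_mult tendsto_const l)+
  hence "(\<lambda>n. pint M p (\<lambda>x. a * \<phi> n x - a * u x)) \<longlonglongrightarrow> 0" "(\<lambda>n. pint M p (\<lambda>x. a *\<^sub>R grad (\<phi> n) x - a *\<^sub>R G x)) \<longlonglongrightarrow> 0"
   using pint_scaleR[of M p a "\<lambda>x. \<phi> _ x - u x"] pint_scaleR[of M p a "\<lambda>x. grad (\<phi> _) x - G x"]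
   by (simp_all add: right_diff_distrib scaleR_diff_right)
  moreover have "(\<lambda>x. a * u x) \<in> Lspace M p" "(\<lambda>x. a *\<^sub>R G x) \<in> Lspace M p"
   using Lspace_scaleR[OF u(1) p0, of a] Lspace_scaleR[OF u(2) p0, of a] by simp_all
  ultimately show ?thesis unfolding test_limit_def using s by (intro conjI exI[of _ "\<lambda>n x. a * \<phi> n x"]) simp_all
 qed
 have W: "(\<lambda>x. a * u x) \<in> W01p p \<Omega>" if "u \<in> W01p p \<Omega>" for u a using test_limit_imp_W01p(1)[OF sc[OF W01p_imp_test_limit[OF that]]] .
 have f1: "f (\<lambda>x. u x + v x) = f u + f v" if "u \<in> W01p p \<Omega>" "v \<in> W01p p \<Omega>" for u v using f that unfolding W01p_dual_def by blast
 have f2: "f (\<lambda>x. c * u x) = c * f u" if "u \<in> W01p p \<Omega>" for u c using f that unfolding W01p_dual_def by blast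
 show "f (\<lambda>x. a * u x + b * v x) = a * f u + b * f v" if "u \<in> W01p p \<Omega>" "v \<in> W01p p \<Omega>"
  using f1[OF W[OF that(1)] W[OF that(2)]] f2[OF that(1)] f2[OF that(2)] by simp
 obtain C where C: "\<And>u. u \<in> W01p p \<Omega> ==> \<bar>f u\<bar> \<le> C * W01p_norm p \<Omega> u" using f unfolding W01p_dual_def by blast
 show "\<exists>C\<ge>0. \<forall>u G. test_limit u G --> \<bar>f u\<bar> \<le> C * pint M p G powr (1 / p)"
 proof (intro exI[of _ "\<bar>C\<bar>"] conjI allI impI)
  fix u G assume t: "test_limit u G"
  have "W01p_norm p \<Omega> u = pint M p (weak_grad \<Omega> u) powr (1 / p)" by (simp add: W01p_norm_def Lp_norm_def pint_def)
  also have "pint M p (weak_grad \<Omega> u) = pint M p G"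
  proof (rule Lspace_cong_AE(2))
   show "G \<in> Lspace M p" using t by (simp add: test_limit_def)
   show "AE x in M. G x = weak_grad \<Omega> u x" using test_limit_imp_W01p(2)[OF t] by (simp add: eq_commute)
  qed
  finally have "\<bar>f u\<bar> \<le> C * pint M p G powr (1 / p)" using C[OF test_limit_imp_W01p(1)[OF t]] by simp
  also have "\<dots> \<le> \<bar>C\<bar> * pint M p G powr (1 / p)" by (intro mult_right_mono) auto
  finally show "\<bar>f u\<bar> \<le> \<bar>C\<bar> * pint M p G powr (1 / p)" .
 qed simp
qed

lemma galerkin_basis_test_functions:
 assumes \<phi>: "\<And>i. \<phi> i \<in> test_functions \<Omega>" and q: "1 < q" "q < p" and f: "f \<in> W01p_dual p \<Omega>"
 shows "\<exists>CP Cf. galerkin_basis M p q (galerkin_space \<phi>) f CP Cf \<phi> (\<lambda>i. grad (\<phi> i)) (fresh_indices \<phi>)"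
proof -
 obtain R where R: "0 < R" "\<Omega> \<subseteq> cball 0 R" using enclosing_radius by (elim exE conjE)
 obtain Cf where Cf: "0 \<le> Cf" "\<And>u G. test_limit u G ==> \<bar>f u\<bar> \<le> Cf * pint M p G powr (1 / p)" using dual_properties(2)[OF f] by blast
 note D = galerkin_spaceD[where \<phi> = \<phi>, OF \<phi>]
 have "galerkin_basis M p q (galerkin_space \<phi>) f ((3 * R) powr p) Cf \<phi> (\<lambda>i. grad (\<phi> i)) (fresh_indices \<phi>)"
 proof unfold_locales
  show "1 < q" "q < p" by fact+
  fix u v n assume uv: "(u, v) \<in> galerkin_space \<phi> n"
  show "u \<in> Lspace M p \<and> v \<in> Lspace M p" using test_Lspace[OF D(1)[OF uv]] D(2)[OF uv] by simp
  show "pint M p u \<le> (3 * R) powr p * pint M p v" using poincare_test[OF p1 R D(1)[OF uv]] pint_test[OF D(1)[OF uv]] D(2)[OF uv] by simp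
  show "\<bar>f u\<bar> \<le> Cf * pint M p v powr (1 / p)" using Cf(2)[OF test_limit_test[OF D(1)[OF uv]]] D(2)[OF uv] by simp
  fix u' v' and a b :: real assume uv': "(u', v') \<in> galerkin_space \<phi> n"
  show "f (\<lambda>x. a *\<^sub>R u x + b *\<^sub>R u' x) = a * f u + b * f u'"
   using dual_properties(1)[OF f test_W01p[OF D(1)[OF uv]] test_W01p[OF D(1)[OF uv']]] by simp
  obtain c c' where "u = lincomb (fresh_indices \<phi> \<inter> {..<n}) \<phi> c" "v = lincomb (fresh_indices \<phi> \<inter> {..<n}) (\<lambda>i. grad (\<phi> i)) c"
   "u' = lincomb (fresh_indices \<phi> \<inter> {..<n}) \<phi> c'" "v' = lincomb (fresh_indices \<phi> \<inter> {..<n}) (\<lambda>i. grad (\<phi> i)) c'"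
   using uv uv' by (auto simp: galerkin_space_def)
  thus "((\<lambda>x. a *\<^sub>R u x + b *\<^sub>R u' x), (\<lambda>x. a *\<^sub>R v x + b *\<^sub>R v' x)) \<in> galerkin_space \<phi> n"
   unfolding galerkin_space_def by (intro image_eqI[of _ _ "\<lambda>i. a * c i + b * c' i"]) (simp_all add: lincomb_linear)
 next
  show "galerkin_space \<phi> m \<subseteq> galerkin_space \<phi> n" if "m \<le> n" for m n by (rule galerkin_space_mono[OF that])
  show "0 \<le> (3 * R) powr p" by simp
  show "0 \<le> Cf" by fact
  fix u :: "nat => 'a => real" and v K assume uv: "\<And>k. \<exists>n. (u k, v k) \<in> galerkin_space \<phi> n" and K: "\<And>k. pint M p (v k) \<le> K"
  have t: "u k \<in> test_functions \<Omega>" "v k = grad (u k)" for k using uv[of k] D by blast+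
  have "pint lborel p (grad (u k)) \<le> K" for k using K[of k] t(2)[of k] pint_test(2)[OF t(1)] by simp
  from test_functions_rellich[where \<phi> = u, OF p1 R t(1) this] obtain \<sigma> :: "nat => nat" where s: "strict_mono \<sigma>"
   "\<forall>e>0. \<exists>N. \<forall>k\<ge>N. \<forall>l\<ge>N. pdist lborel p (u (\<sigma> k)) (u (\<sigma> l)) < e" by (elim exE conjE)
  thus "\<exists>\<sigma>::nat => nat. strict_mono \<sigma> \<and> (\<forall>e>0. \<exists>N. \<forall>k\<ge>N. \<forall>l\<ge>N. pdist M p (u (\<sigma> k)) (u (\<sigma> l)) < e)"
   unfolding pint_test(1)[OF test_diff(1)[OF t(1) t(1)]] by blast
 next
  show "galerkin_space \<phi> n = range (\<lambda>c. (lincomb (fresh_indices \<phi> \<inter> {..<n}) \<phi> c, lincomb (fresh_indices \<phi> \<inter> {..<n}) (\<lambda>i. grad (\<phi> i)) c))" for n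
   by (rule galerkin_space_def)
  fix n i and c :: "nat => real"
  assume z: "pint M p (lincomb (fresh_indices \<phi> \<inter> {..<n}) (\<lambda>i. grad (\<phi> i)) c) = 0" and i: "i \<in> fresh_indices \<phi>" "i < n"
  have "lincomb (fresh_indices \<phi> \<inter> {..<n}) \<phi> c = (\<lambda>x. 0)"
   using lincomb_test_functions[where \<phi> = \<phi>, OF \<phi>, of "fresh_indices \<phi> \<inter> {..<n}" c] z by (intro test_function_pint_zero) auto
  thus "c i = 0" by (rule fresh_independent[OF _ i])
 qed
 thus ?thesis by blast
qed

text \<open>Density with respect to gradients suffices because the Poincare inequality controls the functions.\<close>

lemma dense_test_limit:
 assumes \<phi>: "\<And>i::nat. \<phi> i \<in> test_functions \<Omega>"
  and dense: "\<And>\<psi> e. \<psi> \<in> test_functions \<Omega> ==> 0 < e ==> \<exists>i. pdist lborel p (grad \<psi>) (grad (\<phi> i)) < e"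
  and t: "test_limit u G"
 shows "\<exists>i :: nat => nat. (\<lambda>n. pdist M p (\<phi> (i n)) u) \<longlonglongrightarrow> 0 \<and> (\<lambda>n. pdist M p (grad (\<phi> (i n))) G) \<longlonglongrightarrow> 0"
proof -
 obtain R where R: "0 < R" "\<Omega> \<subseteq> cball 0 R" using enclosing_radius by (elim exE conjE)
 obtain \<psi> where u: "u \<in> Lspace M p" "G \<in> Lspace M p" and \<psi>: "\<And>n::nat. \<psi> n \<in> test_functions \<Omega>"
  and l: "(\<lambda>n. pdist M p (\<psi> n) u) \<longlonglongrightarrow> 0" "(\<lambda>n. pdist M p (grad (\<psi> n)) G) \<longlonglongrightarrow> 0" using t unfolding test_limit_def by blast
 have "\<exists>i. pdist lborel p (grad (\<psi> n)) (grad (\<phi> i)) < 1 / real (Suc n)" for n by (rule dense[OF \<psi>]) simp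
 hence "\<forall>n. \<exists>i. pdist lborel p (grad (\<psi> n)) (grad (\<phi> i)) < 1 / real (Suc n)" by blast
 from choice[OF this] obtain i where i: "\<And>n. pdist lborel p (grad (\<psi> n)) (grad (\<phi> (i n))) < 1 / real (Suc n)" by blast
 have gr: "pdist M p (grad (\<phi> (i n))) (grad (\<psi> n)) \<le> 1 / real (Suc n)" for n
  using i[of n] pint_test(2)[OF test_diff(1)[OF \<psi> \<phi>], of n "i n"] test_diff(2)[OF \<psi> \<phi>, of n "i n"]
  by (simp add: pint_minus_commute[of M p "grad (\<phi> (i n))"])
 have fn: "pdist M p (\<phi> (i n)) (\<psi> n) \<le> (3 * R) powr p * (1 / real (Suc n))" for n
 proof -
  have "pdist M p (\<phi> (i n)) (\<psi> n) \<le> (3 * R) powr p * pdist M p (grad (\<phi> (i n))) (grad (\<psi> n))"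
   using poincare_test[OF p1 R test_diff(1)[OF \<phi> \<psi>]] pint_test[OF test_diff(1)[OF \<phi> \<psi>]] test_diff(2)[OF \<phi> \<psi>] by simp
  thus ?thesis using mult_left_mono[OF gr[of n], of "(3 * R) powr p"] by simp
 qed
 have lim: "(\<lambda>n. pdist M p (w n) h) \<longlonglongrightarrow> 0"
  if w: "\<And>n. w n \<in> Lspace M p" "\<And>n. y n \<in> Lspace M p" "h \<in> Lspace M p" and wy: "\<And>n. pdist M p (w n) (y n) \<le> c * (1 / real (Suc n))"
   and yh: "(\<lambda>n. pdist M p (y n) h) \<longlonglongrightarrow> 0" for w y :: "nat => 'a => 'c::euclidean_space" and h c
 proof -
  have "(\<lambda>n. 2 powr p * (c * (1 / real (Suc n)) + pdist M p (y n) h)) \<longlonglongrightarrow> 2 powr p * (c * 0 + 0)"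
   by (intro tendsto_mult tendsto_add tendsto_const yh LIMSEQ_Suc[OF lim_1_over_n])
  hence z: "(\<lambda>n. 2 powr p * (c * (1 / real (Suc n)) + pdist M p (y n) h)) \<longlonglongrightarrow> 0" by simp
  show ?thesis
  proof (rule tendsto_sandwich[OF _ _ tendsto_const z])
   show "\<forall>\<^sub>F n in sequentially. pdist M p (w n) h \<le> 2 powr p * (c * (1 / real (Suc n)) + pdist M p (y n) h)"
   proof (rule always_eventually, rule allI)
    fix n
    have "pdist M p (w n) h \<le> 2 powr p * (pdist M p (w n) (y n) + pdist M p (y n) h)"
     using pint_add_le[OF Lspace_diff[OF w(1,2) p0] Lspace_diff[OF w(2,3) p0] p0, of n n n] by simp
    also have "\<dots> \<le> 2 powr p * (c * (1 / real (Suc n)) + pdist M p (y n) h)" using wy by (intro mult_left_mono add_right_mono) auto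
    finally show "pdist M p (w n) h \<le> 2 powr p * (c * (1 / real (Suc n)) + pdist M p (y n) h)" .
   qed
  qed (simp add: pint_nonneg)
 qed
 have L: "\<phi> (i n) \<in> Lspace M p" "grad (\<phi> (i n)) \<in> Lspace M p" "\<psi> n \<in> Lspace M p" "grad (\<psi> n) \<in> Lspace M p" for n
  using test_Lspace[OF \<phi>] test_Lspace[OF \<psi>] by auto
 have gr': "pdist M p (grad (\<phi> (i n))) (grad (\<psi> n)) \<le> 1 * (1 / real (Suc n))" for n using gr[of n] by (simp only: mult_1)
 have "(\<lambda>n. pdist M p (\<phi> (i n)) u) \<longlonglongrightarrow> 0" by (rule lim[OF L(1,3) u(1) fn l(1)])
 moreover have "(\<lambda>n. pdist M p (grad (\<phi> (i n))) G) \<longlonglongrightarrow> 0" by (rule lim[OF L(2,4) u(2) gr' l(2)])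
 ultimately show ?thesis by blast
qed

end

section \<open>Weak solutions\<close>

context bounded_open_set
begin

lemma test_limit_minus_test:
 assumes t: "test_limit u G" and \<psi>: "\<psi> \<in> test_functions \<Omega>"
 shows "test_limit (\<lambda>x. u x - \<psi> x) (\<lambda>x. G x - grad \<psi> x)"
proof -
 obtain \<phi> where u: "u \<in> Lspace M p" "G \<in> Lspace M p" and \<phi>: "\<And>n::nat. \<phi> n \<in> test_functions \<Omega>"
  and l: "(\<lambda>n. pdist M p (\<phi> n) u) \<longlonglongrightarrow> 0" "(\<lambda>n. pdist M p (grad (\<phi> n)) G) \<longlonglongrightarrow> 0" using t unfolding test_limit_def by blast
 show ?thesis unfolding test_limit_def
 proof (intro conjI exI[of _ "\<lambda>n x. \<phi> n x - \<psi> x"] allI)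
  show "(\<lambda>x. u x - \<psi> x) \<in> Lspace M p" "(\<lambda>x. G x - grad \<psi> x) \<in> Lspace M p" by (intro Lspace_diff u test_Lspace \<psi> p0)+
  show "(\<lambda>x. \<phi> n x - \<psi> x) \<in> test_functions \<Omega>" for n by (rule test_diff(1)[OF \<phi> \<psi>])
 qed (use l in \<open>simp_all add: test_diff(2)[OF \<phi> \<psi>]\<close>)
qed

text \<open>Both sides are continuous in the test function, so it is enough to test with a dense sequence. The factor
\<open>b\<close> is 0 for the eigenvalue equation and 1 for the full equation.\<close>

lemma equation_extends_to_limits:
 assumes \<phi>: "\<And>i::nat. \<phi> i \<in> test_functions \<Omega>"
  and dense: "\<And>\<psi> e. \<psi> \<in> test_functions \<Omega> ==> 0 < e ==> \<exists>i. pdist lborel p (grad \<psi>) (grad (\<phi> i)) < e"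
  and q: "1 < q" "q < p" and f: "f \<in> W01p_dual p \<Omega>"
  and u: "u \<in> Lspace M p" and v: "v \<in> Lspace M p"
  and eq: "\<And>i. pairing M p v (grad (\<phi> i)) + b * pairing M q v (grad (\<phi> i))
    = \<alpha> * pairing M p u (\<phi> i) + b * (\<beta> * pairing M q u (\<phi> i) + f (\<phi> i))"
  and t: "test_limit w g"
 shows "pairing M p v g + b * pairing M q v g = \<alpha> * pairing M p u w + b * (\<beta> * pairing M q u w + f w)"
proof -
 have q0: "0 < q" using q by simp
 obtain i :: "nat => nat" where l: "(\<lambda>n. pdist M p (\<phi> (i n)) w) \<longlonglongrightarrow> 0" "(\<lambda>n. pdist M p (grad (\<phi> (i n))) g) \<longlonglongrightarrow> 0"
  using dense_test_limit[OF \<phi> dense t] by blast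
 have L: "\<phi> (i n) \<in> Lspace M p" "grad (\<phi> (i n)) \<in> Lspace M p" for n using test_Lspace[OF \<phi>] by auto
 have wg: "w \<in> Lspace M p" "g \<in> Lspace M p" using t by (auto simp: test_limit_def)
 note mono = Lspace_mono[OF q0 q(2)]
 have lq: "(\<lambda>n. pdist M q (\<phi> (i n)) w) \<longlonglongrightarrow> 0" "(\<lambda>n. pdist M q (grad (\<phi> (i n))) g) \<longlonglongrightarrow> 0"
  by (rule pint_low_tendsto[OF q0 q(2) _ l(1)], intro Lspace_diff L wg p0)
   (rule pint_low_tendsto[OF q0 q(2) _ l(2)], intro Lspace_diff L wg p0)
 obtain C where C: "\<And>u G. test_limit u G ==> \<bar>f u\<bar> \<le> C * pint M p G powr (1 / p)" using dual_properties(2)[OF f] by blast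
 have "(\<lambda>n. f w - f (\<phi> (i n))) \<longlonglongrightarrow> 0"
 proof (rule Lim_null_comparison)
  have "(\<lambda>n. C * pdist M p (grad (\<phi> (i n))) g powr (1 / p)) \<longlonglongrightarrow> C * 0 powr (1 / p)"
   using p0 by (intro tendsto_mult tendsto_const tendsto_powr' l) (auto simp: pint_nonneg)
  thus "(\<lambda>n. C * pdist M p (grad (\<phi> (i n))) g powr (1 / p)) \<longlonglongrightarrow> 0" by simp
  show "\<forall>\<^sub>F n in sequentially. norm (f w - f (\<phi> (i n))) \<le> C * pdist M p (grad (\<phi> (i n))) g powr (1 / p)"
  proof (rule always_eventually, rule allI)
   fix n
   have "f w - f (\<phi> (i n)) = f (\<lambda>x. w x - \<phi> (i n) x)"
    using dual_properties(1)[OF f test_limit_imp_W01p(1)[OF t] test_W01p[OF \<phi>], of 1 "-1" "i n"] by simp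
   thus "norm (f w - f (\<phi> (i n))) \<le> C * pdist M p (grad (\<phi> (i n))) g powr (1 / p)"
    using C[OF test_limit_minus_test[OF t \<phi>], of "i n"] by (simp add: pint_minus_commute[of M p g])
  qed
 qed
 from tendsto_diff[OF tendsto_const[of "f w"] this] have fl: "(\<lambda>n. f (\<phi> (i n))) \<longlonglongrightarrow> f w" by simp
 have pl: "(\<lambda>n. pairing M p v (grad (\<phi> (i n)))) \<longlonglongrightarrow> pairing M p v g" by (rule pairing_tendsto_right[OF p1 v L(2) wg(2) l(2)])
 have pu: "(\<lambda>n. pairing M p u (\<phi> (i n))) \<longlonglongrightarrow> pairing M p u w" by (rule pairing_tendsto_right[OF p1 u L(1) wg(1) l(1)])
 have ql: "(\<lambda>n. pairing M q v (grad (\<phi> (i n)))) \<longlonglongrightarrow> pairing M q v g"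
  by (rule pairing_tendsto_right[OF q(1) mono[OF v] mono[OF L(2)] mono[OF wg(2)] lq(2)])
 have qu: "(\<lambda>n. pairing M q u (\<phi> (i n))) \<longlonglongrightarrow> pairing M q u w"
  by (rule pairing_tendsto_right[OF q(1) mono[OF u] mono[OF L(1)] mono[OF wg(1)] lq(1)])
 have "(\<lambda>n. pairing M p v (grad (\<phi> (i n))) + b * pairing M q v (grad (\<phi> (i n)))) \<longlonglongrightarrow> pairing M p v g + b * pairing M q v g"
  by (intro tendsto_intros pl ql)
 moreover have "(\<lambda>n. \<alpha> * pairing M p u (\<phi> (i n)) + b * (\<beta> * pairing M q u (\<phi> (i n)) + f (\<phi> (i n)))) \<longlonglongrightarrow> \<alpha> * pairing M p u w + b * (\<beta> * pairing M q u w + f w)"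
  by (intro tendsto_intros pu qu fl)
 ultimately show ?thesis unfolding eq by (rule LIMSEQ_unique)
qed

lemma pairing_cong_AE:
 assumes r: "1 < r" and v: "v \<in> Lspace M r" and g: "g \<in> Lspace M r" and e: "AE x in M. v x = v' x"
 shows "pairing M r v' g = pairing M r v (g :: 'a => 'c::euclidean_space)"
proof -
 have [measurable]: "v \<in> borel_measurable M" "v' \<in> borel_measurable M" "g \<in> borel_measurable M"
  using LspaceD(1)[OF v] LspaceD(1)[OF g] measurable_cong_AE[OF LspaceD(1)[OF v] e] by auto
 note [measurable] = measurable_powmap[OF r]
 show ?thesis unfolding pairing_def
 proof (rule integral_cong_AE)
  show "AE x in M. powmap r (v' x) \<bullet> g x = powmap r (v x) \<bullet> g x" using e by eventually_elim simp
 qed measurable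
qed

lemma pairing_real: "pairing M r u w = (LINT x|M. \<bar>u x\<bar> powr (r - 2) * u x * w x)" by (simp add: pairing_def powmap_def mult_ac)

lemma pairing_vector: "pairing M r v g = (LINT x|M. norm (v x) powr (r - 2) * (v x \<bullet> g x))" by (simp add: pairing_def powmap_def)

text \<open>Links the eigenpairs of the Galerkin scheme to \<open>beta_lower\<close> and \<open>beta_upper\<close>, which are defined by Rayleigh
quotients over \<open>ES_nonzero\<close>.\<close>

lemma eigen_in_ES:
 assumes t: "test_limit u v" and pos: "0 < pint M p u"
  and eq: "\<And>w g. test_limit w g ==> pairing M p v g = \<alpha> * pairing M p u w" and q: "1 < q" "q < p"
 shows "u \<in> ES_nonzero p \<Omega> \<alpha>" "rayleigh q \<Omega> u = pint M q v / pint M q u" "0 < pint M q u"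
proof -
 have uW: "u \<in> W01p p \<Omega>" and e: "AE x in M. v x = weak_grad \<Omega> u x" using test_limit_imp_W01p[OF t] by (auto simp: eq_commute)
 have L: "u \<in> Lspace M p" "v \<in> Lspace M p" using t by (auto simp: test_limit_def)
 have q0: "0 < q" using q by simp
 note Lq = Lspace_mono[OF q0 q(2) L(1)] Lspace_mono[OF q0 q(2) L(2)]
 have "u \<in> ES p \<Omega> \<alpha>" unfolding ES_def
 proof (intro CollectI conjI uW ballI)
  fix w assume "w \<in> W01p p \<Omega>"
  hence tw: "test_limit w (weak_grad \<Omega> w)" by (rule W01p_imp_test_limit)
  hence Lw: "weak_grad \<Omega> w \<in> Lspace M p" by (simp add: test_limit_def)
  show "(LINT x|M. norm (weak_grad \<Omega> u x) powr (p - 2) * (weak_grad \<Omega> u x \<bullet> weak_grad \<Omega> w x)) = \<alpha> * (LINT x|M. \<bar>u x\<bar> powr (p - 2) * u x * w x)"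
   unfolding pairing_real[symmetric] pairing_vector[symmetric] pairing_cong_AE[OF p1 L(2) Lw e] by (rule eq[OF tw])
 qed
 moreover have nz: "\<not> (AE x in M. u x = 0)"
 proof
  assume z: "AE x in M. u x = 0"
  have "pint M p (\<lambda>x. 0 :: real) = pint M p u" by (rule Lspace_cong_AE(2)[OF L(1) z])
  thus False using pos by (simp add: pint_def)
 qed
 ultimately show "u \<in> ES_nonzero p \<Omega> \<alpha>" by (simp add: ES_nonzero_def)
 have Lpq: "Lp_norm q \<Omega> h powr q = pint M q h" for h :: "'a => 'c::euclidean_space"
  using pint_nonneg[of M q h] q0 by (simp add: Lp_norm_def pint_def[symmetric] powr_powr)
 show "rayleigh q \<Omega> u = pint M q v / pint M q u" unfolding rayleigh_def Lpq Lspace_cong_AE(2)[OF Lq(2) e] by simp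
 have "pint M q u \<noteq> 0"
 proof
  assume "pint M q u = 0"
  hence "AE x in M. norm (u x) powr q = 0" using integral_nonneg_eq_0_iff_AE[OF LspaceD(2)[OF Lq(1)]] by (simp add: pint_def)
  hence "AE x in M. u x = 0" by eventually_elim simp
  thus False using nz by simp
 qed
 thus "0 < pint M q u" using pint_nonneg[of M q u] by simp
qed

lemma limit_equation_weak_solution:
 assumes t: "test_limit u v" and q: "1 < q" "q < p"
  and eq: "\<And>w g. test_limit w g ==> pairing M p v g + pairing M q v g = \<alpha> * pairing M p u w + \<beta> * pairing M q u w + f w"
 shows "weak_solution p q \<Omega> \<alpha> \<beta> f u" unfolding weak_solution_def
proof (intro conjI ballI)
 let ?v = "weak_grad \<Omega> u"
 show uW: "u \<in> W01p p \<Omega>" using test_limit_imp_W01p[OF t] by simp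
 have e: "AE x in M. v x = ?v x" using test_limit_imp_W01p[OF t] by (auto simp: eq_commute)
 have L: "u \<in> Lspace M p" "v \<in> Lspace M p" using t by (auto simp: test_limit_def)
 have q0: "0 < q" using q by simp
 note mono = Lspace_mono[OF q0 q(2)]
 fix w assume "w \<in> W01p p \<Omega>"
 hence tw: "test_limit w (weak_grad \<Omega> w)" by (rule W01p_imp_test_limit)
 hence Lw: "w \<in> Lspace M p" "weak_grad \<Omega> w \<in> Lspace M p" by (auto simp: test_limit_def)
 have L': "?v \<in> Lspace M p" by (rule Lspace_cong_AE(1)[OF L(2) e])
 have "(LINT x|M. (norm (?v x) powr (p - 2) + norm (?v x) powr (q - 2)) * (?v x \<bullet> weak_grad \<Omega> w x))
   = (LINT x|M. powmap p (?v x) \<bullet> weak_grad \<Omega> w x + powmap q (?v x) \<bullet> weak_grad \<Omega> w x)" by (simp add: powmap_def distrib_right)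
 also have "\<dots> = pairing M p ?v (weak_grad \<Omega> w) + pairing M q ?v (weak_grad \<Omega> w)" unfolding pairing_def
  by (rule Bochner_Integration.integral_add[OF integrable_pairing[OF L' Lw(2) p1] integrable_pairing[OF mono[OF L'] mono[OF Lw(2)] q(1)]])
 also have "\<dots> = \<alpha> * pairing M p u w + \<beta> * pairing M q u w + f w"
  unfolding pairing_cong_AE[OF p1 L(2) Lw(2) e] pairing_cong_AE[OF q(1) mono[OF L(2)] mono[OF Lw(2)] e] by (rule eq[OF tw])
 also have "\<alpha> * pairing M p u w + \<beta> * pairing M q u w = (LINT x|M. \<alpha> * (powmap p (u x) \<bullet> w x) + \<beta> * (powmap q (u x) \<bullet> w x))"
  unfolding pairing_def by (subst Bochner_Integration.integral_add)
   (intro integrable_mult_right integrable_pairing L Lw mono p1 q | simp)+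
 also have "\<dots> = (LINT x|M. (\<alpha> * \<bar>u x\<bar> powr (p - 2) * u x + \<beta> * \<bar>u x\<bar> powr (q - 2) * u x) * w x)" by (simp add: powmap_def algebra_simps)
 finally show "(LINT x|M. (norm (?v x) powr (p - 2) + norm (?v x) powr (q - 2)) * (?v x \<bullet> weak_grad \<Omega> w x))
  = (LINT x|M. (\<alpha> * \<bar>u x\<bar> powr (p - 2) * u x + \<beta> * \<bar>u x\<bar> powr (q - 2) * u x) * w x) + f w" .
qed

lemma weak_solution_exists:
 assumes q: "1 < q" "q < p" and f: "f \<in> W01p_dual p \<Omega>"
  and H: "ereal \<beta> < beta_lower p q \<Omega> \<alpha> \<or> ereal \<beta> > beta_upper p q \<Omega> \<alpha>"
 shows "\<exists>u. weak_solution p q \<Omega> \<alpha> \<beta> f u"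
proof -
 obtain \<phi> where \<phi>: "\<And>i::nat. \<phi> i \<in> test_functions \<Omega>"
  and dense: "\<And>\<psi> e. \<psi> \<in> test_functions \<Omega> ==> 0 < e ==> \<exists>i. pdist lborel p (grad \<psi>) (grad (\<phi> i)) < e"
  using test_functions_separable[OF p1 bounded_\<Omega>] by blast
 obtain CP Cf where "galerkin_basis M p q (galerkin_space \<phi>) f CP Cf \<phi> (\<lambda>i. grad (\<phi> i)) (fresh_indices \<phi>)"
  using galerkin_basis_test_functions[where \<phi> = \<phi>, OF \<phi> q f] by blast
 then interpret G: galerkin_basis M p q "galerkin_space \<phi>" f CP Cf \<phi> "\<lambda>i. grad (\<phi> i)" "fresh_indices \<phi>" .
 have lim: "test_limit u v" if "G.lim_pair u v" for u v
 proof -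
  obtain U V where uv: "u \<in> Lspace M p" "v \<in> Lspace M p" and UV: "\<forall>k::nat. \<exists>n. (U k, V k) \<in> galerkin_space \<phi> n"
   and l: "(\<lambda>k. pdist M p (U k) u) \<longlonglongrightarrow> 0" "(\<lambda>k. pdist M p (V k) v) \<longlonglongrightarrow> 0" using \<open>G.lim_pair u v\<close> unfolding G.lim_pair_def by (elim exE conjE)
  have t: "U k \<in> test_functions \<Omega>" "V k = grad (U k)" for k using UV galerkin_spaceD[where \<phi> = \<phi>, OF \<phi>, of "U k" "V k"] by blast+
  show ?thesis unfolding test_limit_def using uv t(1) l unfolding t(2) by blast
 qed
 have eigen: "u \<in> ES_nonzero p \<Omega> \<alpha> \<and> rayleigh q \<Omega> u = pint M q v / pint M q u \<and> 0 < pint M q u" if "G.eigen_pair \<alpha> u v" for u v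
 proof -
  have lp: "G.lim_pair u v" and pos: "0 < pint M p u" and E: "\<And>n wu wv. (wu, wv) \<in> galerkin_space \<phi> n ==> pairing M p v wv = \<alpha> * pairing M p u wu"
   using that unfolding G.eigen_pair_def by auto
  have t: "test_limit u v" by (rule lim[OF lp])
  hence L: "u \<in> Lspace M p" "v \<in> Lspace M p" by (auto simp: test_limit_def)
  have "pairing M p v g + 0 * pairing M q v g = \<alpha> * pairing M p u w + 0 * (0 * pairing M q u w + f w)" if "test_limit w g" for w g
   by (rule equation_extends_to_limits[where \<phi> = \<phi>, OF \<phi> dense q f L _ that])
    (use E[OF galerkin_space_contains[where \<phi> = \<phi>, OF \<phi>]] in simp_all)
  hence "\<And>w g. test_limit w g ==> pairing M p v g = \<alpha> * pairing M p u w" by simp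
  from eigen_in_ES[OF t pos this q] show ?thesis by blast
 qed
 have "\<exists>u v. G.lim_pair u v \<and> (\<forall>n. \<forall>(wu, wv)\<in>galerkin_space \<phi> n.
   pairing M p v wv + pairing M q v wv = \<alpha> * pairing M p u wu + \<beta> * pairing M q u wu + f wu)" using H
 proof
  assume b: "ereal \<beta> < beta_lower p q \<Omega> \<alpha>"
  show ?thesis
  proof (rule G.galerkin_solution_below)
   fix u v assume "G.eigen_pair \<alpha> u v"
   from eigen[OF this] have u: "u \<in> ES_nonzero p \<Omega> \<alpha>" "rayleigh q \<Omega> u = pint M q v / pint M q u" "0 < pint M q u" by auto
   hence "beta_lower p q \<Omega> \<alpha> \<le> ereal (rayleigh q \<Omega> u)"
    using INF_lower[OF u(1), of "\<lambda>u. ereal (rayleigh q \<Omega> u)"] by (auto simp: beta_lower_def plap_spectrum_def)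
   hence "\<beta> < pint M q v / pint M q u" using less_le_trans[OF b] u(2) by fastforce
   thus "0 < pint M q v - \<beta> * pint M q u" using u(3) by (simp add: field_simps)
  qed
 next
  assume b: "ereal \<beta> > beta_upper p q \<Omega> \<alpha>"
  show ?thesis
  proof (rule G.galerkin_solution_above)
   fix u v assume "G.eigen_pair \<alpha> u v"
   from eigen[OF this] have u: "u \<in> ES_nonzero p \<Omega> \<alpha>" "rayleigh q \<Omega> u = pint M q v / pint M q u" "0 < pint M q u" by auto
   hence "ereal (rayleigh q \<Omega> u) \<le> beta_upper p q \<Omega> \<alpha>"
    using SUP_upper[OF u(1), of "\<lambda>u. ereal (rayleigh q \<Omega> u)"] by (auto simp: beta_upper_def plap_spectrum_def)
   hence "pint M q v / pint M q u < \<beta>" using le_less_trans[OF _ b] u(2) by fastforce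
   thus "pint M q v - \<beta> * pint M q u < 0" using u(3) by (simp add: field_simps)
  qed
 qed
 then obtain u v where lp: "G.lim_pair u v" and E: "\<And>n wu wv. (wu, wv) \<in> galerkin_space \<phi> n ==>
   pairing M p v wv + pairing M q v wv = \<alpha> * pairing M p u wu + \<beta> * pairing M q u wu + f wu" by blast
 have t: "test_limit u v" by (rule lim[OF lp])
 hence L: "u \<in> Lspace M p" "v \<in> Lspace M p" by (auto simp: test_limit_def)
 have "pairing M p v g + 1 * pairing M q v g = \<alpha> * pairing M p u w + 1 * (\<beta> * pairing M q u w + f w)" if "test_limit w g" for w g
  by (rule equation_extends_to_limits[where \<phi> = \<phi>, OF \<phi> dense q f L _ that])
   (use E[OF galerkin_space_contains[where \<phi> = \<phi>, OF \<phi>]] in simp_all)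
 hence "pairing M p v g + pairing M q v g = \<alpha> * pairing M p u w + \<beta> * pairing M q u w + f w" if "test_limit w g" for w g using that by simp
 from limit_equation_weak_solution[OF t q this] show ?thesis by blast
qed

end

theorem theorem2p2:
 fixes \<Omega> :: "'a::euclidean_space set"
  and p q \<alpha> \<beta> :: real
  and f :: "('a => real) => real"
 assumes "bounded_C2_domain \<Omega>"
  and "1 < q" and "q < p"
  and "f \<in> W01p_dual p \<Omega>"
  and "ereal \<beta> < beta_lower p q \<Omega> \<alpha> \<or> ereal \<beta> > beta_upper p q \<Omega> \<alpha>"
 shows "\<exists>u. weak_solution p q \<Omega> \<alpha> \<beta> f u"
proof -
 interpret bounded_open_set \<Omega> p using assms(1-3) by unfold_locales (auto simp: bounded_C2_domain_def)
 show ?thesis by (rule weak_solution_exists[OF assms(2-5)])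
qed

end
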